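(* Let $\mathscr{P}^\heartsuit$ be a $k$-linear highest weight category with standard objects $M_w$ indexed by a finite poset $\mathscr{W}$ with compatible length function $\ell$, and let $\mathscr{P}$ be its bounded derived category. Consider a distinguished triangle in $\mathscr{P}$ $$N'\rightarrow N\rightarrow N''\xrightarrow{+1}.$$ If $N'$ and $N''$ admit ordinary BGG resolutions for the same shift $[m]$ (that is, for some $m\in\mathbb{Z}$ both $N'[m]$ and $N''[m]$ are quasi-isomorphic to BGG complexes), then so does $N$ (that is, $N[m]$ is quasi-isomorphic to a BGG complex).
   Context: Highest weight category: $k$ is a field and $\mathscr{P}^\heartsuit$ is a $k$-linear abelian category with enough injectives and projectives, all of whose objects have finite length, with finitely many isomorphism classes of simple objects $L_w$, $w\in\mathscr{W}$, and $\mathrm{End}(L_w)=k$. Given a partial order $\leqslant$ on $\mathscr{W}$, let $\mathscr{P}^\heartsuit_{\leqslant w}$ be the full subcategory of objects all of whose composition factors are of the form $L_y$ with $y\leqslant w$; the standard object $M_w$ and costandard object $A_w$ are a projective cover and an injective envelope of $L_w$ in $\mathscr{P}^\heartsuit_{\leqslant w}$. $\mathscr{P}^\heartsuit$ is a highest weight category if: (1) $\mathrm{End}(M_w)=k$ for all $w$; (2) $\mathrm{Hom}(M_y,M_w)\neq 0$ implies $y\leqslant w$; (3) for $P_w$ a projective cover of $L_w$ in $\mathscr{P}^\heartsuit$, the kernel of the canonical surjection $P_w\to M_w$ has a filtration with successive quotients of the form $M_x$, $x>w$. A compatible length function is a map $\ell:\mathscr{W}\to\mathbb{Z}$, $w\mapsto\ell_w$,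 such that $w<y$ implies $\ell_w<\ell_y$; $\mathscr{W}_n=\{w:\ell_w=n\}$, and $\ell_\circ$, $\ell^\circ$ are the maximal and minimal values of $\ell$. A BGG complex is a complex of the form $$0\to\bigoplus_{w\in\mathscr{W}_{\ell^\circ}}M_w\otimes V_w\to\bigoplus_{w\in\mathscr{W}_{\ell^\circ+1}}M_w\otimes V_w\to\cdots\to\bigoplus_{w\in\mathscr{W}_{\ell_\circ}}M_w\otimes V_w\to 0,$$ where the $V_w$ are finite dimensional $k$-vector spaces (in cohomological degree zero) and $M_w$ occurs in cohomological degree $\ell_w$. An object of $\mathscr{P}$ admits an ordinary BGG resolution if it is quasi-isomorphic to a shift of a BGG complex. *)

theory Defs
  imports Main
begin

section \<open>Linear and abelian categories\<close>

text \<open>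
  The record fields Zero, Add and Scale carry the linear structure of the Hom spaces:
  Zero A B is the zero morphism from A to B, while Add and Scale are only meaningful for
  morphisms with the same domain and the same codomain.
\<close>

record ('o, 'm, 'k) lincat =
  Obj :: "'o set"
  Arr :: "'m set"
  Dom :: "'m \<Rightarrow> 'o"
  Cod :: "'m \<Rightarrow> 'o"
  Ident :: "'o \<Rightarrow> 'm"
  Comp :: "'m \<Rightarrow> 'm \<Rightarrow> 'm"  (infixr "\<cdot>\<index>" 70)
  Zero :: "'o \<Rightarrow> 'o \<Rightarrow> 'm"
  Add :: "'m \<Rightarrow> 'm \<Rightarrow> 'm"  (infixl "\<oplus>\<index>" 65)
  Scale :: "'k \<Rightarrow> 'm \<Rightarrow> 'm"  (infixr "\<odot>\<index>" 75)

definition Hom :: "('o, 'm, 'k) lincat \<Rightarrow> 'o \<Rightarrow> 'o \<Rightarrow> 'm set" where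
  "Hom C A B = {f \<in> Arr C. Dom C f = A \<and> Cod C f = B}"

locale linear_category =
  fixes C :: "('o, 'm, 'k::field) lincat" (structure)
  assumes Dom_Obj: "f \<in> Arr C \<Longrightarrow> Dom C f \<in> Obj C"
    and Cod_Obj: "f \<in> Arr C \<Longrightarrow> Cod C f \<in> Obj C"
    and Ident_Hom: "A \<in> Obj C \<Longrightarrow> Ident C A \<in> Hom C A A"
    and Comp_Hom: "f \<in> Hom C A B \<Longrightarrow> g \<in> Hom C B D \<Longrightarrow> g \<cdot> f \<in> Hom C A D"
    and Comp_Ident: "f \<in> Hom C A B \<Longrightarrow> f \<cdot> Ident C A = f"
    and Ident_Comp: "f \<in> Hom C A B \<Longrightarrow> Ident C B \<cdot> f = f"
    and Comp_assoc: "f \<in> Hom C A B \<Longrightarrow> g \<in> Hom C B D \<Longrightarrow> h \<in> Hom C D E \<Longrightarrow>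
      (h \<cdot> g) \<cdot> f = h \<cdot> (g \<cdot> f)"
    and Zero_Hom: "A \<in> Obj C \<Longrightarrow> B \<in> Obj C \<Longrightarrow> Zero C A B \<in> Hom C A B"
    and Add_Hom: "f \<in> Hom C A B \<Longrightarrow> g \<in> Hom C A B \<Longrightarrow> f \<oplus> g \<in> Hom C A B"
    and Scale_Hom: "f \<in> Hom C A B \<Longrightarrow> c \<odot> f \<in> Hom C A B"
    and Add_assoc: "f \<in> Hom C A B \<Longrightarrow> g \<in> Hom C A B \<Longrightarrow> h \<in> Hom C A B \<Longrightarrow>
      (f \<oplus> g) \<oplus> h = f \<oplus> (g \<oplus> h)"
    and Add_commute: "f \<in> Hom C A B \<Longrightarrow> g \<in> Hom C A B \<Longrightarrow> f \<oplus> g = g \<oplus> f"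
    and Add_Zero: "f \<in> Hom C A B \<Longrightarrow> f \<oplus> Zero C A B = f"
    and Add_inverse: "f \<in> Hom C A B \<Longrightarrow> \<exists>g \<in> Hom C A B. f \<oplus> g = Zero C A B"
    and Scale_Add: "f \<in> Hom C A B \<Longrightarrow> g \<in> Hom C A B \<Longrightarrow>
      c \<odot> (f \<oplus> g) = c \<odot> f \<oplus> c \<odot> g"
    and Scale_plus: "f \<in> Hom C A B \<Longrightarrow> (c + d) \<odot> f = c \<odot> f \<oplus> d \<odot> f"
    and Scale_Scale: "f \<in> Hom C A B \<Longrightarrow> c \<odot> (d \<odot> f) = (c * d) \<odot> f"
    and Scale_one: "f \<in> Hom C A B \<Longrightarrow> 1 \<odot> f = f"
    and Comp_Add: "f \<in> Hom C A B \<Longrightarrow> g \<in> Hom C B D \<Longrightarrow> h \<in> Hom C B D \<Longrightarrow>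
      (g \<oplus> h) \<cdot> f = (g \<cdot> f) \<oplus> (h \<cdot> f)"
    and Add_Comp: "f \<in> Hom C A B \<Longrightarrow> g \<in> Hom C A B \<Longrightarrow> h \<in> Hom C B D \<Longrightarrow>
      h \<cdot> (f \<oplus> g) = (h \<cdot> f) \<oplus> (h \<cdot> g)"
    and Scale_Comp: "f \<in> Hom C A B \<Longrightarrow> g \<in> Hom C B D \<Longrightarrow> (c \<odot> g) \<cdot> f = c \<odot> (g \<cdot> f)"
    and Comp_Scale: "f \<in> Hom C A B \<Longrightarrow> g \<in> Hom C B D \<Longrightarrow> g \<cdot> (c \<odot> f) = c \<odot> (g \<cdot> f)"

definition full_sub :: "('o, 'm, 'k) lincat \<Rightarrow> 'o set \<Rightarrow> ('o, 'm, 'k) lincat" where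
  "full_sub C D = C\<lparr>Obj := Obj C \<inter> D, Arr := {f \<in> Arr C. Dom C f \<in> D \<and> Cod C f \<in> D}\<rparr>"

definition monic :: "('o, 'm, 'k) lincat \<Rightarrow> 'm \<Rightarrow> bool" where
  "monic C f \<longleftrightarrow> f \<in> Arr C \<and>
    (\<forall>A. \<forall>g \<in> Hom C A (Dom C f). \<forall>h \<in> Hom C A (Dom C f).
      f \<cdot>\<^bsub>C\<^esub> g = f \<cdot>\<^bsub>C\<^esub> h \<longrightarrow> g = h)"

definition epic :: "('o, 'm, 'k) lincat \<Rightarrow> 'm \<Rightarrow> bool" where
  "epic C f \<longleftrightarrow> f \<in> Arr C \<and>
    (\<forall>B. \<forall>g \<in> Hom C (Cod C f) B. \<forall>h \<in> Hom C (Cod C f) B.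
      g \<cdot>\<^bsub>C\<^esub> f = h \<cdot>\<^bsub>C\<^esub> f \<longrightarrow> g = h)"

definition iso_arr :: "('o, 'm, 'k) lincat \<Rightarrow> 'm \<Rightarrow> bool" where
  "iso_arr C f \<longleftrightarrow> f \<in> Arr C \<and>
    (\<exists>g \<in> Hom C (Cod C f) (Dom C f).
      g \<cdot>\<^bsub>C\<^esub> f = Ident C (Dom C f) \<and> f \<cdot>\<^bsub>C\<^esub> g = Ident C (Cod C f))"

definition iso_objs :: "('o, 'm, 'k) lincat \<Rightarrow> 'o \<Rightarrow> 'o \<Rightarrow> bool" where
  "iso_objs C A B \<longleftrightarrow> (\<exists>f \<in> Hom C A B. iso_arr C f)"

definition zero_object :: "('o, 'm, 'k) lincat \<Rightarrow> 'o \<Rightarrow> bool" where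
  "zero_object C Z \<longleftrightarrow> Z \<in> Obj C \<and>
    (\<forall>A \<in> Obj C. (\<exists>!f. f \<in> Hom C A Z) \<and> (\<exists>!f. f \<in> Hom C Z A))"

definition is_kernel :: "('o, 'm, 'k) lincat \<Rightarrow> 'm \<Rightarrow> 'm \<Rightarrow> bool" where
  "is_kernel C i f \<longleftrightarrow> i \<in> Arr C \<and> f \<in> Arr C \<and> Cod C i = Dom C f \<and>
    f \<cdot>\<^bsub>C\<^esub> i = Zero C (Dom C i) (Cod C f) \<and>
    (\<forall>A. \<forall>g \<in> Hom C A (Dom C f). f \<cdot>\<^bsub>C\<^esub> g = Zero C A (Cod C f) \<longrightarrow>
      (\<exists>!h. h \<in> Hom C A (Dom C i) \<and> i \<cdot>\<^bsub>C\<^esub> h = g))"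

definition is_cokernel :: "('o, 'm, 'k) lincat \<Rightarrow> 'm \<Rightarrow> 'm \<Rightarrow> bool" where
  "is_cokernel C p f \<longleftrightarrow> p \<in> Arr C \<and> f \<in> Arr C \<and> Dom C p = Cod C f \<and>
    p \<cdot>\<^bsub>C\<^esub> f = Zero C (Dom C f) (Cod C p) \<and>
    (\<forall>B. \<forall>g \<in> Hom C (Cod C f) B. g \<cdot>\<^bsub>C\<^esub> f = Zero C (Dom C f) B \<longrightarrow>
      (\<exists>!h. h \<in> Hom C (Cod C p) B \<and> h \<cdot>\<^bsub>C\<^esub> p = g))"

definition short_exact :: "('o, 'm, 'k) lincat \<Rightarrow> 'm \<Rightarrow> 'm \<Rightarrow> bool" where
  "short_exact C i p \<longleftrightarrow> is_kernel C i p \<and> is_cokernel C p i"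

definition is_biproduct ::
  "('o, 'm, 'k) lincat \<Rightarrow> 'o \<Rightarrow> 'o \<Rightarrow> 'o \<times> 'm \<times> 'm \<times> 'm \<times> 'm \<Rightarrow> bool" where
  "is_biproduct C A B = (\<lambda>(S, i1, i2, p1, p2).
    i1 \<in> Hom C A S \<and> i2 \<in> Hom C B S \<and> p1 \<in> Hom C S A \<and> p2 \<in> Hom C S B \<and>
    p1 \<cdot>\<^bsub>C\<^esub> i1 = Ident C A \<and> p2 \<cdot>\<^bsub>C\<^esub> i2 = Ident C B \<and>
    p2 \<cdot>\<^bsub>C\<^esub> i1 = Zero C A B \<and> p1 \<cdot>\<^bsub>C\<^esub> i2 = Zero C B A \<and>
    (i1 \<cdot>\<^bsub>C\<^esub> p1) \<oplus>\<^bsub>C\<^esub> (i2 \<cdot>\<^bsub>C\<^esub> p2) = Ident C S)"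

text \<open>Finite direct sums are expressed as coproducts; for an empty index set this says that
  S is initial, i.e. a zero object in an abelian category.\<close>

definition is_direct_sum ::
  "('o, 'm, 'k) lincat \<Rightarrow> 'i set \<Rightarrow> ('i \<Rightarrow> 'o) \<Rightarrow> 'o \<Rightarrow> ('i \<Rightarrow> 'm) \<Rightarrow> bool" where
  "is_direct_sum C I X S \<iota> \<longleftrightarrow> finite I \<and> S \<in> Obj C \<and>
    (\<forall>i \<in> I. \<iota> i \<in> Hom C (X i) S) \<and>
    (\<forall>T \<in> Obj C. \<forall>g. (\<forall>i \<in> I. g i \<in> Hom C (X i) T) \<longrightarrow>
      (\<exists>!h. h \<in> Hom C S T \<and> (\<forall>i \<in> I. h \<cdot>\<^bsub>C\<^esub> \<iota> i = g i)))"

locale abelian_category = linear_category +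
  assumes ex_zero_object: "\<exists>Z. zero_object C Z"
    and ex_biproduct: "A \<in> Obj C \<Longrightarrow> B \<in> Obj C \<Longrightarrow> \<exists>S. is_biproduct C A B S"
    and ex_kernel: "f \<in> Arr C \<Longrightarrow> \<exists>i. is_kernel C i f"
    and ex_cokernel: "f \<in> Arr C \<Longrightarrow> \<exists>p. is_cokernel C p f"
    and monic_kernel: "monic C f \<Longrightarrow> \<exists>g. is_kernel C f g"
    and epic_cokernel: "epic C f \<Longrightarrow> \<exists>g. is_cokernel C f g"


section \<open>Projectives, injectives, filtrations\<close>

definition projective_obj :: "('o, 'm, 'k) lincat \<Rightarrow> 'o \<Rightarrow> bool" where
  "projective_obj C P \<longleftrightarrow> P \<in> Obj C \<and>
    (\<forall>g f. epic C g \<and> f \<in> Hom C P (Cod C g) \<longrightarrow>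
      (\<exists>h \<in> Hom C P (Dom C g). g \<cdot>\<^bsub>C\<^esub> h = f))"

definition injective_obj :: "('o, 'm, 'k) lincat \<Rightarrow> 'o \<Rightarrow> bool" where
  "injective_obj C I \<longleftrightarrow> I \<in> Obj C \<and>
    (\<forall>g f. monic C g \<and> f \<in> Hom C (Dom C g) I \<longrightarrow>
      (\<exists>h \<in> Hom C (Cod C g) I. h \<cdot>\<^bsub>C\<^esub> g = f))"

definition projective_cover :: "('o, 'm, 'k) lincat \<Rightarrow> 'o \<Rightarrow> 'm \<Rightarrow> 'o \<Rightarrow> bool" where
  "projective_cover C P p X \<longleftrightarrow> projective_obj C P \<and> p \<in> Hom C P X \<and> epic C p \<and>
    (\<forall>f \<in> Arr C. Cod C f = P \<and> epic C (p \<cdot>\<^bsub>C\<^esub> f) \<longrightarrow> epic C f)"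

definition simple_obj :: "('o, 'm, 'k) lincat \<Rightarrow> 'o \<Rightarrow> bool" where
  "simple_obj C S \<longleftrightarrow> S \<in> Obj C \<and> \<not> zero_object C S \<and>
    (\<forall>i. monic C i \<and> Cod C i = S \<longrightarrow> zero_object C (Dom C i) \<or> iso_arr C i)"

text \<open>A finite filtration of X is a chain of subobjects F 0 = 0, F 1, ..., F n = X with
  inclusions i j from F j to F (j+1) and quotients q j from F (j+1) onto Q j.\<close>

definition filtration :: "('o, 'm, 'k) lincat \<Rightarrow> 'o \<Rightarrow> nat \<Rightarrow> (nat \<Rightarrow> 'o) \<Rightarrow> (nat \<Rightarrow> 'm)
    \<Rightarrow> (nat \<Rightarrow> 'm) \<Rightarrow> (nat \<Rightarrow> 'o) \<Rightarrow> bool" where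
  "filtration C X n F i q Q \<longleftrightarrow> zero_object C (F 0) \<and> F n = X \<and>
    (\<forall>j<n. i j \<in> Hom C (F j) (F (Suc j)) \<and> q j \<in> Hom C (F (Suc j)) (Q j) \<and>
      short_exact C (i j) (q j))"

definition composition_series :: "('o, 'm, 'k) lincat \<Rightarrow> 'o \<Rightarrow> nat \<Rightarrow> (nat \<Rightarrow> 'o) \<Rightarrow> bool" where
  "composition_series C X n Q \<longleftrightarrow>
    (\<exists>F i q. filtration C X n F i q Q) \<and> (\<forall>j<n. simple_obj C (Q j))"

definition finite_length :: "('o, 'm, 'k) lincat \<Rightarrow> 'o \<Rightarrow> bool" where
  "finite_length C X \<longleftrightarrow> (\<exists>n Q. composition_series C X n Q)"

definition composition_factor :: "('o, 'm, 'k) lincat \<Rightarrow> 'o \<Rightarrow> 'o \<Rightarrow> bool" where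
  "composition_factor C S X \<longleftrightarrow>
    (\<exists>n Q. composition_series C X n Q \<and> (\<exists>j<n. iso_objs C S (Q j)))"

definition filtered_by :: "('o, 'm, 'k) lincat \<Rightarrow> 'o set \<Rightarrow> 'o \<Rightarrow> bool" where
  "filtered_by C T X \<longleftrightarrow>
    (\<exists>n F i q Q. filtration C X n F i q Q \<and> (\<forall>j<n. \<exists>Y \<in> T. iso_objs C (Q j) Y))"


section \<open>Highest weight categories\<close>

text \<open>End(A) = k: the map from k to End(A) sending c to c times the identity is bijective.\<close>

definition End_trivial :: "('o, 'm, 'k) lincat \<Rightarrow> 'o \<Rightarrow> bool" where
  "End_trivial C A \<longleftrightarrow> bij_betw (\<lambda>c. c \<odot>\<^bsub>C\<^esub> Ident C A) UNIV (Hom C A A)"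

definition truncation ::
  "('o, 'm, 'k) lincat \<Rightarrow> 'w::order set \<Rightarrow> ('w \<Rightarrow> 'o) \<Rightarrow> 'w \<Rightarrow> ('o, 'm, 'k) lincat" where
  "truncation C W L w = full_sub C {X \<in> Obj C.
    \<forall>S. composition_factor C S X \<longrightarrow> (\<exists>y \<in> W. y \<le> w \<and> iso_objs C S (L y))}"

text \<open>
  The family \<open>\<mu> w\<close> consists of the projections from \<open>M w\<close> to \<open>L w\<close> which make \<open>M w\<close> a projective
  cover in the truncated category.  In the last axiom, q is the canonical surjection from the
  projective cover \<open>P w\<close> to \<open>M w\<close>, characterized by \<open>\<mu> w \<cdot> q = p\<close> (it is unique because
  \<open>End(M w) = k\<close>), and \<open>\<kappa>\<close> is its kernel.  Projective covers exist, and are unique up to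
  isomorphism, in a finite length category with enough projectives, so it is immaterial
  which projective cover is used.
\<close>

locale highest_weight_category = abelian_category C
  for C :: "('o, 'm, 'k::field) lincat" (structure) +
  fixes W :: "'w::order set" and L M :: "'w \<Rightarrow> 'o" and \<mu> :: "'w \<Rightarrow> 'm"
  assumes enough_projectives:
      "X \<in> Obj C \<Longrightarrow> \<exists>P p. projective_obj C P \<and> p \<in> Hom C P X \<and> epic C p"
    and enough_injectives:
      "X \<in> Obj C \<Longrightarrow> \<exists>I i. injective_obj C I \<and> i \<in> Hom C X I \<and> monic C i"
    and all_finite_length: "X \<in> Obj C \<Longrightarrow> finite_length C X"
    and finite_W: "finite W"
    and simple_L: "w \<in> W \<Longrightarrow> simple_obj C (L w)"
    and L_distinct: "w \<in> W \<Longrightarrow> y \<in> W \<Longrightarrow> iso_objs C (L w) (L y) \<Longrightarrow> w = y"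
    and L_exhaust: "simple_obj C S \<Longrightarrow> \<exists>w \<in> W. iso_objs C S (L w)"
    and End_L: "w \<in> W \<Longrightarrow> End_trivial C (L w)"
    and M_standard: "w \<in> W \<Longrightarrow> projective_cover (truncation C W L w) (M w) (\<mu> w) (L w)"
    and End_M: "w \<in> W \<Longrightarrow> End_trivial C (M w)"
    and Hom_M: "w \<in> W \<Longrightarrow> y \<in> W \<Longrightarrow> Hom C (M y) (M w) \<noteq> {Zero C (M y) (M w)} \<Longrightarrow> y \<le> w"
    and M_filtration: "w \<in> W \<Longrightarrow>
      \<exists>P p q \<kappa>. projective_cover C P p (L w) \<and> q \<in> Hom C P (M w) \<and> \<mu> w \<cdot> q = p \<and>
        is_kernel C \<kappa> q \<and> filtered_by C (M ` {x \<in> W. w < x}) (Dom C \<kappa>)"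

definition compatible_length :: "'w::order set \<Rightarrow> ('w \<Rightarrow> int) \<Rightarrow> bool" where
  "compatible_length W l \<longleftrightarrow> (\<forall>w \<in> W. \<forall>y \<in> W. w < y \<longrightarrow> l w < l y)"


section \<open>Complexes\<close>

record ('o, 'm) cochain =
  cx_ob :: "int \<Rightarrow> 'o"
  cx_d :: "int \<Rightarrow> 'm"

definition bounded_cx :: "('o, 'm, 'k) lincat \<Rightarrow> ('o, 'm) cochain \<Rightarrow> bool" where
  "bounded_cx C X \<longleftrightarrow>
    (\<forall>n. cx_d X n \<in> Hom C (cx_ob X n) (cx_ob X (n + 1)) \<and>
      cx_d X (n + 1) \<cdot>\<^bsub>C\<^esub> cx_d X n = Zero C (cx_ob X n) (cx_ob X (n + 2))) \<and>
    (\<exists>a b. \<forall>n. n < a \<or> b < n \<longrightarrow> zero_object C (cx_ob X n))"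

definition chain_map ::
  "('o, 'm, 'k) lincat \<Rightarrow> ('o, 'm) cochain \<Rightarrow> ('o, 'm) cochain \<Rightarrow> (int \<Rightarrow> 'm) \<Rightarrow> bool" where
  "chain_map C X Y f \<longleftrightarrow> (\<forall>n. f n \<in> Hom C (cx_ob X n) (cx_ob Y n) \<and>
    f (n + 1) \<cdot>\<^bsub>C\<^esub> cx_d X n = cx_d Y n \<cdot>\<^bsub>C\<^esub> f n)"

definition chain_id :: "('o, 'm, 'k) lincat \<Rightarrow> ('o, 'm) cochain \<Rightarrow> int \<Rightarrow> 'm" where
  "chain_id C X = (\<lambda>n. Ident C (cx_ob X n))"

definition chain_comp ::
  "('o, 'm, 'k) lincat \<Rightarrow> (int \<Rightarrow> 'm) \<Rightarrow> (int \<Rightarrow> 'm) \<Rightarrow> int \<Rightarrow> 'm" where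
  "chain_comp C g f = (\<lambda>n. g n \<cdot>\<^bsub>C\<^esub> f n)"

definition homotopic :: "('o, 'm, 'k) lincat \<Rightarrow> ('o, 'm) cochain \<Rightarrow> ('o, 'm) cochain
    \<Rightarrow> (int \<Rightarrow> 'm) \<Rightarrow> (int \<Rightarrow> 'm) \<Rightarrow> bool" where
  "homotopic C X Y f g \<longleftrightarrow> (\<exists>h. \<forall>n. h n \<in> Hom C (cx_ob X n) (cx_ob Y (n - 1)) \<and>
    f n = g n \<oplus>\<^bsub>C\<^esub> ((cx_d Y (n - 1) \<cdot>\<^bsub>C\<^esub> h n) \<oplus>\<^bsub>C\<^esub> (h (n + 1) \<cdot>\<^bsub>C\<^esub> cx_d X n)))"

text \<open>
  Cohomology with respect to chosen kernels and cokernels: \<open>cocycle_arr C X n\<close> is the inclusion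
  of the n-cocycles into \<open>X\<^sup>n\<close>, \<open>boundary_arr C X n\<close> is the map from \<open>X\<^sup>n\<^sup>-\<^sup>1\<close> to the n-cocycles
  induced by the differential, and \<open>cohom_arr C X n\<close> is its cokernel, whose codomain is the
  n-th cohomology object.
\<close>

definition cocycle_arr :: "('o, 'm, 'k) lincat \<Rightarrow> ('o, 'm) cochain \<Rightarrow> int \<Rightarrow> 'm" where
  "cocycle_arr C X n = (SOME i. is_kernel C i (cx_d X n))"

definition boundary_arr :: "('o, 'm, 'k) lincat \<Rightarrow> ('o, 'm) cochain \<Rightarrow> int \<Rightarrow> 'm" where
  "boundary_arr C X n = (THE h. h \<in> Hom C (cx_ob X (n - 1)) (Dom C (cocycle_arr C X n)) \<and>
    cocycle_arr C X n \<cdot>\<^bsub>C\<^esub> h = cx_d X (n - 1))"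

definition cohom_arr :: "('o, 'm, 'k) lincat \<Rightarrow> ('o, 'm) cochain \<Rightarrow> int \<Rightarrow> 'm" where
  "cohom_arr C X n = (SOME p. is_cokernel C p (boundary_arr C X n))"

definition cohom :: "('o, 'm, 'k) lincat \<Rightarrow> ('o, 'm) cochain \<Rightarrow> int \<Rightarrow> 'o" where
  "cohom C X n = Cod C (cohom_arr C X n)"

definition cocycle_map ::
  "('o, 'm, 'k) lincat \<Rightarrow> ('o, 'm) cochain \<Rightarrow> ('o, 'm) cochain \<Rightarrow> (int \<Rightarrow> 'm) \<Rightarrow> int \<Rightarrow> 'm" where
  "cocycle_map C X Y f n =
    (THE h. h \<in> Hom C (Dom C (cocycle_arr C X n)) (Dom C (cocycle_arr C Y n)) \<and>
      cocycle_arr C Y n \<cdot>\<^bsub>C\<^esub> h = f n \<cdot>\<^bsub>C\<^esub> cocycle_arr C X n)"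

definition cohom_map ::
  "('o, 'm, 'k) lincat \<Rightarrow> ('o, 'm) cochain \<Rightarrow> ('o, 'm) cochain \<Rightarrow> (int \<Rightarrow> 'm) \<Rightarrow> int \<Rightarrow> 'm" where
  "cohom_map C X Y f n = (THE h. h \<in> Hom C (cohom C X n) (cohom C Y n) \<and>
    h \<cdot>\<^bsub>C\<^esub> cohom_arr C X n = cohom_arr C Y n \<cdot>\<^bsub>C\<^esub> cocycle_map C X Y f n)"

definition quasi_iso ::
  "('o, 'm, 'k) lincat \<Rightarrow> ('o, 'm) cochain \<Rightarrow> ('o, 'm) cochain \<Rightarrow> (int \<Rightarrow> 'm) \<Rightarrow> bool" where
  "quasi_iso C X Y f \<longleftrightarrow> chain_map C X Y f \<and> (\<forall>n. iso_arr C (cohom_map C X Y f n))"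

definition shift_cx ::
  "('o, 'm, 'k::field) lincat \<Rightarrow> int \<Rightarrow> ('o, 'm) cochain \<Rightarrow> ('o, 'm) cochain" where
  "shift_cx C m X = \<lparr>cx_ob = (\<lambda>n. cx_ob X (n + m)),
    cx_d = (\<lambda>n. (if even m then 1 else - 1) \<odot>\<^bsub>C\<^esub> cx_d X (n + m))\<rparr>"

definition shift_map :: "int \<Rightarrow> (int \<Rightarrow> 'm) \<Rightarrow> int \<Rightarrow> 'm" where
  "shift_map m f = (\<lambda>n. f (n + m))"

text \<open>
  The mapping cone of f from X to Y is \<open>X\<^sup>n\<^sup>+\<^sup>1 \<oplus> Y\<^sup>n\<close> in degree n, with differential
  sending (x, y) to (- d x, f x + d y).
\<close>

definition bip :: "('o, 'm, 'k) lincat \<Rightarrow> 'o \<Rightarrow> 'o \<Rightarrow> 'o \<times> 'm \<times> 'm \<times> 'm \<times> 'm" where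
  "bip C A B = (SOME S. is_biproduct C A B S)"

definition bip_ob :: "('o, 'm, 'k) lincat \<Rightarrow> 'o \<Rightarrow> 'o \<Rightarrow> 'o" where
  "bip_ob C A B = (case bip C A B of (S, i1, i2, p1, p2) \<Rightarrow> S)"

definition bip_in1 :: "('o, 'm, 'k) lincat \<Rightarrow> 'o \<Rightarrow> 'o \<Rightarrow> 'm" where
  "bip_in1 C A B = (case bip C A B of (S, i1, i2, p1, p2) \<Rightarrow> i1)"

definition bip_in2 :: "('o, 'm, 'k) lincat \<Rightarrow> 'o \<Rightarrow> 'o \<Rightarrow> 'm" where
  "bip_in2 C A B = (case bip C A B of (S, i1, i2, p1, p2) \<Rightarrow> i2)"

definition bip_pr1 :: "('o, 'm, 'k) lincat \<Rightarrow> 'o \<Rightarrow> 'o \<Rightarrow> 'm" where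
  "bip_pr1 C A B = (case bip C A B of (S, i1, i2, p1, p2) \<Rightarrow> p1)"

definition bip_pr2 :: "('o, 'm, 'k) lincat \<Rightarrow> 'o \<Rightarrow> 'o \<Rightarrow> 'm" where
  "bip_pr2 C A B = (case bip C A B of (S, i1, i2, p1, p2) \<Rightarrow> p2)"

definition cone_in ::
  "('o, 'm, 'k) lincat \<Rightarrow> ('o, 'm) cochain \<Rightarrow> ('o, 'm) cochain \<Rightarrow> int \<Rightarrow> 'm" where
  "cone_in C X Y = (\<lambda>n. bip_in2 C (cx_ob X (n + 1)) (cx_ob Y n))"

definition cone_out ::
  "('o, 'm, 'k) lincat \<Rightarrow> ('o, 'm) cochain \<Rightarrow> ('o, 'm) cochain \<Rightarrow> int \<Rightarrow> 'm" where
  "cone_out C X Y = (\<lambda>n. bip_pr1 C (cx_ob X (n + 1)) (cx_ob Y n))"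

definition mapping_cone :: "('o, 'm, 'k::field) lincat \<Rightarrow> ('o, 'm) cochain \<Rightarrow> ('o, 'm) cochain
    \<Rightarrow> (int \<Rightarrow> 'm) \<Rightarrow> ('o, 'm) cochain" where
  "mapping_cone C X Y f = \<lparr>cx_ob = (\<lambda>n. bip_ob C (cx_ob X (n + 1)) (cx_ob Y n)),
    cx_d = (\<lambda>n.
      (bip_in1 C (cx_ob X (n + 1 + 1)) (cx_ob Y (n + 1)) \<cdot>\<^bsub>C\<^esub>
        ((- 1) \<odot>\<^bsub>C\<^esub> cx_d X (n + 1)) \<cdot>\<^bsub>C\<^esub> cone_out C X Y n) \<oplus>\<^bsub>C\<^esub>
      (cone_in C X Y (n + 1) \<cdot>\<^bsub>C\<^esub>
        ((f (n + 1) \<cdot>\<^bsub>C\<^esub> cone_out C X Y n) \<oplus>\<^bsub>C\<^esub>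
         (cx_d Y n \<cdot>\<^bsub>C\<^esub> bip_pr2 C (cx_ob X (n + 1)) (cx_ob Y n)))))\<rparr>"


section \<open>The bounded derived category\<close>

text \<open>
  Objects are bounded complexes.  Morphisms from X to Y are equivalence classes of roofs
  (Z, s, f) with a quasi-isomorphism s from Z to X and a chain map f from Z to Y; two roofs are
  equivalent if they are dominated, up to homotopy, by a common third roof.  This is the
  localization of the bounded homotopy category at the quasi-isomorphisms.
\<close>

type_synonym ('o, 'm) roof = "('o, 'm) cochain \<times> (int \<Rightarrow> 'm) \<times> (int \<Rightarrow> 'm)"

definition roofs ::
  "('o, 'm, 'k) lincat \<Rightarrow> ('o, 'm) cochain \<Rightarrow> ('o, 'm) cochain \<Rightarrow> ('o, 'm) roof set" where
  "roofs C X Y = {(Z, s, f). bounded_cx C Z \<and> quasi_iso C Z X s \<and> chain_map C Z Y f}"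

definition roof_rel :: "('o, 'm, 'k) lincat \<Rightarrow> ('o, 'm) cochain \<Rightarrow> ('o, 'm) cochain
    \<Rightarrow> (('o, 'm) roof \<times> ('o, 'm) roof) set" where
  "roof_rel C X Y = {((Z1, s1, f1), (Z2, s2, f2)).
    (Z1, s1, f1) \<in> roofs C X Y \<and> (Z2, s2, f2) \<in> roofs C X Y \<and>
    (\<exists>Z a b. bounded_cx C Z \<and> chain_map C Z Z1 a \<and> chain_map C Z Z2 b \<and>
      quasi_iso C Z X (chain_comp C s1 a) \<and>
      homotopic C Z X (chain_comp C s1 a) (chain_comp C s2 b) \<and>
      homotopic C Z Y (chain_comp C f1 a) (chain_comp C f2 b))}"

definition D_Hom :: "('o, 'm, 'k) lincat \<Rightarrow> ('o, 'm) cochain \<Rightarrow> ('o, 'm) cochain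
    \<Rightarrow> ('o, 'm) roof set set" where
  "D_Hom C X Y = roofs C X Y // roof_rel C X Y"

definition D_of :: "('o, 'm, 'k) lincat \<Rightarrow> ('o, 'm) cochain \<Rightarrow> ('o, 'm) cochain
    \<Rightarrow> (int \<Rightarrow> 'm) \<Rightarrow> ('o, 'm) roof set" where
  "D_of C X Y f = roof_rel C X Y `` {(X, chain_id C X, f)}"

definition D_id :: "('o, 'm, 'k) lincat \<Rightarrow> ('o, 'm) cochain \<Rightarrow> ('o, 'm) roof set" where
  "D_id C X = D_of C X X (chain_id C X)"

text \<open>
  \<open>D_comp C X Y Z G F\<close> is the composite of F from X to Y with G from Y to Z.  A roof (U, s, f) in F
  and a roof (V, t, g) in G are composed by completing f and t to a square which commutes up to
  homotopy, with a quasi-isomorphism a from T to U opposite to t; the resulting class does not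
  depend on any of these choices.
\<close>

definition D_comp :: "('o, 'm, 'k) lincat \<Rightarrow> ('o, 'm) cochain \<Rightarrow> ('o, 'm) cochain
    \<Rightarrow> ('o, 'm) cochain \<Rightarrow> ('o, 'm) roof set \<Rightarrow> ('o, 'm) roof set \<Rightarrow> ('o, 'm) roof set" where
  "D_comp C X Y Z G F = {R. \<exists>U s f V t g T a b. (U, s, f) \<in> F \<and> (V, t, g) \<in> G \<and>
    bounded_cx C T \<and> quasi_iso C T U a \<and> chain_map C T V b \<and>
    homotopic C T Y (chain_comp C f a) (chain_comp C t b) \<and>
    ((T, chain_comp C s a, chain_comp C g b), R) \<in> roof_rel C X Z}"

definition D_shift :: "('o, 'm, 'k::field) lincat \<Rightarrow> int \<Rightarrow> ('o, 'm) cochain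
    \<Rightarrow> ('o, 'm) cochain \<Rightarrow> ('o, 'm) roof set \<Rightarrow> ('o, 'm) roof set" where
  "D_shift C m X Y F = {R. \<exists>Z s f. (Z, s, f) \<in> F \<and>
    ((shift_cx C m Z, shift_map m s, shift_map m f), R)
      \<in> roof_rel C (shift_cx C m X) (shift_cx C m Y)}"

definition D_iso_arr :: "('o, 'm, 'k) lincat \<Rightarrow> ('o, 'm) cochain \<Rightarrow> ('o, 'm) cochain
    \<Rightarrow> ('o, 'm) roof set \<Rightarrow> bool" where
  "D_iso_arr C X Y F \<longleftrightarrow> F \<in> D_Hom C X Y \<and>
    (\<exists>G \<in> D_Hom C Y X. D_comp C X Y X G F = D_id C X \<and> D_comp C Y X Y F G = D_id C Y)"

text \<open>Two bounded complexes are called quasi-isomorphic if they are isomorphic in the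
  derived category.\<close>

definition D_isomorphic ::
  "('o, 'm, 'k) lincat \<Rightarrow> ('o, 'm) cochain \<Rightarrow> ('o, 'm) cochain \<Rightarrow> bool" where
  "D_isomorphic C X Y \<longleftrightarrow> bounded_cx C X \<and> bounded_cx C Y \<and> (\<exists>F. D_iso_arr C X Y F)"

text \<open>
  A triangle \<open>N' \<rightarrow> N \<rightarrow> N'' \<rightarrow> N'[1]\<close> with morphisms u, v, t is distinguished if it is isomorphic,
  as a triangle in the derived category, to the triangle
  \<open>X \<rightarrow> Y \<rightarrow> cone(f) \<rightarrow> X[1]\<close> of a chain map f from X to Y.
\<close>

definition distinguished_triangle :: "('o, 'm, 'k::field) lincat
    \<Rightarrow> ('o, 'm) cochain \<Rightarrow> ('o, 'm) cochain \<Rightarrow> ('o, 'm) cochain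
    \<Rightarrow> ('o, 'm) roof set \<Rightarrow> ('o, 'm) roof set \<Rightarrow> ('o, 'm) roof set \<Rightarrow> bool" where
  "distinguished_triangle C N' N N'' u v t \<longleftrightarrow>
    bounded_cx C N' \<and> bounded_cx C N \<and> bounded_cx C N'' \<and>
    u \<in> D_Hom C N' N \<and> v \<in> D_Hom C N N'' \<and> t \<in> D_Hom C N'' (shift_cx C 1 N') \<and>
    (\<exists>X Y f \<alpha> \<beta> \<gamma>. bounded_cx C X \<and> bounded_cx C Y \<and> chain_map C X Y f \<and>
      D_iso_arr C N' X \<alpha> \<and> D_iso_arr C N Y \<beta> \<and> D_iso_arr C N'' (mapping_cone C X Y f) \<gamma> \<and>
      D_comp C N' N Y \<beta> u = D_comp C N' X Y (D_of C X Y f) \<alpha> \<and>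
      D_comp C N N'' (mapping_cone C X Y f) \<gamma> v =
        D_comp C N Y (mapping_cone C X Y f) (D_of C Y (mapping_cone C X Y f) (cone_in C X Y)) \<beta> \<and>
      D_comp C N'' (shift_cx C 1 N') (shift_cx C 1 X) (D_shift C 1 N' X \<alpha>) t =
        D_comp C N'' (mapping_cone C X Y f) (shift_cx C 1 X)
          (D_of C (mapping_cone C X Y f) (shift_cx C 1 X) (cone_out C X Y)) \<gamma>)"


section \<open>BGG complexes\<close>

text \<open>
  A finite-dimensional vector space V is given, up to isomorphism, by its dimension d, and
  the object \<open>A \<otimes> V\<close> is the direct sum of d copies of A.
\<close>

definition is_tensor :: "('o, 'm, 'k) lincat \<Rightarrow> 'o \<Rightarrow> nat \<Rightarrow> 'o \<Rightarrow> bool" where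
  "is_tensor C A d T \<longleftrightarrow> (\<exists>\<iota>. is_direct_sum C {..<d} (\<lambda>_. A) T \<iota>)"

text \<open>In degrees in which l takes no value, the direct sum is empty and the term is zero; this
  covers in particular all degrees outside the range of l.\<close>

definition BGG_complex :: "('o, 'm, 'k) lincat \<Rightarrow> 'w set \<Rightarrow> ('w \<Rightarrow> 'o) \<Rightarrow> ('w \<Rightarrow> int)
    \<Rightarrow> ('o, 'm) cochain \<Rightarrow> bool" where
  "BGG_complex C W M l B \<longleftrightarrow> bounded_cx C B \<and>
    (\<exists>(d :: 'w \<Rightarrow> nat) T. (\<forall>w \<in> W. is_tensor C (M w) (d w) (T w)) \<and>
      (\<forall>n. \<exists>\<iota>. is_direct_sum C {w \<in> W. l w = n} T (cx_ob B n) \<iota>))"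

text \<open>N admits an ordinary BGG resolution for the shift [m].\<close>

definition admits_BGG_resolution :: "('o, 'm, 'k::field) lincat \<Rightarrow> 'w set \<Rightarrow> ('w \<Rightarrow> 'o)
    \<Rightarrow> ('w \<Rightarrow> int) \<Rightarrow> int \<Rightarrow> ('o, 'm) cochain \<Rightarrow> bool" where
  "admits_BGG_resolution C W M l m N \<longleftrightarrow> bounded_cx C N \<and>
    (\<exists>B. BGG_complex C W M l B \<and> D_isomorphic C (shift_cx C m N) B)"

end

(* The idea.  After rotating the triangle, N[m] is the fibre of a morphism in the derived category
   from a BGG complex B'' to B'[1].  The terms of B'' in degree n are sums of objects M_y with
   l(y) = n.  The projective cover of M_y has kernel filtered by objects M_x with l(x) > n, so M_y
   has a finite projective resolution whose terms in negative degrees have no morphisms to the terms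
   of B' in degrees at most n.  Gluing these gives a projective resolution Q'' of B'' such that every
   chain map from Q'' to B'[1] factors strictly through B''.  The morphism is thus induced by a
   chain map g from B'' to B'[1], and N[m] is quasi-isomorphic to the extension of B'' by B' twisted
   by g, whose terms are sums of terms of B' and B''.

   All diagram chases are made with generalized elements, i.e. morphisms out of projective objects.
   To have unconditional algebra at one's disposal, the category is embedded in a ring: an arrow is
   represented by its action on the linear functionals on the Hom spaces. *)

theory Submission
  imports Defs Complex_Main "HOL-Library.Function_Algebras"
begin

section \<open>Arrows as elements of a ring\<close>

text \<open>The obstacle is that a morphism from B'' to B'[1] in the derived category is a chain map
  only on a resolution of B'', and such a map need not descend to B''. A count of degrees makes it
  descend. In the resolution of the term of B'' in degree a, a component in degree n < a has its
  target in B'^(n+1), and n + 1 <= a is still in the range where the terms below the top have no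
  maps to B'. So only the component in degree a survives. It kills boundaries, and therefore it
  factors through the term itself. The bound has its origin in condition (2): a nonzero map from M_x
  to M_w forces l(x) <= l(w), and the standard objects in the kernel of P_w -> M_w are strictly
  longer than M_w. The head P_w may map to the term of B' in degree l(w), but no later term of the
  resolution does. That P_w -> M_w is surjective is derived from End(M_w) = k.\<close>

typedef (overloaded) 'g op_end = "{F :: 'g::ab_group_add \<Rightarrow> 'g. \<forall>x y. F (x + y) = F x + F y}"
  by (rule exI[of _ "\<lambda>_. 0"]) simp

setup_lifting type_definition_op_end

text \<open>Products are composed in reverse order because arrows act contravariantly on functionals.\<close>

instantiation op_end :: (ab_group_add) ring
begin

lift_definition zero_op_end :: "'a op_end" is "\<lambda>_. 0" by simp
lift_definition plus_op_end :: "'a op_end \<Rightarrow> 'a op_end \<Rightarrow> 'a op_end" is "\<lambda>F G x. F x + G x"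
  by (simp add: algebra_simps)
lift_definition uminus_op_end :: "'a op_end \<Rightarrow> 'a op_end" is "\<lambda>F x. - F x" by simp
lift_definition minus_op_end :: "'a op_end \<Rightarrow> 'a op_end \<Rightarrow> 'a op_end" is "\<lambda>F G x. F x - G x"
  by (simp add: algebra_simps)
lift_definition times_op_end :: "'a op_end \<Rightarrow> 'a op_end \<Rightarrow> 'a op_end" is "\<lambda>F G x. G (F x)" by simp

instance
  by standard (transfer; simp add: fun_eq_iff algebra_simps)+

end

section \<open>Linear algebra in the Hom spaces: separation by linear forms\<close>

context linear_category
begin

abbreviation neg :: "'m \<Rightarrow> 'm" where "neg f \<equiv> (- 1) \<odot> f"

lemma HomD: "f \<in> Hom C A B \<Longrightarrow> f \<in> Arr C \<and> Dom C f = A \<and> Cod C f = B"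
  by (simp add: Hom_def)

lemma Hom_Obj: "f \<in> Hom C A B \<Longrightarrow> A \<in> Obj C \<and> B \<in> Obj C"
  using Dom_Obj Cod_Obj by (auto simp: Hom_def)

lemma Arr_Hom: "f \<in> Arr C \<Longrightarrow> f \<in> Hom C (Dom C f) (Cod C f)"
  by (simp add: Hom_def)

lemma Zero_Add: "f \<in> Hom C A B \<Longrightarrow> Zero C A B \<oplus> f = f"
  using Add_Zero Add_commute Zero_Hom Hom_Obj by metis

lemma Scale_zero: assumes f: "f \<in> Hom C A B" shows "0 \<odot> f = Zero C A B"
proof -
  have z: "0 \<odot> f \<in> Hom C A B" using Scale_Hom f .
  obtain g where g: "g \<in> Hom C A B" "0 \<odot> f \<oplus> g = Zero C A B" using Add_inverse[OF z] by blast
  have "0 \<odot> f \<oplus> 0 \<odot> f = 0 \<odot> f" using Scale_plus[OF f, of 0 0] by simp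
  then have "(0 \<odot> f \<oplus> 0 \<odot> f) \<oplus> g = 0 \<odot> f \<oplus> g" by simp
  then show ?thesis using Add_assoc[OF z z g(1)] g Add_Zero[OF z] by simp
qed

lemma Add_neg: assumes f: "f \<in> Hom C A B" shows "f \<oplus> neg f = Zero C A B"
  using Scale_plus[OF f, of 1 "-1"] Scale_zero[OF f] Scale_one[OF f] by simp

lemma Add_left_cancel:
  assumes f: "f \<in> Hom C A B" and g: "g \<in> Hom C A B" and h: "h \<in> Hom C A B" and e: "f \<oplus> g = f \<oplus> h"
  shows "g = h"
proof -
  have n: "neg f \<in> Hom C A B" using Scale_Hom f .
  have "neg f \<oplus> (f \<oplus> g) = neg f \<oplus> (f \<oplus> h)" using e by simp
  then have "(neg f \<oplus> f) \<oplus> g = (neg f \<oplus> f) \<oplus> h"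
    using Add_assoc[OF n f g] Add_assoc[OF n f h] by simp
  then show ?thesis using Add_neg[OF f] Add_commute[OF f n] Zero_Add[OF g] Zero_Add[OF h] by simp
qed

lemma Scale_Zero: assumes "A \<in> Obj C" "B \<in> Obj C" shows "c \<odot> Zero C A B = Zero C A B"
  using Scale_Scale[OF Zero_Hom[OF assms], of c 0] Scale_zero[OF Zero_Hom[OF assms]] by simp

lemma Add_4: assumes "a \<in> Hom C A B" "b \<in> Hom C A B" "c \<in> Hom C A B" "d \<in> Hom C A B"
  shows "(a \<oplus> b) \<oplus> (c \<oplus> d) = (a \<oplus> c) \<oplus> (b \<oplus> d)"
proof -
  have "b \<oplus> (c \<oplus> d) = c \<oplus> (b \<oplus> d)"
    using Add_assoc[OF assms(2,3,4)] Add_commute[OF assms(2,3)] Add_assoc[OF assms(3,2,4)] by simp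
  then show ?thesis
    using Add_assoc[OF assms(1,2) Add_Hom[OF assms(3,4)]] Add_assoc[OF assms(1,3) Add_Hom[OF assms(2,4)]] by simp
qed

text \<open>One \<open>\<phi>\<close> is a whole family of linear forms, one on each Hom space,
  extended by 0 to elements of the type that are not arrows. All Hom spaces are thus dualized into
  one abelian group on which every arrow can act.\<close>

definition functionals :: "('m \<Rightarrow> 'k) set" where
  "functionals = {\<phi>. (\<forall>x. x \<notin> Arr C \<longrightarrow> \<phi> x = 0) \<and>
     (\<forall>A B. \<forall>f \<in> Hom C A B. \<forall>g \<in> Hom C A B. \<phi> (f \<oplus> g) = \<phi> f + \<phi> g) \<and>
     (\<forall>f \<in> Arr C. \<forall>c. \<phi> (c \<odot> f) = c * \<phi> f)}"

text \<open>A maximal subspace of Hom(A, B) avoiding u, given by Zorn, is a complement of the line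
  spanned by u. The wanted form reads off the coefficient of u.\<close>

lemma separating_functional:
  assumes u: "u \<in> Hom C A B" and nz: "u \<noteq> Zero C A B"
  shows "\<exists>\<phi> \<in> functionals. \<phi> u \<noteq> 0"
proof -
  have AB: "A \<in> Obj C" "B \<in> Obj C" using Hom_Obj[OF u] by auto
  define \<S> where "\<S> = {S. S \<subseteq> Hom C A B \<and> Zero C A B \<in> S \<and> (\<forall>f \<in> S. \<forall>g \<in> S. f \<oplus> g \<in> S) \<and>
    (\<forall>c. \<forall>f \<in> S. c \<odot> f \<in> S) \<and> u \<notin> S}"
  have "{Zero C A B} \<in> \<S>"
    using AB Zero_Hom Add_Zero Scale_Zero nz by (auto simp: \<S>_def)
  moreover have "\<Union>\<C> \<in> \<S>" if ne: "\<C> \<noteq> {}" and ch: "subset.chain \<S> \<C>" for \<C>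
  proof -
    have sub: "\<C> \<subseteq> \<S>" and lin: "\<And>S T. S \<in> \<C> \<Longrightarrow> T \<in> \<C> \<Longrightarrow> S \<subseteq> T \<or> T \<subseteq> S"
      using ch by (auto simp: subset.chain_def)
    have "f \<oplus> g \<in> \<Union>\<C>" if fg: "f \<in> \<Union>\<C>" "g \<in> \<Union>\<C>" for f g
    proof -
      obtain S T where S: "S \<in> \<C>" "f \<in> S" and T: "T \<in> \<C>" "g \<in> T" using fg by blast
      then obtain R where R: "R \<in> \<C>" "f \<in> R" "g \<in> R" using lin[OF S(1) T(1)] by blast
      then have "f \<oplus> g \<in> R" using sub by (auto simp: \<S>_def)
      then show ?thesis using R by blast
    qed
    moreover have sD: "S \<subseteq> Hom C A B" "Zero C A B \<in> S" "\<And>c f. f \<in> S \<Longrightarrow> c \<odot> f \<in> S" "u \<notin> S"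
      if "S \<in> \<C>" for S
      using that sub by (auto simp: \<S>_def)
    have "\<Union>\<C> \<subseteq> Hom C A B" "u \<notin> \<Union>\<C>" using sD(1,4) by blast+
    moreover have "Zero C A B \<in> \<Union>\<C>" using sD(2) ne by blast
    moreover have "c \<odot> f \<in> \<Union>\<C>" if "f \<in> \<Union>\<C>" for c f using sD(3) that by blast
    ultimately show ?thesis unfolding \<S>_def by blast
  qed
  ultimately obtain S where S: "S \<in> \<S>" and max: "\<And>X. X \<in> \<S> \<Longrightarrow> S \<subseteq> X \<Longrightarrow> X = S"
    using subset_Zorn_nonempty[of \<S>] by blast
  have sH: "\<And>s. s \<in> S \<Longrightarrow> s \<in> Hom C A B" and s0: "Zero C A B \<in> S"
    and sA: "\<And>f g. f \<in> S \<Longrightarrow> g \<in> S \<Longrightarrow> f \<oplus> g \<in> S" and sS: "\<And>c f. f \<in> S \<Longrightarrow> c \<odot> f \<in> S"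
    and sU: "u \<notin> S"
    using S by (auto simp: \<S>_def)
  have ex: "\<exists>s \<in> S. \<exists>c. g = s \<oplus> c \<odot> u" if g: "g \<in> Hom C A B" for g
  proof (cases "g \<in> S")
    case True
    then show ?thesis using Scale_zero[OF u] Add_Zero[OF g] by metis
  next
    case False
    \<comment> \<open>T is strictly larger than S, so by maximality it contains u. The equation u =
      s + c g is then solved for g; c is nonzero because u is not in S.\<close>
    define T where "T = {s \<oplus> c \<odot> g | s c. s \<in> S}"
    have "s = s \<oplus> 0 \<odot> g" if "s \<in> S" for s
      using Scale_zero[OF g] Add_Zero[OF sH[OF that]] by simp
    then have ST: "S \<subseteq> T" unfolding T_def by blast
    have "g = Zero C A B \<oplus> 1 \<odot> g" using Scale_one[OF g] Zero_Add[OF g] by simp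
    then have gT: "g \<in> T" unfolding T_def using s0 by blast
    have TH: "T \<subseteq> Hom C A B" unfolding T_def using sH Add_Hom Scale_Hom g by blast
    have "f \<oplus> h \<in> T" if fh: "f \<in> T" "h \<in> T" for f h
    proof -
      obtain s c s' c' where e: "s \<in> S" "f = s \<oplus> c \<odot> g" "s' \<in> S" "h = s' \<oplus> c' \<odot> g"
        using fh unfolding T_def by blast
      have "f \<oplus> h = (s \<oplus> s') \<oplus> (c + c') \<odot> g"
        using Add_4[OF sH[OF e(1)] Scale_Hom[OF g] sH[OF e(3)] Scale_Hom[OF g]] e Scale_plus[OF g] by simp
      then show ?thesis unfolding T_def using sA e by blast
    qed
    moreover have "k \<odot> f \<in> T" if fT: "f \<in> T" for f k
    proof -
      obtain s c where e: "s \<in> S" "f = s \<oplus> c \<odot> g" using fT unfolding T_def by blast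
      have "k \<odot> f = k \<odot> s \<oplus> (k * c) \<odot> g"
        using Scale_Add[OF sH[OF e(1)] Scale_Hom[OF g]] Scale_Scale[OF g] e by simp
      then show ?thesis unfolding T_def using sS e by blast
    qed
    ultimately have "u \<notin> T \<Longrightarrow> T \<in> \<S>" unfolding \<S>_def using TH ST s0 by blast
    then have "u \<in> T" using max[of T] ST gT False by blast
    then obtain s c where e: "s \<in> S" "u = s \<oplus> c \<odot> g" unfolding T_def by blast
    note s = sH[OF e(1)]
    have c0: "c \<noteq> 0" using e sU Scale_zero[OF g] Add_Zero[OF s] by auto
    have "inverse c \<odot> u = inverse c \<odot> s \<oplus> g"
      using e Scale_Add[OF s Scale_Hom[OF g]] Scale_Scale[OF g] Scale_one[OF g] c0 by simp
    then have "neg (inverse c \<odot> s) \<oplus> inverse c \<odot> u = (neg (inverse c \<odot> s) \<oplus> inverse c \<odot> s) \<oplus> g"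
      using Add_assoc[OF Scale_Hom Scale_Hom g] Scale_Hom[OF s] s by simp
    also have "\<dots> = g" using Add_neg[OF Scale_Hom[OF s]] Zero_Add[OF g]
      Add_commute[OF Scale_Hom[OF s] Scale_Hom[OF Scale_Hom[OF s]]] by metis
    finally show ?thesis using sS[OF sS[OF e(1)]] by metis
  qed
  \<comment> \<open>Two expressions with different coefficients would put a nonzero multiple of u,
    hence u itself, into S.\<close>
  have un: "c = c'" if e: "s \<in> S" "s' \<in> S" "s \<oplus> c \<odot> u = s' \<oplus> c' \<odot> u" for s s' c c'
  proof (rule ccontr)
    assume ne: "c \<noteq> c'"
    note s = sH[OF e(1)] and s' = sH[OF e(2)]
    have "neg s \<oplus> (s' \<oplus> c' \<odot> u) = (neg s \<oplus> s) \<oplus> c \<odot> u"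
      using Add_assoc[OF Scale_Hom[OF s] s Scale_Hom[OF u]] e by simp
    also have "\<dots> = c \<odot> u" using Add_neg[OF s] Add_commute[OF s Scale_Hom[OF s]] Zero_Add[OF Scale_Hom[OF u]]
      by metis
    finally have "c \<odot> u = (neg s \<oplus> s') \<oplus> c' \<odot> u"
      using Add_assoc[OF Scale_Hom[OF s] s' Scale_Hom[OF u]] by simp
    then have "c \<odot> u \<oplus> (- c') \<odot> u = (neg s \<oplus> s') \<oplus> (c' \<odot> u \<oplus> (- c') \<odot> u)"
      using Add_assoc[OF Add_Hom[OF Scale_Hom[OF s] s'] Scale_Hom[OF u] Scale_Hom[OF u]] by simp
    then have "(c - c') \<odot> u = neg s \<oplus> s'"
      using Scale_plus[OF u, of c "- c'"] Scale_plus[OF u, of c' "- c'"] Scale_zero[OF u]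
        Add_Zero[OF Add_Hom[OF Scale_Hom[OF s] s']] by simp
    then have "(c - c') \<odot> u \<in> S" using sA sS e by simp
    then have "inverse (c - c') \<odot> ((c - c') \<odot> u) \<in> S" by (rule sS)
    then show False using Scale_Scale[OF u] Scale_one[OF u] ne sU by simp
  qed
  define \<phi> where "\<phi> g = (if g \<in> Hom C A B then THE c. \<exists>s \<in> S. g = s \<oplus> c \<odot> u else 0)" for g
  have \<phi>: "\<phi> (s \<oplus> c \<odot> u) = c" if s: "s \<in> S" for s c
    unfolding \<phi>_def using Add_Hom[OF sH[OF s] Scale_Hom[OF u]] un s by (auto intro!: the_equality)
  have "\<phi> (f \<oplus> g) = \<phi> f + \<phi> g" if fg: "f \<in> Hom C A' B'" "g \<in> Hom C A' B'" for A' B' f g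
  proof (cases "A' = A \<and> B' = B")
    case True
    then obtain s c s' c' where e: "s \<in> S" "f = s \<oplus> c \<odot> u" "s' \<in> S" "g = s' \<oplus> c' \<odot> u"
      using ex fg by metis
    have "f \<oplus> g = (s \<oplus> s') \<oplus> (c + c') \<odot> u"
      using Add_4[OF sH[OF e(1)] Scale_Hom[OF u] sH[OF e(3)] Scale_Hom[OF u]] e Scale_plus[OF u] by simp
    then show ?thesis using \<phi> e sA by simp
  next
    case False
    then show ?thesis using Add_Hom[OF fg] fg by (auto simp: \<phi>_def Hom_def)
  qed
  moreover have "\<phi> (k \<odot> f) = k * \<phi> f" if f: "f \<in> Arr C" for f k
  proof (cases "f \<in> Hom C A B")
    case True
    then obtain s c where e: "s \<in> S" "f = s \<oplus> c \<odot> u" using ex by metis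
    have "k \<odot> f = k \<odot> s \<oplus> (k * c) \<odot> u"
      using Scale_Add[OF sH[OF e(1)] Scale_Hom[OF u]] Scale_Scale[OF u] e by simp
    then show ?thesis using \<phi> e sS by simp
  next
    case False
    then show ?thesis using Scale_Hom[OF Arr_Hom[OF f], of k] f by (auto simp: \<phi>_def Hom_def)
  qed
  moreover have "\<phi> x = 0" if "x \<notin> Arr C" for x using that by (simp add: \<phi>_def Hom_def)
  ultimately have "\<phi> \<in> functionals" unfolding functionals_def by blast
  moreover have "\<phi> u = 1" using \<phi>[OF s0, of 1] Scale_one[OF u] Zero_Add[OF u] by simp
  ultimately show ?thesis by force
qed

text \<open>An element of \<open>op_end\<close> must be defined on the whole group of functions,
  whereas arrows act on functionals. Composing with an additive projection onto
  \<open>functionals\<close> extends the action.\<close>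

definition functional_proj :: "('m \<Rightarrow> 'k) \<Rightarrow> 'm \<Rightarrow> 'k" where
  "functional_proj = (SOME p. (\<forall>\<phi> \<psi>. p (\<phi> + \<psi>) = p \<phi> + p \<psi>) \<and> range p \<subseteq> functionals \<and>
    (\<forall>\<phi> \<in> functionals. p \<phi> = \<phi>))"

lemma functional_proj:
  "functional_proj (\<phi> + \<psi>) = functional_proj \<phi> + functional_proj \<psi>"
  "functional_proj \<phi> \<in> functionals"
  "\<phi> \<in> functionals \<Longrightarrow> functional_proj \<phi> = \<phi>"
proof -
  let ?s = "\<lambda>(c :: 'k) (\<phi> :: 'm \<Rightarrow> 'k) x. c * \<phi> x"
  interpret V: vector_space ?s
    by standard (auto simp: fun_eq_iff algebra_simps)
  interpret VV: vector_space_pair ?s ?s ..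
  have sub: "V.subspace functionals"
    by (auto simp: V.subspace_def functionals_def algebra_simps)
  have "Vector_Spaces.linear ?s ?s (\<lambda>x. x)"
    by (rule V.linear_ident)
  from VV.linear_exists_left_inverse_on[OF this sub]
  obtain p where p: "range p \<subseteq> functionals" "Vector_Spaces.linear ?s ?s p" "\<forall>\<phi>\<in>functionals. p \<phi> = \<phi>"
    by (auto simp: inj_on_def)
  have "p (\<phi> + \<psi>) = p \<phi> + p \<psi>" for \<phi> \<psi>
    using Vector_Spaces.linear.axioms(3)[OF p(2)] by (simp add: module_hom_iff)
  then have "\<exists>p. (\<forall>\<phi> \<psi>. p (\<phi> + \<psi>) = p \<phi> + p \<psi>) \<and> range p \<subseteq> functionals \<and>
    (\<forall>\<phi> \<in> functionals. p \<phi> = (\<phi> :: 'm \<Rightarrow> 'k))" using p by blast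
  from someI_ex[OF this] show
    "functional_proj (\<phi> + \<psi>) = functional_proj \<phi> + functional_proj \<psi>"
    "functional_proj \<phi> \<in> functionals"
    "\<phi> \<in> functionals \<Longrightarrow> functional_proj \<phi> = \<phi>"
    unfolding functional_proj_def by blast+
qed

section \<open>The transposed action of arrows on linear forms\<close>

definition act :: "'m \<Rightarrow> ('m \<Rightarrow> 'k) \<Rightarrow> 'm \<Rightarrow> 'k" where
  "act f \<phi> = (\<lambda>h. if h \<in> Arr C \<and> Cod C h = Dom C f then \<phi> (f \<cdot> h) else 0)"

definition rep :: "'m \<Rightarrow> ('m \<Rightarrow> 'k) op_end" where
  "rep f = Abs_op_end (\<lambda>\<phi>. act f (functional_proj \<phi>))"

lemma Rep_rep: "Rep_op_end (rep f) \<phi> = act f (functional_proj \<phi>)"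
proof -
  have "(\<lambda>\<phi>. act f (functional_proj \<phi>)) \<in> {F. \<forall>x y. F (x + y) = F x + F y}"
    by (auto simp: act_def functional_proj fun_eq_iff)
  then show ?thesis by (simp add: rep_def Abs_op_end_inverse)
qed

lemma act_functionals:
  assumes f: "f \<in> Arr C" and \<phi>: "\<phi> \<in> functionals" shows "act f \<phi> \<in> functionals"
proof -
  note fH = Arr_Hom[OF f]
  have "act f \<phi> (h \<oplus> h') = act f \<phi> h + act f \<phi> h'" if h: "h \<in> Hom C A B" "h' \<in> Hom C A B" for A B h h'
  proof (cases "B = Dom C f")
    case True
    then have "f \<cdot> (h \<oplus> h') = f \<cdot> h \<oplus> f \<cdot> h'" "f \<cdot> h \<in> Hom C A (Cod C f)" "f \<cdot> h' \<in> Hom C A (Cod C f)"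
      using Add_Comp h fH Comp_Hom by blast+
    then show ?thesis using \<phi> HomD[OF h(1)] HomD[OF h(2)] HomD[OF Add_Hom[OF h]] True
      by (auto simp: act_def functionals_def)
  next
    case False
    then show ?thesis using HomD[OF h(1)] HomD[OF h(2)] HomD[OF Add_Hom[OF h]] by (simp add: act_def)
  qed
  moreover have "act f \<phi> (c \<odot> h) = c * act f \<phi> h" if h: "h \<in> Arr C" for c h
  proof (cases "Cod C h = Dom C f")
    case True
    then have hH: "h \<in> Hom C (Dom C h) (Dom C f)" using Arr_Hom[OF h] by simp
    have "f \<cdot> (c \<odot> h) = c \<odot> (f \<cdot> h)" "f \<cdot> h \<in> Arr C"
      using Comp_Scale[OF hH fH] HomD[OF Comp_Hom[OF hH fH]] by auto
    then show ?thesis using \<phi> h HomD[OF Scale_Hom[OF Arr_Hom[OF h], of c]] True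
      by (auto simp: act_def functionals_def)
  next
    case False
    then show ?thesis using h HomD[OF Scale_Hom[OF Arr_Hom[OF h], of c]] by (simp add: act_def)
  qed
  ultimately show ?thesis unfolding functionals_def by (auto simp: act_def)
qed

lemma rep_Add: assumes "f \<in> Hom C A B" "g \<in> Hom C A B" shows "rep (f \<oplus> g) = rep f + rep g"
proof -
  have "act (f \<oplus> g) \<phi> = act f \<phi> + act g \<phi>" if \<phi>: "\<phi> \<in> functionals" for \<phi>
  proof (rule ext)
    fix h
    show "act (f \<oplus> g) \<phi> h = (act f \<phi> + act g \<phi>) h"
    proof (cases "h \<in> Arr C \<and> Cod C h = A")
      case True
      then have h: "h \<in> Hom C (Dom C h) A" by (simp add: Hom_def)
      have "(f \<oplus> g) \<cdot> h = f \<cdot> h \<oplus> g \<cdot> h" using Comp_Add[OF h assms] .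
      then show ?thesis using \<phi> Comp_Hom[OF h assms(1)] Comp_Hom[OF h assms(2)] True
        HomD[OF assms(1)] HomD[OF assms(2)] HomD[OF Add_Hom[OF assms]]
        by (auto simp: act_def functionals_def)
    next
      case False
      then show ?thesis using HomD[OF assms(1)] HomD[OF assms(2)] HomD[OF Add_Hom[OF assms]]
        by (auto simp: act_def)
    qed
  qed
  then show ?thesis
    by (simp add: Rep_op_end_inject[symmetric] plus_op_end.rep_eq Rep_rep fun_eq_iff functional_proj)
qed

text \<open>\<open>act g\<close> maps functionals to functionals, so the projection inserted between
  the two actions is the identity there.\<close>

lemma rep_Comp: assumes f: "f \<in> Hom C A B" and g: "g \<in> Hom C B D" shows "rep (g \<cdot> f) = rep g * rep f"
proof -
  have "act (g \<cdot> f) \<phi> = act f (act g \<phi>)" for \<phi>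
  proof (rule ext)
    fix h
    show "act (g \<cdot> f) \<phi> h = act f (act g \<phi>) h"
    proof (cases "h \<in> Arr C \<and> Cod C h = A")
      case True
      then have h: "h \<in> Hom C (Dom C h) A" by (simp add: Hom_def)
      show ?thesis using True HomD[OF Comp_Hom[OF h f]] HomD[OF f] HomD[OF g] HomD[OF Comp_Hom[OF f g]]
        Comp_assoc[OF h f g] by (simp add: act_def)
    next
      case False
      then show ?thesis using HomD[OF f] HomD[OF Comp_Hom[OF f g]] by (auto simp: act_def)
    qed
  qed
  moreover have "functional_proj (act g (functional_proj \<phi>)) = act g (functional_proj \<phi>)" for \<phi>
    using functional_proj act_functionals HomD[OF g] by blast
  ultimately have "Rep_op_end (rep (g \<cdot> f)) = Rep_op_end (rep g * rep f)"
    by (intro ext) (simp add: times_op_end.rep_eq Rep_rep)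
  then show ?thesis by (simp add: Rep_op_end_inject)
qed

lemma rep_Zero: assumes "A \<in> Obj C" "B \<in> Obj C" shows "rep (Zero C A B) = 0"
  using rep_Add[OF Zero_Hom[OF assms] Zero_Hom[OF assms]] Add_Zero[OF Zero_Hom[OF assms]] by simp

lemma rep_neg: assumes "f \<in> Hom C A B" shows "rep (neg f) = - rep f"
  using rep_Add[OF assms Scale_Hom[OF assms]] Add_neg[OF assms] Hom_Obj[OF assms] rep_Zero
  by (metis add.inverse_unique)

text \<open>A functional that is nonzero on f - g is pulled back along f and along g and evaluated
  at the identity of A. Only parallel arrows can be told apart: all zero arrows are sent to
  0.\<close>

lemma rep_inj: assumes f: "f \<in> Hom C A B" and g: "g \<in> Hom C A B" and e: "rep f = rep g" shows "f = g"
proof (rule ccontr)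
  assume ne: "f \<noteq> g"
  note n = Scale_Hom[OF g, of "-1"]
  have AB: "A \<in> Obj C" "B \<in> Obj C" using Hom_Obj[OF f] by auto
  have "f \<oplus> neg g \<noteq> Zero C A B"
  proof
    assume "f \<oplus> neg g = Zero C A B"
    then have "neg g \<oplus> f = neg g \<oplus> g" using Add_commute[OF f n] Add_commute[OF g n] Add_neg[OF g] by simp
    then show False using Add_left_cancel[OF n f g] ne by blast
  qed
  then obtain \<phi> where \<phi>: "\<phi> \<in> functionals" "\<phi> (f \<oplus> neg g) \<noteq> 0"
    using separating_functional[OF Add_Hom[OF f n]] by blast
  have "act f \<phi> = act g \<phi>" using e Rep_rep functional_proj(3)[OF \<phi>(1)] by metis
  then have "act f \<phi> (Ident C A) = act g \<phi> (Ident C A)" by simp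
  then have "\<phi> f = \<phi> g"
    using HomD[OF Ident_Hom[OF AB(1)]] HomD[OF f] HomD[OF g] Comp_Ident[OF f] Comp_Ident[OF g]
    by (simp add: act_def)
  moreover have "\<phi> (f \<oplus> neg g) = \<phi> f + \<phi> (neg g)" "\<phi> (neg g) = (-1) * \<phi> g"
    using \<phi>(1) f n HomD[OF g] unfolding functionals_def by blast+
  ultimately show False using \<phi>(2) by simp
qed

end

section \<open>Complexes and generalized elements\<close>

text \<open>This is what the chases use of an abelian category with enough projectives.
  \<open>H_eqI\<close>: an arrow that vanishes on generalized elements is 0. \<open>factor\<close>:
  an arrow that is surjective on generalized elements is a cokernel of its kernel. Composability is
  recorded by H, while the ring laws hold without side conditions.\<close>

locale hom_ring =
  fixes H :: "'o \<Rightarrow> 'o \<Rightarrow> 'u::ring set" and Ob PR :: "'o set" and one :: "'o \<Rightarrow> 'u"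
    and zo :: 'o and bp :: "'o \<Rightarrow> 'o \<Rightarrow> 'o" and in1 in2 pr1 pr2 :: "'o \<Rightarrow> 'o \<Rightarrow> 'u"
  assumes H_Ob: "x \<in> H A B \<Longrightarrow> A \<in> Ob \<and> B \<in> Ob"
    and zero_H [intro, simp]: "A \<in> Ob \<Longrightarrow> B \<in> Ob \<Longrightarrow> 0 \<in> H A B"
    and add_H [intro, simp]: "x \<in> H A B \<Longrightarrow> y \<in> H A B \<Longrightarrow> x + y \<in> H A B"
    and uminus_H [intro, simp]: "x \<in> H A B \<Longrightarrow> - x \<in> H A B"
    and mult_H [intro]: "x \<in> H A B \<Longrightarrow> y \<in> H B D \<Longrightarrow> y * x \<in> H A D"
    and one_H [intro, simp]: "A \<in> Ob \<Longrightarrow> one A \<in> H A A"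
    and mult_one [simp]: "x \<in> H A B \<Longrightarrow> x * one A = x"
    and one_mult [simp]: "x \<in> H A B \<Longrightarrow> one B * x = x"
    and bp_Ob [intro, simp]: "A \<in> Ob \<Longrightarrow> B \<in> Ob \<Longrightarrow> bp A B \<in> Ob"
    and in1_H [intro, simp]: "A \<in> Ob \<Longrightarrow> B \<in> Ob \<Longrightarrow> in1 A B \<in> H A (bp A B)"
    and in2_H [intro, simp]: "A \<in> Ob \<Longrightarrow> B \<in> Ob \<Longrightarrow> in2 A B \<in> H B (bp A B)"
    and pr1_H [intro, simp]: "A \<in> Ob \<Longrightarrow> B \<in> Ob \<Longrightarrow> pr1 A B \<in> H (bp A B) A"
    and pr2_H [intro, simp]: "A \<in> Ob \<Longrightarrow> B \<in> Ob \<Longrightarrow> pr2 A B \<in> H (bp A B) B"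
    and pr1_in1 [simp]: "A \<in> Ob \<Longrightarrow> B \<in> Ob \<Longrightarrow> pr1 A B * in1 A B = one A"
    and pr2_in2 [simp]: "A \<in> Ob \<Longrightarrow> B \<in> Ob \<Longrightarrow> pr2 A B * in2 A B = one B"
    and pr2_in1 [simp]: "A \<in> Ob \<Longrightarrow> B \<in> Ob \<Longrightarrow> pr2 A B * in1 A B = 0"
    and pr1_in2 [simp]: "A \<in> Ob \<Longrightarrow> B \<in> Ob \<Longrightarrow> pr1 A B * in2 A B = 0"
    and bp_sum: "A \<in> Ob \<Longrightarrow> B \<in> Ob \<Longrightarrow> in1 A B * pr1 A B + in2 A B * pr2 A B = one (bp A B)"
    and PR_Ob: "P \<in> PR \<Longrightarrow> P \<in> Ob"
    and PR_bp [intro, simp]: "P \<in> PR \<Longrightarrow> Q \<in> PR \<Longrightarrow> bp P Q \<in> PR"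
    and zo_PR [intro, simp]: "zo \<in> PR" and one_zo [simp]: "one zo = 0"
    and H_eqI: "u \<in> H A B \<Longrightarrow> (\<And>P x. P \<in> PR \<Longrightarrow> x \<in> H P A \<Longrightarrow> u * x = 0) \<Longrightarrow> u = 0"
    and factor: "e \<in> H A E \<Longrightarrow> f \<in> H A B \<Longrightarrow>
      (\<And>P x. P \<in> PR \<Longrightarrow> x \<in> H P E \<Longrightarrow> \<exists>y \<in> H P A. x = e * y) \<Longrightarrow>
      (\<And>P x. P \<in> PR \<Longrightarrow> x \<in> H P A \<Longrightarrow> e * x = 0 \<Longrightarrow> f * x = 0) \<Longrightarrow> \<exists>g \<in> H E B. f = g * e"
begin

lemma minus_H [intro, simp]: "x \<in> H A B \<Longrightarrow> y \<in> H A B \<Longrightarrow> x - y \<in> H A B"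
  using add_H[of x A B "- y"] by simp

lemma zo_Ob [simp]: "zo \<in> Ob" using PR_Ob by simp

definition zob :: "'o \<Rightarrow> bool" where "zob A \<longleftrightarrow> A \<in> Ob \<and> one A = 0"

lemma zob_Ob: "zob A \<Longrightarrow> A \<in> Ob" by (simp add: zob_def)

lemma zob_zo [simp]: "zob zo" by (simp add: zob_def)

lemma from_zob: "zob A \<Longrightarrow> x \<in> H A B \<Longrightarrow> x = 0"
  by (metis mult_one mult_zero_right zob_def)

lemma to_zob: "zob B \<Longrightarrow> x \<in> H A B \<Longrightarrow> x = 0"
  by (metis mult_zero_left one_mult zob_def)

lemma zob_bp: assumes "zob A" "zob B" shows "zob (bp A B)"
  using assms bp_sum[of A B] to_zob[OF assms(1), of "pr1 A B" "bp A B"] to_zob[OF assms(2), of "pr2 A B" "bp A B"]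
  by (simp add: zob_def)

section \<open>Complexes, chain maps, homotopies and quasi-isomorphisms\<close>

definition cx :: "('o, 'u) cochain \<Rightarrow> bool" where
  "cx X \<longleftrightarrow> (\<forall>n. cx_d X n \<in> H (cx_ob X n) (cx_ob X (n + 1)) \<and> cx_d X (n + 1) * cx_d X n = 0)"

definition bdd :: "('o, 'u) cochain \<Rightarrow> bool" where
  "bdd X \<longleftrightarrow> cx X \<and> (\<exists>a b. \<forall>n. n < a \<or> b < n \<longrightarrow> zob (cx_ob X n))"

definition cm :: "('o, 'u) cochain \<Rightarrow> ('o, 'u) cochain \<Rightarrow> (int \<Rightarrow> 'u) \<Rightarrow> bool" where
  "cm X Y f \<longleftrightarrow> (\<forall>n. f n \<in> H (cx_ob X n) (cx_ob Y n) \<and> f (n + 1) * cx_d X n = cx_d Y n * f n)"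

definition htp :: "('o, 'u) cochain \<Rightarrow> ('o, 'u) cochain \<Rightarrow> (int \<Rightarrow> 'u) \<Rightarrow> (int \<Rightarrow> 'u) \<Rightarrow> bool" where
  "htp X Y f g \<longleftrightarrow> (\<exists>h. \<forall>n. h n \<in> H (cx_ob X n) (cx_ob Y (n - 1)) \<and>
    f n = g n + (cx_d Y (n - 1) * h n + h (n + 1) * cx_d X n))"

text \<open>Injectivity and surjectivity on cohomology, tested on generalized elements, i.e. on
  morphisms out of objects of \<open>PR\<close>.\<close>

definition qinj :: "('o, 'u) cochain \<Rightarrow> ('o, 'u) cochain \<Rightarrow> (int \<Rightarrow> 'u) \<Rightarrow> bool" where
  "qinj X Y f \<longleftrightarrow> (\<forall>P \<in> PR. \<forall>n. \<forall>x \<in> H P (cx_ob X (n + 1)). \<forall>y \<in> H P (cx_ob Y n).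
    cx_d X (n + 1) * x = 0 \<longrightarrow> f (n + 1) * x = cx_d Y n * y \<longrightarrow> (\<exists>x' \<in> H P (cx_ob X n). x = cx_d X n * x'))"

definition qsur :: "('o, 'u) cochain \<Rightarrow> ('o, 'u) cochain \<Rightarrow> (int \<Rightarrow> 'u) \<Rightarrow> bool" where
  "qsur X Y f \<longleftrightarrow> (\<forall>P \<in> PR. \<forall>n. \<forall>y \<in> H P (cx_ob Y (n + 1)). cx_d Y (n + 1) * y = 0 \<longrightarrow>
    (\<exists>x \<in> H P (cx_ob X (n + 1)). \<exists>y' \<in> H P (cx_ob Y n). cx_d X (n + 1) * x = 0 \<and>
      y = f (n + 1) * x + cx_d Y n * y'))"

definition qi :: "('o, 'u) cochain \<Rightarrow> ('o, 'u) cochain \<Rightarrow> (int \<Rightarrow> 'u) \<Rightarrow> bool" where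
  "qi X Y f \<longleftrightarrow> cm X Y f \<and> qinj X Y f \<and> qsur X Y f"

lemma mult_zero_cancel: "a * b = (0 :: 'u) \<Longrightarrow> a * (b * x) = 0"
  by (simp add: mult.assoc[symmetric])

lemma mult_eq_assoc: "a * b = (c :: 'u) \<Longrightarrow> a * (b * x) = c * x"
  by (simp add: mult.assoc[symmetric])

lemma cx_H: "cx X \<Longrightarrow> cx_d X n \<in> H (cx_ob X n) (cx_ob X (n + 1))" by (simp add: cx_def)

lemma cx_H': "cx X \<Longrightarrow> cx_d X (n - 1) \<in> H (cx_ob X (n - 1)) (cx_ob X n)" using cx_H[of X "n - 1"] by simp

lemma cx_dd: "cx X \<Longrightarrow> cx_d X (n + 1) * cx_d X n = 0" by (simp add: cx_def)

lemma cx_dd_el: "cx X \<Longrightarrow> cx_d X (n + 1) * (cx_d X n * x) = 0" by (simp add: cx_dd mult_zero_cancel)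

lemma cx_dd_el': "cx X \<Longrightarrow> cx_d X n * (cx_d X (n - 1) * x) = 0" using cx_dd_el[of X "n - 1"] by simp

lemma cx_Ob: "cx X \<Longrightarrow> cx_ob X n \<in> Ob" using cx_H H_Ob by blast

lemma cm_H: "cm X Y f \<Longrightarrow> f n \<in> H (cx_ob X n) (cx_ob Y n)" by (simp add: cm_def)

lemma cm_d: "cm X Y f \<Longrightarrow> f (n + 1) * cx_d X n = cx_d Y n * f n" by (simp add: cm_def)

lemma cm_d_el: "cm X Y f \<Longrightarrow> f (n + 1) * (cx_d X n * x) = cx_d Y n * (f n * x)"
  using mult_eq_assoc[OF cm_d, of X Y f n x] by (simp add: mult.assoc)

lemma cm_d_el': "cm X Y f \<Longrightarrow> f n * (cx_d X (n - 1) * x) = cx_d Y (n - 1) * (f (n - 1) * x)"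
  using cm_d_el[of X Y f "n - 1"] by simp

lemma bdd_cx: "bdd X \<Longrightarrow> cx X" by (simp add: bdd_def)

lemma qi_cm: "qi X Y f \<Longrightarrow> cm X Y f" by (simp add: qi_def)

lemma qi_injD:
  assumes "qi X Y f" "P \<in> PR" "x \<in> H P (cx_ob X n)" "cx_d X n * x = 0" "y \<in> H P (cx_ob Y (n - 1))"
    "f n * x = cx_d Y (n - 1) * y"
  obtains x' where "x' \<in> H P (cx_ob X (n - 1))" "x = cx_d X (n - 1) * x'"
  using assms unfolding qi_def qinj_def by (metis diff_add_cancel)

lemma qi_surD:
  assumes "qi X Y f" "P \<in> PR" "y \<in> H P (cx_ob Y n)" "cx_d Y n * y = 0"
  obtains x y' where "x \<in> H P (cx_ob X n)" "cx_d X n * x = 0" "y' \<in> H P (cx_ob Y (n - 1))"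
    "y = f n * x + cx_d Y (n - 1) * y'"
  using assms unfolding qi_def qsur_def by (metis diff_add_cancel)

lemma qiI:
  assumes "cm X Y f"
    and "\<And>P n x y. P \<in> PR \<Longrightarrow> x \<in> H P (cx_ob X (n + 1)) \<Longrightarrow> y \<in> H P (cx_ob Y n) \<Longrightarrow>
      cx_d X (n + 1) * x = 0 \<Longrightarrow> f (n + 1) * x = cx_d Y n * y \<Longrightarrow> \<exists>x' \<in> H P (cx_ob X n). x = cx_d X n * x'"
    and "\<And>P n y. P \<in> PR \<Longrightarrow> y \<in> H P (cx_ob Y (n + 1)) \<Longrightarrow> cx_d Y (n + 1) * y = 0 \<Longrightarrow>
      \<exists>x \<in> H P (cx_ob X (n + 1)). \<exists>y' \<in> H P (cx_ob Y n). cx_d X (n + 1) * x = 0 \<and>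
      y = f (n + 1) * x + cx_d Y n * y'"
  shows "qi X Y f"
proof -
  have "qinj X Y f" unfolding qinj_def by (intro ballI allI impI) (rule assms(2))
  moreover have "qsur X Y f" unfolding qsur_def by (intro ballI allI impI) (rule assms(3))
  ultimately show ?thesis using assms(1) by (simp add: qi_def)
qed

lemma cm_comp: assumes "cm X Y f" "cm Y Z g" shows "cm X Z (\<lambda>n. g n * f n)"
proof -
  have "g (n + 1) * f (n + 1) * cx_d X n = cx_d Z n * (g n * f n)" for n
    using cm_d[OF assms(1), of n] cm_d[OF assms(2), of n] by (metis mult.assoc)
  then show ?thesis using cm_H[OF assms(1)] cm_H[OF assms(2)] by (auto simp: cm_def)
qed

lemma cm_one: "cx X \<Longrightarrow> cm X X (\<lambda>n. one (cx_ob X n))"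
  by (simp add: cm_def cx_Ob mult_one[OF cx_H] one_mult[OF cx_H])

lemma htp_refl: "cx X \<Longrightarrow> cx Y \<Longrightarrow> htp X Y f f"
  unfolding htp_def by (rule exI[of _ "\<lambda>_. 0"]) (simp add: cx_Ob)

lemma htp_sym: assumes "htp X Y f g" shows "htp X Y g f"
proof -
  obtain h where "\<forall>n. h n \<in> H (cx_ob X n) (cx_ob Y (n - 1)) \<and>
    f n = g n + (cx_d Y (n - 1) * h n + h (n + 1) * cx_d X n)" using assms by (auto simp: htp_def)
  then show ?thesis unfolding htp_def by (intro exI[of _ "\<lambda>n. - h n"]) simp
qed

lemma htp_trans: assumes "htp X Y f g" "htp X Y g k" shows "htp X Y f k"
proof -
  obtain h where "\<forall>n. h n \<in> H (cx_ob X n) (cx_ob Y (n - 1)) \<and>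
    f n = g n + (cx_d Y (n - 1) * h n + h (n + 1) * cx_d X n)" using assms by (auto simp: htp_def)
  moreover obtain h' where "\<forall>n. h' n \<in> H (cx_ob X n) (cx_ob Y (n - 1)) \<and>
    g n = k n + (cx_d Y (n - 1) * h' n + h' (n + 1) * cx_d X n)" using assms by (auto simp: htp_def)
  ultimately show ?thesis unfolding htp_def
    by (intro exI[of _ "\<lambda>n. h n + h' n"]) (simp add: algebra_simps)
qed

lemma htp_comp_left: assumes "htp X Y f g" "cm Y Z k" shows "htp X Z (\<lambda>n. k n * f n) (\<lambda>n. k n * g n)"
proof -
  obtain h where h: "\<And>n. h n \<in> H (cx_ob X n) (cx_ob Y (n - 1))"
    "\<And>n. f n = g n + (cx_d Y (n - 1) * h n + h (n + 1) * cx_d X n)" using assms by (auto simp: htp_def)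
  have "k (n - 1) * h n \<in> H (cx_ob X n) (cx_ob Z (n - 1))" for n using h(1) cm_H[OF assms(2)] by blast
  moreover have "k n * f n = k n * g n + (cx_d Z (n - 1) * (k (n - 1) * h n) + k n * h (n + 1) * cx_d X n)" for n
    by (simp add: h(2)[of n] distrib_left cm_d_el'[OF assms(2)] mult.assoc)
  ultimately show ?thesis unfolding htp_def by (intro exI[of _ "\<lambda>n. k (n - 1) * h n"]) simp
qed

lemma htp_comp_right: assumes "htp X Y f g" "cm Z X k" shows "htp Z Y (\<lambda>n. f n * k n) (\<lambda>n. g n * k n)"
proof -
  obtain h where h: "\<And>n. h n \<in> H (cx_ob X n) (cx_ob Y (n - 1))"
    "\<And>n. f n = g n + (cx_d Y (n - 1) * h n + h (n + 1) * cx_d X n)" using assms by (auto simp: htp_def)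
  have "h n * k n \<in> H (cx_ob Z n) (cx_ob Y (n - 1))" for n using h(1) cm_H[OF assms(2)] by blast
  moreover have "f n * k n = g n * k n + (cx_d Y (n - 1) * (h n * k n) + h (n + 1) * k (n + 1) * cx_d Z n)" for n
    by (simp add: h(2)[of n] distrib_right cm_d[OF assms(2)] mult.assoc)
  ultimately show ?thesis unfolding htp_def by (intro exI[of _ "\<lambda>n. h n * k n"]) simp
qed

lemma htp_el:
  assumes "htp X Y f g" "x \<in> H P (cx_ob X n)" "cx_d X n * x = 0"
  obtains y where "y \<in> H P (cx_ob Y (n - 1))" "f n * x = g n * x + cx_d Y (n - 1) * y"
proof -
  obtain h where h: "\<And>n. h n \<in> H (cx_ob X n) (cx_ob Y (n - 1))"
    "\<And>n. f n = g n + (cx_d Y (n - 1) * h n + h (n + 1) * cx_d X n)" using assms(1) by (auto simp: htp_def)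
  have "h n * x \<in> H P (cx_ob Y (n - 1))" using h(1) assms(2) by blast
  moreover have "f n * x = g n * x + cx_d Y (n - 1) * (h n * x)"
    by (simp add: h(2)[of n] distrib_right mult.assoc assms(3))
  ultimately show ?thesis using that by blast
qed

text \<open>Homotopic maps differ on a cocycle by a coboundary (\<open>htp_el\<close>), which is
  absorbed into the witness.\<close>

lemma qi_htp: assumes q: "qi X Y f" and h: "htp X Y f g" and g: "cm X Y g" and X: "cx X" and Y: "cx Y"
  shows "qi X Y g"
proof (rule qiI[OF g])
  fix P n x y assume P: "P \<in> PR" and x: "x \<in> H P (cx_ob X (n + 1))" and y: "y \<in> H P (cx_ob Y n)"
    and dx: "cx_d X (n + 1) * x = 0" and gx: "g (n + 1) * x = cx_d Y n * y"
  obtain z where z: "z \<in> H P (cx_ob Y n)" "f (n + 1) * x = g (n + 1) * x + cx_d Y n * z"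
    using htp_el[OF h x dx] by auto
  then have "f (n + 1) * x = cx_d Y n * (y + z)" using gx by (simp add: distrib_left)
  then show "\<exists>x' \<in> H P (cx_ob X n). x = cx_d X n * x'"
    using q P x dx add_H[OF y z(1)] unfolding qi_def qinj_def by blast
next
  fix P n y assume P: "P \<in> PR" and y: "y \<in> H P (cx_ob Y (n + 1))" and dy: "cx_d Y (n + 1) * y = 0"
  obtain x y' where x: "x \<in> H P (cx_ob X (n + 1))" "y' \<in> H P (cx_ob Y n)" "cx_d X (n + 1) * x = 0"
    "y = f (n + 1) * x + cx_d Y n * y'" using q P y dy unfolding qi_def qsur_def by blast
  obtain z where z: "z \<in> H P (cx_ob Y n)" "f (n + 1) * x = g (n + 1) * x + cx_d Y n * z"
    using htp_el[OF h x(1,3)] by auto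
  have "y = g (n + 1) * x + cx_d Y n * (z + y')" using x(4) z(2) by (simp add: distrib_left)
  then show "\<exists>x \<in> H P (cx_ob X (n + 1)). \<exists>y' \<in> H P (cx_ob Y n). cx_d X (n + 1) * x = 0 \<and>
      y = g (n + 1) * x + cx_d Y n * y'" using x(1,3) add_H[OF z(1) x(2)] by blast
qed

lemma qi_comp: assumes f: "qi X Y f" and g: "qi Y Z g" shows "qi X Z (\<lambda>n. g n * f n)"
proof (rule qiI[OF cm_comp[OF qi_cm[OF f] qi_cm[OF g]]])
  note fm = qi_cm[OF f] and gm = qi_cm[OF g]
  fix P n x y assume P: "P \<in> PR" and x: "x \<in> H P (cx_ob X (n + 1))" and y: "y \<in> H P (cx_ob Z n)"
    and dx: "cx_d X (n + 1) * x = 0" and gx: "g (n + 1) * f (n + 1) * x = cx_d Z n * y"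
  have fx: "f (n + 1) * x \<in> H P (cx_ob Y (n + 1))" using x cm_H[OF fm] by blast
  have "cx_d Y (n + 1) * (f (n + 1) * x) = 0" using cm_d_el[OF fm, of "n + 1" x] dx by simp
  then obtain y' where y': "y' \<in> H P (cx_ob Y n)" "f (n + 1) * x = cx_d Y n * y'"
    using qi_injD[OF g P fx, of y] y gx by (auto simp: mult.assoc)
  then show "\<exists>x' \<in> H P (cx_ob X n). x = cx_d X n * x'"
    using f P x dx unfolding qi_def qinj_def by blast
next
  note fm = qi_cm[OF f] and gm = qi_cm[OF g]
  fix P n y assume P: "P \<in> PR" and y: "y \<in> H P (cx_ob Z (n + 1))" and dy: "cx_d Z (n + 1) * y = 0"
  obtain w z where w: "w \<in> H P (cx_ob Y (n + 1))" "z \<in> H P (cx_ob Z n)" "cx_d Y (n + 1) * w = 0"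
    "y = g (n + 1) * w + cx_d Z n * z" using g P y dy unfolding qi_def qsur_def by blast
  obtain x y' where x: "x \<in> H P (cx_ob X (n + 1))" "y' \<in> H P (cx_ob Y n)" "cx_d X (n + 1) * x = 0"
    "w = f (n + 1) * x + cx_d Y n * y'" using f P w unfolding qi_def qsur_def by blast
  have "y = g (n + 1) * f (n + 1) * x + cx_d Z n * (g n * y' + z)"
    using w(4) x(4) by (simp add: distrib_left mult.assoc cm_d_el[OF gm])
  moreover have "g n * y' + z \<in> H P (cx_ob Z n)" using x(2) w(2) cm_H[OF gm] by blast
  ultimately show "\<exists>x \<in> H P (cx_ob X (n + 1)). \<exists>y' \<in> H P (cx_ob Z n). cx_d X (n + 1) * x = 0 \<and>
      y = g (n + 1) * f (n + 1) * x + cx_d Z n * y'" using x(1,3) by blast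
qed

text \<open>Two out of three: injectivity of f on cohomology follows from that of the composite, and
  surjectivity from that of the composite together with injectivity of g.\<close>

lemma qi_cancel_left:
  assumes g: "qi Y Z g" and gf: "qi X Z (\<lambda>n. g n * f n)" and fm: "cm X Y f" and Y: "cx Y"
  shows "qi X Y f"
proof (rule qiI[OF fm])
  note gm = qi_cm[OF g]
  fix P n x y assume P: "P \<in> PR" and x: "x \<in> H P (cx_ob X (n + 1))" and y: "y \<in> H P (cx_ob Y n)"
    and dx: "cx_d X (n + 1) * x = 0" and fx: "f (n + 1) * x = cx_d Y n * y"
  have "g (n + 1) * f (n + 1) * x = cx_d Z n * (g n * y)" by (simp add: mult.assoc fx cm_d_el[OF gm])
  moreover have "g n * y \<in> H P (cx_ob Z n)" using y cm_H[OF gm] by blast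
  ultimately show "\<exists>x' \<in> H P (cx_ob X n). x = cx_d X n * x'"
    using gf P x dx unfolding qi_def qinj_def by blast
next
  note gm = qi_cm[OF g]
  fix P n y assume P: "P \<in> PR" and y: "y \<in> H P (cx_ob Y (n + 1))" and dy: "cx_d Y (n + 1) * y = 0"
  have gy: "g (n + 1) * y \<in> H P (cx_ob Z (n + 1))" using y cm_H[OF gm] by blast
  have "cx_d Z (n + 1) * (g (n + 1) * y) = 0" using cm_d_el[OF gm, of "n + 1" y] dy by simp
  then obtain x z where x: "x \<in> H P (cx_ob X (n + 1))" "z \<in> H P (cx_ob Z n)" "cx_d X (n + 1) * x = 0"
    "g (n + 1) * y = g (n + 1) * f (n + 1) * x + cx_d Z n * z" using gf P gy unfolding qi_def qsur_def by blast
  have "g (n + 1) * (y - f (n + 1) * x) = cx_d Z n * z" using x(4) by (simp add: right_diff_distrib mult.assoc)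
  moreover have "y - f (n + 1) * x \<in> H P (cx_ob Y (n + 1))" using x(1) y cm_H[OF fm] by blast
  moreover have "cx_d Y (n + 1) * (y - f (n + 1) * x) = 0"
    using cm_d_el[OF fm, of "n + 1" x] dy x(3) by (simp add: right_diff_distrib)
  ultimately obtain y' where "y' \<in> H P (cx_ob Y n)" "y - f (n + 1) * x = cx_d Y n * y'"
    using g P x(2) unfolding qi_def qinj_def by blast
  then have "y' \<in> H P (cx_ob Y n)" "y = f (n + 1) * x + cx_d Y n * y'" by (auto simp: algebra_simps)
  then show "\<exists>x \<in> H P (cx_ob X (n + 1)). \<exists>y' \<in> H P (cx_ob Y n). cx_d X (n + 1) * x = 0 \<and>
      y = f (n + 1) * x + cx_d Y n * y'" using x(1,3) by blast
qed

lemma qi_one: assumes "cx X" shows "qi X X (\<lambda>n. one (cx_ob X n))"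
proof (rule qiI[OF cm_one[OF assms]])
  fix P n y assume y: "y \<in> H P (cx_ob X (n + 1))" "cx_d X (n + 1) * y = 0"
  show "\<exists>x \<in> H P (cx_ob X (n + 1)). \<exists>y' \<in> H P (cx_ob X n). cx_d X (n + 1) * x = 0 \<and>
      y = one (cx_ob X (n + 1)) * x + cx_d X n * y'"
    using y H_Ob[OF y(1)] cx_Ob[OF assms] by (intro bexI[of _ y] bexI[of _ 0]) auto
qed auto

section \<open>Shift, and lifting through quasi-isomorphisms\<close>

definition sh :: "('o, 'u) cochain \<Rightarrow> ('o, 'u) cochain" where
  "sh X = \<lparr>cx_ob = (\<lambda>n. cx_ob X (n + 1)), cx_d = (\<lambda>n. - cx_d X (n + 1))\<rparr>"

lemma sh_simps [simp]: "cx_ob (sh X) n = cx_ob X (n + 1)" "cx_d (sh X) n = - cx_d X (n + 1)"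
  by (simp_all add: sh_def)

lemma cx_sh: assumes "cx X" shows "cx (sh X)"
  unfolding cx_def
proof
  fix n
  show "cx_d (sh X) n \<in> H (cx_ob (sh X) n) (cx_ob (sh X) (n + 1)) \<and> cx_d (sh X) (n + 1) * cx_d (sh X) n = 0"
    using cx_H[OF assms, of "n + 1"] cx_dd[OF assms, of "n + 1"] by simp
qed

lemma bdd_sh: assumes "bdd X" shows "bdd (sh X)"
proof -
  obtain a b where "\<forall>n. n < a \<or> b < n \<longrightarrow> zob (cx_ob X n)" using assms by (auto simp: bdd_def)
  then have "\<forall>n. n < a - 1 \<or> b - 1 < n \<longrightarrow> zob (cx_ob (sh X) n)" by simp
  then show ?thesis using cx_sh[OF bdd_cx[OF assms]] unfolding bdd_def by blast
qed

text \<open>The datum \<open>(z, e)\<close> is a cocycle, and \<open>(r, h)\<close> a primitive of it, in the complex of maps from Q to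
  the mapping cone of s.  With \<open>z = 0\<close> this lifts e through s up to homotopy.\<close>

lemma cone_lift:
  assumes Q: "bdd Q" and QP: "\<And>n. cx_ob Q n \<in> PR" and s: "qi Z E s" and Z: "cx Z" and E: "cx E"
    and z: "\<And>n. z n \<in> H (cx_ob Q n) (cx_ob Z (n + 1))" and e: "\<And>n. e n \<in> H (cx_ob Q n) (cx_ob E n)"
    and dz: "\<And>n. z (n + 1) * cx_d Q n = - (cx_d Z (n + 1) * z n)"
    and de: "\<And>n. e (n + 1) * cx_d Q n = cx_d E n * e n + s (n + 1) * z n"
  obtains r h where "\<And>n. r n \<in> H (cx_ob Q n) (cx_ob Z n)" "\<And>n. h n \<in> H (cx_ob Q n) (cx_ob E (n - 1))"
    "\<And>n. z n = r (n + 1) * cx_d Q n - cx_d Z n * r n"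
    "\<And>n. e n = s n * r n + cx_d E (n - 1) * h n + h (n + 1) * cx_d Q n"
proof -
  note Qc = bdd_cx[OF Q] and sm = qi_cm[OF s]
  obtain a b where ab: "\<And>n. n < a \<or> b < n \<Longrightarrow> zob (cx_ob Q n)" using Q by (auto simp: bdd_def)
  define ok where "ok r h n \<longleftrightarrow> r n \<in> H (cx_ob Q n) (cx_ob Z n) \<and> h n \<in> H (cx_ob Q n) (cx_ob E (n - 1)) \<and>
    z n = r (n + 1) * cx_d Q n - cx_d Z n * r n \<and>
    e n = s n * r n + cx_d E (n - 1) * h n + h (n + 1) * cx_d Q n" for r h and n :: int
  have zero: "ok r h n" if "zob (cx_ob Q n)" "r n = 0" "h n = 0" for r h n
    using that from_zob[OF that(1) z] from_zob[OF that(1) e] from_zob[OF that(1) cx_H[OF Qc]]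
      zob_Ob[OF that(1)] cx_Ob[OF Z] cx_Ob[OF E] by (simp add: ok_def)
  \<comment> \<open>Descending induction on the degree: above b everything is 0, and each step
    extends r and h by one degree.\<close>
  have "\<exists>r h. \<forall>n \<ge> b + 1 - int k. ok r h n" for k
  proof (induction k)
    case 0
    have "\<forall>n \<ge> b + 1 - int 0. ok (\<lambda>_. 0) (\<lambda>_. 0) n" using zero ab by simp
    then show ?case by blast
  next
    case (Suc k)
    then obtain r h where rh: "\<And>n. n \<ge> b + 1 - int k \<Longrightarrow> ok r h n" by blast
    define m where "m = b - int k"
    have ok1: "ok r h (m + 1)" using rh by (simp add: m_def)
    let ?d = "cx_d Q m"
    note dQ = cx_H[OF Qc, of m]
    \<comment> \<open>The first equation asks for \<open>w = cx_d Z m * r m\<close>. Here w is a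
      cocycle whose image under s is a boundary, so injectivity on cohomology provides
      \<open>r0\<close>.\<close>
    define w where "w = r (m + 1) * ?d - z m"
    have r1: "r (m + 1) \<in> H (cx_ob Q (m + 1)) (cx_ob Z (m + 1))" and h1: "h (m + 1) \<in> H (cx_ob Q (m + 1)) (cx_ob E m)"
      and z1: "z (m + 1) = r (m + 2) * cx_d Q (m + 1) - cx_d Z (m + 1) * r (m + 1)"
      and e1: "e (m + 1) = s (m + 1) * r (m + 1) + cx_d E m * h (m + 1) + h (m + 2) * cx_d Q (m + 1)"
      using ok1 by (auto simp: ok_def add.assoc)
    have dd: "cx_d Q (m + 1) * ?d = 0" using cx_dd[OF Qc] .
    have w: "w \<in> H (cx_ob Q m) (cx_ob Z (m + 1))" unfolding w_def using r1 dQ z by blast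
    have "z (m + 1) * ?d = - (cx_d Z (m + 1) * (r (m + 1) * ?d))"
      using z1 dd by (simp add: left_diff_distrib mult.assoc)
    then have dw: "cx_d Z (m + 1) * w = 0" using dz[of m] by (simp add: w_def right_diff_distrib)
    have hd: "h (m + 1) * ?d \<in> H (cx_ob Q m) (cx_ob E m)" using h1 dQ by blast
    have "e (m + 1) * ?d = s (m + 1) * (r (m + 1) * ?d) + cx_d E m * (h (m + 1) * ?d)"
      using e1 dd by (simp add: distrib_right mult.assoc)
    then have sw: "s (m + 1) * w = cx_d E m * (e m - h (m + 1) * ?d)"
      using de[of m] by (simp add: w_def right_diff_distrib algebra_simps)
    obtain r0 where r0: "r0 \<in> H (cx_ob Q m) (cx_ob Z m)" "w = cx_d Z m * r0"
      using qi_injD[OF s QP w dw, of "e m - h (m + 1) * ?d"] sw e hd by auto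
    \<comment> \<open>The defect of the second equation for \<open>r0\<close> is a cocycle.
      Surjectivity writes it as the image of a cocycle c plus a boundary. Adding c to
      \<open>r0\<close> does not disturb the first equation.\<close>
    define v where "v = e m - h (m + 1) * ?d - s m * r0"
    have v: "v \<in> H (cx_ob Q m) (cx_ob E m)" unfolding v_def using e hd r0(1) cm_H[OF sm] by blast
    have dv: "cx_d E m * v = 0" using sw r0(2) cm_d_el[OF sm, of m r0] by (simp add: v_def right_diff_distrib)
    obtain c y where c: "c \<in> H (cx_ob Q m) (cx_ob Z m)" "cx_d Z m * c = 0" "y \<in> H (cx_ob Q m) (cx_ob E (m - 1))"
      "v = s m * c + cx_d E (m - 1) * y" using qi_surD[OF s QP v dv] by blast
    let ?r = "r(m := r0 + c)" and ?h = "h(m := y)"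
    have "ok ?r ?h m"
      unfolding ok_def using c r0 w_def v_def by (auto simp: algebra_simps)
    moreover have "ok ?r ?h n" if "n > m" for n
      using rh[of n] that by (simp add: ok_def m_def)
    ultimately have "ok ?r ?h n" if "n \<ge> b + 1 - int (Suc k)" for n
      using that by (cases "n = m") (simp_all add: m_def)
    then show ?case by blast
  qed
  then obtain r h where rh: "\<And>n. n \<ge> b + 1 - int (nat (b + 1 - a)) \<Longrightarrow> ok r h n" by blast
  then have rh: "\<And>n. n \<ge> a \<Longrightarrow> b + 1 \<ge> a \<Longrightarrow> ok r h n" by simp
  \<comment> \<open>Below a the induction says nothing, but Q is 0 there and the value 0 solves the
    equations. Terms involving degree n + 1 are unaffected, because \<open>cx_d Q n\<close> vanishes
    when its target is 0.\<close>
  define r' h' where "r' n = (if zob (cx_ob Q n) then 0 else r n)"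
    and "h' n = (if zob (cx_ob Q n) then 0 else h n)" for n
  have "ok r' h' n" for n
  proof (cases "zob (cx_ob Q n)")
    case True
    then show ?thesis using zero by (simp add: r'_def h'_def)
  next
    case False
    then have "n \<ge> a" "b + 1 \<ge> a" using ab by force+
    then have o: "ok r h n" using rh by blast
    have "r' (n + 1) * cx_d Q n = r (n + 1) * cx_d Q n" "h' (n + 1) * cx_d Q n = h (n + 1) * cx_d Q n"
      using to_zob[OF _ cx_H[OF Qc], of n] by (auto simp: r'_def h'_def)
    then show ?thesis using o False by (simp add: ok_def r'_def h'_def)
  qed
  then show ?thesis using that unfolding ok_def by blast
qed

lemma lift:
  assumes Q: "bdd Q" and QP: "\<And>n. cx_ob Q n \<in> PR" and s: "qi Z E s" and Z: "cx Z" and E: "cx E" and q: "cm Q E q"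
  obtains r where "cm Q Z r" "htp Q E q (\<lambda>n. s n * r n)"
proof -
  have Qo: "\<And>n. cx_ob Q n \<in> Ob" using QP PR_Ob by blast
  obtain r h where "\<And>n. r n \<in> H (cx_ob Q n) (cx_ob Z n)" "\<And>n. h n \<in> H (cx_ob Q n) (cx_ob E (n - 1))"
    "\<And>n. 0 = r (n + 1) * cx_d Q n - cx_d Z n * r n"
    "\<And>n. q n = s n * r n + cx_d E (n - 1) * h n + h (n + 1) * cx_d Q n"
    using cone_lift[OF Q QP s Z E, of "\<lambda>_. 0" q] Qo cx_Ob[OF Z] cm_H[OF q] cm_d[OF q] by auto
  then show ?thesis using that[of r] unfolding cm_def htp_def by (auto simp: add.assoc)
qed

text \<open>The difference f - g, together with the given homotopy after s, is a cocycle of the kind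
  treated in \<open>cone_lift\<close>, with source the shift of Q. Its primitive contains the
  homotopy between f and g.\<close>

lemma lift_unique:
  assumes Q: "bdd Q" and QP: "\<And>n. cx_ob Q n \<in> PR" and s: "qi Z E s" and Z: "cx Z" and E: "cx E"
    and f: "cm Q Z f" and g: "cm Q Z g" and h: "htp Q E (\<lambda>n. s n * f n) (\<lambda>n. s n * g n)"
  shows "htp Q Z f g"
proof -
  define Q' where "Q' = sh Q"
  have Q': "bdd Q'" using bdd_sh[OF Q] by (simp add: Q'_def)
  obtain k where k: "\<And>n. k n \<in> H (cx_ob Q n) (cx_ob E (n - 1))"
    "\<And>n. s n * f n = s n * g n + (cx_d E (n - 1) * k n + k (n + 1) * cx_d Q n)" using h by (auto simp: htp_def)
  have k1: "k (n + 1) \<in> H (cx_ob Q (n + 1)) (cx_ob E n)" for n using k(1)[of "n + 1"] by simp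
  have k2: "s (n + 1) * f (n + 1) = s (n + 1) * g (n + 1) + (cx_d E n * k (n + 1) + k (n + 1 + 1) * cx_d Q (n + 1))" for n
    using k(2)[of "n + 1"] by simp
  have fg: "f (n + 1) - g (n + 1) \<in> H (cx_ob Q' n) (cx_ob Z (n + 1))" for n
    using cm_H[OF f, of "n + 1"] cm_H[OF g, of "n + 1"] by (simp add: Q'_def sh_def)
  have dfg: "(f (n + 1 + 1) - g (n + 1 + 1)) * cx_d Q' n = - (cx_d Z (n + 1) * (f (n + 1) - g (n + 1)))" for n
    using cm_d[OF f, of "n + 1"] cm_d[OF g, of "n + 1"] by (simp add: Q'_def sh_def left_diff_distrib right_diff_distrib)
  obtain r h' where r: "\<And>n. r n \<in> H (cx_ob Q' n) (cx_ob Z n)"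
     "\<And>n. f (n + 1) - g (n + 1) = r (n + 1) * cx_d Q' n - cx_d Z n * r n"
    by (rule cone_lift[OF Q' _ s Z E fg _ dfg, of "\<lambda>n. - k (n + 1)"])
      (use QP k1 k2 in \<open>auto simp: Q'_def sh_def algebra_simps\<close>)
  \<comment> \<open>Undoing the shift costs one degree and one sign.\<close>
  have "- r (n - 1) \<in> H (cx_ob Q n) (cx_ob Z (n - 1))" for n using r(1)[of "n - 1"] by (simp add: Q'_def sh_def)
  moreover have "f n = g n + (cx_d Z (n - 1) * (- r (n - 1)) + (- r n) * cx_d Q n)" for n
    using r(2)[of "n - 1"] by (simp add: Q'_def sh_def algebra_simps)
  ultimately show ?thesis unfolding htp_def by (intro exI[of _ "\<lambda>n. - r (n - 1)"]) simp
qed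

section \<open>Twisted extensions\<close>

text \<open>A degreewise split short exact sequence of complexes: i and p are chain maps, while the
  splittings j and r need not commute with the differentials.\<close>

definition dsplit where
  "dsplit X' X X'' i p j r \<longleftrightarrow> cx X' \<and> cx X \<and> cx X'' \<and> cm X' X i \<and> cm X X'' p \<and>
    (\<forall>n. j n \<in> H (cx_ob X'' n) (cx_ob X n) \<and> r n \<in> H (cx_ob X n) (cx_ob X' n) \<and>
      r n * i n = one (cx_ob X' n) \<and> p n * j n = one (cx_ob X'' n) \<and> p n * i n = 0 \<and> r n * j n = 0 \<and>
      i n * r n + j n * p n = one (cx_ob X n))"

lemma dsplitD:
  assumes "dsplit X' X X'' i p j r"
  shows "cx X'" "cx X" "cx X''" "cm X' X i" "cm X X'' p"
    "i n \<in> H (cx_ob X' n) (cx_ob X n)" "p n \<in> H (cx_ob X n) (cx_ob X'' n)"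
    "j n \<in> H (cx_ob X'' n) (cx_ob X n)" "r n \<in> H (cx_ob X n) (cx_ob X' n)"
    "r n * i n = one (cx_ob X' n)" "p n * j n = one (cx_ob X'' n)" "p n * i n = 0" "r n * j n = 0"
    "i n * r n + j n * p n = one (cx_ob X n)"
    "x' \<in> H P (cx_ob X' n) \<Longrightarrow> r n * (i n * x') = x'" "x'' \<in> H P (cx_ob X'' n) \<Longrightarrow> p n * (j n * x'') = x''"
    "p n * (i n * y) = 0" "r n * (j n * y) = 0"
    "x \<in> H P (cx_ob X n) \<Longrightarrow> i n * (r n * x) + j n * (p n * x) = x"
proof -
  show A: "cx X'" "cx X" "cx X''" "cm X' X i" "cm X X'' p"
    "j n \<in> H (cx_ob X'' n) (cx_ob X n)" "r n \<in> H (cx_ob X n) (cx_ob X' n)"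
    "r n * i n = one (cx_ob X' n)" "p n * j n = one (cx_ob X'' n)" "p n * i n = 0" "r n * j n = 0"
    "i n * r n + j n * p n = one (cx_ob X n)"
    using assms by (auto simp: dsplit_def)
  show "i n \<in> H (cx_ob X' n) (cx_ob X n)" "p n \<in> H (cx_ob X n) (cx_ob X'' n)"
    using A(4,5) cm_H by blast+
  show "x' \<in> H P (cx_ob X' n) \<Longrightarrow> r n * (i n * x') = x'" "x'' \<in> H P (cx_ob X'' n) \<Longrightarrow> p n * (j n * x'') = x''"
    "p n * (i n * y) = 0" "r n * (j n * y) = 0"
    using A by (simp_all add: mult_eq_assoc mult_zero_cancel)
  assume x: "x \<in> H P (cx_ob X n)"
  have "i n * (r n * x) + j n * (p n * x) = (i n * r n + j n * p n) * x" by (simp add: distrib_right mult.assoc)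
  then show "i n * (r n * x) + j n * (p n * x) = x" using A x by simp
qed

text \<open>In the splitting the differential of X is triangular with off-diagonal entry
  \<open>\<psi>\<close>. The equation d d = 0 makes \<open>\<psi>\<close> anticommute with the
  differentials, so it is a chain map from X'' to X'[1] representing the connecting
  morphism.\<close>

lemma dsplit_d:
  assumes D: "dsplit X' X X'' i p j r"
  defines "\<psi> \<equiv> \<lambda>n. r (n + 1) * (cx_d X n * j n)"
  shows "\<psi> n \<in> H (cx_ob X'' n) (cx_ob X' (n + 1))"
    and "cx_d X n * j n = i (n + 1) * \<psi> n + j (n + 1) * cx_d X'' n"
    and "cx_d X' (n + 1) * \<psi> n + \<psi> (n + 1) * cx_d X'' n = 0"
proof -
  note d = dsplitD[OF D]
  have dj: "cx_d X n * j n \<in> H (cx_ob X'' n) (cx_ob X (n + 1))" for n using d(8) cx_H[OF d(2)] by blast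
  show psi: "\<psi> n \<in> H (cx_ob X'' n) (cx_ob X' (n + 1))" for n unfolding \<psi>_def using dj d(9) by blast
  have "p (n + 1) * (cx_d X n * j n) = cx_d X'' n" for n
    using mult_eq_assoc[OF cm_d[OF d(5)], of n "j n"] d(11)[of n] mult_one[OF cx_H[OF d(3)], of n] by (simp add: mult.assoc)
  then show e: "cx_d X n * j n = i (n + 1) * \<psi> n + j (n + 1) * cx_d X'' n" for n
    using d(19)[OF dj, of n] by (simp add: \<psi>_def)
  let ?s = "cx_d X' (n + 1) * \<psi> n + \<psi> (n + 1) * cx_d X'' n"
  have "0 = cx_d X (n + 1) * (cx_d X n * j n)" using cx_dd_el[OF d(2)] by simp
  also have "\<dots> = cx_d X (n + 1) * (i (n + 1) * \<psi> n) + (cx_d X (n + 1) * j (n + 1)) * cx_d X'' n"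
    by (simp add: e[of n] distrib_left mult.assoc)
  also have "\<dots> = i (n + 1 + 1) * ?s"
    by (simp only: e[of "n + 1"] cm_d_el[OF d(4), symmetric] distrib_left distrib_right mult.assoc cx_dd[OF d(3)]) simp
  finally have "r (n + 1 + 1) * (i (n + 1 + 1) * ?s) = 0" by simp
  moreover have "?s \<in> H (cx_ob X'' n) (cx_ob X' (n + 1 + 1))"
    using psi[of n] psi[of "n + 1"] cx_H[OF d(1), of "n + 1"] cx_H[OF d(3), of n] by blast
  ultimately show "?s = 0" using d(15)[of ?s] by simp
qed

text \<open>An explicit chase replaces the long exact cohomology sequence: the splittings produce
  preimages, and the off-diagonal entry \<open>\<psi>\<close> acts as the connecting
  homomorphism.\<close>

lemma five_lemma:
  assumes DQ: "dsplit Q' Q Q'' i p j r" and DX: "dsplit X' X X'' i' p' j' r'"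
    and \<theta>: "cm Q X \<theta>" and ti: "\<And>n. \<theta> n * i n = i' n * a n" and pt: "\<And>n. p' n * \<theta> n = g n * p n"
    and a: "qi Q' X' a" and g: "qi Q'' X'' g"
  shows "qi Q X \<theta>"
proof (rule qiI[OF \<theta>])
  note dq = dsplitD[OF DQ] and dx = dsplitD[OF DX] and am = qi_cm[OF a] and gm = qi_cm[OF g]
  define \<psi> where "\<psi> n = r (n + 1) * (cx_d Q n * j n)" for n
  have psi: "\<psi> n \<in> H (cx_ob Q'' n) (cx_ob Q' (n + 1))" for n
    using dsplit_d(1)[OF DQ, of n] by (simp add: \<psi>_def)
  have dj: "cx_d Q n * (j n * x) = i (n + 1) * (\<psi> n * x) + j (n + 1) * (cx_d Q'' n * x)" for n x
    using mult_eq_assoc[OF dsplit_d(2)[OF DQ, of n], of x] by (simp add: \<psi>_def distrib_right mult.assoc)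
  have ps: "cx_d Q' (n + 1) * (\<psi> n * x) + \<psi> (n + 1) * (cx_d Q'' n * x) = 0" for n x
  proof -
    have "(cx_d Q' (n + 1) * \<psi> n + \<psi> (n + 1) * cx_d Q'' n) * x = 0"
      using dsplit_d(3)[OF DQ, of n] by (simp add: \<psi>_def)
    then show ?thesis by (simp add: distrib_right mult.assoc)
  qed
  have ti': "\<theta> n * (i n * x) = i' n * (a n * x)" for n x
    using mult_eq_assoc[OF ti, of n x] by (simp add: mult.assoc)
  have pt': "p' n * (\<theta> n * x) = g n * (p n * x)" for n x
    using mult_eq_assoc[OF pt, of n x] by (simp add: mult.assoc)
  note td = cm_d_el[OF \<theta>] and id = cm_d_el[OF dq(4)] and pd = cm_d_el[OF dq(5)]
    and id' = cm_d_el[OF dx(4)] and pd' = cm_d_el[OF dx(5)] and ad = cm_d_el[OF am] and gd = cm_d_el[OF gm]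
  have i_inj: "x = y" if "i n * x = i n * y" "x \<in> H P (cx_ob Q' n)" "y \<in> H P (cx_ob Q' n)" for n x y P
    using that dq(15) by metis
  have i_inj': "x = y" if "i' n * x = i' n * y" "x \<in> H P (cx_ob X' n)" "y \<in> H P (cx_ob X' n)" for n x y P
    using that dx(15) by metis
  note Hs = mult_H[OF _ dq(6)] mult_H[OF _ dq(7)] mult_H[OF _ dq(8)] mult_H[OF _ dq(9)]
    mult_H[OF _ dx(6)] mult_H[OF _ dx(7)] mult_H[OF _ dx(8)] mult_H[OF _ dx(9)]
    mult_H[OF _ cm_H[OF am]] mult_H[OF _ cm_H[OF gm]] mult_H[OF _ cm_H[OF \<theta>]] mult_H[OF _ psi]
    mult_H[OF _ cx_H[OF dq(1)]] mult_H[OF _ cx_H[OF dq(2)]] mult_H[OF _ cx_H[OF dq(3)]]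
    mult_H[OF _ cx_H[OF dx(1)]] mult_H[OF _ cx_H[OF dx(2)]] mult_H[OF _ cx_H[OF dx(3)]]
  {
    fix P n x y assume P: "P \<in> PR" and x: "x \<in> H P (cx_ob Q (n + 1))" and y: "y \<in> H P (cx_ob X n)"
      and dx0: "cx_d Q (n + 1) * x = 0" and tx: "\<theta> (n + 1) * x = cx_d X n * y"
    have "p (n + 1) * x \<in> H P (cx_ob Q'' (n + 1))" "cx_d Q'' (n + 1) * (p (n + 1) * x) = 0"
      "g (n + 1) * (p (n + 1) * x) = cx_d X'' n * (p' n * y)" "p' n * y \<in> H P (cx_ob X'' n)"
      using x y pd[of "n + 1" x] dx0 tx pt'[of "n + 1" x] pd'[of n y] by (auto intro: Hs)
    then obtain z where z: "z \<in> H P (cx_ob Q'' n)" "p (n + 1) * x = cx_d Q'' n * z"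
      using g P unfolding qi_def qinj_def by blast
    \<comment> \<open>The component of x in Q'' is the boundary of z, so subtracting a boundary
      moves x into the image of i.\<close>
    define x1 where "x1 = x - cx_d Q n * (j n * z)"
    have x1: "x1 \<in> H P (cx_ob Q (n + 1))" unfolding x1_def by (intro minus_H add_H uminus_H Hs x z)
    have "p (n + 1) * x1 = 0" using z by (simp add: x1_def right_diff_distrib pd dq(16))
    define w where "w = r (n + 1) * x1"
    have w: "w \<in> H P (cx_ob Q' (n + 1))" unfolding w_def by (intro minus_H add_H uminus_H Hs x1)
    have x1w: "x1 = i (n + 1) * w" using dq(19)[OF x1] \<open>p (n + 1) * x1 = 0\<close> by (simp add: w_def)
    define y1 where "y1 = y - \<theta> n * (j n * z)"
    have y1: "y1 \<in> H P (cx_ob X n)" unfolding y1_def by (intro minus_H add_H uminus_H Hs y z)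
    have iaw: "i' (n + 1) * (a (n + 1) * w) = cx_d X n * y1"
      by (simp add: ti'[symmetric] x1w[symmetric]) (simp add: x1_def y1_def right_diff_distrib tx td)
    have "cx_d Q (n + 1) * x1 = 0" using dx0 cx_dd_el[OF dq(2), of n] by (simp add: x1_def right_diff_distrib)
    then have "i (n + 1 + 1) * (cx_d Q' (n + 1) * w) = 0" using x1w id[of "n + 1" w] by simp
    then have dw: "cx_d Q' (n + 1) * w = 0"
      using i_inj[of "n + 1 + 1" "cx_d Q' (n + 1) * w" 0 P] Hs(13)[OF w] zero_H[OF _ cx_Ob[OF dq(1)]] H_Ob[OF x] by simp
    have pin: "cx_d X'' n * (p' n * y1) = 0" using iaw pd'[of n y1] dx(17)[of "n + 1"] by metis
    have m: "n - 1 + 1 = n" by simp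
    obtain z2 e2 where z2: "z2 \<in> H P (cx_ob Q'' n)" "cx_d Q'' n * z2 = 0" "e2 \<in> H P (cx_ob X'' (n - 1))"
      "p' n * y1 = g n * z2 + cx_d X'' (n - 1) * e2"
      using qi_surD[OF g P Hs(6)[OF y1] pin] by blast
    have je: "cx_d X (n - 1) * (j' (n - 1) * e2) \<in> H P (cx_ob X n)"
      by (intro mult_H[OF _ cx_H'[OF dx(2)]] Hs z2)
    \<comment> \<open>The component of \<open>y1\<close> in X'' is a cocycle, hence comes from a
      cocycle of Q'' up to a boundary. Removing both moves \<open>y1\<close> into the image of
      i'.\<close>
    define y2 where "y2 = y1 - \<theta> n * (j n * z2) - cx_d X (n - 1) * (j' (n - 1) * e2)"
    have y2: "y2 \<in> H P (cx_ob X n)" unfolding y2_def by (intro minus_H add_H uminus_H Hs y1 z2  je)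
    have "p' n * y2 = 0" using z2 cm_d_el'[OF dx(5), of n]
      by (simp add: y2_def right_diff_distrib pt' dq(16) dx(16))
    define v where "v = r' n * y2"
    have v: "v \<in> H P (cx_ob X' n)" unfolding v_def by (intro minus_H add_H uminus_H Hs y2)
    have y2v: "y2 = i' n * v" using dx(19)[OF y2] \<open>p' n * y2 = 0\<close> by (simp add: v_def)
    have "i' (n + 1) * (cx_d X' n * v) = cx_d X n * y2" using y2v id'[of n v] by simp
    also have "\<dots> = i' (n + 1) * (a (n + 1) * (w - \<psi> n * z2))"
      using z2 by (simp add: y2_def right_diff_distrib iaw cx_dd_el'[OF dx(2)] td[symmetric] dj ti')
    finally have eq: "cx_d X' n * v = a (n + 1) * (w - \<psi> n * z2)"
      by (rule i_inj'[where P = P]) (intro minus_H Hs v w z2)+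
    have "cx_d Q' (n + 1) * (\<psi> n * z2) = 0"
      using ps[of n z2] z2(2) by simp
    then have "cx_d Q' (n + 1) * (w - \<psi> n * z2) = 0" using dw by (simp add: right_diff_distrib)
    then obtain c where c: "c \<in> H P (cx_ob Q' n)" "w - \<psi> n * z2 = cx_d Q' n * c"
      using a P eq[symmetric] v minus_H[OF w Hs(12)[OF z2(1)]] unfolding qi_def qinj_def by blast
    have "x = cx_d Q n * (j n * z + j n * z2 + i n * c)"
    proof -
      have "x = x1 + cx_d Q n * (j n * z)" by (simp add: x1_def)
      also have "x1 = i (n + 1) * (\<psi> n * z2) + i (n + 1) * (cx_d Q' n * c)"
        using c(2) x1w by (metis add_diff_cancel_left' diff_add_cancel distrib_left add.commute)
      also have "\<dots> = cx_d Q n * (j n * z2) + cx_d Q n * (i n * c)" using dj z2 id by simp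
      finally show ?thesis by (simp add: distrib_left algebra_simps)
    qed
    moreover have "j n * z + j n * z2 + i n * c \<in> H P (cx_ob Q n)" by (intro add_H Hs z z2 c)
    ultimately show "\<exists>x' \<in> H P (cx_ob Q n). x = cx_d Q n * x'" by blast
  }
  fix P n y assume P: "P \<in> PR" and y: "y \<in> H P (cx_ob X (n + 1))" and dy: "cx_d X (n + 1) * y = 0"
  have "p' (n + 1) * y \<in> H P (cx_ob X'' (n + 1))" "cx_d X'' (n + 1) * (p' (n + 1) * y) = 0"
    using y pd'[of "n + 1" y] dy by (auto intro: Hs)
  then obtain q x1 where q: "q \<in> H P (cx_ob Q'' (n + 1))" "x1 \<in> H P (cx_ob X'' n)" "cx_d Q'' (n + 1) * q = 0"
    "p' (n + 1) * y = g (n + 1) * q + cx_d X'' n * x1" using g P unfolding qi_def qsur_def by blast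
  \<comment> \<open>The image of q under the connecting map. Its image under a bounds, hence so does
    u, and this is what allows q to be completed to a cocycle of Q.\<close>
  define u where "u = \<psi> (n + 1) * q"
  have u: "u \<in> H P (cx_ob Q' (n + 1 + 1))" unfolding u_def by (intro minus_H add_H uminus_H Hs q)
  have djq: "cx_d Q (n + 1) * (j (n + 1) * q) = i (n + 1 + 1) * u" using dj[of "n + 1" q] q by (simp add: u_def)
  have du: "cx_d Q' (n + 1 + 1) * u = 0"
    using ps[of "n + 1" q] q(3) by (simp add: u_def)
  define x2 where "x2 = y - \<theta> (n + 1) * (j (n + 1) * q) - cx_d X n * (j' n * x1)"
  have x2: "x2 \<in> H P (cx_ob X (n + 1))" unfolding x2_def by (intro minus_H add_H uminus_H Hs y q)
  have "p' (n + 1) * x2 = 0" using q by (simp add: x2_def right_diff_distrib pt' dq(16) dx(16) pd')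
  define v where "v = r' (n + 1) * x2"
  have v: "v \<in> H P (cx_ob X' (n + 1))" unfolding v_def by (intro minus_H add_H uminus_H Hs x2)
  have x2v: "x2 = i' (n + 1) * v" using dx(19)[OF x2] \<open>p' (n + 1) * x2 = 0\<close> by (simp add: v_def)
  have "i' (n + 1 + 1) * (cx_d X' (n + 1) * (- v)) = - (cx_d X (n + 1) * x2)" using x2v id'[of "n + 1" v] by simp
  also have "\<dots> = i' (n + 1 + 1) * (a (n + 1 + 1) * u)"
    by (simp only: x2_def right_diff_distrib dy cx_dd_el[OF dx(2)] td[symmetric] djq ti') simp
  finally have "i' (n + 1 + 1) * (a (n + 1 + 1) * u) = i' (n + 1 + 1) * (cx_d X' (n + 1) * (- v))" by (rule sym)
  then have au: "a (n + 1 + 1) * u = cx_d X' (n + 1) * (- v)"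
    by (rule i_inj'[where P = P]) (intro uminus_H Hs v u)+
  then obtain c where c: "c \<in> H P (cx_ob Q' (n + 1))" "u = cx_d Q' (n + 1) * c"
    using a P u du au uminus_H[OF v] unfolding qi_def qinj_def by blast
  have eq: "cx_d X' (n + 1) * v = - (a (n + 1 + 1) * u)"
    using au by simp
  \<comment> \<open>The correction by c turns v into a cocycle, to which surjectivity of a
    applies.\<close>
  define y3 where "y3 = v + a (n + 1) * c"
  have y3: "y3 \<in> H P (cx_ob X' (n + 1))" "cx_d X' (n + 1) * y3 = 0"
    using v c eq ad[of "n + 1" c] by (auto simp: y3_def distrib_left intro: Hs)
  then obtain q' y4 where q': "q' \<in> H P (cx_ob Q' (n + 1))" "y4 \<in> H P (cx_ob X' n)" "cx_d Q' (n + 1) * q' = 0"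
    "y3 = a (n + 1) * q' + cx_d X' n * y4" using a P unfolding qi_def qsur_def by blast
  let ?x = "j (n + 1) * q - i (n + 1) * c + i (n + 1) * q'" and ?y = "j' n * x1 + i' n * y4"
  have "?x \<in> H P (cx_ob Q (n + 1))" "?y \<in> H P (cx_ob X n)" by (intro add_H minus_H Hs q q' c)+
  moreover have "cx_d Q (n + 1) * ?x = 0"
    using djq c(2) q'(3) id[of "n + 1" c] id[of "n + 1" q'] by (simp add: distrib_left right_diff_distrib)
  moreover have "y = \<theta> (n + 1) * ?x + cx_d X n * ?y"
  proof -
    have "y = x2 + \<theta> (n + 1) * (j (n + 1) * q) + cx_d X n * (j' n * x1)" by (simp add: x2_def)
    also have "x2 = i' (n + 1) * y3 - i' (n + 1) * (a (n + 1) * c)" by (simp add: x2v y3_def distrib_left)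
    finally show ?thesis by (simp add: q'(4) distrib_left right_diff_distrib ti' id')
  qed
  ultimately show "\<exists>x \<in> H P (cx_ob Q (n + 1)). \<exists>y' \<in> H P (cx_ob X n). cx_d Q (n + 1) * x = 0 \<and>
      y = \<theta> (n + 1) * x + cx_d X n * y'" by blast
qed

text \<open>An extension of Y with X as subcomplex: the differential sends (x, y) to (d x +
  \<open>\<psi>\<close> y, d y). Up to sign conventions it is the cone of \<open>\<psi>\<close> from
  Y to X[1], shifted by -1.\<close>

definition tw :: "('o, 'u) cochain \<Rightarrow> ('o, 'u) cochain \<Rightarrow> (int \<Rightarrow> 'u) \<Rightarrow> ('o, 'u) cochain" where
  "tw X Y \<psi> = \<lparr>cx_ob = (\<lambda>n. bp (cx_ob X n) (cx_ob Y n)),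
    cx_d = (\<lambda>n. in1 (cx_ob X (n + 1)) (cx_ob Y (n + 1)) *
        (cx_d X n * pr1 (cx_ob X n) (cx_ob Y n) + \<psi> n * pr2 (cx_ob X n) (cx_ob Y n)) +
      in2 (cx_ob X (n + 1)) (cx_ob Y (n + 1)) * (cx_d Y n * pr2 (cx_ob X n) (cx_ob Y n)))\<rparr>"

abbreviation "ti1 X Y \<equiv> \<lambda>n. in1 (cx_ob X n) (cx_ob Y n)"
abbreviation "ti2 X Y \<equiv> \<lambda>n. in2 (cx_ob X n) (cx_ob Y n)"
abbreviation "tp1 X Y \<equiv> \<lambda>n. pr1 (cx_ob X n) (cx_ob Y n)"
abbreviation "tp2 X Y \<equiv> \<lambda>n. pr2 (cx_ob X n) (cx_ob Y n)"

text \<open>Equivalently, \<open>\<psi>\<close> is a chain map from Y to \<open>sh X\<close>: the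
  sign in the shifted differential turns commuting into anticommuting.\<close>

definition anti :: "('o, 'u) cochain \<Rightarrow> ('o, 'u) cochain \<Rightarrow> (int \<Rightarrow> 'u) \<Rightarrow> bool" where
  "anti Y X \<psi> \<longleftrightarrow> (\<forall>n. \<psi> n \<in> H (cx_ob Y n) (cx_ob X (n + 1)) \<and> cx_d X (n + 1) * \<psi> n + \<psi> (n + 1) * cx_d Y n = 0)"

lemma tw_dsplit:
  assumes X: "cx X" and Y: "cx Y" and \<psi>: "anti Y X \<psi>"
  shows "dsplit X (tw X Y \<psi>) Y (ti1 X Y) (tp2 X Y) (ti2 X Y) (tp1 X Y)"
    and "cx_d (tw X Y \<psi>) n * ti1 X Y n = ti1 X Y (n + 1) * cx_d X n"
    and "cx_d (tw X Y \<psi>) n * ti2 X Y n = ti1 X Y (n + 1) * \<psi> n + ti2 X Y (n + 1) * cx_d Y n"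
    and "cx_ob (tw X Y \<psi>) n = bp (cx_ob X n) (cx_ob Y n)"
proof -
  note Ob = cx_Ob[OF X] cx_Ob[OF Y]
  have psi: "\<psi> n \<in> H (cx_ob Y n) (cx_ob X (n + 1))" for n using \<psi> by (simp add: anti_def)
  have psid: "cx_d X (n + 1) * \<psi> n + \<psi> (n + 1) * cx_d Y n = 0" for n using \<psi> by (simp add: anti_def)
  let ?T = "tw X Y \<psi>"
  have ob: "cx_ob ?T n = bp (cx_ob X n) (cx_ob Y n)" for n by (simp add: tw_def)
  then show "cx_ob ?T n = bp (cx_ob X n) (cx_ob Y n)" .
  have d: "cx_d ?T n = ti1 X Y (n + 1) * (cx_d X n * tp1 X Y n + \<psi> n * tp2 X Y n) + ti2 X Y (n + 1) * (cx_d Y n * tp2 X Y n)" for n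
    by (simp add: tw_def)
  have dH: "cx_d ?T n \<in> H (cx_ob ?T n) (cx_ob ?T (n + 1))" for n unfolding d ob
    by (intro add_H mult_H[OF _ in1_H] mult_H[OF _ in2_H] mult_H[OF pr1_H cx_H[OF X]]
        mult_H[OF pr2_H psi] mult_H[OF pr2_H cx_H[OF Y]] Ob)
  have oo: "cx_d X n * one (cx_ob X n) = cx_d X n" "\<psi> n * one (cx_ob Y n) = \<psi> n" "cx_d Y n * one (cx_ob Y n) = cx_d Y n"
    "one (cx_ob X (n + 1)) * cx_d X n = cx_d X n" "one (cx_ob X (n + 1)) * \<psi> n = \<psi> n"
    "one (cx_ob Y (n + 1)) * cx_d Y n = cx_d Y n" for n
    using cx_H[OF X] cx_H[OF Y] psi by (auto intro: mult_one one_mult)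
  show i1: "cx_d ?T n * ti1 X Y n = ti1 X Y (n + 1) * cx_d X n" for n
    by (simp add: d Ob distrib_right mult.assoc oo)
  show i2: "cx_d ?T n * ti2 X Y n = ti1 X Y (n + 1) * \<psi> n + ti2 X Y (n + 1) * cx_d Y n" for n
    by (simp add: d Ob distrib_right mult.assoc oo)
  have p2: "tp2 X Y (n + 1) * cx_d ?T n = cx_d Y n * tp2 X Y n" for n
    using Ob by (simp add: d distrib_left mult_eq_assoc mult_zero_cancel
        mult.assoc[symmetric] oo)
  have i1': "cx_d ?T n * (ti1 X Y n * x) = ti1 X Y (n + 1) * (cx_d X n * x)" for n x
    using mult_eq_assoc[OF i1, of n x] by (simp add: mult.assoc)
  have i2': "cx_d ?T n * (ti2 X Y n * x) = ti1 X Y (n + 1) * (\<psi> n * x) + ti2 X Y (n + 1) * (cx_d Y n * x)" for n x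
    using mult_eq_assoc[OF i2, of n x] by (simp add: mult.assoc distrib_right)
  have ps: "cx_d X (n + 1) * (\<psi> n * x) + \<psi> (n + 1) * (cx_d Y n * x) = 0" for n x
  proof -
    have "(cx_d X (n + 1) * \<psi> n + \<psi> (n + 1) * cx_d Y n) * x = 0" using psid by simp
    then show ?thesis by (simp add: distrib_right mult.assoc)
  qed
  have "cx_d ?T (n + 1) * cx_d ?T n = 0" for n
  proof -
    have "cx_d ?T (n + 1) * cx_d ?T n = ti1 X Y (n + 1 + 1) * (cx_d X (n + 1) * (\<psi> n * tp2 X Y n) +
       \<psi> (n + 1) * (cx_d Y n * tp2 X Y n))"
      by (subst (2) d) (simp only: distrib_left i1' i2' cx_dd_el[OF X] cx_dd_el[OF Y] mult_zero_right add_0_left add_0_right add.assoc)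
    then show ?thesis using ps by simp
  qed
  then have T: "cx ?T" using dH by (simp add: cx_def)
  show "dsplit X ?T Y (ti1 X Y) (tp2 X Y) (ti2 X Y) (tp1 X Y)"
    unfolding dsplit_def cm_def using X Y T Ob i1 p2 by (simp add: ob bp_sum)
qed

lemma tw_bdd: assumes X: "bdd X" and Y: "bdd Y" and \<psi>: "anti Y X \<psi>" shows "bdd (tw X Y \<psi>)"
proof -
  obtain a b where ab: "\<And>n. n < a \<or> b < n \<Longrightarrow> zob (cx_ob X n)" using X by (auto simp: bdd_def)
  obtain c d where cd: "\<And>n. n < c \<or> d < n \<Longrightarrow> zob (cx_ob Y n)" using Y by (auto simp: bdd_def)
  have "zob (cx_ob (tw X Y \<psi>) n)" if "n < min a c \<or> max b d < n" for n
  proof -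
    have "zob (cx_ob X n)" "zob (cx_ob Y n)" using that ab cd by auto
    then show ?thesis by (simp add: tw_def zob_bp)
  qed
  then show ?thesis using tw_dsplit(1)[OF bdd_cx[OF X] bdd_cx[OF Y] \<psi>] dsplitD(2) unfolding bdd_def by blast
qed

lemma bp_eqI:
  assumes "u \<in> H (bp A B) X" "v \<in> H (bp A B) X" "A \<in> Ob" "B \<in> Ob"
    "u * in1 A B = v * in1 A B" "u * in2 A B = v * in2 A B"
  shows "u = v"
proof -
  have "w = w * in1 A B * pr1 A B + w * in2 A B * pr2 A B" if "w \<in> H (bp A B) X" for w
    using mult_one[OF that] bp_sum[OF assms(3,4)] by (simp add: mult.assoc flip: distrib_left)
  then show ?thesis using assms by metis
qed

lemma qi_sh: assumes q: "qi X Y f" shows "qi (sh X) (sh Y) (\<lambda>n. f (n + 1))"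
proof (rule qiI)
  note fm = qi_cm[OF q]
  show "cm (sh X) (sh Y) (\<lambda>n. f (n + 1))"
    using cm_H[OF fm] cm_d[OF fm, of "_ + 1"] by (simp add: cm_def)
next
  fix P n x y assume "P \<in> PR" "x \<in> H P (cx_ob (sh X) (n + 1))" "y \<in> H P (cx_ob (sh Y) n)"
    "cx_d (sh X) (n + 1) * x = 0" "f (n + 1 + 1) * x = cx_d (sh Y) n * y"
  then have "x \<in> H P (cx_ob X (n + 1 + 1))" "- y \<in> H P (cx_ob Y (n + 1))" "cx_d X (n + 1 + 1) * x = 0"
    "f (n + 1 + 1) * x = cx_d Y (n + 1) * (- y)" by simp_all
  then have "\<exists>x' \<in> H P (cx_ob X (n + 1)). x = cx_d X (n + 1) * x'"
    using q \<open>P \<in> PR\<close> unfolding qi_def qinj_def by blast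
  then show "\<exists>x' \<in> H P (cx_ob (sh X) n). x = cx_d (sh X) n * x'"
    using uminus_H by (metis minus_mult_minus sh_simps)
next
  fix P n y assume "P \<in> PR" "y \<in> H P (cx_ob (sh Y) (n + 1))" "cx_d (sh Y) (n + 1) * y = 0"
  then have "y \<in> H P (cx_ob Y (n + 1 + 1))" "cx_d Y (n + 1 + 1) * y = 0" by simp_all
  then obtain x y' where xy: "x \<in> H P (cx_ob X (n + 1 + 1))" "y' \<in> H P (cx_ob Y (n + 1))" "cx_d X (n + 1 + 1) * x = 0"
    "y = f (n + 1 + 1) * x + cx_d Y (n + 1) * y'" using q \<open>P \<in> PR\<close> unfolding qi_def qsur_def by blast
  show "\<exists>x \<in> H P (cx_ob (sh X) (n + 1)). \<exists>y' \<in> H P (cx_ob (sh Y) n). cx_d (sh X) (n + 1) * x = 0 \<and>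
      y = f (n + 1 + 1) * x + cx_d (sh Y) n * y'"
    by (intro bexI[of _ x] bexI[of _ "- y'"]) (use xy in auto)
qed

text \<open>Moves a resolution to another degree without the sign of \<open>sh\<close>. It takes the
  stalk of A in degree 0 to the stalk in degree a.\<close>

definition reindex :: "int \<Rightarrow> ('o, 'u) cochain \<Rightarrow> ('o, 'u) cochain" where
  "reindex a X = \<lparr>cx_ob = (\<lambda>n. cx_ob X (n - a)), cx_d = (\<lambda>n. cx_d X (n - a))\<rparr>"

lemma reindex_simps [simp]: "cx_ob (reindex a X) n = cx_ob X (n - a)" "cx_d (reindex a X) n = cx_d X (n - a)"
  by (simp_all add: reindex_def)

lemma reindex_bdd: assumes "bdd X" shows "bdd (reindex a X)"
proof -
  obtain b c where "\<And>n. n < b \<or> c < n \<Longrightarrow> zob (cx_ob X n)" using assms by (auto simp: bdd_def)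
  then have "\<forall>n. n < b + a \<or> c + a < n \<longrightarrow> zob (cx_ob (reindex a X) n)" by simp
  moreover have e: "n + 1 - a = n - a + 1" for n by simp
  have "cx (reindex a X)" using bdd_cx[OF assms] unfolding cx_def reindex_simps e by blast
  ultimately show ?thesis unfolding bdd_def by blast
qed

lemma qi_reindex: assumes q: "qi X Y f" shows "qi (reindex a X) (reindex a Y) (\<lambda>n. f (n - a))"
proof -
  have e: "n + 1 - a = n - a + 1" for n by simp
  have "cm (reindex a X) (reindex a Y) (\<lambda>n. f (n - a))" using qi_cm[OF q] unfolding cm_def reindex_simps e by blast
  moreover have "qinj (reindex a X) (reindex a Y) (\<lambda>n. f (n - a))"
    using q unfolding qi_def qinj_def reindex_simps e by blast
  moreover have "qsur (reindex a X) (reindex a Y) (\<lambda>n. f (n - a))"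
    using q unfolding qi_def qsur_def reindex_simps e by blast
  ultimately show ?thesis by (simp add: qi_def)
qed

text \<open>A horseshoe lemma for complexes. The connecting map \<open>\<psi>X\<close> of X,
  composed with g, is lifted through the shift of a. The lift is the twist \<open>\<psi>\<close>,
  the homotopy h of the lift is the off-diagonal entry of the comparison map, and
  \<open>five_lemma\<close> concludes.\<close>

lemma tw_resolution:
  assumes D: "dsplit X' X X'' i p j r"
    and Q': "bdd Q'" and Q'': "bdd Q''" and PR'': "\<And>n. cx_ob Q'' n \<in> PR"
    and a: "qi Q' X' a" and g: "qi Q'' X'' g"
  obtains \<psi> h where "anti Q'' Q' \<psi>" "\<And>n. h n \<in> H (cx_ob Q'' n) (cx_ob X' n)"
    "qi (tw Q' Q'' \<psi>) X (\<lambda>n. i n * (a n * tp1 Q' Q'' n) + (j n * g n + i n * h n) * tp2 Q' Q'' n)"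
proof -
  note d = dsplitD[OF D] and am = qi_cm[OF a] and gm = qi_cm[OF g]
  note Q'c = bdd_cx[OF Q'] and Q''c = bdd_cx[OF Q'']
  define \<psi>X where "\<psi>X n = r (n + 1) * (cx_d X n * j n)" for n
  have pX: "\<psi>X n \<in> H (cx_ob X'' n) (cx_ob X' (n + 1))" for n
    using dsplit_d(1)[OF D, of n] by (simp add: \<psi>X_def)
  have dj: "cx_d X n * j n = i (n + 1) * \<psi>X n + j (n + 1) * cx_d X'' n" for n
    using dsplit_d(2)[OF D, of n] by (simp add: \<psi>X_def)
  have pXd: "cx_d X' (n + 1) * \<psi>X n + \<psi>X (n + 1) * cx_d X'' n = 0" for n
    using dsplit_d(3)[OF D, of n] by (simp add: \<psi>X_def)
  have e: "\<psi>X n * g n \<in> H (cx_ob Q'' n) (cx_ob (sh X') n)" for n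
    using mult_H[OF cm_H[OF gm] pX] by simp
  have de: "\<psi>X (n + 1) * g (n + 1) * cx_d Q'' n = cx_d (sh X') n * (\<psi>X n * g n) + a (n + 1 + 1) * 0" for n
  proof -
    have "\<psi>X (n + 1) * g (n + 1) * cx_d Q'' n = \<psi>X (n + 1) * cx_d X'' n * g n"
      by (simp add: mult.assoc cm_d[OF gm])
    also have "\<psi>X (n + 1) * cx_d X'' n = - (cx_d X' (n + 1) * \<psi>X n)" using pXd[of n] by (simp add: add_eq_0_iff)
    finally show ?thesis by (simp add: mult.assoc)
  qed
  have z: "0 \<in> H (cx_ob Q'' n) (cx_ob (sh Q') (n + 1))" for n
    using cx_Ob[OF Q''c] cx_Ob[OF Q'c] by simp
  obtain \<psi> h where psi: "\<And>n. \<psi> n \<in> H (cx_ob Q'' n) (cx_ob (sh Q') n)"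
    and h: "\<And>n. h n \<in> H (cx_ob Q'' n) (cx_ob (sh X') (n - 1))"
    and p1: "\<And>n. 0 = \<psi> (n + 1) * cx_d Q'' n - cx_d (sh Q') n * \<psi> n"
    and p2: "\<And>n. \<psi>X n * g n = a (n + 1) * \<psi> n + cx_d (sh X') (n - 1) * h n + h (n + 1) * cx_d Q'' n"
    using cone_lift[OF Q'' PR'' qi_sh[OF a] cx_sh[OF Q'c] cx_sh[OF d(1)] z e _ de] by auto
  have psi: "\<psi> n \<in> H (cx_ob Q'' n) (cx_ob Q' (n + 1))" for n using psi by simp
  have h: "h n \<in> H (cx_ob Q'' n) (cx_ob X' n)" for n using h[of n] by simp
  have p2: "\<psi>X n * g n = a (n + 1) * \<psi> n - cx_d X' n * h n + h (n + 1) * cx_d Q'' n" for n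
    using p2[of n] by simp
  have anti: "anti Q'' Q' \<psi>" using psi p1 by (simp add: anti_def algebra_simps)
  note T = tw_dsplit[OF Q'c Q''c anti]
  note Td = dsplitD[OF T(1)]
  have Ob: "cx_ob Q' n \<in> Ob" "cx_ob Q'' n \<in> Ob" for n using cx_Ob Q'c Q''c by auto
  define \<theta> where "\<theta> n = i n * (a n * tp1 Q' Q'' n) + (j n * g n + i n * h n) * tp2 Q' Q'' n" for n
  have ia: "i n * a n \<in> H (cx_ob Q' n) (cx_ob X n)" for n using cm_H[OF am] d(6) by blast
  have jg: "j n * g n + i n * h n \<in> H (cx_ob Q'' n) (cx_ob X n)" for n
    by (intro add_H mult_H[OF cm_H[OF gm] d(8)] mult_H[OF h d(6)])
  have t1: "\<theta> n * ti1 Q' Q'' n = i n * a n" for n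
    using mult_one[OF ia] by (simp add: \<theta>_def distrib_right mult.assoc Ob)
  have t2: "\<theta> n * ti2 Q' Q'' n = j n * g n + i n * h n" for n
    using mult_one[OF jg, of n] by (simp add: \<theta>_def distrib_right mult.assoc Ob)
  have tH: "\<theta> n \<in> H (cx_ob (tw Q' Q'' \<psi>) n) (cx_ob X n)" for n
    unfolding \<theta>_def T(4) using mult_H[OF pr1_H[OF Ob] ia] mult_H[OF pr2_H[OF Ob] jg]
    by (intro add_H) (auto simp: mult.assoc)
  have "\<theta> (n + 1) * cx_d (tw Q' Q'' \<psi>) n = cx_d X n * \<theta> n" for n
  proof (rule bp_eqI)
    show "\<theta> (n + 1) * cx_d (tw Q' Q'' \<psi>) n \<in> H (bp (cx_ob Q' n) (cx_ob Q'' n)) (cx_ob X (n + 1))"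
      "cx_d X n * \<theta> n \<in> H (bp (cx_ob Q' n) (cx_ob Q'' n)) (cx_ob X (n + 1))"
      using mult_H[OF cx_H[OF Td(2), of n] tH[of "n + 1"]] mult_H[OF tH[of n] cx_H[OF d(2)]] by (auto simp: T(4))
    have "\<theta> (n + 1) * (ti1 Q' Q'' (n + 1) * cx_d Q' n) = i (n + 1) * a (n + 1) * cx_d Q' n"
      using mult_eq_assoc[OF t1] by simp
    also have "\<dots> = cx_d X n * (i n * a n)"
      using cm_d_el[OF d(4), of n "a n"] cm_d[OF am, of n] by (simp add: mult.assoc)
    finally show "\<theta> (n + 1) * cx_d (tw Q' Q'' \<psi>) n * ti1 Q' Q'' n = cx_d X n * \<theta> n * ti1 Q' Q'' n"
      by (simp add: mult.assoc T(2) t1)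
    have gd: "g (n + 1) * cx_d Q'' n = cx_d X'' n * g n" by (rule cm_d[OF gm])
    have "\<theta> (n + 1) * (ti1 Q' Q'' (n + 1) * \<psi> n + ti2 Q' Q'' (n + 1) * cx_d Q'' n) =
      i (n + 1) * (a (n + 1) * \<psi> n) + (j (n + 1) * (cx_d X'' n * g n) + i (n + 1) * (h (n + 1) * cx_d Q'' n))"
      using mult_eq_assoc[OF t1, of "n + 1" "\<psi> n"] mult_eq_assoc[OF t2, of "n + 1" "cx_d Q'' n"] gd
      by (simp add: distrib_left distrib_right mult.assoc)
    also have "\<dots> = i (n + 1) * (\<psi>X n * g n) + j (n + 1) * (cx_d X'' n * g n) + i (n + 1) * (cx_d X' n * h n)"
      by (simp add: p2 algebra_simps)
    also have "\<dots> = cx_d X n * (j n * g n + i n * h n)"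
      using mult_eq_assoc[OF dj, of n "g n"] cm_d_el[OF d(4), of n "h n"]
      by (simp add: distrib_left distrib_right mult.assoc)
    finally show "\<theta> (n + 1) * cx_d (tw Q' Q'' \<psi>) n * ti2 Q' Q'' n = cx_d X n * \<theta> n * ti2 Q' Q'' n"
      by (simp add: mult.assoc T(3) t2)
  qed (use Ob in auto)
  then have tm: "cm (tw Q' Q'' \<psi>) X \<theta>" using tH by (simp add: cm_def)
  have "p n * \<theta> n = g n * tp2 Q' Q'' n" for n
  proof -
    have "one (cx_ob X'' n) * (g n * tp2 Q' Q'' n) = g n * tp2 Q' Q'' n"
      using one_mult[OF mult_H[OF pr2_H[OF Ob] cm_H[OF gm]]] .
    then show ?thesis
      using mult_eq_assoc[OF d(11), of n "g n * tp2 Q' Q'' n"] by (simp add: \<theta>_def distrib_left distrib_right mult.assoc d(17))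
  qed
  then have "qi (tw Q' Q'' \<psi>) X \<theta>" using five_lemma[OF T(1) D tm t1 _ a g] by blast
  then show ?thesis using that[OF anti h] unfolding \<theta>_def by blast
qed

text \<open>If Y is the fibre of p from C to X[1], then Y is quasi-isomorphic to the extension of C by X
  twisted by -p, and the latter is resolved by a twisted extension of resolutions.\<close>

lemma fibre_resolution:
  assumes D: "dsplit Y K (sh X) i p j r" and X: "cx X"
    and Q': "bdd Q'" and Q'': "bdd Q''" and PR'': "\<And>n. cx_ob Q'' n \<in> PR"
    and a: "qi Q' X a" and g: "qi Q'' K g"
  obtains \<psi> \<theta> where "anti Q'' Q' \<psi>" "qi (tw Q' Q'' \<psi>) Y \<theta>"
proof -
  note d = dsplitD[OF D]
  define \<phi> where "\<phi> n = - p n" for n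
  have pd: "p (n + 1) * cx_d K n = - (cx_d X (n + 1) * p n)" for n
    using cm_d[OF d(5), of n] by simp
  have phi: "anti K X \<phi>" using d(7) pd by (simp add: anti_def \<phi>_def)
  note F = tw_dsplit[OF X d(2) phi]
  note Fd = dsplitD[OF F(1)]
  \<comment> \<open>The off-diagonal entry of the differential of K is a chain map from X to Y, and
    K is its cone.\<close>
  define f where "f n = r (n + 1) * (cx_d K n * j n)" for n
  have fH: "f n \<in> H (cx_ob X (n + 1)) (cx_ob Y (n + 1))" for n
    using dsplit_d(1)[OF D, of n] by (simp add: f_def)
  have dj: "cx_d K n * (j n * x) = i (n + 1) * (f n * x) - j (n + 1) * (cx_d X (n + 1) * x)" for n x
    using mult_eq_assoc[OF dsplit_d(2)[OF D, of n], of x] by (simp add: f_def algebra_simps)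
  have fd: "cx_d Y (n + 1) * f n = f (n + 1) * cx_d X (n + 1)" for n
    using dsplit_d(3)[OF D, of n] by (simp add: f_def)
  have rd: "r (n + 1) * cx_d K n = cx_d Y n * r n + f n * p n" for n
  proof -
    have "cx_d K n = cx_d K n * (i n * r n) + cx_d K n * (j n * p n)"
      using mult_one[OF cx_H[OF d(2), of n]] d(14)[of n] by (simp flip: distrib_left)
    then have "r (n + 1) * cx_d K n = r (n + 1) * (cx_d K n * (i n * r n)) + r (n + 1) * (cx_d K n * (j n * p n))"
      by (metis distrib_left)
    moreover have "r (n + 1) * (cx_d K n * (i n * r n)) = cx_d Y n * r n"
      using cm_d_el[OF d(4), of n "r n"] d(15)[OF mult_H[OF d(9) cx_H[OF d(1)]], of n] by simp
    moreover have "r (n + 1) * (cx_d K n * (j n * p n)) = f n * p n" by (simp add: f_def mult.assoc)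
    ultimately show ?thesis by simp
  qed
  have Ob: "cx_ob X n \<in> Ob" "cx_ob K n \<in> Ob" for n using cx_Ob X d(2) by auto
  \<comment> \<open>On (s, c) the value is f s + r c. The summand f s compensates the failure of r
    to be a chain map, which is recorded in \<open>rd\<close>.\<close>
  define \<sigma> where "\<sigma> n = f (n - 1) * tp1 X K n + r n * tp2 X K n" for n
  have fH': "f (n - 1) \<in> H (cx_ob X n) (cx_ob Y n)" for n using fH[of "n - 1"] by simp
  have s1: "\<sigma> n * ti1 X K n = f (n - 1)" for n
    using mult_one[OF fH'] by (simp add: \<sigma>_def distrib_right mult.assoc Ob)
  have s2: "\<sigma> n * ti2 X K n = r n" for n
    using mult_one[OF d(9)] by (simp add: \<sigma>_def distrib_right mult.assoc Ob)
  let ?F = "tw X K \<phi>"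
  have sH: "\<sigma> n \<in> H (cx_ob ?F n) (cx_ob Y n)" for n
    unfolding \<sigma>_def F(4) by (intro add_H mult_H[OF pr1_H fH'] mult_H[OF pr2_H d(9)] Ob)
  have "\<sigma> (n + 1) * cx_d ?F n = cx_d Y n * \<sigma> n" for n
  proof (rule bp_eqI)
    show "\<sigma> (n + 1) * cx_d ?F n \<in> H (bp (cx_ob X n) (cx_ob K n)) (cx_ob Y (n + 1))"
      "cx_d Y n * \<sigma> n \<in> H (bp (cx_ob X n) (cx_ob K n)) (cx_ob Y (n + 1))"
      using mult_H[OF cx_H[OF Fd(2), of n] sH[of "n + 1"]] mult_H[OF sH[of n] cx_H[OF d(1)]] by (auto simp: F(4))
    show "\<sigma> (n + 1) * cx_d ?F n * ti1 X K n = cx_d Y n * \<sigma> n * ti1 X K n"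
      using mult_eq_assoc[OF s1, of "n + 1" "cx_d X n"] fd[of "n - 1"] by (simp add: mult.assoc F(2) s1)
    show "\<sigma> (n + 1) * cx_d ?F n * ti2 X K n = cx_d Y n * \<sigma> n * ti2 X K n"
      using mult_eq_assoc[OF s1, of "n + 1" "\<phi> n"] mult_eq_assoc[OF s2, of "n + 1" "cx_d K n"] rd[of n]
      by (simp add: mult.assoc F(3) s2 distrib_left right_diff_distrib \<phi>_def)
  qed (use Ob in auto)
  then have sm: "cm ?F Y \<sigma>" using sH by (simp add: cm_def)
  have sig: "qi ?F Y \<sigma>"
  proof (rule qiI[OF sm])
    fix P n x y assume P: "P \<in> PR" and x: "x \<in> H P (cx_ob ?F (n + 1))" and y: "y \<in> H P (cx_ob Y n)"
      and dx: "cx_d ?F (n + 1) * x = 0" and sx: "\<sigma> (n + 1) * x = cx_d Y n * y"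
    define s c where "s = tp1 X K (n + 1) * x" and "c = tp2 X K (n + 1) * x"
    have s: "s \<in> H P (cx_ob X (n + 1))" and c: "c \<in> H P (cx_ob K (n + 1))"
      unfolding s_def c_def by (intro mult_H[OF x] Fd)+
    have xsc: "x = ti1 X K (n + 1) * s + ti2 X K (n + 1) * c"
      using Fd(19)[OF x] by (simp add: s_def c_def)
    have "tp1 X K (n + 1 + 1) * (cx_d ?F (n + 1) * x) =
       tp1 X K (n + 1 + 1) * (ti1 X K (n + 1 + 1) * (cx_d X (n + 1) * s) +
       (ti1 X K (n + 1 + 1) * (\<phi> (n + 1) * c) + ti2 X K (n + 1 + 1) * (cx_d K (n + 1) * c)))"
      using mult_eq_assoc[OF F(2), of "n + 1" s] mult_eq_assoc[OF F(3), of "n + 1" c]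
      by (simp add: xsc distrib_left distrib_right mult.assoc)
    also have "\<dots> = cx_d X (n + 1) * s - p (n + 1) * c"
    proof -
      have "cx_d X (n + 1) * s \<in> H P (cx_ob X (n + 1 + 1))" by (rule mult_H[OF s cx_H[OF X]])
      moreover have "p (n + 1) * c \<in> H P (cx_ob X (n + 1 + 1))" using mult_H[OF c d(7)] by simp
      ultimately show ?thesis using Fd(15)[of _ P "n + 1 + 1"] Fd(18)[of "n + 1 + 1"] by (simp add: distrib_left right_diff_distrib \<phi>_def)
    qed
    finally have pc: "p (n + 1) * c = cx_d X (n + 1) * s" using dx by simp
    have "\<sigma> (n + 1) * x = f n * s + r (n + 1) * c"
      using mult_eq_assoc[OF s1, of "n + 1" s] mult_eq_assoc[OF s2, of "n + 1" c] by (simp add: xsc distrib_left)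
    then have rc: "r (n + 1) * c = cx_d Y n * y - f n * s" using sx by (simp add: algebra_simps)
    \<comment> \<open>With x = (s, c), the cocycle condition yields p c = d s. The primitive of x is
      (0, \<open>c1\<close>), and the minus sign before j s matches the twist -p.\<close>
    define c1 where "c1 = i n * y - j n * s"
    have s': "s \<in> H P (cx_ob (sh X) n)" using s by simp
    have c1: "c1 \<in> H P (cx_ob K n)" unfolding c1_def by (intro minus_H mult_H[OF y d(6)] mult_H[OF s' d(8)])
    have "cx_d K n * c1 = i (n + 1) * (r (n + 1) * c) + j (n + 1) * (p (n + 1) * c)"
      by (simp add: c1_def right_diff_distrib dj cm_d_el[OF d(4), symmetric] pc rc)
    also have "\<dots> = c" by (rule d(19)[OF c])
    finally have dc: "cx_d K n * c1 = c" .
    have "\<phi> n * c1 = s" using d(16)[OF s'] by (simp add: \<phi>_def c1_def right_diff_distrib d(17))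
    then have "cx_d ?F n * (ti2 X K n * c1) = x"
      using mult_eq_assoc[OF F(3), of n c1] dc xsc by (simp add: distrib_right mult.assoc)
    moreover have "ti2 X K n * c1 \<in> H P (cx_ob ?F n)" by (rule mult_H[OF c1 Fd(8)])
    ultimately show "\<exists>x' \<in> H P (cx_ob ?F n). x = cx_d ?F n * x'" by blast
  next
    fix P n y assume y: "y \<in> H P (cx_ob Y (n + 1))" and dy: "cx_d Y (n + 1) * y = 0"
    \<comment> \<open>The element y is hit by (0, i y), which is a cocycle because p i = 0.\<close>
    let ?x = "ti2 X K (n + 1) * (i (n + 1) * y)"
    have "?x \<in> H P (cx_ob ?F (n + 1))" by (intro mult_H[OF _ Fd(8)] mult_H[OF _ d(6)] y)
    moreover have "cx_d ?F (n + 1) * ?x = 0"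
      using mult_eq_assoc[OF F(3), of "n + 1" "i (n + 1) * y"] cm_d_el[OF d(4), of "n + 1" y] dy
      by (simp add: left_diff_distrib mult.assoc \<phi>_def d(17))
    moreover have "y = \<sigma> (n + 1) * ?x + cx_d Y n * 0"
      using mult_eq_assoc[OF s2, of "n + 1" "i (n + 1) * y"] d(15)[OF y] by simp
    ultimately show "\<exists>x \<in> H P (cx_ob ?F (n + 1)). \<exists>y' \<in> H P (cx_ob Y n). cx_d ?F (n + 1) * x = 0 \<and>
      y = \<sigma> (n + 1) * x + cx_d Y n * y'" using zero_H[of P "cx_ob Y n"] H_Ob[OF y] cx_Ob[OF d(1)] by blast
  qed
  obtain \<psi> h where psi: "anti Q'' Q' \<psi>" "\<And>n. h n \<in> H (cx_ob Q'' n) (cx_ob X n)"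
    "qi (tw Q' Q'' \<psi>) ?F (\<lambda>n. ti1 X K n * (a n * tp1 Q' Q'' n) + (ti2 X K n * g n + ti1 X K n * h n) * tp2 Q' Q'' n)"
    by (rule tw_resolution[OF F(1) Q' Q'' PR'' a g]) (rule that)
  show ?thesis by (rule that[OF psi(1) qi_comp[OF psi(3) sig]])
qed

section \<open>Resolutions of objects\<close>

definition stalk :: "'o \<Rightarrow> int \<Rightarrow> ('o, 'u) cochain" where
  "stalk A a = \<lparr>cx_ob = (\<lambda>n. if n = a then A else zo), cx_d = (\<lambda>_. 0)\<rparr>"

lemma stalk_simps: "cx_ob (stalk A a) n = (if n = a then A else zo)" "cx_d (stalk A a) n = 0"
  by (simp_all add: stalk_def)

lemma stalk_bdd: assumes "A \<in> Ob" shows "bdd (stalk A a)"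
proof -
  have "\<forall>n. n < a \<or> a < n \<longrightarrow> zob (cx_ob (stalk A a) n)" by (auto simp: stalk_simps)
  then show ?thesis using assms unfolding bdd_def cx_def by (auto simp: stalk_simps)
qed

lemma stalk_cx: "A \<in> Ob \<Longrightarrow> cx (stalk A a)" using bdd_cx[OF stalk_bdd] .

lemma reindex_stalk: "reindex a (stalk A 0) = stalk A a" by (simp add: reindex_def stalk_def)

lemma sh_stalk: "sh (stalk A 0) = stalk A (- 1)" by (simp add: sh_def stalk_def add_eq_0_iff fun_eq_iff)

definition exact :: "'o \<Rightarrow> 'o \<Rightarrow> 'o \<Rightarrow> 'u \<Rightarrow> 'u \<Rightarrow> bool" where
  "exact K P M i q \<longleftrightarrow> i \<in> H K P \<and> q \<in> H P M \<and> q * i = 0 \<and>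
    (\<forall>R \<in> PR. \<forall>x \<in> H R M. \<exists>y \<in> H R P. x = q * y) \<and>
    (\<forall>R \<in> PR. \<forall>x \<in> H R P. q * x = 0 \<longrightarrow> (\<exists>k \<in> H R K. x = i * k)) \<and>
    (\<forall>R \<in> PR. \<forall>x \<in> H R K. i * x = 0 \<longrightarrow> x = 0)"

definition two_term :: "'o \<Rightarrow> 'o \<Rightarrow> 'u \<Rightarrow> ('o, 'u) cochain" where
  "two_term K P i = \<lparr>cx_ob = (\<lambda>n. if n = 0 then P else if n = - 1 then K else zo),
    cx_d = (\<lambda>n. if n = - 1 then i else 0)\<rparr>"

lemma two_term_simps: "cx_ob (two_term K P i) n = (if n = 0 then P else if n = - 1 then K else zo)"
  "cx_d (two_term K P i) n = (if n = - 1 then i else 0)"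
  by (simp_all add: two_term_def)

text \<open>The brutal filtration: P in degree 0 is a subcomplex, K in degree -1 is the quotient,
  and i is the connecting map.\<close>

lemma two_term_dsplit: assumes i: "i \<in> H K P"
  shows "dsplit (stalk P 0) (two_term K P i) (stalk K (- 1)) (\<lambda>n. if n = 0 then one P else 0)
    (\<lambda>n. if n = - 1 then one K else 0) (\<lambda>n. if n = - 1 then one K else 0) (\<lambda>n. if n = 0 then one P else 0)"
proof -
  have o: "K \<in> Ob" "P \<in> Ob" using H_Ob[OF i] by auto
  have "cx (two_term K P i)"
    using i o unfolding cx_def by (auto simp: two_term_simps)
  then show ?thesis
    using o stalk_cx mult_one[OF one_H[OF o(1)]] mult_one[OF one_H[OF o(2)]]
    unfolding dsplit_def cm_def by (auto simp: two_term_simps stalk_simps)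
qed

lemma two_term_qi: assumes e: "exact K P M i q"
  shows "qi (two_term K P i) (stalk M 0) (\<lambda>n. if n = 0 then q else 0)"
proof -
  have i: "i \<in> H K P" and q: "q \<in> H P M" and qi0: "q * i = 0"
    and sur: "\<And>R x. R \<in> PR \<Longrightarrow> x \<in> H R M \<Longrightarrow> \<exists>y \<in> H R P. x = q * y"
    and ker: "\<And>R x. R \<in> PR \<Longrightarrow> x \<in> H R P \<Longrightarrow> q * x = 0 \<Longrightarrow> \<exists>k \<in> H R K. x = i * k"
    and inj: "\<And>R x. R \<in> PR \<Longrightarrow> x \<in> H R K \<Longrightarrow> i * x = 0 \<Longrightarrow> x = 0"
    using e by (auto simp: exact_def)
  have o: "K \<in> Ob" "P \<in> Ob" "M \<in> Ob" using H_Ob[OF i] H_Ob[OF q] by auto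
  show ?thesis
  proof (rule qiI)
    show "cm (two_term K P i) (stalk M 0) (\<lambda>n. if n = 0 then q else 0)"
      unfolding cm_def using q o qi0 by (auto simp: two_term_simps stalk_simps)
  next
    fix R n x y assume R: "R \<in> PR" and x: "x \<in> H R (cx_ob (two_term K P i) (n + 1))"
      and dx: "cx_d (two_term K P i) (n + 1) * x = 0" and qx: "(if n + 1 = 0 then q else 0) * x = cx_d (stalk M 0) n * y"
    consider "n = -1" | "n = -2" | "n \<noteq> -1" "n \<noteq> -2" by blast
    then show "\<exists>x' \<in> H R (cx_ob (two_term K P i) n). x = cx_d (two_term K P i) n * x'"
    proof cases
      case 1
      then show ?thesis using ker[OF R, of x] x qx by (auto simp: two_term_simps stalk_simps)
    next
      case 2
      then have "x = 0" using inj[OF R, of x] x dx by (auto simp: two_term_simps)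
      then show ?thesis using 2 zero_H[OF PR_Ob[OF R] zo_Ob] by (auto simp: two_term_simps)
    next
      case 3
      then have "x = 0" using to_zob[OF zob_zo] x by (auto simp: two_term_simps)
      moreover have "0 \<in> H R (cx_ob (two_term K P i) n)" using o PR_Ob[OF R] by (auto simp: two_term_simps)
      ultimately show ?thesis by (intro bexI[of _ 0]) auto
    qed
  next
    fix R n y assume R: "R \<in> PR" and y: "y \<in> H R (cx_ob (stalk M 0) (n + 1))"
    have "\<exists>x \<in> H R (cx_ob (two_term K P i) (n + 1)). y = (if n + 1 = 0 then q else 0) * x \<and> cx_d (two_term K P i) (n + 1) * x = 0"
    proof (cases "n = -1")
      case True
      then show ?thesis using sur[OF R, of y] y by (auto simp: two_term_simps stalk_simps)
    next
      case False
      then have "y = 0" using to_zob[OF zob_zo] y by (auto simp: stalk_simps split: if_splits)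
      moreover have "0 \<in> H R (cx_ob (two_term K P i) (n + 1))" using o PR_Ob[OF R] by (auto simp: two_term_simps)
      ultimately show ?thesis by (intro bexI[of _ 0]) auto
    qed
    moreover have "0 \<in> H R (cx_ob (stalk M 0) n)" using o PR_Ob[OF R] by (auto simp: stalk_simps)
    ultimately show "\<exists>x \<in> H R (cx_ob (two_term K P i) (n + 1)). \<exists>y' \<in> H R (cx_ob (stalk M 0) n).
      cx_d (two_term K P i) (n + 1) * x = 0 \<and> y = (if n + 1 = 0 then q else 0) * x + cx_d (stalk M 0) n * y'"
      by (auto simp: stalk_simps)
  qed
qed

section \<open>Projective resolutions with prescribed terms\<close>

definition resolution_terms :: "'o set \<Rightarrow> 'o set \<Rightarrow> int \<Rightarrow> 'o set" where
  "resolution_terms P0 PC n = (if n = 0 then P0 else if n < 0 then PC else {A \<in> PR. zob A})"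

text \<open>The head of the resolution, in degree 0, gets its own class P0, because later only the
  head may have maps to the target complex in the critical degrees. All terms in negative degrees
  lie in PC.\<close>

definition resolved_objs :: "'o set \<Rightarrow> 'o set \<Rightarrow> 'o set" where
  "resolved_objs P0 PC = {A \<in> Ob. \<exists>Q a. bdd Q \<and> (\<forall>n. cx_ob Q n \<in> resolution_terms P0 PC n) \<and> qi Q (stalk A 0) a}"

text \<open>Closure under biproducts keeps the terms of twisted extensions in their classes. Zero
  objects are included for the degrees in which a complex has no term.\<close>

definition admissible :: "'o set \<Rightarrow> 'o set \<Rightarrow> bool" where
  "admissible P0 PC \<longleftrightarrow> PC \<subseteq> P0 \<and> P0 \<subseteq> PR \<and> {A \<in> PR. zob A} \<subseteq> PC \<and>
    (\<forall>A \<in> PC. \<forall>B \<in> PC. bp A B \<in> PC) \<and> (\<forall>A \<in> P0. \<forall>B \<in> P0. bp A B \<in> P0)"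

lemma resolution_terms_PR: "admissible P0 PC \<Longrightarrow> A \<in> resolution_terms P0 PC n \<Longrightarrow> A \<in> PR"
  by (auto simp: admissible_def resolution_terms_def split: if_splits)

lemma resolution_terms_bp: "admissible P0 PC \<Longrightarrow> A \<in> resolution_terms P0 PC n \<Longrightarrow> B \<in> resolution_terms P0 PC n \<Longrightarrow> bp A B \<in> resolution_terms P0 PC n"
  by (auto simp: admissible_def resolution_terms_def zob_bp split: if_splits)

lemma zo_resolution_terms: "admissible P0 PC \<Longrightarrow> zo \<in> resolution_terms P0 PC n"
  by (auto simp: admissible_def resolution_terms_def split: if_splits)

lemma resolved_objs_Ob: "A \<in> resolved_objs P0 PC \<Longrightarrow> A \<in> Ob" by (simp add: resolved_objs_def)

lemma resolved_objs_iso: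
  assumes A: "A \<in> resolved_objs P0 PC" and u: "u \<in> H A B" and v: "v \<in> H B A" and vu: "v * u = one A" and uv: "u * v = one B"
  shows "B \<in> resolved_objs P0 PC"
proof -
  have o: "A \<in> Ob" "B \<in> Ob" using H_Ob[OF u] by auto
  have "qi (stalk A 0) (stalk B 0) (\<lambda>n. if n = 0 then u else 0)"
  proof (rule qiI)
    show "cm (stalk A 0) (stalk B 0) (\<lambda>n. if n = 0 then u else 0)"
      unfolding cm_def using o u by (auto simp: stalk_simps)
  next
    fix R n x y assume R: "R \<in> PR" and x: "x \<in> H R (cx_ob (stalk A 0) (n + 1))"
      and ux: "(if n + 1 = 0 then u else 0) * x = cx_d (stalk B 0) n * y"
    have "x = 0"
    proof (cases "n + 1 = 0")
      case True
      then have "v * (u * x) = 0" "x \<in> H R A" using ux x by (simp_all add: stalk_simps)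
      then show ?thesis using mult_eq_assoc[OF vu, of x] by simp
    next
      case False
      then show ?thesis using x to_zob[OF zob_zo] by (auto simp: stalk_simps)
    qed
    moreover have "0 \<in> H R (cx_ob (stalk A 0) n)" using o PR_Ob[OF R] by (auto simp: stalk_simps)
    ultimately show "\<exists>x' \<in> H R (cx_ob (stalk A 0) n). x = cx_d (stalk A 0) n * x'" by (auto simp: stalk_simps)
  next
    fix R n y assume R: "R \<in> PR" and y: "y \<in> H R (cx_ob (stalk B 0) (n + 1))"
    have "\<exists>x \<in> H R (cx_ob (stalk A 0) (n + 1)). y = (if n + 1 = 0 then u else 0) * x"
    proof (cases "n + 1 = 0")
      case True
      then have "y \<in> H R B" using y by (simp add: stalk_simps)
      then have "v * y \<in> H R A" "y = u * (v * y)" using mult_H[OF _ v] mult_eq_assoc[OF uv, of y] by auto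
      then show ?thesis using True by (auto simp: stalk_simps)
    next
      case False
      then show ?thesis using y to_zob[OF zob_zo] by (auto simp: stalk_simps intro!: bexI[of _ 0] PR_Ob[OF R])
    qed
    moreover have "0 \<in> H R (cx_ob (stalk B 0) n)" using o PR_Ob[OF R] by (auto simp: stalk_simps)
    ultimately show "\<exists>x \<in> H R (cx_ob (stalk A 0) (n + 1)). \<exists>y' \<in> H R (cx_ob (stalk B 0) n). cx_d (stalk A 0) (n + 1) * x = 0 \<and>
      y = (if n + 1 = 0 then u else 0) * x + cx_d (stalk B 0) n * y'" by (auto simp: stalk_simps)
  qed
  then show ?thesis using A qi_comp o unfolding resolved_objs_def by blast
qed

lemma resolved_objs_P0: assumes ad: "admissible P0 PC" and P: "P \<in> P0" shows "P \<in> resolved_objs P0 PC"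
proof -
  have o: "P \<in> Ob" using ad P PR_Ob by (auto simp: admissible_def)
  have "cx_ob (stalk P 0) n \<in> resolution_terms P0 PC n" for n
    using zo_resolution_terms[OF ad, of n] P by (auto simp: stalk_simps resolution_terms_def)
  then show ?thesis using stalk_bdd[OF o] qi_one[OF stalk_cx[OF o]] o unfolding resolved_objs_def by blast
qed

lemma resolved_objs_zob: assumes ad: "admissible P0 PC" and A: "zob A" shows "A \<in> resolved_objs P0 PC"
proof -
  have "zo \<in> P0" using ad by (auto simp: admissible_def)
  then show ?thesis
    using resolved_objs_iso[OF resolved_objs_P0[OF ad], of zo 0 A 0] zob_Ob[OF A] A by (auto simp: zob_def)
qed

text \<open>Splicing: the resolution of K, shifted by one, is glued below P. Its head lands in
  degree -1, which is why K is to be resolved with all terms in PC.\<close>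

lemma resolved_objs_cokernel:
  assumes ad: "admissible P0 PC" and ad': "admissible PC PC" and e: "exact K P M i q" and P: "P \<in> P0" and K: "K \<in> resolved_objs PC PC"
  shows "M \<in> resolved_objs P0 PC"
proof -
  have i: "i \<in> H K P" and q: "q \<in> H P M" using e by (auto simp: exact_def)
  have o: "K \<in> Ob" "P \<in> Ob" "M \<in> Ob" using H_Ob[OF i] H_Ob[OF q] by auto
  obtain Q a where Q: "bdd Q" "\<And>n. cx_ob Q n \<in> resolution_terms PC PC n" "qi Q (stalk K 0) a" using K by (auto simp: resolved_objs_def)
  have a: "qi (sh Q) (stalk K (- 1)) (\<lambda>n. a (n + 1))" using qi_sh[OF Q(3)] by (simp add: sh_stalk)
  have pr: "cx_ob (sh Q) n \<in> PR" for n using resolution_terms_PR[OF ad' Q(2)] by simp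
  obtain \<psi> h where psi: "anti (sh Q) (stalk P 0) \<psi>" and "\<And>n. h n \<in> H (cx_ob (sh Q) n) (cx_ob (stalk P 0) n)"
    and "qi (tw (stalk P 0) (sh Q) \<psi>) (two_term K P i)
     (\<lambda>n. (if n = 0 then one P else 0) * (one (cx_ob (stalk P 0) n) * tp1 (stalk P 0) (sh Q) n) +
      ((if n = - 1 then one K else 0) * a (n + 1) + (if n = 0 then one P else 0) * h n) * tp2 (stalk P 0) (sh Q) n)"
    by (rule tw_resolution[OF two_term_dsplit[OF i] stalk_bdd[OF o(2)] bdd_sh[OF Q(1)] pr qi_one[OF stalk_cx[OF o(2)]] a]) (rule that)
  then obtain t where "qi (tw (stalk P 0) (sh Q) \<psi>) (stalk M 0) t" using qi_comp[OF _ two_term_qi[OF e]] by blast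
  moreover have "bdd (tw (stalk P 0) (sh Q) \<psi>)" using tw_bdd[OF stalk_bdd[OF o(2)] bdd_sh[OF Q(1)] psi] .
  moreover have "cx_ob (tw (stalk P 0) (sh Q) \<psi>) n \<in> resolution_terms P0 PC n" for n
  proof -
    have "cx_ob (stalk P 0) n \<in> resolution_terms P0 PC n" using zo_resolution_terms[OF ad, of n] P by (auto simp: stalk_simps resolution_terms_def)
    moreover have "cx_ob (sh Q) n \<in> resolution_terms P0 PC n" using Q(2)[of "n + 1"] ad by (auto simp: resolution_terms_def admissible_def split: if_splits)
    ultimately show ?thesis using resolution_terms_bp[OF ad] by (simp add: tw_def)
  qed
  ultimately show ?thesis using o unfolding resolved_objs_def by blast
qed

text \<open>The horseshoe lemma, reduced to \<open>fibre_resolution\<close>: the stalk of A is the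
  fibre of the map to A'[1] from the two-term complex of A' and A, which is quasi-isomorphic to
  A''.\<close>

lemma resolved_objs_extension:
  assumes ad: "admissible P0 PC" and e: "exact A' A A'' i q" and A': "A' \<in> resolved_objs P0 PC" and A'': "A'' \<in> resolved_objs P0 PC"
  shows "A \<in> resolved_objs P0 PC"
proof -
  have i: "i \<in> H A' A" and q: "q \<in> H A A''" using e by (auto simp: exact_def)
  have o: "A' \<in> Ob" "A \<in> Ob" "A'' \<in> Ob" using H_Ob[OF i] H_Ob[OF q] by auto
  obtain Q' a where Q': "bdd Q'" "\<And>n. cx_ob Q' n \<in> resolution_terms P0 PC n" "qi Q' (stalk A' 0) a" using A' by (auto simp: resolved_objs_def)
  obtain Q'' g where Q'': "bdd Q''" "\<And>n. cx_ob Q'' n \<in> resolution_terms P0 PC n" "qi Q'' (stalk A'' 0) g" using A'' by (auto simp: resolved_objs_def)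
  have pr: "cx_ob Q'' n \<in> PR" for n using resolution_terms_PR[OF ad Q''(2)] .
  note D = two_term_dsplit[OF i]
  have tc: "cx (two_term A' A i)" using dsplitD(2)[OF D] .
  \<comment> \<open>The resolution of A'' is lifted to the two-term complex, and by two out of three
    it resolves that complex as well.\<close>
  obtain r where r: "cm Q'' (two_term A' A i) r" "htp Q'' (stalk A'' 0) g (\<lambda>n. (if n = 0 then q else 0) * r n)"
    using lift[OF Q''(1) pr two_term_qi[OF e] tc stalk_cx[OF o(3)] qi_cm[OF Q''(3)]] .
  have "qi Q'' (stalk A'' 0) (\<lambda>n. (if n = 0 then q else 0) * r n)"
    using qi_htp[OF Q''(3) r(2) cm_comp[OF r(1) qi_cm[OF two_term_qi[OF e]]] bdd_cx[OF Q''(1)] stalk_cx[OF o(3)]] .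
  then have rq: "qi Q'' (two_term A' A i) r" using qi_cancel_left[OF two_term_qi[OF e] _ r(1) tc] by blast
  obtain \<psi> \<theta> where psi: "anti Q'' Q' \<psi>" "qi (tw Q' Q'' \<psi>) (stalk A 0) \<theta>"
    using fibre_resolution[OF D[folded sh_stalk] stalk_cx[OF o(1)] Q'(1) Q''(1) pr Q'(3) rq] .
  moreover have "cx_ob (tw Q' Q'' \<psi>) n \<in> resolution_terms P0 PC n" for n
    using resolution_terms_bp[OF ad Q'(2) Q''(2)] by (simp add: tw_def)
  ultimately show ?thesis using tw_bdd[OF Q'(1) Q''(1) psi(1)] o unfolding resolved_objs_def by blast
qed

lemma bp_exact: assumes "A \<in> Ob" "B \<in> Ob" shows "exact A (bp A B) B (in1 A B) (pr2 A B)"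
proof -
  have d: "in1 A B * (pr1 A B * x) + in2 A B * (pr2 A B * x) = x" if "x \<in> H R (bp A B)" for x R
    using bp_sum[OF assms] one_mult[OF that] by (simp flip: mult.assoc distrib_right)
  have s: "\<exists>y \<in> H R (bp A B). x = pr2 A B * y" if "x \<in> H R B" for x R
    using that assms mult_eq_assoc[OF pr2_in2[OF assms], of x] by (intro bexI[of _ "in2 A B * x"]) (auto intro: mult_H)
  have k: "\<exists>k \<in> H R A. x = in1 A B * k" if "x \<in> H R (bp A B)" "pr2 A B * x = 0" for x R
    using that assms d[OF that(1)] by (intro bexI[of _ "pr1 A B * x"]) (auto intro: mult_H)
  have z: "x = 0" if "x \<in> H R A" "in1 A B * x = 0" for x R
    using that assms mult_eq_assoc[OF pr1_in1[OF assms], of x] by simp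
  show ?thesis unfolding exact_def
  proof (intro conjI ballI impI)
    show "in1 A B \<in> H A (bp A B)" "pr2 A B \<in> H (bp A B) B" "pr2 A B * in1 A B = 0" using assms by auto
  qed (erule s, erule (1) k, erule (1) z)
qed

lemma resolved_objs_bp: "admissible P0 PC \<Longrightarrow> A \<in> resolved_objs P0 PC \<Longrightarrow> B \<in> resolved_objs P0 PC \<Longrightarrow> bp A B \<in> resolved_objs P0 PC"
  using resolved_objs_extension bp_exact resolved_objs_Ob by metis

text \<open>Serves as the class PC in the resolution of a term that sits in degree c.\<close>

definition vanishing :: "('o, 'u) cochain \<Rightarrow> int \<Rightarrow> 'o set" where
  "vanishing B c = {P \<in> PR. \<forall>n \<le> c. H P (cx_ob B n) \<subseteq> {0}}"

lemma vanishing_admissible: "admissible (vanishing B c) (vanishing B c)" "admissible PR (vanishing B c)"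
proof -
  have "bp P Q \<in> vanishing B c" if "P \<in> vanishing B c" "Q \<in> vanishing B c" for P Q
  proof -
    have o: "P \<in> Ob" "Q \<in> Ob" using that PR_Ob by (auto simp: vanishing_def)
    have "x = 0" if n: "n \<le> c" and x: "x \<in> H (bp P Q) (cx_ob B n)" for n x
    proof (rule bp_eqI[OF x _ o])
      show "0 \<in> H (bp P Q) (cx_ob B n)" using H_Ob[OF x] by auto
      have "x * in1 P Q \<in> H P (cx_ob B n)" "x * in2 P Q \<in> H Q (cx_ob B n)" using x o by (auto intro: mult_H)
      then show "x * in1 P Q = 0 * in1 P Q" "x * in2 P Q = 0 * in2 P Q"
        using n \<open>P \<in> vanishing B c\<close> \<open>Q \<in> vanishing B c\<close> by (auto simp: vanishing_def)
    qed
    then show ?thesis using that by (auto simp: vanishing_def)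
  qed
  moreover have "{A \<in> PR. zob A} \<subseteq> vanishing B c" using from_zob by (auto simp: vanishing_def)
  ultimately show "admissible (vanishing B c) (vanishing B c)" "admissible PR (vanishing B c)"
    by (auto simp: admissible_def vanishing_def)
qed

text \<open>The last clause makes derived morphisms of degree 1 from E to B representable by chain maps.\<close>

definition good_res :: "('o, 'u) cochain \<Rightarrow> ('o, 'u) cochain \<Rightarrow> ('o, 'u) cochain \<Rightarrow> (int \<Rightarrow> 'u) \<Rightarrow> bool" where
  "good_res B E Q q \<longleftrightarrow> bdd Q \<and> (\<forall>n. cx_ob Q n \<in> PR) \<and> qi Q E q \<and>
    (\<forall>n. \<forall>P \<in> PR. \<forall>x \<in> H P (cx_ob E n). \<exists>y \<in> H P (cx_ob Q n). x = q n * y) \<and>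
    (\<forall>\<phi>. anti Q B \<phi> \<longrightarrow> (\<forall>n. \<exists>g \<in> H (cx_ob E n) (cx_ob B (n + 1)). \<phi> n = g * q n))"

text \<open>Induction on the number k of degrees, from a on, in which E may be nonzero. The lowest
  term, placed in degree a, is a quotient complex of E, so a resolution of it is glued to one of the
  remaining subcomplex by \<open>tw_resolution\<close>.\<close>

lemma good_resolution_aux:
  assumes B: "cx B"
  shows "bdd E \<Longrightarrow> (\<And>n. n < a \<Longrightarrow> zob (cx_ob E n)) \<Longrightarrow> (\<And>n. n \<ge> a + int k \<Longrightarrow> zob (cx_ob E n)) \<Longrightarrow>
    (\<And>n. cx_ob E n \<in> resolved_objs PR (vanishing B n)) \<Longrightarrow> \<exists>Q q. good_res B E Q q"
proof (induction k arbitrary: E a)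
  case 0
  have z: "zob (cx_ob E n)" for n using 0(2,3)[of n] by (cases "n < a") auto
  note Ec = bdd_cx[OF 0(1)]
  let ?Q = "stalk zo 0"
  have zQ: "cx_ob ?Q n = zo" for n by (simp add: stalk_simps)
  have "qi ?Q E (\<lambda>_. 0)"
  proof (rule qiI)
    show "cm ?Q E (\<lambda>_. 0)" using cx_Ob[OF Ec] by (simp add: cm_def zQ stalk_simps)
  next
    fix P n x assume x: "x \<in> H P (cx_ob ?Q (n + 1))"
    then show "\<exists>x' \<in> H P (cx_ob ?Q n). x = cx_d ?Q n * x'" using to_zob[OF zob_zo] by (auto simp: zQ stalk_simps)
  next
    fix P n y assume y: "y \<in> H P (cx_ob E (n + 1))"
    then have "P \<in> Ob" "y = 0" using H_Ob[OF y] to_zob[OF z y] by auto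
    then show "\<exists>x \<in> H P (cx_ob ?Q (n + 1)). \<exists>y' \<in> H P (cx_ob E n). cx_d ?Q (n + 1) * x = 0 \<and>
      y = 0 * x + cx_d E n * y'" using cx_Ob[OF Ec] by (auto simp: zQ intro!: bexI[of _ 0])
  qed
  moreover have "\<exists>y \<in> H P (cx_ob ?Q n). x = 0 * y" if "x \<in> H P (cx_ob E n)" for n P x
    using H_Ob[OF that] to_zob[OF z that] by (intro bexI[of _ 0]) (auto simp: zQ)
  moreover have "\<exists>g \<in> H (cx_ob E n) (cx_ob B (n + 1)). \<phi> n = g * 0" if "anti ?Q B \<phi>" for \<phi> n
  proof -
    have "\<phi> n \<in> H zo (cx_ob B (n + 1))" using that by (simp add: anti_def zQ)
    then have "\<phi> n = 0" by (rule from_zob[OF zob_zo])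
    then show ?thesis using cx_Ob[OF Ec, of n] cx_Ob[OF B, of "n + 1"] by (auto intro!: bexI[of _ 0])
  qed
  ultimately have "good_res B E ?Q (\<lambda>_. 0)" using stalk_bdd[OF zo_Ob] unfolding good_res_def by (auto simp: zQ)
  then show ?case by blast
next
  case (Suc k)
  note Ec = bdd_cx[OF Suc.prems(1)] and zl = Suc.prems(2) and zr = Suc.prems(3)
  define E' where "E' = \<lparr>cx_ob = (\<lambda>n. if n \<le> a then zo else cx_ob E n), cx_d = (\<lambda>n. if n \<le> a then 0 else cx_d E n)\<rparr>"
  have E'o: "cx_ob E' n = (if n \<le> a then zo else cx_ob E n)"
    and E'd: "cx_d E' n = (if n \<le> a then 0 else cx_d E n)" for n by (simp_all add: E'_def)
  have E'c: "cx E'" using cx_H[OF Ec] cx_dd[OF Ec] cx_Ob[OF Ec] by (auto simp: cx_def E'o E'd)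
  have "zob (cx_ob E' n)" if "n < a \<or> a + int (Suc k) < n" for n using that zl zr by (auto simp: E'o)
  then have E'b: "bdd E'" using E'c unfolding bdd_def by blast
  define i p where "i n = (if n \<le> a then 0 else one (cx_ob E n))" and "p n = (if n = a then one (cx_ob E a) else 0)" for n
  have D: "dsplit E' E (stalk (cx_ob E a) a) i p p i"
  proof -
    have "one (cx_ob E (n + 1)) * cx_d E n = cx_d E n" "cx_d E n * one (cx_ob E n) = cx_d E n" for n
      using one_mult[OF cx_H[OF Ec]] mult_one[OF cx_H[OF Ec]] by auto
    moreover have "one (cx_ob E n) = 0" "cx_d E n = 0" if "n < a" for n
      using zl[OF that] from_zob[OF zl[OF that] cx_H[OF Ec]] by (auto simp: zob_def)
    ultimately show ?thesis
      using E'c Ec stalk_cx[of "cx_ob E a" a] cx_Ob[OF Ec] mult_one[OF one_H[OF cx_Ob[OF Ec]]]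
      unfolding dsplit_def cm_def by (auto simp: E'o E'd stalk_simps i_def p_def)
  qed
  have "cx_ob E' n \<in> resolved_objs PR (vanishing B n)" for n
    using Suc.prems(4) resolved_objs_zob[OF vanishing_admissible(2) zob_zo] by (simp add: E'o)
  moreover have "zob (cx_ob E' n)" if "n < a + 1" for n using that by (simp add: E'o)
  moreover have "zob (cx_ob E' n)" if "n \<ge> a + 1 + int k" for n using that zr by (simp add: E'o)
  ultimately obtain Q' q' where "good_res B E' Q' q'" using Suc.IH[OF E'b, of "a + 1"] by blast
  then have Q': "bdd Q'" "\<And>n. cx_ob Q' n \<in> PR" "qi Q' E' q'"
    and Q'sur: "\<And>n P x. P \<in> PR \<Longrightarrow> x \<in> H P (cx_ob E' n) \<Longrightarrow> \<exists>y \<in> H P (cx_ob Q' n). x = q' n * y"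
    and Q'fac: "\<And>\<phi> n. anti Q' B \<phi> \<Longrightarrow> \<exists>g \<in> H (cx_ob E' n) (cx_ob B (n + 1)). \<phi> n = g * q' n"
    by (auto simp: good_res_def)
  obtain R0 e0 where R0: "bdd R0" "\<And>n. cx_ob R0 n \<in> resolution_terms PR (vanishing B a) n" "qi R0 (stalk (cx_ob E a) 0) e0"
    using Suc.prems(4)[of a] by (auto simp: resolved_objs_def)
  define R where "R = reindex a R0"
  define e where "e = (\<lambda>n. e0 (n - a))"
  have R: "bdd R" "qi R (stalk (cx_ob E a) a) e" using reindex_bdd[OF R0(1)] qi_reindex[OF R0(3), of a] by (auto simp: R_def e_def reindex_stalk)
  have RPR: "cx_ob R n \<in> PR" for n using resolution_terms_PR[OF vanishing_admissible(2) R0(2)] by (simp add: R_def)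
  have Rlow: "cx_ob R n \<in> vanishing B a" if "n < a" for n using R0(2)[of "n - a"] that by (simp add: R_def resolution_terms_def)
  have Rhigh: "zob (cx_ob R n)" if "n > a" for n using R0(2)[of "n - a"] that by (simp add: R_def resolution_terms_def)
  obtain \<psi> h where psi: "anti R Q' \<psi>" and h: "\<And>n. h n \<in> H (cx_ob R n) (cx_ob E' n)"
    and th: "qi (tw Q' R \<psi>) E (\<lambda>n. i n * (q' n * tp1 Q' R n) + (p n * e n + i n * h n) * tp2 Q' R n)"
    by (rule tw_resolution[OF D Q'(1) R(1) RPR Q'(3) R(2)]) (rule that)
  define \<theta> where "\<theta> n = i n * (q' n * tp1 Q' R n) + (p n * e n + i n * h n) * tp2 Q' R n" for n
  let ?T = "tw Q' R \<psi>"
  note Q'c = bdd_cx[OF Q'(1)] and Rc = bdd_cx[OF R(1)] and q'm = qi_cm[OF Q'(3)] and em = qi_cm[OF R(2)]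
  note T = tw_dsplit[OF Q'c Rc psi]
  note Td = dsplitD[OF T(1)] and d = dsplitD[OF D]
  have Ob: "cx_ob Q' n \<in> Ob" "cx_ob R n \<in> Ob" for n using cx_Ob Q'c Rc by auto
  have iq: "i n * q' n \<in> H (cx_ob Q' n) (cx_ob E n)" for n by (intro mult_H[OF cm_H[OF q'm] d(6)])
  have pe: "p n * e n + i n * h n \<in> H (cx_ob R n) (cx_ob E n)" for n
    by (intro add_H mult_H[OF cm_H[OF em] d(8)] mult_H[OF h d(6)])
  have t1: "\<theta> n * ti1 Q' R n = i n * q' n" for n
    using mult_one[OF iq] by (simp add: \<theta>_def distrib_right mult.assoc Ob)
  have t2: "\<theta> n * ti2 Q' R n = p n * e n + i n * h n" for n
    using mult_one[OF pe, of n] by (simp add: \<theta>_def distrib_right mult.assoc Ob)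
  have thq: "qi ?T E \<theta>" using th unfolding \<theta>_def .
  have tH: "\<theta> n \<in> H (bp (cx_ob Q' n) (cx_ob R n)) (cx_ob E n)" for n using cm_H[OF qi_cm[OF thq], of n] by (simp add: T(4))
  have ia: "i n = 0" if "n \<le> a" for n using that by (simp add: i_def)
  have pn: "p n = 0" if "n \<noteq> a" for n using that by (simp add: p_def)
  have ea: "e a \<in> H (cx_ob R a) (cx_ob E a)" using cm_H[OF em, of a] by (simp add: stalk_simps)
  have ta2: "\<theta> a * ti2 Q' R a = e a" using t2[of a] ia[of a] one_mult[OF ea] by (simp add: p_def)
  have esur: "\<exists>y \<in> H P (cx_ob R a). x = e a * y" if P: "P \<in> PR" and x: "x \<in> H P (cx_ob E a)" for P x
    using qi_surD[OF R(2) P, of x a] x by (auto simp: stalk_simps)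
  have sur: "\<exists>y \<in> H P (cx_ob ?T n). x = \<theta> n * y" if P: "P \<in> PR" and x: "x \<in> H P (cx_ob E n)" for n P x
  proof -
    consider "n > a" | "n = a" | "n < a" by linarith
    then show ?thesis
    proof cases
      case 1
      then obtain y where y: "y \<in> H P (cx_ob Q' n)" "x = q' n * y" using Q'sur[OF P, of x n] x by (auto simp: E'o)
      have "\<theta> n * (ti1 Q' R n * y) = i n * x" using mult_eq_assoc[OF t1, of n y] y by (simp add: mult.assoc)
      also have "\<dots> = x" using 1 one_mult[OF x] by (simp add: i_def)
      finally show ?thesis using mult_H[OF y(1) Td(6)] by metis
    next
      case 2
      then obtain y where y: "y \<in> H P (cx_ob R n)" "x = e n * y" using esur[OF P] x by auto
      have "\<theta> n * (ti2 Q' R n * y) = x" using mult_eq_assoc[OF ta2, of y] y 2 by simp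
      then show ?thesis using mult_H[OF y(1) Td(8)] by metis
    next
      case 3
      then have "x = 0" using to_zob[OF zl x] by simp
      then show ?thesis using PR_Ob[OF P] cx_Ob[OF Td(2)] by (intro bexI[of _ 0]) auto
    qed
  qed
  \<comment> \<open>A map \<open>\<phi>\<close> has a component on Q' and one on R. The first
    descends by the induction hypothesis; the second can be nonzero in degree a only.\<close>
  have fac: "\<exists>g \<in> H (cx_ob E n) (cx_ob B (n + 1)). \<phi> n = g * \<theta> n" if phi: "anti ?T B \<phi>" for \<phi> n
  proof -
    have pH: "\<phi> n \<in> H (bp (cx_ob Q' n) (cx_ob R n)) (cx_ob B (n + 1))" for n using phi by (simp add: anti_def T(4))
    have pd: "cx_d B (n + 1) * \<phi> n + \<phi> (n + 1) * cx_d ?T n = 0" for n using phi by (simp add: anti_def)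
    have p1H: "\<phi> n * ti1 Q' R n \<in> H (cx_ob Q' n) (cx_ob B (n + 1))" for n by (intro mult_H[OF _ pH] in1_H Ob)
    have p2H: "\<phi> n * ti2 Q' R n \<in> H (cx_ob R n) (cx_ob B (n + 1))" for n by (intro mult_H[OF _ pH] in2_H Ob)
    have "cx_d B (n + 1) * (\<phi> n * ti1 Q' R n) + \<phi> (n + 1) * ti1 Q' R (n + 1) * cx_d Q' n = 0" for n
    proof -
      have "(cx_d B (n + 1) * \<phi> n + \<phi> (n + 1) * cx_d ?T n) * ti1 Q' R n = 0" using pd by simp
      then show ?thesis by (simp add: distrib_right mult.assoc T(2))
    qed
    then have "anti Q' B (\<lambda>n. \<phi> n * ti1 Q' R n)" using p1H by (simp add: anti_def)
    from Q'fac[OF this] have fac1: "\<exists>g \<in> H (cx_ob E' n) (cx_ob B (n + 1)). \<phi> n * ti1 Q' R n = g * q' n" for n .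
    \<comment> \<open>In these degrees the component factors over a term of \<open>E'\<close>, and
      that term is 0.\<close>
    have p1z: "\<phi> n * ti1 Q' R n = 0" if n: "n \<le> a" for n
    proof -
      obtain g where g: "g \<in> H zo (cx_ob B (n + 1))" "\<phi> n * ti1 Q' R n = g * q' n"
        using fac1[of n] n by (auto simp: E'o)
      then show ?thesis using from_zob[OF zob_zo g(1)] by simp
    qed
    \<comment> \<open>The target is in degree n + 1, which is still at most a, and up to this bound
      the terms of R below degree a have no maps to B.\<close>
    have R0z: "\<phi> n * ti2 Q' R n = 0" if n: "n < a" for n
    proof -
      have "\<forall>m \<le> a. H (cx_ob R n) (cx_ob B m) \<subseteq> {0}" using Rlow[OF n] by (simp add: vanishing_def)
      then have "H (cx_ob R n) (cx_ob B (n + 1)) \<subseteq> {0}" using n by simp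
      then show ?thesis using p2H[of n] by blast
    qed
    have gH: "g * \<theta> n \<in> H (bp (cx_ob Q' n) (cx_ob R n)) (cx_ob B (n + 1))"
      if "g \<in> H (cx_ob E n) (cx_ob B (n + 1))" for g n using mult_H[OF tH that] .
    consider "n > a" | "n = a" | "n < a" by linarith
    then show ?thesis
    proof cases
      case 1
      then obtain g where g: "g \<in> H (cx_ob E n) (cx_ob B (n + 1))" "\<phi> n * ti1 Q' R n = g * q' n"
        using fac1[of n] by (auto simp: E'o)
      have "\<phi> n = g * \<theta> n"
      proof (rule bp_eqI[OF pH gH[OF g(1)] Ob])
        have "g * i n = g" using 1 mult_one[OF g(1)] by (simp add: i_def)
        then show "\<phi> n * ti1 Q' R n = g * \<theta> n * ti1 Q' R n"
          using mult_eq_assoc[of g "i n" g "q' n"] by (simp add: mult.assoc t1 g(2))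
        have "g * \<theta> n * ti2 Q' R n \<in> H (cx_ob R n) (cx_ob B (n + 1))" by (intro mult_H[OF _ gH[OF g(1)]] in2_H Ob)
        then show "\<phi> n * ti2 Q' R n = g * \<theta> n * ti2 Q' R n" using from_zob[OF Rhigh[OF 1]] p2H by metis
      qed
      then show ?thesis using g(1) by blast
    next
      case 2
      \<comment> \<open>An element killed by \<open>e a\<close> is a boundary from degree a - 1. As
        \<open>\<phi>\<close> vanishes on R in degree a - 1 and on Q' in degree a, anticommutation
        shows that it kills this boundary. Hence \<open>factor\<close> applies.\<close>
      have kz: "\<phi> a * ti2 Q' R a * x = 0" if P: "P \<in> PR" and x: "x \<in> H P (cx_ob R a)" and ex: "e a * x = 0" for P x
      proof -
        have dx: "cx_d R a * x = 0" using to_zob[OF Rhigh[of "a + 1"] mult_H[OF x cx_H[OF Rc]]] by simp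
        have "e a * x = cx_d (stalk (cx_ob E a) a) (a - 1) * 0" using ex by simp
        moreover have "0 \<in> H P (cx_ob (stalk (cx_ob E a) a) (a - 1))" using PR_Ob[OF P] by (simp add: stalk_simps)
        ultimately obtain x' where x': "x' \<in> H P (cx_ob R (a - 1))" "x = cx_d R (a - 1) * x'"
          using qi_injD[OF R(2) P x dx] by blast
        have m: "a - 1 + 1 = a" by simp
        have "\<phi> a * cx_d ?T (a - 1) * ti2 Q' R (a - 1) = - (cx_d B a * (\<phi> (a - 1) * ti2 Q' R (a - 1)))"
          using pd[of "a - 1"] by (simp add: add_eq_0_iff mult.assoc)
        also have "\<dots> = 0" using R0z[of "a - 1"] by simp
        finally have "\<phi> a * (ti1 Q' R a * \<psi> (a - 1) + ti2 Q' R a * cx_d R (a - 1)) = 0"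
          using T(3)[of "a - 1"] by (simp add: mult.assoc)
        then have "\<phi> a * ti2 Q' R a * cx_d R (a - 1) = - (\<phi> a * ti1 Q' R a * \<psi> (a - 1))"
          by (simp add: distrib_left mult.assoc add_eq_0_iff)
        then have "\<phi> a * ti2 Q' R a * cx_d R (a - 1) = 0" using p1z[of a] by simp
        then have "\<phi> a * ti2 Q' R a * cx_d R (a - 1) * x' = 0" by simp
        then show ?thesis using x'(2) by (simp add: mult.assoc)
      qed
      have "\<exists>g \<in> H (cx_ob E a) (cx_ob B (a + 1)). \<phi> a * ti2 Q' R a = g * e a"
        by (rule factor[OF ea p2H]) (erule (1) esur, erule (2) kz)
      then obtain g where g: "g \<in> H (cx_ob E a) (cx_ob B (a + 1))" "\<phi> a * ti2 Q' R a = g * e a" by blast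
      have "\<phi> a = g * \<theta> a"
      proof (rule bp_eqI[OF pH gH[OF g(1)] Ob])
        show "\<phi> a * ti1 Q' R a = g * \<theta> a * ti1 Q' R a" using p1z[of a] ia[of a] by (simp add: mult.assoc t1)
        show "\<phi> a * ti2 Q' R a = g * \<theta> a * ti2 Q' R a" using g(2) by (simp add: mult.assoc ta2)
      qed
      then show ?thesis using g(1) 2 by blast
    next
      case 3
      have zH: "0 \<in> H (cx_ob E n) (cx_ob B (n + 1))" using cx_Ob[OF Ec] cx_Ob[OF B] by simp
      have "\<phi> n = 0 * \<theta> n"
        using bp_eqI[OF pH gH[OF zH] Ob] p1z[of n] R0z[OF 3] 3 by simp
      then show ?thesis using zH by blast
    qed
  qed
  have "cx_ob ?T n \<in> PR" for n using Q'(2) RPR by (simp add: T(4))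
  then have "good_res B E ?T \<theta>"
    using tw_bdd[OF Q'(1) R(1) psi] thq sur fac unfolding good_res_def by blast
  then show ?case by blast
qed

lemma good_resolution:
  assumes B: "cx B" and E: "bdd E" and obj: "\<And>n. cx_ob E n \<in> resolved_objs PR (vanishing B n)"
  obtains Q q where "good_res B E Q q"
proof -
  obtain a b where ab: "\<And>n. n < a \<or> b < n \<Longrightarrow> zob (cx_ob E n)" using E by (auto simp: bdd_def)
  have "zob (cx_ob E n)" if "n \<ge> a + int (nat (b - a + 1))" for n
    using that by (intro ab) linarith
  then show ?thesis using good_resolution_aux[OF B E, of a "nat (b - a + 1)"] ab obj that by blast
qed

section \<open>Abelian categories with enough projectives\<close>

text \<open>Cohomology in degree n + 1: Z stands for the cocycles, \<open>\<beta>\<close> for the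
  differential into them, K for the cohomology. Using n + 1 as the degree keeps the preceding term
  free of subtraction.\<close>

definition cohom_data where
  "cohom_data X n Z K \<iota> \<beta> \<pi> \<longleftrightarrow> \<iota> \<in> H Z (cx_ob X (n + 1)) \<and> \<beta> \<in> H (cx_ob X n) Z \<and> \<pi> \<in> H Z K \<and>
    cx_d X (n + 1) * \<iota> = 0 \<and> \<iota> * \<beta> = cx_d X n \<and> \<pi> * \<beta> = 0 \<and>
    (\<forall>P \<in> PR. \<forall>z \<in> H P Z. \<iota> * z = 0 \<longrightarrow> z = 0) \<and>
    (\<forall>P \<in> PR. \<forall>x \<in> H P (cx_ob X (n + 1)). cx_d X (n + 1) * x = 0 \<longrightarrow> (\<exists>z \<in> H P Z. x = \<iota> * z)) \<and>
    (\<forall>P \<in> PR. \<forall>c \<in> H P K. \<exists>z \<in> H P Z. c = \<pi> * z) \<and>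
    (\<forall>P \<in> PR. \<forall>z \<in> H P Z. \<pi> * z = 0 \<longrightarrow> (\<exists>y \<in> H P (cx_ob X n). z = \<beta> * y))"

text \<open>A cohomology class lifts to a cocycle, unique up to boundaries, so conditions on
  cocycles translate into conditions on the induced map \<open>\<eta>\<close>. This ties
  \<open>qinj\<close> and \<open>qsur\<close> to cohomology objects.\<close>

lemma cohom_data_qi:
  assumes cX: "cohom_data X n Z K \<iota> \<beta> \<pi>" and cY: "cohom_data Y n Z' K' \<iota>' \<beta>' \<pi>'"
    and f: "cm X Y f" and \<zeta>: "\<zeta> \<in> H Z Z'" "\<iota>' * \<zeta> = f (n + 1) * \<iota>" and \<eta>: "\<eta> \<in> H K K'" "\<eta> * \<pi> = \<pi>' * \<zeta>"
  shows "(\<forall>P \<in> PR. \<forall>x \<in> H P (cx_ob X (n + 1)). \<forall>y \<in> H P (cx_ob Y n). cx_d X (n + 1) * x = 0 \<longrightarrow>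
      f (n + 1) * x = cx_d Y n * y \<longrightarrow> (\<exists>x' \<in> H P (cx_ob X n). x = cx_d X n * x')) \<longleftrightarrow>
      (\<forall>P \<in> PR. \<forall>c \<in> H P K. \<eta> * c = 0 \<longrightarrow> c = 0)" (is "?I \<longleftrightarrow> ?I'")
    and "(\<forall>P \<in> PR. \<forall>y \<in> H P (cx_ob Y (n + 1)). cx_d Y (n + 1) * y = 0 \<longrightarrow>
    (\<exists>x \<in> H P (cx_ob X (n + 1)). \<exists>y' \<in> H P (cx_ob Y n). cx_d X (n + 1) * x = 0 \<and>
      y = f (n + 1) * x + cx_d Y n * y')) \<longleftrightarrow> (\<forall>P \<in> PR. \<forall>c \<in> H P K'. \<exists>b \<in> H P K. c = \<eta> * b)" (is "?S \<longleftrightarrow> ?S'")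
proof -
  have X: "\<iota> \<in> H Z (cx_ob X (n + 1))" "\<beta> \<in> H (cx_ob X n) Z" "\<pi> \<in> H Z K" "cx_d X (n + 1) * \<iota> = 0"
    "\<iota> * \<beta> = cx_d X n" "\<pi> * \<beta> = 0" "\<And>P z. P \<in> PR \<Longrightarrow> z \<in> H P Z \<Longrightarrow> \<iota> * z = 0 \<Longrightarrow> z = 0"
    "\<And>P x. P \<in> PR \<Longrightarrow> x \<in> H P (cx_ob X (n + 1)) \<Longrightarrow> cx_d X (n + 1) * x = 0 \<Longrightarrow> \<exists>z \<in> H P Z. x = \<iota> * z"
    "\<And>P c. P \<in> PR \<Longrightarrow> c \<in> H P K \<Longrightarrow> \<exists>z \<in> H P Z. c = \<pi> * z"
    "\<And>P z. P \<in> PR \<Longrightarrow> z \<in> H P Z \<Longrightarrow> \<pi> * z = 0 \<Longrightarrow> \<exists>y \<in> H P (cx_ob X n). z = \<beta> * y"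
    using cX unfolding cohom_data_def by simp_all
  have Y: "\<iota>' \<in> H Z' (cx_ob Y (n + 1))" "\<beta>' \<in> H (cx_ob Y n) Z'" "\<pi>' \<in> H Z' K'" "cx_d Y (n + 1) * \<iota>' = 0"
    "\<iota>' * \<beta>' = cx_d Y n" "\<pi>' * \<beta>' = 0" "\<And>P z. P \<in> PR \<Longrightarrow> z \<in> H P Z' \<Longrightarrow> \<iota>' * z = 0 \<Longrightarrow> z = 0"
    "\<And>P x. P \<in> PR \<Longrightarrow> x \<in> H P (cx_ob Y (n + 1)) \<Longrightarrow> cx_d Y (n + 1) * x = 0 \<Longrightarrow> \<exists>z \<in> H P Z'. x = \<iota>' * z"
    "\<And>P c. P \<in> PR \<Longrightarrow> c \<in> H P K' \<Longrightarrow> \<exists>z \<in> H P Z'. c = \<pi>' * z"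
    "\<And>P z. P \<in> PR \<Longrightarrow> z \<in> H P Z' \<Longrightarrow> \<pi>' * z = 0 \<Longrightarrow> \<exists>y \<in> H P (cx_ob Y n). z = \<beta>' * y"
    using cY unfolding cohom_data_def by simp_all
  have inj: "a = b" if "P \<in> PR" "a \<in> H P Z" "b \<in> H P Z" "\<iota> * a = \<iota> * b" for P a b
    using X(7)[OF that(1) minus_H[OF that(2,3)]] that(4) by (simp add: right_diff_distrib)
  have inj': "a = b" if "P \<in> PR" "a \<in> H P Z'" "b \<in> H P Z'" "\<iota>' * a = \<iota>' * b" for P a b
    using Y(7)[OF that(1) minus_H[OF that(2,3)]] that(4) by (simp add: right_diff_distrib)
  have ib: "\<iota> * (\<beta> * x) = cx_d X n * x" "\<pi> * (\<beta> * x) = 0" "cx_d X (n + 1) * (\<iota> * x) = 0"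
    "\<iota>' * (\<beta>' * x) = cx_d Y n * x" "\<pi>' * (\<beta>' * x) = 0" "cx_d Y (n + 1) * (\<iota>' * x) = 0"
    "\<iota>' * (\<zeta> * x) = f (n + 1) * (\<iota> * x)" "\<eta> * (\<pi> * x) = \<pi>' * (\<zeta> * x)" for x
    using mult_eq_assoc[OF X(5)] mult_eq_assoc[OF Y(5)] mult_zero_cancel X(4,6) Y(4,6) mult_eq_assoc[OF \<zeta>(2)]
      mult_eq_assoc[OF \<eta>(2)] by (auto simp: mult.assoc)
  show "?I \<longleftrightarrow> ?I'"
  proof
    assume I: ?I
    show ?I'
    proof (intro ballI impI)
      fix P c assume P: "P \<in> PR" and c: "c \<in> H P K" "\<eta> * c = 0"
      obtain z where z: "z \<in> H P Z" "c = \<pi> * z" using X(9)[OF P c(1)] by blast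
      have "\<pi>' * (\<zeta> * z) = 0" using c(2) z(2) ib by simp
      then obtain y where y: "y \<in> H P (cx_ob Y n)" "\<zeta> * z = \<beta>' * y"
        using Y(10)[OF P mult_H[OF z(1) \<zeta>(1)]] by blast
      have "f (n + 1) * (\<iota> * z) = cx_d Y n * y" using ib(7)[of z] ib(4)[of y] y(2) by simp
      then obtain x' where "x' \<in> H P (cx_ob X n)" "\<iota> * z = cx_d X n * x'"
        using I P mult_H[OF z(1) X(1)] y(1) ib(3) by blast
      then have "z = \<beta> * x'" using inj[OF P z(1) mult_H[OF _ X(2)], of x'] ib(1) by simp
      then show "c = 0" using z(2) ib(2) by simp
    qed
  next
    assume I: ?I'
    show ?I
    proof (intro ballI impI)
      fix P x y assume P: "P \<in> PR" and x: "x \<in> H P (cx_ob X (n + 1))" and y: "y \<in> H P (cx_ob Y n)"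
        and dx: "cx_d X (n + 1) * x = 0" and fx: "f (n + 1) * x = cx_d Y n * y"
      obtain z where z: "z \<in> H P Z" "x = \<iota> * z" using X(8)[OF P x dx] by blast
      have "\<zeta> * z = \<beta>' * y"
        using inj'[OF P mult_H[OF z(1) \<zeta>(1)] mult_H[OF y Y(2)]] ib(4,7) fx z(2) by simp
      then have "\<eta> * (\<pi> * z) = 0" using ib(5,8) by simp
      then have "\<pi> * z = 0" using I P mult_H[OF z(1) X(3)] by blast
      then obtain x' where "x' \<in> H P (cx_ob X n)" "z = \<beta> * x'" using X(10)[OF P z(1)] by blast
      then show "\<exists>x' \<in> H P (cx_ob X n). x = cx_d X n * x'" using z(2) ib(1) by blast
    qed
  qed
  show "?S \<longleftrightarrow> ?S'"
  proof
    assume S: ?S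
    show ?S'
    proof (intro ballI)
      fix P c assume P: "P \<in> PR" and c: "c \<in> H P K'"
      obtain w where w: "w \<in> H P Z'" "c = \<pi>' * w" using Y(9)[OF P c(1)] by blast
      obtain x y' where x: "x \<in> H P (cx_ob X (n + 1))" "y' \<in> H P (cx_ob Y n)" "cx_d X (n + 1) * x = 0"
        "\<iota>' * w = f (n + 1) * x + cx_d Y n * y'" using S P mult_H[OF w(1) Y(1)] ib(6) by blast
      obtain z where z: "z \<in> H P Z" "x = \<iota> * z" using X(8)[OF P x(1,3)] by blast
      have "w = \<zeta> * z + \<beta>' * y'"
        by (rule inj'[OF P w(1) add_H[OF mult_H[OF z(1) \<zeta>(1)] mult_H[OF x(2) Y(2)]]])
          (use x(4) z(2) ib in \<open>simp add: distrib_left\<close>)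
      then have "c = \<eta> * (\<pi> * z)" using w(2) ib by (simp add: distrib_left)
      then show "\<exists>b \<in> H P K. c = \<eta> * b" using mult_H[OF z(1) X(3)] by blast
    qed
  next
    assume S: ?S'
    show ?S
    proof (intro ballI impI)
      fix P y assume P: "P \<in> PR" and y: "y \<in> H P (cx_ob Y (n + 1))" "cx_d Y (n + 1) * y = 0"
      obtain w where w: "w \<in> H P Z'" "y = \<iota>' * w" using Y(8)[OF P y] by blast
      obtain b where b: "b \<in> H P K" "\<pi>' * w = \<eta> * b" using S P mult_H[OF w(1) Y(3)] by blast
      obtain z where z: "z \<in> H P Z" "b = \<pi> * z" using X(9)[OF P b(1)] by blast
      have "\<pi>' * (w - \<zeta> * z) = 0" using b(2) z(2) ib by (simp add: right_diff_distrib)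
      then obtain y' where y': "y' \<in> H P (cx_ob Y n)" "w - \<zeta> * z = \<beta>' * y'"
        using Y(10)[OF P minus_H[OF w(1) mult_H[OF z(1) \<zeta>(1)]]] by blast
      have "y = \<iota>' * (\<zeta> * z + \<beta>' * y')" using w(2) y'(2) by (simp add: algebra_simps)
      then have "y = f (n + 1) * (\<iota> * z) + cx_d Y n * y'" using ib by (simp add: distrib_left)
      then show "\<exists>x \<in> H P (cx_ob X (n + 1)). \<exists>y' \<in> H P (cx_ob Y n). cx_d X (n + 1) * x = 0 \<and>
        y = f (n + 1) * x + cx_d Y n * y'" using mult_H[OF z(1) X(1)] y'(1) ib(3) by blast
    qed
  qed
qed

text \<open>By injectivity, \<open>factor\<close> applies to the identity of A and gives a left
  inverse of e. It is a right inverse too, because every generalized element of B has the form e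
  x.\<close>

lemma iso_iff:
  assumes e: "e \<in> H A B"
  shows "(\<exists>g \<in> H B A. g * e = one A \<and> e * g = one B) \<longleftrightarrow>
    (\<forall>P \<in> PR. \<forall>x \<in> H P A. e * x = 0 \<longrightarrow> x = 0) \<and> (\<forall>P \<in> PR. \<forall>y \<in> H P B. \<exists>x \<in> H P A. y = e * x)" (is "?L \<longleftrightarrow> ?R")
proof
  assume ?L
  then obtain g where g: "g \<in> H B A" "g * e = one A" "e * g = one B" by blast
  have "x = 0" if "x \<in> H P A" "e * x = 0" for P x using mult_eq_assoc[OF g(2), of x] that by simp
  moreover have "\<exists>x \<in> H P A. y = e * x" if "y \<in> H P B" for P y
    using mult_eq_assoc[OF g(3), of y] that mult_H[OF that g(1)] by (intro bexI[of _ "g * y"]) auto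
  ultimately show ?R by blast
next
  assume R: ?R
  have o: "A \<in> Ob" "B \<in> Ob" using H_Ob[OF e] by auto
  obtain g where g: "g \<in> H B A" "one A = g * e"
    using factor[OF e one_H[OF o(1)]] R by (metis mult_zero_right)
  have "e * g - one B = 0"
  proof (rule H_eqI)
    show "e * g - one B \<in> H B B" using mult_H[OF g(1) e] one_H[OF o(2)] by blast
    fix P y assume P: "P \<in> PR" and y: "y \<in> H P B"
    obtain x where x: "x \<in> H P A" "y = e * x" using R P y by blast
    have "g * (e * x) = x" using mult_eq_assoc[OF g(2)[symmetric], of x] x(1) by simp
    then show "(e * g - one B) * y = 0" using x y by (simp add: left_diff_distrib mult.assoc)
  qed
  then show ?L using g by auto
qed

end

section \<open>From an abelian category with enough projectives to the ring\<close>

context linear_category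
begin

lemma cokernelD: assumes "is_cokernel C p f"
  shows "p \<in> Hom C (Cod C f) (Cod C p)" "f \<in> Hom C (Dom C f) (Cod C f)" "p \<cdot> f = Zero C (Dom C f) (Cod C p)"
    "g \<in> Hom C (Cod C f) B \<Longrightarrow> g \<cdot> f = Zero C (Dom C f) B \<Longrightarrow> \<exists>!h. h \<in> Hom C (Cod C p) B \<and> h \<cdot> p = g"
proof -
  show "p \<in> Hom C (Cod C f) (Cod C p)" "f \<in> Hom C (Dom C f) (Cod C f)" "p \<cdot> f = Zero C (Dom C f) (Cod C p)"
    using assms unfolding is_cokernel_def by (simp_all add: Hom_def)
  show "g \<in> Hom C (Cod C f) B \<Longrightarrow> g \<cdot> f = Zero C (Dom C f) B \<Longrightarrow> \<exists>!h. h \<in> Hom C (Cod C p) B \<and> h \<cdot> p = g"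
    using assms unfolding is_cokernel_def by blast
qed

lemma kernelD: assumes "is_kernel C i f"
  shows "i \<in> Hom C (Dom C i) (Dom C f)" "f \<in> Hom C (Dom C f) (Cod C f)" "f \<cdot> i = Zero C (Dom C i) (Cod C f)"
    "g \<in> Hom C A (Dom C f) \<Longrightarrow> f \<cdot> g = Zero C A (Cod C f) \<Longrightarrow> \<exists>!h. h \<in> Hom C A (Dom C i) \<and> i \<cdot> h = g"
proof -
  show "i \<in> Hom C (Dom C i) (Dom C f)" "f \<in> Hom C (Dom C f) (Cod C f)" "f \<cdot> i = Zero C (Dom C i) (Cod C f)"
    using assms unfolding is_kernel_def by (simp_all add: Hom_def)
  show "g \<in> Hom C A (Dom C f) \<Longrightarrow> f \<cdot> g = Zero C A (Cod C f) \<Longrightarrow> \<exists>!h. h \<in> Hom C A (Dom C i) \<and> i \<cdot> h = g"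
    using assms unfolding is_kernel_def by blast
qed

end

locale enough_projectives_category = abelian_category C
  for C :: "('o, 'm, 'k::field) lincat" (structure) +
  assumes enough_proj: "X \<in> Obj C \<Longrightarrow> \<exists>P p. projective_obj C P \<and> p \<in> Hom C P X \<and> epic C p"
begin

definition hom :: "'o \<Rightarrow> 'o \<Rightarrow> ('m \<Rightarrow> 'k) op_end set" where "hom A B = rep ` Hom C A B"
definition one :: "'o \<Rightarrow> ('m \<Rightarrow> 'k) op_end" where "one A = rep (Ident C A)"
definition zo :: 'o where "zo = (SOME Z. zero_object C Z)"
definition PR :: "'o set" where "PR = {P. projective_obj C P}"

lemma homI [intro]: "f \<in> Hom C A B \<Longrightarrow> rep f \<in> hom A B" by (simp add: hom_def)

lemma homE: assumes "x \<in> hom A B" obtains f where "f \<in> Hom C A B" "x = rep f" using assms by (auto simp: hom_def)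

lemma rep_0_iff: assumes "f \<in> Hom C A B" shows "rep f = 0 \<longleftrightarrow> f = Zero C A B"
  using rep_inj[OF assms Zero_Hom] rep_Zero Hom_Obj[OF assms] by auto

lemma rep_eq_iff: "f \<in> Hom C A B \<Longrightarrow> g \<in> Hom C A B \<Longrightarrow> rep f = rep g \<longleftrightarrow> f = g"
  using rep_inj by blast

lemma Comp_Zero: "f \<in> Hom C A B \<Longrightarrow> D \<in> Obj C \<Longrightarrow> f \<cdot> Zero C D A = Zero C D B"
  using rep_0_iff[OF Comp_Hom[OF Zero_Hom]] rep_Comp[OF Zero_Hom] rep_Zero Hom_Obj by (metis mult_zero_right)

lemma Zero_Comp: "f \<in> Hom C A B \<Longrightarrow> D \<in> Obj C \<Longrightarrow> Zero C B D \<cdot> f = Zero C A D"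
  using rep_0_iff[OF Comp_Hom[OF _ Zero_Hom]] rep_Comp[OF _ Zero_Hom] rep_Zero Hom_Obj by (metis mult_zero_left)

lemma zero_object_zo: "zero_object C zo"
  unfolding zo_def using someI_ex[OF ex_zero_object] .

lemma zero_object_iff: "zero_object C Z \<longleftrightarrow> Z \<in> Obj C \<and> one Z = 0"
proof
  assume z: "zero_object C Z"
  then have o: "Z \<in> Obj C" by (simp add: zero_object_def)
  then have "Ident C Z = Zero C Z Z" using z Ident_Hom[OF o] Zero_Hom[OF o o] unfolding zero_object_def by blast
  then show "Z \<in> Obj C \<and> one Z = 0" using o rep_Zero by (simp add: one_def)
next
  assume z: "Z \<in> Obj C \<and> one Z = 0"
  then have o: "Z \<in> Obj C" and r: "rep (Ident C Z) = 0" by (auto simp: one_def)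
  have "f = Zero C A Z" if "f \<in> Hom C A Z" for f A
    using rep_0_iff[OF that] rep_Comp[OF that Ident_Hom[OF o]] Ident_Comp[OF that] r by simp
  moreover have "f = Zero C Z A" if "f \<in> Hom C Z A" for f A
    using rep_0_iff[OF that] rep_Comp[OF Ident_Hom[OF o] that] Comp_Ident[OF that] r by simp
  ultimately show "zero_object C Z" unfolding zero_object_def using o Zero_Hom by metis
qed

lemma bip: assumes "A \<in> Obj C" "B \<in> Obj C"
  shows "is_biproduct C A B (bip_ob C A B, bip_in1 C A B, bip_in2 C A B, bip_pr1 C A B, bip_pr2 C A B)"
proof -
  obtain S i1 i2 p1 p2 where e: "bip C A B = (S, i1, i2, p1, p2)" by (cases "bip C A B") auto
  have "is_biproduct C A B (bip C A B)" unfolding bip_def using someI_ex[OF ex_biproduct[OF assms]] .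
  then show ?thesis by (simp add: e bip_ob_def bip_in1_def bip_in2_def bip_pr1_def bip_pr2_def)
qed

lemma bip_Hom: assumes "A \<in> Obj C" "B \<in> Obj C"
  shows "bip_in1 C A B \<in> Hom C A (bip_ob C A B)" "bip_in2 C A B \<in> Hom C B (bip_ob C A B)"
    "bip_pr1 C A B \<in> Hom C (bip_ob C A B) A" "bip_pr2 C A B \<in> Hom C (bip_ob C A B) B" "bip_ob C A B \<in> Obj C"
  using bip[OF assms] Hom_Obj unfolding is_biproduct_def by auto

lemma bip_rep: assumes "A \<in> Obj C" "B \<in> Obj C"
  shows "rep (bip_pr1 C A B) * rep (bip_in1 C A B) = one A" "rep (bip_pr2 C A B) * rep (bip_in2 C A B) = one B"
    "rep (bip_pr2 C A B) * rep (bip_in1 C A B) = 0" "rep (bip_pr1 C A B) * rep (bip_in2 C A B) = 0"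
    "rep (bip_in1 C A B) * rep (bip_pr1 C A B) + rep (bip_in2 C A B) * rep (bip_pr2 C A B) = one (bip_ob C A B)"
proof -
  note h = bip_Hom[OF assms]
  have b: "bip_pr1 C A B \<cdot> bip_in1 C A B = Ident C A" "bip_pr2 C A B \<cdot> bip_in2 C A B = Ident C B"
    "bip_pr2 C A B \<cdot> bip_in1 C A B = Zero C A B" "bip_pr1 C A B \<cdot> bip_in2 C A B = Zero C B A"
    "(bip_in1 C A B \<cdot> bip_pr1 C A B) \<oplus> (bip_in2 C A B \<cdot> bip_pr2 C A B) = Ident C (bip_ob C A B)"
    using bip[OF assms] unfolding is_biproduct_def by auto
  show "rep (bip_pr1 C A B) * rep (bip_in1 C A B) = one A" "rep (bip_pr2 C A B) * rep (bip_in2 C A B) = one B"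
    "rep (bip_pr2 C A B) * rep (bip_in1 C A B) = 0" "rep (bip_pr1 C A B) * rep (bip_in2 C A B) = 0"
    using b rep_Comp[OF h(1) h(3)] rep_Comp[OF h(2) h(4)] rep_Comp[OF h(1) h(4)] rep_Comp[OF h(2) h(3)] rep_Zero assms
    by (auto simp: one_def)
  show "rep (bip_in1 C A B) * rep (bip_pr1 C A B) + rep (bip_in2 C A B) * rep (bip_pr2 C A B) = one (bip_ob C A B)"
    using b(5) rep_Add[OF Comp_Hom[OF h(3) h(1)] Comp_Hom[OF h(4) h(2)]] rep_Comp[OF h(3) h(1)] rep_Comp[OF h(4) h(2)]
    by (simp add: one_def)
qed

lemma epicI: assumes f: "f \<in> Hom C A B"
  and u: "\<And>D g h. g \<in> Hom C B D \<Longrightarrow> h \<in> Hom C B D \<Longrightarrow> g \<cdot> f = h \<cdot> f \<Longrightarrow> g = h" shows "epic C f"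
  using HomD[OF f] u unfolding epic_def by auto

lemma epicD: "epic C f \<Longrightarrow> f \<in> Hom C A B \<Longrightarrow> g \<in> Hom C B D \<Longrightarrow> h \<in> Hom C B D \<Longrightarrow> g \<cdot> f = h \<cdot> f \<Longrightarrow> g = h"
  unfolding epic_def by (auto dest: HomD)

lemma projD: "projective_obj C P \<Longrightarrow> epic C g \<Longrightarrow> g \<in> Hom C A B \<Longrightarrow> f \<in> Hom C P B \<Longrightarrow> \<exists>h \<in> Hom C P A. g \<cdot> h = f"
  unfolding projective_obj_def by (auto dest: HomD)

lemma projective_bip: assumes P: "projective_obj C P" and Q: "projective_obj C Q"
  shows "projective_obj C (bip_ob C P Q)"
proof -
  have o: "P \<in> Obj C" "Q \<in> Obj C" using P Q by (auto simp: projective_obj_def)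
  note h = bip_Hom[OF o] and r = bip_rep[OF o]
  have "\<exists>k \<in> Hom C (bip_ob C P Q) (Dom C g). g \<cdot> k = f" if g: "epic C g" and f: "f \<in> Hom C (bip_ob C P Q) (Cod C g)" for g f
  proof -
    have gH: "g \<in> Hom C (Dom C g) (Cod C g)" using g by (auto simp: epic_def intro: Arr_Hom)
    obtain k1 where k1: "k1 \<in> Hom C P (Dom C g)" "g \<cdot> k1 = f \<cdot> bip_in1 C P Q" using projD[OF P g gH Comp_Hom[OF h(1) f]] by blast
    obtain k2 where k2: "k2 \<in> Hom C Q (Dom C g)" "g \<cdot> k2 = f \<cdot> bip_in2 C P Q" using projD[OF Q g gH Comp_Hom[OF h(2) f]] by blast
    let ?k = "k1 \<cdot> bip_pr1 C P Q \<oplus> k2 \<cdot> bip_pr2 C P Q"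
    note kk = Comp_Hom[OF h(3) k1(1)] Comp_Hom[OF h(4) k2(1)]
    have kH: "?k \<in> Hom C (bip_ob C P Q) (Dom C g)" using Add_Hom[OF kk] .
    have "rep f = rep f * (rep (bip_in1 C P Q) * rep (bip_pr1 C P Q) + rep (bip_in2 C P Q) * rep (bip_pr2 C P Q))"
      unfolding r(5) one_def using rep_Comp[OF Ident_Hom[OF h(5)] f] Comp_Ident[OF f] by simp
    moreover have "rep g * rep k1 = rep f * rep (bip_in1 C P Q)" "rep g * rep k2 = rep f * rep (bip_in2 C P Q)"
      using rep_Comp[OF k1(1) gH] rep_Comp[OF k2(1) gH] k1(2) k2(2) rep_Comp[OF h(1) f] rep_Comp[OF h(2) f] by simp_all
    ultimately have "rep (g \<cdot> ?k) = rep f"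
      using rep_Comp[OF kH gH] rep_Add[OF kk] rep_Comp[OF h(3) k1(1)] rep_Comp[OF h(4) k2(1)]
      by (simp add: distrib_left flip: mult.assoc)
    then show ?thesis using kH rep_inj[OF Comp_Hom[OF kH gH] f] by blast
  qed
  then show ?thesis using h(5) by (simp add: projective_obj_def)
qed

lemma hom_ring: "hom_ring hom (Obj C) PR one zo (bip_ob C) (\<lambda>A B. rep (bip_in1 C A B)) (\<lambda>A B. rep (bip_in2 C A B))
    (\<lambda>A B. rep (bip_pr1 C A B)) (\<lambda>A B. rep (bip_pr2 C A B))"
proof
  fix A B D x y
  show "A \<in> Obj C \<and> B \<in> Obj C" if "x \<in> hom A B" using that Hom_Obj by (elim homE) auto
  show "0 \<in> hom A B" if "A \<in> Obj C" "B \<in> Obj C" using homI[OF Zero_Hom[OF that]] rep_Zero[OF that] by simp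
  show "x + y \<in> hom A B" if xy: "x \<in> hom A B" "y \<in> hom A B"
  proof -
    obtain f where f: "f \<in> Hom C A B" "x = rep f" using xy(1) by (rule homE)
    obtain g where g: "g \<in> Hom C A B" "y = rep g" using xy(2) by (rule homE)
    show ?thesis using homI[OF Add_Hom[OF f(1) g(1)]] rep_Add[OF f(1) g(1)] f(2) g(2) by simp
  qed
  show "- x \<in> hom A B" if x: "x \<in> hom A B"
  proof -
    obtain f where f: "f \<in> Hom C A B" "x = rep f" using x by (rule homE)
    show ?thesis using homI[OF Scale_Hom[OF f(1)], of "-1"] rep_neg[OF f(1)] f(2) by simp
  qed
  show "y * x \<in> hom A D" if xy: "x \<in> hom A B" "y \<in> hom B D"
  proof -
    obtain f where f: "f \<in> Hom C A B" "x = rep f" using xy(1) by (rule homE)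
    obtain g where g: "g \<in> Hom C B D" "y = rep g" using xy(2) by (rule homE)
    show ?thesis using homI[OF Comp_Hom[OF f(1) g(1)]] rep_Comp[OF f(1) g(1)] f(2) g(2) by simp
  qed
  show "one A \<in> hom A A" if "A \<in> Obj C" using homI[OF Ident_Hom[OF that]] by (simp add: one_def)
  show "x * one A = x" if x: "x \<in> hom A B"
  proof -
    obtain f where f: "f \<in> Hom C A B" "x = rep f" using x by (rule homE)
    then have "A \<in> Obj C" using Hom_Obj by blast
    then show ?thesis using rep_Comp[OF Ident_Hom f(1)] Comp_Ident[OF f(1)] f(2) by (simp add: one_def)
  qed
  show "one B * x = x" if x: "x \<in> hom A B"
  proof -
    obtain f where f: "f \<in> Hom C A B" "x = rep f" using x by (rule homE)
    then have "B \<in> Obj C" using Hom_Obj by blast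
    then show ?thesis using rep_Comp[OF f(1) Ident_Hom] Ident_Comp[OF f(1)] f(2) by (simp add: one_def)
  qed
next
  fix A B assume o: "A \<in> Obj C" "B \<in> Obj C"
  note h = bip_Hom[OF o] and r = bip_rep[OF o]
  show "bip_ob C A B \<in> Obj C" by (rule h)
  show "rep (bip_in1 C A B) \<in> hom A (bip_ob C A B)" "rep (bip_in2 C A B) \<in> hom B (bip_ob C A B)"
    "rep (bip_pr1 C A B) \<in> hom (bip_ob C A B) A" "rep (bip_pr2 C A B) \<in> hom (bip_ob C A B) B"
    using h by auto
  show "rep (bip_pr1 C A B) * rep (bip_in1 C A B) = one A" "rep (bip_pr2 C A B) * rep (bip_in2 C A B) = one B"
    "rep (bip_pr2 C A B) * rep (bip_in1 C A B) = 0" "rep (bip_pr1 C A B) * rep (bip_in2 C A B) = 0"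
    "rep (bip_in1 C A B) * rep (bip_pr1 C A B) + rep (bip_in2 C A B) * rep (bip_pr2 C A B) = one (bip_ob C A B)"
    by (rule r)+
next
  show "P \<in> PR \<Longrightarrow> P \<in> Obj C" for P by (simp add: PR_def projective_obj_def)
  show "P \<in> PR \<Longrightarrow> Q \<in> PR \<Longrightarrow> bip_ob C P Q \<in> PR" for P Q by (simp add: PR_def projective_bip)
  have z: "zo \<in> Obj C" "one zo = 0" using zero_object_zo zero_object_iff by auto
  then show "one zo = 0" by simp
  have "\<exists>h \<in> Hom C zo (Dom C g). g \<cdot> h = f" if g: "epic C g" and f: "f \<in> Hom C zo (Cod C g)" for g f
  proof -
    have gH: "g \<in> Hom C (Dom C g) (Cod C g)" using g by (auto simp: epic_def intro: Arr_Hom)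
    have "g \<cdot> Zero C zo (Dom C g) = Zero C zo (Cod C g)" using Comp_Zero[OF gH z(1)] .
    moreover have "f = Zero C zo (Cod C g)"
      using zero_object_zo f Zero_Hom[OF z(1)] Hom_Obj[OF gH] unfolding zero_object_def by metis
    ultimately show ?thesis using Zero_Hom[OF z(1)] Hom_Obj[OF gH] by metis
  qed
  then show "zo \<in> PR" using z by (simp add: PR_def projective_obj_def)
next
  \<comment> \<open>A single generalized element suffices: an epimorphism from a projective onto
    A.\<close>
  have eqI: "f = Zero C A B" if f: "f \<in> Hom C A B" and t: "\<And>P x. P \<in> PR \<Longrightarrow> x \<in> hom P A \<Longrightarrow> rep f * x = 0" for f A B
  proof -
    obtain P p where p: "projective_obj C P" "p \<in> Hom C P A" "epic C p" using enough_proj Hom_Obj[OF f] by blast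
    have "rep f * rep p = 0" using t p by (auto simp: PR_def)
    then have "f \<cdot> p = Zero C P B" using rep_Comp[OF p(2) f] rep_0_iff[OF Comp_Hom[OF p(2) f]] by simp
    also have "\<dots> = Zero C A B \<cdot> p" using Zero_Comp[OF p(2)] Hom_Obj[OF f] by simp
    finally show ?thesis using epicD[OF p(3,2) f] Zero_Hom Hom_Obj[OF f] by blast
  qed
  show "u = 0" if u: "u \<in> hom A B" and ux: "\<And>P x. P \<in> PR \<Longrightarrow> x \<in> hom P A \<Longrightarrow> u * x = 0" for u A B
  proof -
    obtain f where f: "f \<in> Hom C A B" "u = rep f" using u by (rule homE)
    then show ?thesis using eqI[OF f(1)] ux rep_0_iff[OF f(1)] by simp
  qed
  show "\<exists>g \<in> hom E B. f = g * e" if e: "e \<in> hom A E" and f: "f \<in> hom A B"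
    and sur: "\<And>P x. P \<in> PR \<Longrightarrow> x \<in> hom P E \<Longrightarrow> \<exists>y \<in> hom P A. x = e * y"
    and ker: "\<And>P x. P \<in> PR \<Longrightarrow> x \<in> hom P A \<Longrightarrow> e * x = 0 \<Longrightarrow> f * x = 0" for e f A E B
  proof -
    obtain \<epsilon> where ep: "\<epsilon> \<in> Hom C A E" "e = rep \<epsilon>" using e by (rule homE)
    obtain \<phi> where ph: "\<phi> \<in> Hom C A B" "f = rep \<phi>" using f by (rule homE)
    \<comment> \<open>Surjectivity on generalized elements lifts an epimorphism from a projective
      onto E through \<open>\<epsilon>\<close>. So \<open>\<epsilon>\<close> is epic, and in an
      abelian category it is a cokernel.\<close>
    have "epic C \<epsilon>"
    proof (rule epicI[OF ep(1)])
      fix D g h assume g: "g \<in> Hom C E D" and h: "h \<in> Hom C E D" and e: "g \<cdot> \<epsilon> = h \<cdot> \<epsilon>"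
      obtain P p where p: "projective_obj C P" "p \<in> Hom C P E" "epic C p" using enough_proj Hom_Obj[OF g] by blast
      obtain y where y: "y \<in> Hom C P A" "rep p = rep \<epsilon> * rep y"
        using sur[of P "rep p"] p ep by (auto simp: PR_def elim: homE)
      then have "p = \<epsilon> \<cdot> y" using rep_inj[OF p(2) Comp_Hom[OF y(1) ep(1)]] rep_Comp[OF y(1) ep(1)] by simp
      then have "g \<cdot> p = h \<cdot> p" using Comp_assoc[OF y(1) ep(1) g] Comp_assoc[OF y(1) ep(1) h] e by simp
      then show "g = h" using epicD[OF p(3,2) g h] by blast
    qed
    then obtain k where k: "is_cokernel C \<epsilon> k" using epic_cokernel by blast
    note c = cokernelD[OF k]
    have dc: "Cod C k = A" "Cod C \<epsilon> = E" using HomD[OF c(1)] HomD[OF ep(1)] by simp_all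
    have kH: "k \<in> Hom C (Dom C k) A" and ek: "\<epsilon> \<cdot> k = Zero C (Dom C k) E" using c(2,3) dc by simp_all
    have univ: "\<exists>!h. h \<in> Hom C E B \<and> h \<cdot> \<epsilon> = g" if "g \<in> Hom C A B" "g \<cdot> k = Zero C (Dom C k) B" for B g
      using c(4)[of g B] that dc by simp
    have "\<phi> \<cdot> k = Zero C (Dom C k) B"
    proof (rule eqI[OF Comp_Hom[OF kH ph(1)]])
      fix P x assume P: "P \<in> PR" and x: "x \<in> hom P (Dom C k)"
      obtain \<xi> where xi: "\<xi> \<in> Hom C P (Dom C k)" "x = rep \<xi>" using x by (rule homE)
      have kx: "k \<cdot> \<xi> \<in> Hom C P A" using Comp_Hom[OF xi(1) kH] .
      have "rep \<epsilon> * rep k = 0" using rep_Comp[OF kH ep(1)] ek rep_Zero Hom_Obj[OF kH] Hom_Obj[OF ep(1)] by simp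
      then have "e * rep (k \<cdot> \<xi>) = 0" using rep_Comp[OF xi(1) kH] ep(2) by (simp flip: mult.assoc)
      then have "f * rep (k \<cdot> \<xi>) = 0" using ker[OF P] kx by blast
      then show "rep (\<phi> \<cdot> k) * x = 0" using rep_Comp[OF xi(1) kH] rep_Comp[OF kH ph(1)] ph(2) xi(2) by (simp add: mult.assoc)
    qed
    then obtain h where "h \<in> Hom C E B" "h \<cdot> \<epsilon> = \<phi>" using univ[OF ph(1)] by blast
    then show ?thesis using rep_Comp[OF ep(1)] ep ph by blast
  qed
qed

sublocale HR: hom_ring hom "Obj C" PR one zo "bip_ob C" "\<lambda>A B. rep (bip_in1 C A B)" "\<lambda>A B. rep (bip_in2 C A B)"
    "\<lambda>A B. rep (bip_pr1 C A B)" "\<lambda>A B. rep (bip_pr2 C A B)"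
  by (rule hom_ring)

text \<open>Source and target are arguments because \<open>rep\<close> is injective only on a fixed
  Hom space.\<close>

definition unrep :: "'o \<Rightarrow> 'o \<Rightarrow> ('m \<Rightarrow> 'k) op_end \<Rightarrow> 'm" where
  "unrep A B u = (SOME f. f \<in> Hom C A B \<and> rep f = u)"

lemma unrep: assumes "u \<in> hom A B" shows "unrep A B u \<in> Hom C A B" "rep (unrep A B u) = u"
proof -
  have "\<exists>f. f \<in> Hom C A B \<and> rep f = u" using assms by (auto elim: homE)
  from someI_ex[OF this] show "unrep A B u \<in> Hom C A B" "rep (unrep A B u) = u"
    unfolding unrep_def by auto
qed

section \<open>Transport of complexes, chain maps, homotopies and exactness\<close>

definition hx :: "('o, 'm) cochain \<Rightarrow> ('o, ('m \<Rightarrow> 'k) op_end) cochain" where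
  "hx X = \<lparr>cx_ob = cx_ob X, cx_d = (\<lambda>n. rep (cx_d X n))\<rparr>"

lemma hx_simps [simp]: "cx_ob (hx X) = cx_ob X" "cx_d (hx X) n = rep (cx_d X n)"
  by (simp_all add: hx_def)

lemma zob_iff: "HR.zob A \<longleftrightarrow> zero_object C A"
  by (simp add: HR.zob_def zero_object_iff)

lemma bounded_cxD: assumes "bounded_cx C X"
  shows "cx_d X n \<in> Hom C (cx_ob X n) (cx_ob X (n + 1))"
    "cx_d X (n + 1) \<cdot> cx_d X n = Zero C (cx_ob X n) (cx_ob X (n + 1 + 1))"
    "cx_ob X n \<in> Obj C"
proof -
  show 1: "cx_d X n \<in> Hom C (cx_ob X n) (cx_ob X (n + 1))" using assms by (simp add: bounded_cx_def)
  show "cx_ob X n \<in> Obj C" using Hom_Obj[OF 1] by simp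
  show "cx_d X (n + 1) \<cdot> cx_d X n = Zero C (cx_ob X n) (cx_ob X (n + 1 + 1))"
    using assms by (simp add: bounded_cx_def add.assoc)
qed

lemma bounded_cx_iff:
  assumes d: "\<And>n. cx_d X n \<in> Hom C (cx_ob X n) (cx_ob X (n + 1))"
  shows "bounded_cx C X \<longleftrightarrow> HR.bdd (hx X)"
proof -
  have "cx_d X (n + 1) \<cdot> cx_d X n = Zero C (cx_ob X n) (cx_ob X (n + 2)) \<longleftrightarrow> rep (cx_d X (n + 1)) * rep (cx_d X n) = 0" for n
    using rep_0_iff[OF Comp_Hom[OF d[of n] d[of "n + 1"]]] rep_Comp[OF d[of n] d[of "n + 1"]] by (simp add: add.assoc)
  then show ?thesis using d unfolding bounded_cx_def HR.bdd_def HR.cx_def by (auto simp: zob_iff)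
qed

lemma bounded_bdd: "bounded_cx C X \<Longrightarrow> HR.bdd (hx X)"
  using bounded_cx_iff bounded_cxD(1) by blast

lemma bounded_hx: "bounded_cx C X \<Longrightarrow> HR.cx (hx X)"
  using HR.bdd_cx bounded_bdd by blast

lemma bdd_bounded: assumes "HR.bdd K" obtains X where "bounded_cx C X" "hx X = K"
proof -
  define X where "X = \<lparr>cx_ob = cx_ob K, cx_d = (\<lambda>n. unrep (cx_ob K n) (cx_ob K (n + 1)) (cx_d K n))\<rparr>"
  note u = unrep[OF HR.cx_H[OF HR.bdd_cx[OF assms]]]
  have "hx X = K" using u(2) by (simp add: hx_def X_def)
  moreover have "bounded_cx C X"
    using bounded_cx_iff[of X] u(1) assms \<open>hx X = K\<close> by (simp add: X_def)
  ultimately show ?thesis using that by blast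
qed

lemma chain_mapD: assumes "chain_map C X Y f"
  shows "f n \<in> Hom C (cx_ob X n) (cx_ob Y n)" "f (n + 1) \<cdot> cx_d X n = cx_d Y n \<cdot> f n"
  using assms by (auto simp: chain_map_def)

lemma chain_map_iff:
  assumes X: "bounded_cx C X" and Y: "bounded_cx C Y" and f: "\<And>n. f n \<in> Hom C (cx_ob X n) (cx_ob Y n)"
  shows "chain_map C X Y f \<longleftrightarrow> HR.cm (hx X) (hx Y) (\<lambda>n. rep (f n))"
proof -
  have "f (n + 1) \<cdot> cx_d X n = cx_d Y n \<cdot> f n \<longleftrightarrow> rep (f (n + 1)) * rep (cx_d X n) = rep (cx_d Y n) * rep (f n)" for n
    using rep_eq_iff[OF Comp_Hom[OF bounded_cxD(1)[OF X] f] Comp_Hom[OF f bounded_cxD(1)[OF Y]], of n]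
      rep_Comp[OF bounded_cxD(1)[OF X] f, of n] rep_Comp[OF f bounded_cxD(1)[OF Y], of n] by simp
  then show ?thesis using f by (auto simp: chain_map_def HR.cm_def)
qed

lemma chain_map_cm: "bounded_cx C X \<Longrightarrow> bounded_cx C Y \<Longrightarrow> chain_map C X Y f \<Longrightarrow> HR.cm (hx X) (hx Y) (\<lambda>n. rep (f n))"
  using chain_map_iff chain_mapD(1) by blast

lemma cm_chain_map:
  assumes X: "bounded_cx C X" and Y: "bounded_cx C Y" and f: "HR.cm (hx X) (hx Y) f"
  obtains g where "chain_map C X Y g" "\<And>n. rep (g n) = f n"
proof -
  have u: "f n \<in> hom (cx_ob X n) (cx_ob Y n)" for n using HR.cm_H[OF f] by simp
  define g where "g n = unrep (cx_ob X n) (cx_ob Y n) (f n)" for n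
  have g: "g n \<in> Hom C (cx_ob X n) (cx_ob Y n)" "rep (g n) = f n" for n using unrep[OF u] by (auto simp: g_def)
  then show ?thesis using that[of g] chain_map_iff[OF X Y g(1)] f by simp
qed

lemma homotopic_iff:
  assumes X: "bounded_cx C X" and Y: "bounded_cx C Y"
    and f: "\<And>n. f n \<in> Hom C (cx_ob X n) (cx_ob Y n)" and g: "\<And>n. g n \<in> Hom C (cx_ob X n) (cx_ob Y n)"
  shows "homotopic C X Y f g \<longleftrightarrow> HR.htp (hx X) (hx Y) (\<lambda>n. rep (f n)) (\<lambda>n. rep (g n))"
proof -
  have eq: "f n = g n \<oplus> ((cx_d Y (n - 1) \<cdot> h n) \<oplus> (h (n + 1) \<cdot> cx_d X n)) \<longleftrightarrow>
    rep (f n) = rep (g n) + (rep (cx_d Y (n - 1)) * rep (h n) + rep (h (n + 1)) * rep (cx_d X n))"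
    if h: "\<And>n. h n \<in> Hom C (cx_ob X n) (cx_ob Y (n - 1))" for h n
  proof -
    have dY: "cx_d Y (n - 1) \<in> Hom C (cx_ob Y (n - 1)) (cx_ob Y n)" using bounded_cxD(1)[OF Y, of "n - 1"] by simp
    have h1: "h (n + 1) \<in> Hom C (cx_ob X (n + 1)) (cx_ob Y n)" using h[of "n + 1"] by simp
    note dX = bounded_cxD(1)[OF X, of n]
    note a = Comp_Hom[OF h dY] and b = Comp_Hom[OF dX h1]
    show ?thesis using rep_eq_iff[OF f[of n] Add_Hom[OF g Add_Hom[OF a b]]] rep_Add[OF g Add_Hom[OF a b]]
      rep_Add[OF a b] rep_Comp[OF h dY] rep_Comp[OF dX h1] by simp
  qed
  show ?thesis
  proof
    assume "homotopic C X Y f g"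
    then obtain h where h: "\<And>n. h n \<in> Hom C (cx_ob X n) (cx_ob Y (n - 1))"
      "\<And>n. f n = g n \<oplus> ((cx_d Y (n - 1) \<cdot> h n) \<oplus> (h (n + 1) \<cdot> cx_d X n))" by (auto simp: homotopic_def)
    have "rep (h n) \<in> hom (cx_ob X n) (cx_ob Y (n - 1))" for n using h(1) by blast
    then show "HR.htp (hx X) (hx Y) (\<lambda>n. rep (f n)) (\<lambda>n. rep (g n))"
      using eq[OF h(1)] h(2) unfolding HR.htp_def by (intro exI[of _ "\<lambda>n. rep (h n)"]) simp
  next
    assume "HR.htp (hx X) (hx Y) (\<lambda>n. rep (f n)) (\<lambda>n. rep (g n))"
    then obtain k where k: "\<And>n. k n \<in> hom (cx_ob X n) (cx_ob Y (n - 1))"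
      "\<And>n. rep (f n) = rep (g n) + (rep (cx_d Y (n - 1)) * k n + k (n + 1) * rep (cx_d X n))"
      by (auto simp: HR.htp_def)
    define h where "h n = unrep (cx_ob X n) (cx_ob Y (n - 1)) (k n)" for n
    have h: "h n \<in> Hom C (cx_ob X n) (cx_ob Y (n - 1))" "rep (h n) = k n" for n using unrep[OF k(1)] by (auto simp: h_def)
    show "homotopic C X Y f g" unfolding homotopic_def
      using eq[OF h(1)] h k(2) by (intro exI[of _ h]) simp
  qed
qed

lemma kernel_rep: assumes k: "is_kernel C i f"
  shows "rep f * rep i = 0"
    and "x \<in> hom A (Dom C f) \<Longrightarrow> rep f * x = 0 \<Longrightarrow> \<exists>z \<in> hom A (Dom C i). x = rep i * z"
    and "z \<in> hom A (Dom C i) \<Longrightarrow> rep i * z = 0 \<Longrightarrow> z = 0"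
proof -
  note d = kernelD[OF k]
  show "rep f * rep i = 0" using rep_Comp[OF d(1,2)] d(3) rep_Zero Hom_Obj[OF d(1)] Hom_Obj[OF d(2)] by simp
  show "\<exists>z \<in> hom A (Dom C i). x = rep i * z" if x: "x \<in> hom A (Dom C f)" and fx: "rep f * x = 0"
  proof -
    obtain g where g: "g \<in> Hom C A (Dom C f)" "x = rep g" using x by (rule homE)
    have "f \<cdot> g = Zero C A (Cod C f)" using rep_0_iff[OF Comp_Hom[OF g(1) d(2)]] rep_Comp[OF g(1) d(2)] fx g(2) by simp
    then obtain h where "h \<in> Hom C A (Dom C i)" "i \<cdot> h = g" using d(4)[OF g(1)] by blast
    then show ?thesis using rep_Comp[OF _ d(1), of h] g(2) by blast
  qed
  show "z = 0" if z: "z \<in> hom A (Dom C i)" and iz: "rep i * z = 0"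
  proof -
    obtain h where h: "h \<in> Hom C A (Dom C i)" "z = rep h" using z by (rule homE)
    have o: "A \<in> Obj C" "Dom C i \<in> Obj C" "Dom C f \<in> Obj C" "Cod C f \<in> Obj C"
      using Hom_Obj[OF h(1)] Hom_Obj[OF d(2)] by auto
    have "i \<cdot> h = Zero C A (Dom C f)" using rep_0_iff[OF Comp_Hom[OF h(1) d(1)]] rep_Comp[OF h(1) d(1)] iz h(2) by simp
    moreover have "i \<cdot> Zero C A (Dom C i) = Zero C A (Dom C f)" using Comp_Zero[OF d(1) o(1)] .
    moreover have "f \<cdot> Zero C A (Dom C f) = Zero C A (Cod C f)" using Comp_Zero[OF d(2) o(1)] .
    ultimately have "h = Zero C A (Dom C i)"
      using d(4)[OF Zero_Hom[OF o(1,3)]] h(1) Zero_Hom[OF o(1,2)] by blast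
    then show ?thesis using h(2) rep_Zero o by simp
  qed
qed

lemma epic_iff: assumes p: "p \<in> Hom C A B"
  shows "epic C p \<longleftrightarrow> (\<forall>P \<in> PR. \<forall>x \<in> hom P B. \<exists>y \<in> hom P A. x = rep p * y)"
proof
  assume e: "epic C p"
  show "\<forall>P \<in> PR. \<forall>x \<in> hom P B. \<exists>y \<in> hom P A. x = rep p * y"
  proof (intro ballI)
    fix P x assume P: "P \<in> PR" and x: "x \<in> hom P B"
    obtain g where g: "g \<in> Hom C P B" "x = rep g" using x by (rule homE)
    obtain h where "h \<in> Hom C P A" "p \<cdot> h = g" using projD[OF _ e p g(1)] P by (auto simp: PR_def)
    then show "\<exists>y \<in> hom P A. x = rep p * y" using g(2) rep_Comp[OF _ p] by blast
  qed
next
  assume s: "\<forall>P \<in> PR. \<forall>x \<in> hom P B. \<exists>y \<in> hom P A. x = rep p * y"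
  show "epic C p"
  proof (rule epicI[OF p])
    fix D g h assume g: "g \<in> Hom C B D" and h: "h \<in> Hom C B D" and e: "g \<cdot> p = h \<cdot> p"
    have gh: "rep g * rep p = rep h * rep p" using rep_Comp[OF p g] rep_Comp[OF p h] e by simp
    have "rep g - rep h = 0"
    proof (rule HR.H_eqI)
      show "rep g - rep h \<in> hom B D" using HR.minus_H g h by blast
      fix P x assume "P \<in> PR" "x \<in> hom P B"
      then obtain y where "x = rep p * y" using s by blast
      then show "(rep g - rep h) * x = 0" using gh by (simp add: left_diff_distrib flip: mult.assoc)
    qed
    then show "g = h" using rep_inj[OF g h] by simp
  qed
qed

lemma monicI: assumes f: "f \<in> Hom C A B" and u: "\<And>D x. x \<in> hom D A \<Longrightarrow> rep f * x = 0 \<Longrightarrow> x = 0" shows "monic C f"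
proof -
  have "g = h" if g: "g \<in> Hom C D A" and h: "h \<in> Hom C D A" and e: "f \<cdot> g = f \<cdot> h" for D g h
  proof -
    have "rep f * (rep g - rep h) = 0" using rep_Comp[OF g f] rep_Comp[OF h f] e by (simp add: right_diff_distrib)
    moreover have "rep g - rep h \<in> hom D A" using HR.minus_H g h by blast
    ultimately have "rep g - rep h = 0" using u by blast
    then show "g = h" using rep_inj[OF g h] by simp
  qed
  then show ?thesis using HomD[OF f] by (auto simp: monic_def)
qed

lemma cokernel_rep: assumes c: "is_cokernel C p f"
  shows "rep p * rep f = 0"
    and "g \<in> hom (Cod C f) B \<Longrightarrow> g * rep f = 0 \<Longrightarrow> \<exists>h \<in> hom (Cod C p) B. g = h * rep p"
    and "epic C p"
proof -
  note d = cokernelD[OF c]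
  show "rep p * rep f = 0" using rep_Comp[OF d(2,1)] d(3) rep_Zero Hom_Obj[OF d(1)] Hom_Obj[OF d(2)] by simp
  show "\<exists>h \<in> hom (Cod C p) B. g = h * rep p" if g: "g \<in> hom (Cod C f) B" and gf: "g * rep f = 0"
  proof -
    obtain k where k: "k \<in> Hom C (Cod C f) B" "g = rep k" using g by (rule homE)
    have "k \<cdot> f = Zero C (Dom C f) B" using rep_0_iff[OF Comp_Hom[OF d(2) k(1)]] rep_Comp[OF d(2) k(1)] gf k(2) by simp
    then obtain h where "h \<in> Hom C (Cod C p) B" "h \<cdot> p = k" using d(4)[OF k(1)] by blast
    then show ?thesis using rep_Comp[OF d(1), of h] k(2) by blast
  qed
  show "epic C p"
  proof (rule epicI[OF d(1)])
    fix D g h assume g: "g \<in> Hom C (Cod C p) D" and h: "h \<in> Hom C (Cod C p) D" and e: "g \<cdot> p = h \<cdot> p"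
    have "(g \<cdot> p) \<cdot> f = Zero C (Dom C f) D"
      using Comp_assoc[OF d(2,1) g] d(3) Comp_Zero[OF g] Hom_Obj[OF d(2)] by simp
    then show "g = h" using d(4)[OF Comp_Hom[OF d(1) g]] g h e by metis
  qed
qed

text \<open>In an abelian category f factors through the kernel of its cokernel by an epimorphism.\<close>

lemma cokernel_exact: assumes c: "is_cokernel C p f" and P: "P \<in> PR" and z: "z \<in> hom P (Cod C f)" and pz: "rep p * z = 0"
  shows "\<exists>y \<in> hom P (Dom C f). z = rep f * y"
proof -
  note d = cokernelD[OF c] and r = cokernel_rep[OF c]
  obtain m where m: "is_kernel C m p" using ex_kernel d(1) HomD by blast
  have dp: "Dom C p = Cod C f" using HomD[OF d(1)] by simp
  define I where "I = Dom C m"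
  have mH: "m \<in> Hom C I (Cod C f)" using kernelD(1)[OF m] dp by (simp add: I_def)
  obtain e where e: "e \<in> Hom C (Dom C f) I" "rep f = rep m * rep e"
    using kernel_rep(2)[OF m, of "rep f" "Dom C f"] homI[OF d(2)] r(1) dp by (auto simp: I_def elim: homE)
  have epi: "epic C e"
  proof (rule epicI[OF e(1)])
    fix D g h assume g: "g \<in> Hom C I D" and h: "h \<in> Hom C I D" and gh: "g \<cdot> e = h \<cdot> e"
    define t where "t = g \<oplus> neg h"
    have t: "t \<in> Hom C I D" and rt: "rep t = rep g - rep h"
      using Add_Hom[OF g Scale_Hom[OF h]] rep_Add[OF g Scale_Hom[OF h]] rep_neg[OF h] by (auto simp: t_def)
    have te: "rep t * rep e = 0" using rep_Comp[OF e(1) g] rep_Comp[OF e(1) h] gh by (simp add: rt left_diff_distrib)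
    obtain \<kappa> where kk: "is_kernel C \<kappa> t" using ex_kernel t HomD by blast
    define J where "J = Dom C \<kappa>"
    have dt: "Dom C t = I" "Cod C t = D" using HomD[OF t] by auto
    have kH: "\<kappa> \<in> Hom C J I" using kernelD(1)[OF kk] dt by (simp add: J_def)
    obtain e' where e': "e' \<in> hom (Dom C f) J" "rep e = rep \<kappa> * e'"
      using kernel_rep(2)[OF kk, of "rep e" "Dom C f"] homI[OF e(1)] te dt by (auto simp: J_def)
    have mk: "m \<cdot> \<kappa> \<in> Hom C J (Cod C f)" "rep (m \<cdot> \<kappa>) = rep m * rep \<kappa>" using Comp_Hom[OF kH mH] rep_Comp[OF kH mH] by auto
    \<comment> \<open>J is the part of I on which g and h agree, and e factors through it. Its
      inclusion into the target of f is monic, hence a kernel of some s.\<close>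
    have "monic C (m \<cdot> \<kappa>)"
    proof (rule monicI[OF mk(1)])
      fix D' x assume x: "x \<in> hom D' J" and "rep (m \<cdot> \<kappa>) * x = 0"
      then have "rep m * (rep \<kappa> * x) = 0" by (simp add: mk(2) mult.assoc)
      then have "rep \<kappa> * x = 0" using kernel_rep(3)[OF m HR.mult_H[OF x]] homI[OF kH] by (simp add: I_def)
      then show "x = 0" using kernel_rep(3)[OF kk] x by (simp add: J_def)
    qed
    then obtain s where s: "is_kernel C (m \<cdot> \<kappa>) s" using monic_kernel by blast
    have ds: "Dom C s = Cod C f" "Dom C (m \<cdot> \<kappa>) = J" using HomD[OF kernelD(1)[OF s]] HomD[OF mk(1)] by auto
    have sH: "rep s \<in> hom (Cod C f) (Cod C s)" using kernelD(2)[OF s] ds by auto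
    \<comment> \<open>Since s kills f, it factors through p and so kills m. Therefore m factors
      through \<open>m \<cdot> \<kappa>\<close>, which makes \<open>\<kappa>\<close> split epic, and
      t = 0 because t kills \<open>\<kappa>\<close>.\<close>
    have "rep s * rep f = rep s * (rep m * rep \<kappa>) * e'" using e(2) e'(2) by (simp add: mult.assoc)
    then have "rep s * rep f = 0" using kernel_rep(1)[OF s] mk(2) by simp
    then obtain s' where s': "rep s = s' * rep p" using r(2)[OF sH] by blast
    have "rep s * rep m = 0" using kernel_rep(1)[OF m] s' by (simp add: mult.assoc)
    then obtain w where w: "w \<in> hom I J" "rep m = rep m * rep \<kappa> * w"
      using kernel_rep(2)[OF s, of "rep m" I] homI[OF mH] ds mk(2) by auto
    have o: "I \<in> Obj C" using Hom_Obj[OF mH] by simp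
    have kw: "rep \<kappa> * w \<in> hom I I" using HR.mult_H[OF w(1) homI[OF kH]] .
    have "rep m * (rep \<kappa> * w - one I) = 0"
      using w(2) HR.mult_one[OF homI[OF mH]] by (simp add: right_diff_distrib mult.assoc)
    then have "rep \<kappa> * w - one I = 0"
      using kernel_rep(3)[OF m, of "rep \<kappa> * w - one I" I] HR.minus_H[OF kw HR.one_H[OF o]] by (simp add: I_def)
    then have "rep t = rep t * (rep \<kappa> * w)" using HR.mult_one[OF homI[OF t]] by simp
    then have "rep t = 0" using kernel_rep(1)[OF kk] by (simp flip: mult.assoc)
    then show "g = h" using rt rep_inj[OF g h] by simp
  qed
  obtain z' where z': "z' \<in> hom P I" "z = rep m * z'" using kernel_rep(2)[OF m, of z P] z pz dp by (auto simp: I_def)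
  then obtain y where "y \<in> hom P (Dom C f)" "z' = rep e * y" using epi epic_iff[OF e(1)] P by blast
  then show ?thesis using z'(2) e(2) by (metis mult.assoc)
qed

end

section \<open>Cohomology and roofs\<close>

context hom_ring
begin

text \<open>The correspondence between the cohomology classes of x and y given by the roof \<open>X \<leftarrow> Z \<rightarrow> Y\<close>.\<close>

definition roof_corr where
  "roof_corr X Y Z s f P n x y \<longleftrightarrow> (\<exists>z \<in> H P (cx_ob Z n). \<exists>a \<in> H P (cx_ob X (n - 1)). \<exists>b \<in> H P (cx_ob Y (n - 1)).
    cx_d Z n * z = 0 \<and> s n * z = x + cx_d X (n - 1) * a \<and> f n * z = y + cx_d Y (n - 1) * b)"

lemma corrE:
  assumes "roof_corr X Y Z s f P n x y"
  obtains z a b where "z \<in> H P (cx_ob Z n)" "a \<in> H P (cx_ob X (n - 1))" "b \<in> H P (cx_ob Y (n - 1))"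
    "cx_d Z n * z = 0" "s n * z = x + cx_d X (n - 1) * a" "f n * z = y + cx_d Y (n - 1) * b"
  using assms unfolding roof_corr_def by blast

lemma cm_cocycle: "cm X Y f \<Longrightarrow> cx_d X n * x = 0 \<Longrightarrow> cx_d Y n * (f n * x) = 0"
  using cm_d_el[of X Y f n x] by simp

lemma cm_el: "cm X Y f \<Longrightarrow> x \<in> H P (cx_ob X n) \<Longrightarrow> f n * x \<in> H P (cx_ob Y n)"
  using cm_H mult_H by blast

text \<open>Since \<open>s1 a\<close> is a quasi-isomorphism, the class of x has a representative z
  on the dominating roof. Injectivity of \<open>s1\<close> compares a z with the given
  \<open>z1\<close>, and the two homotopies carry the relation over to the second roof.\<close>

lemma roof_corr_cong:
  assumes c: "roof_corr X Y Z1 s1 f1 P n x y" and P: "P \<in> PR" and x: "x \<in> H P (cx_ob X n)"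
    and X: "cx X" and Z: "cx Z" and Z1: "cx Z1"
    and s1: "qi Z1 X s1" and f1: "cm Z1 Y f1" and s2: "cm Z2 X s2" and f2: "cm Z2 Y f2"
    and a: "cm Z Z1 a" and b: "cm Z Z2 b" and q: "qi Z X (\<lambda>n. s1 n * a n)"
    and h: "htp Z X (\<lambda>n. s1 n * a n) (\<lambda>n. s2 n * b n)" and k: "htp Z Y (\<lambda>n. f1 n * a n) (\<lambda>n. f2 n * b n)"
  shows "roof_corr X Y Z2 s2 f2 P n x y"
proof -
  obtain z1 a0 b0 where z1: "z1 \<in> H P (cx_ob Z1 n)" "a0 \<in> H P (cx_ob X (n - 1))" "b0 \<in> H P (cx_ob Y (n - 1))"
    "cx_d Z1 n * z1 = 0" "s1 n * z1 = x + cx_d X (n - 1) * a0" "f1 n * z1 = y + cx_d Y (n - 1) * b0"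
    using c by (rule corrE)
  note s1m = qi_cm[OF s1]
  have "cx_d X n * (x + cx_d X (n - 1) * a0) = 0" using cm_cocycle[OF s1m z1(4)] z1(5) by simp
  then have dx: "cx_d X n * x = 0" using cx_dd_el'[OF X] by (simp add: distrib_left)
  obtain z c where z: "z \<in> H P (cx_ob Z n)" "cx_d Z n * z = 0" "c \<in> H P (cx_ob X (n - 1))"
    "x = s1 n * a n * z + cx_d X (n - 1) * c" using qi_surD[OF q P x dx] by blast
  have az: "a n * z \<in> H P (cx_ob Z1 n)" using cm_el[OF a z(1)] .
  have "cx_d Z1 n * (z1 - a n * z) = 0" using z1(4) cm_cocycle[OF a z(2)] by (simp add: right_diff_distrib)
  moreover have "s1 n * (z1 - a n * z) = cx_d X (n - 1) * (a0 + c)"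
    using z1(5) z(4) by (simp add: right_diff_distrib distrib_left mult.assoc)
  ultimately obtain e where e: "e \<in> H P (cx_ob Z1 (n - 1))" "z1 - a n * z = cx_d Z1 (n - 1) * e"
    using qi_injD[OF s1 P minus_H[OF z1(1) az] _ add_H[OF z1(2) z(3)]] by blast
  obtain c1 where c1: "c1 \<in> H P (cx_ob X (n - 1))" "s1 n * a n * z = s2 n * b n * z + cx_d X (n - 1) * c1"
    using htp_el[OF h z(1,2)] by blast
  obtain c2 where c2: "c2 \<in> H P (cx_ob Y (n - 1))" "f1 n * a n * z = f2 n * b n * z + cx_d Y (n - 1) * c2"
    using htp_el[OF k z(1,2)] by blast
  have "f1 n * (z1 - a n * z) = cx_d Y (n - 1) * (f1 (n - 1) * e)" using e(2) cm_d_el'[OF f1] by simp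
  then have "f2 n * (b n * z) = y + cx_d Y (n - 1) * (b0 - f1 (n - 1) * e - c2)"
    using c2(2) z1(6) by (simp add: right_diff_distrib mult.assoc algebra_simps)
  moreover have "s2 n * (b n * z) = x + cx_d X (n - 1) * (- c - c1)"
    using c1(2) z(4) by (simp add: right_diff_distrib mult.assoc)
  moreover have "b n * z \<in> H P (cx_ob Z2 n)" "cx_d Z2 n * (b n * z) = 0"
    using cm_el[OF b z(1)] cm_cocycle[OF b z(2)] by auto
  moreover have "- c - c1 \<in> H P (cx_ob X (n - 1))" using z(3) c1(1) by auto
  moreover have "b0 - f1 (n - 1) * e - c2 \<in> H P (cx_ob Y (n - 1))"
    using z1(3) cm_el[OF f1 e(1)] c2(1) by auto
  ultimately show ?thesis unfolding roof_corr_def by blast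
qed

end

context enough_projectives_category
begin

lemma cohom_facts: fixes n :: int assumes X: "bounded_cx C X"
  defines "\<iota> \<equiv> cocycle_arr C X (n + 1)" and "\<beta> \<equiv> boundary_arr C X (n + 1)" and "\<pi> \<equiv> cohom_arr C X (n + 1)"
  shows "is_kernel C \<iota> (cx_d X (n + 1))" "\<beta> \<in> Hom C (cx_ob X n) (Dom C \<iota>)" "\<iota> \<cdot> \<beta> = cx_d X n"
    "is_cokernel C \<pi> \<beta>" "\<iota> \<in> Hom C (Dom C \<iota>) (cx_ob X (n + 1))" "\<pi> \<in> Hom C (Dom C \<iota>) (cohom C X (n + 1))"
proof -
  note d = bounded_cxD[OF X]
  have D: "Dom C (cx_d X (n + 1)) = cx_ob X (n + 1)" "Cod C (cx_d X (n + 1)) = cx_ob X (n + 1 + 1)"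
    using HomD[OF d(1)[of "n + 1"]] by auto
  show k: "is_kernel C \<iota> (cx_d X (n + 1))"
    unfolding \<iota>_def cocycle_arr_def using someI_ex[OF ex_kernel] HomD[OF d(1)] by blast
  note kd = kernelD[OF k]
  show "\<iota> \<in> Hom C (Dom C \<iota>) (cx_ob X (n + 1))" using kd(1) D by simp
  have "\<exists>!h. h \<in> Hom C (cx_ob X n) (Dom C \<iota>) \<and> \<iota> \<cdot> h = cx_d X n"
    using kd(4)[of "cx_d X n" "cx_ob X n"] d(1,2) D by simp
  from theI'[OF this] have b: "\<beta> \<in> Hom C (cx_ob X n) (Dom C \<iota>) \<and> \<iota> \<cdot> \<beta> = cx_d X n"
    by (simp add: \<beta>_def \<iota>_def boundary_arr_def)
  then show "\<beta> \<in> Hom C (cx_ob X n) (Dom C \<iota>)" "\<iota> \<cdot> \<beta> = cx_d X n" by auto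
  show p: "is_cokernel C \<pi> \<beta>"
    unfolding \<pi>_def cohom_arr_def \<beta>_def[symmetric] using someI_ex[OF ex_cokernel] HomD b by blast
  show "\<pi> \<in> Hom C (Dom C \<iota>) (cohom C X (n + 1))"
    using cokernelD(1)[OF p] HomD[OF conjunct1[OF b]] by (simp add: cohom_def \<pi>_def)
qed

lemma cohom_data_hx: assumes X: "bounded_cx C X"
  shows "HR.cohom_data (hx X) n (Dom C (cocycle_arr C X (n + 1))) (cohom C X (n + 1))
    (rep (cocycle_arr C X (n + 1))) (rep (boundary_arr C X (n + 1))) (rep (cohom_arr C X (n + 1)))"
proof -
  let ?\<iota> = "cocycle_arr C X (n + 1)" and ?\<beta> = "boundary_arr C X (n + 1)" and ?\<pi> = "cohom_arr C X (n + 1)"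
  note f = cohom_facts[OF X, of n]
  have D: "Dom C (cx_d X (n + 1)) = cx_ob X (n + 1)" "Dom C ?\<beta> = cx_ob X n" "Cod C ?\<beta> = Dom C ?\<iota>"
    using HomD[OF bounded_cxD(1)[OF X, of "n + 1"]] HomD[OF f(2)] by auto
  note k = kernel_rep[OF f(1), unfolded D] and c = cokernel_rep[OF f(4)]
  have "\<forall>P \<in> PR. \<forall>x \<in> hom P (cohom C X (n + 1)). \<exists>y \<in> hom P (Dom C ?\<iota>). x = rep ?\<pi> * y"
    using epic_iff[OF f(6)] c(3) by blast
  moreover have "\<forall>P \<in> PR. \<forall>z \<in> hom P (Dom C ?\<iota>). rep ?\<pi> * z = 0 \<longrightarrow> (\<exists>y \<in> hom P (cx_ob X n). z = rep ?\<beta> * y)"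
    using cokernel_exact[OF f(4), unfolded D] by blast
  moreover have "rep ?\<iota> * rep ?\<beta> = rep (cx_d X n)" using rep_Comp[OF f(2,5)] f(3) by simp
  ultimately show ?thesis unfolding HR.cohom_data_def hx_simps using k c(1) f(2,5,6) by blast
qed

text \<open>The maps on cohomology are definite descriptions over chosen kernels and cokernels.
  Universal properties show that they exist and fit into the squares of
  \<open>HR.cohom_data_qi\<close>; being an isomorphism is then decided by
  \<open>HR.iso_iff\<close>.\<close>

lemma quasi_iso_iff:
  assumes X: "bounded_cx C X" and Y: "bounded_cx C Y" and fm: "chain_map C X Y f"
  shows "quasi_iso C X Y f \<longleftrightarrow> HR.qi (hx X) (hx Y) (\<lambda>n. rep (f n))"
proof -
  note cm = chain_map_cm[OF X Y fm]
  have ex: "\<exists>\<zeta> \<in> hom (Dom C (cocycle_arr C X (n + 1))) (Dom C (cocycle_arr C Y (n + 1))).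
      rep (cocycle_arr C Y (n + 1)) * \<zeta> = rep (f (n + 1)) * rep (cocycle_arr C X (n + 1)) \<and>
      cohom_map C X Y f (n + 1) \<in> Hom C (cohom C X (n + 1)) (cohom C Y (n + 1)) \<and>
      rep (cohom_map C X Y f (n + 1)) * rep (cohom_arr C X (n + 1)) = rep (cohom_arr C Y (n + 1)) * \<zeta>" for n
  proof -
    note xf = cohom_facts[OF X, of n] and yf = cohom_facts[OF Y, of n]
    define \<iota> \<iota>' \<beta> \<beta>' \<pi> \<pi>' where d: "\<iota> = cocycle_arr C X (n + 1)" "\<iota>' = cocycle_arr C Y (n + 1)"
      "\<beta> = boundary_arr C X (n + 1)" "\<beta>' = boundary_arr C Y (n + 1)"
      "\<pi> = cohom_arr C X (n + 1)" "\<pi>' = cohom_arr C Y (n + 1)"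
    note xf = xf[folded d] and yf = yf[folded d]
    note f1 = chain_mapD(1)[OF fm, of "n + 1"] and f0 = chain_mapD(1)[OF fm, of n]
    have D: "Dom C (cx_d Y (n + 1)) = cx_ob Y (n + 1)" "Cod C (cx_d Y (n + 1)) = cx_ob Y (n + 1 + 1)"
       "Cod C \<beta> = Dom C \<iota>" "Dom C \<beta> = cx_ob X n" "Cod C \<pi> = cohom C X (n + 1)"
      using HomD[OF bounded_cxD(1)[OF Y, of "n + 1"]] HomD[OF xf(2)] HomD[OF xf(6)] by auto
    have fi: "f (n + 1) \<cdot> \<iota> \<in> Hom C (Dom C \<iota>) (cx_ob Y (n + 1))" using Comp_Hom[OF xf(5) f1] .
    have dY: "cx_d Y (n + 1) \<in> Hom C (cx_ob Y (n + 1)) (cx_ob Y (n + 1 + 1))" using bounded_cxD(1)[OF Y] .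
    have "rep (cx_d Y (n + 1)) * (rep (f (n + 1)) * rep \<iota>) = 0"
      using HR.cm_d_el[OF cm, of "n + 1" "rep \<iota>"] kernel_rep(1)[OF xf(1)] by simp
    then have z: "cx_d Y (n + 1) \<cdot> (f (n + 1) \<cdot> \<iota>) = Zero C (Dom C \<iota>) (cx_ob Y (n + 1 + 1))"
      using rep_0_iff[OF Comp_Hom[OF fi dY]] rep_Comp[OF fi dY] rep_Comp[OF xf(5) f1] by simp
    have "\<exists>!h. h \<in> Hom C (Dom C \<iota>) (Dom C \<iota>') \<and> \<iota>' \<cdot> h = f (n + 1) \<cdot> \<iota>"
      using kernelD(4)[OF yf(1), of "f (n + 1) \<cdot> \<iota>" "Dom C \<iota>"] fi z D by simp
    from theI'[OF this] obtain \<zeta> where ze: "\<zeta> = cocycle_map C X Y f (n + 1)"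
      "\<zeta> \<in> Hom C (Dom C \<iota>) (Dom C \<iota>')" "\<iota>' \<cdot> \<zeta> = f (n + 1) \<cdot> \<iota>"
      by (auto simp: cocycle_map_def d)
    have rz: "rep \<iota>' * rep \<zeta> = rep (f (n + 1)) * rep \<iota>"
      using ze(3) rep_Comp[OF ze(2) yf(5)] rep_Comp[OF xf(5) f1] by simp
    \<comment> \<open>The map on cocycles respects boundaries, so it descends to cohomology. The
      equation is checked after composing with the monic \<open>\<iota>'\<close>.\<close>
    have zb: "rep \<zeta> * rep \<beta> - rep \<beta>' * rep (f n) = 0"
    proof (rule kernel_rep(3)[OF yf(1)])
      show "rep \<zeta> * rep \<beta> - rep \<beta>' * rep (f n) \<in> hom (cx_ob X n) (Dom C \<iota>')"
        using HR.minus_H[OF HR.mult_H[OF homI[OF xf(2)] homI[OF ze(2)]] HR.mult_H[OF homI[OF f0] homI[OF yf(2)]]] .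
      have "rep \<iota>' * (rep \<zeta> * rep \<beta>) = rep (f (n + 1)) * (rep \<iota> * rep \<beta>)" using rz by (simp flip: mult.assoc)
      also have "\<dots> = rep (cx_d Y n) * rep (f n)"
        using rep_Comp[OF xf(2,5)] xf(3) HR.cm_d[OF cm, of n] by simp
      also have "\<dots> = rep \<iota>' * (rep \<beta>' * rep (f n))" using rep_Comp[OF yf(2,5)] yf(3) by (simp flip: mult.assoc)
      finally show "rep \<iota>' * (rep \<zeta> * rep \<beta> - rep \<beta>' * rep (f n)) = 0" by (simp add: right_diff_distrib)
    qed
    have pz: "\<pi>' \<cdot> \<zeta> \<in> Hom C (Dom C \<iota>) (cohom C Y (n + 1))" using Comp_Hom[OF ze(2) yf(6)] .
    have "rep (\<pi>' \<cdot> \<zeta>) * rep \<beta> = rep \<pi>' * (rep \<beta>' * rep (f n))"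
      using rep_Comp[OF ze(2) yf(6)] zb by (simp add: mult.assoc)
    also have "\<dots> = 0" using cokernel_rep(1)[OF yf(4)] by (simp flip: mult.assoc)
    finally have "(\<pi>' \<cdot> \<zeta>) \<cdot> \<beta> = Zero C (cx_ob X n) (cohom C Y (n + 1))"
      using rep_0_iff[OF Comp_Hom[OF xf(2) pz]] rep_Comp[OF xf(2) pz] by simp
    then have "\<exists>!h. h \<in> Hom C (cohom C X (n + 1)) (cohom C Y (n + 1)) \<and> h \<cdot> \<pi> = \<pi>' \<cdot> \<zeta>"
      using cokernelD(4)[OF xf(4), of "\<pi>' \<cdot> \<zeta>" "cohom C Y (n + 1)"] pz D by simp
    from theI'[OF this] have co: "cohom_map C X Y f (n + 1) \<in> Hom C (cohom C X (n + 1)) (cohom C Y (n + 1))"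
      "cohom_map C X Y f (n + 1) \<cdot> \<pi> = \<pi>' \<cdot> \<zeta>" by (auto simp: cohom_map_def d ze(1))
    then have "rep (cohom_map C X Y f (n + 1)) * rep \<pi> = rep \<pi>' * rep \<zeta>"
      using rep_Comp[OF xf(6) co(1)] rep_Comp[OF ze(2) yf(6)] by simp
    then show ?thesis using rz co(1) homI[OF ze(2)] unfolding d by blast
  qed
  have iso: "iso_arr C (cohom_map C X Y f (n + 1)) \<longleftrightarrow>
    (\<forall>P \<in> PR. \<forall>x \<in> hom P (cohom C X (n + 1)). rep (cohom_map C X Y f (n + 1)) * x = 0 \<longrightarrow> x = 0) \<and>
    (\<forall>P \<in> PR. \<forall>y \<in> hom P (cohom C Y (n + 1)). \<exists>x \<in> hom P (cohom C X (n + 1)). y = rep (cohom_map C X Y f (n + 1)) * x)" for n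
  proof -
    define e A B where d: "e = cohom_map C X Y f (n + 1)" "A = cohom C X (n + 1)" "B = cohom C Y (n + 1)"
    have e: "e \<in> Hom C A B" using ex[of n] by (auto simp: d)
    have o: "A \<in> Obj C" "B \<in> Obj C" using Hom_Obj[OF e] by auto
    have eq: "g \<cdot> e = Ident C A \<longleftrightarrow> rep g * rep e = one A" "e \<cdot> g = Ident C B \<longleftrightarrow> rep e * rep g = one B" if "g \<in> Hom C B A" for g
      using rep_eq_iff[OF Comp_Hom[OF e that] Ident_Hom[OF o(1)]] rep_eq_iff[OF Comp_Hom[OF that e] Ident_Hom[OF o(2)]]
        rep_Comp[OF e that] rep_Comp[OF that e] by (auto simp: one_def)
    have "iso_arr C e \<longleftrightarrow> (\<exists>g \<in> hom B A. g * rep e = one A \<and> rep e * g = one B)"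
      unfolding iso_arr_def using HomD[OF e] eq by (auto simp: hom_def)
    then show ?thesis using HR.iso_iff[OF homI[OF e]] by (simp add: d)
  qed
  define I where "I P n \<longleftrightarrow> (\<forall>x \<in> hom P (cx_ob X (n + 1)). \<forall>y \<in> hom P (cx_ob Y n). rep (cx_d X (n + 1)) * x = 0 \<longrightarrow>
      rep (f (n + 1)) * x = rep (cx_d Y n) * y \<longrightarrow> (\<exists>x' \<in> hom P (cx_ob X n). x = rep (cx_d X n) * x'))" for P n
  define S where "S P n \<longleftrightarrow> (\<forall>y \<in> hom P (cx_ob Y (n + 1)). rep (cx_d Y (n + 1)) * y = 0 \<longrightarrow>
    (\<exists>x \<in> hom P (cx_ob X (n + 1)). \<exists>y' \<in> hom P (cx_ob Y n). rep (cx_d X (n + 1)) * x = 0 \<and>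
      y = rep (f (n + 1)) * x + rep (cx_d Y n) * y'))" for P n
  have "iso_arr C (cohom_map C X Y f (n + 1)) \<longleftrightarrow> (\<forall>P \<in> PR. I P n) \<and> (\<forall>P \<in> PR. S P n)" for n
  proof -
    obtain \<zeta> where z: "\<zeta> \<in> hom (Dom C (cocycle_arr C X (n + 1))) (Dom C (cocycle_arr C Y (n + 1)))"
      "rep (cocycle_arr C Y (n + 1)) * \<zeta> = rep (f (n + 1)) * rep (cocycle_arr C X (n + 1))"
      "cohom_map C X Y f (n + 1) \<in> Hom C (cohom C X (n + 1)) (cohom C Y (n + 1))"
      "rep (cohom_map C X Y f (n + 1)) * rep (cohom_arr C X (n + 1)) = rep (cohom_arr C Y (n + 1)) * \<zeta>"
      using ex[of n] by blast
    note q = HR.cohom_data_qi[OF cohom_data_hx[OF X] cohom_data_hx[OF Y] cm z(1,2) homI[OF z(3)] z(4)]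
    show ?thesis unfolding iso I_def S_def by (simp only: q[unfolded hx_simps])
  qed
  \<comment> \<open>Every integer is a successor, so the index n + 1 reaches all degrees.\<close>
  moreover have "(\<forall>n. iso_arr C (cohom_map C X Y f n)) \<longleftrightarrow> (\<forall>n. iso_arr C (cohom_map C X Y f (n + 1)))"
    by (metis diff_add_cancel)
  ultimately have "(\<forall>n. iso_arr C (cohom_map C X Y f n)) \<longleftrightarrow> (\<forall>P \<in> PR. \<forall>n. I P n) \<and> (\<forall>P \<in> PR. \<forall>n. S P n)"
    by blast
  also have "\<dots> \<longleftrightarrow> HR.qinj (hx X) (hx Y) (\<lambda>n. rep (f n)) \<and> HR.qsur (hx X) (hx Y) (\<lambda>n. rep (f n))"
    by (simp only: HR.qinj_def HR.qsur_def hx_simps I_def S_def)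
  finally have "(\<forall>n. iso_arr C (cohom_map C X Y f n)) \<longleftrightarrow>
    HR.qinj (hx X) (hx Y) (\<lambda>n. rep (f n)) \<and> HR.qsur (hx X) (hx Y) (\<lambda>n. rep (f n))" .
  then show ?thesis using fm cm by (simp add: quasi_iso_def HR.qi_def)
qed

section \<open>Roofs and isomorphisms in the derived category\<close>

lemma chain_comp_rep: assumes "chain_map C X Y f" "chain_map C Y Z g"
  shows "rep (chain_comp C g f n) = rep (g n) * rep (f n)" "chain_comp C g f n \<in> Hom C (cx_ob X n) (cx_ob Z n)"
  using rep_Comp[OF chain_mapD(1)[OF assms(1)] chain_mapD(1)[OF assms(2)]]
    Comp_Hom[OF chain_mapD(1)[OF assms(1)] chain_mapD(1)[OF assms(2)]] by (auto simp: chain_comp_def)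

lemma chain_map_comp:
  assumes X: "bounded_cx C X" and Y: "bounded_cx C Y" and Z: "bounded_cx C Z"
    and f: "chain_map C X Y f" and g: "chain_map C Y Z g"
  shows "chain_map C X Z (chain_comp C g f)"
  using chain_map_iff[OF X Z chain_comp_rep(2)[OF f g]] HR.cm_comp[OF chain_map_cm[OF X Y f] chain_map_cm[OF Y Z g]]
    chain_comp_rep(1)[OF f g] by simp

lemma chain_id_map: assumes X: "bounded_cx C X" shows "chain_map C X X (chain_id C X)" "rep (chain_id C X n) = one (cx_ob X n)"
proof -
  show "rep (chain_id C X n) = one (cx_ob X n)" for n by (simp add: chain_id_def one_def)
  then show "chain_map C X X (chain_id C X)"
    using chain_map_iff[OF X X, of "chain_id C X"] HR.cm_one[OF bounded_hx[OF X]] Ident_Hom[OF bounded_cxD(3)[OF X]]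
    by (simp add: chain_id_def)
qed

lemma quasi_iso_qi: "bounded_cx C X \<Longrightarrow> bounded_cx C Y \<Longrightarrow> quasi_iso C X Y f \<Longrightarrow> HR.qi (hx X) (hx Y) (\<lambda>n. rep (f n))"
  using quasi_iso_iff unfolding quasi_iso_def by blast

lemma roofsD:
  assumes X: "bounded_cx C X" and Y: "bounded_cx C Y" and r: "(Z, s, f) \<in> roofs C X Y"
  shows "bounded_cx C Z" "quasi_iso C Z X s" "chain_map C Z X s" "chain_map C Z Y f"
    "HR.qi (hx Z) (hx X) (\<lambda>n. rep (s n))" "HR.cm (hx Z) (hx X) (\<lambda>n. rep (s n))" "HR.cm (hx Z) (hx Y) (\<lambda>n. rep (f n))"
proof -
  show Z: "bounded_cx C Z" and q: "quasi_iso C Z X s" and f: "chain_map C Z Y f"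
    using r by (auto simp: roofs_def)
  then show s: "chain_map C Z X s" by (simp add: quasi_iso_def)
  show "HR.qi (hx Z) (hx X) (\<lambda>n. rep (s n))" using quasi_iso_qi[OF Z X q] .
  show "HR.cm (hx Z) (hx X) (\<lambda>n. rep (s n))" "HR.cm (hx Z) (hx Y) (\<lambda>n. rep (f n))"
    using chain_map_cm[OF Z X s] chain_map_cm[OF Z Y f] by auto
qed

lemma roof_relD:
  assumes X: "bounded_cx C X" and Y: "bounded_cx C Y" and r: "((Z1, s1, f1), (Z2, s2, f2)) \<in> roof_rel C X Y"
  obtains Z a b where "(Z1, s1, f1) \<in> roofs C X Y" "(Z2, s2, f2) \<in> roofs C X Y" "HR.cx (hx Z)"
    "HR.cm (hx Z) (hx Z1) a" "HR.cm (hx Z) (hx Z2) b"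
    "HR.qi (hx Z) (hx X) (\<lambda>n. rep (s1 n) * a n)" "HR.htp (hx Z) (hx X) (\<lambda>n. rep (s1 n) * a n) (\<lambda>n. rep (s2 n) * b n)"
    "HR.htp (hx Z) (hx Y) (\<lambda>n. rep (f1 n) * a n) (\<lambda>n. rep (f2 n) * b n)"
proof -
  from r obtain Z a b where R1: "(Z1, s1, f1) \<in> roofs C X Y" and R2: "(Z2, s2, f2) \<in> roofs C X Y"
    and Z: "bounded_cx C Z" and a: "chain_map C Z Z1 a" and b: "chain_map C Z Z2 b"
    and q: "quasi_iso C Z X (chain_comp C s1 a)"
    and h: "homotopic C Z X (chain_comp C s1 a) (chain_comp C s2 b)"
    and k: "homotopic C Z Y (chain_comp C f1 a) (chain_comp C f2 b)"
    unfolding roof_rel_def by blast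
  note r1 = roofsD[OF X Y R1] and r2 = roofsD[OF X Y R2]
  note s1a = chain_comp_rep[OF a r1(3)] and s2b = chain_comp_rep[OF b r2(3)]
    and f1a = chain_comp_rep[OF a r1(4)] and f2b = chain_comp_rep[OF b r2(4)]
  show ?thesis
    using that[of Z "\<lambda>n. rep (a n)" "\<lambda>n. rep (b n)"] R1 R2 bounded_hx[OF Z] chain_map_cm[OF Z r1(1) a] chain_map_cm[OF Z r2(1) b]
      quasi_iso_qi[OF Z X q] h k homotopic_iff[OF Z X s1a(2) s2b(2)] homotopic_iff[OF Z Y f1a(2) f2b(2)]
    by (simp add: s1a(1) s2b(1) f1a(1) f2b(1))
qed

lemma roof_relI:
  assumes X: "bounded_cx C X" and Y: "bounded_cx C Y" and R1: "(Z1, s1, f1) \<in> roofs C X Y" and R2: "(Z2, s2, f2) \<in> roofs C X Y"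
    and Z: "bounded_cx C Z" and a: "HR.cm (hx Z) (hx Z1) a" and b: "HR.cm (hx Z) (hx Z2) b"
    and q: "HR.qi (hx Z) (hx X) (\<lambda>n. rep (s1 n) * a n)"
    and h: "HR.htp (hx Z) (hx X) (\<lambda>n. rep (s1 n) * a n) (\<lambda>n. rep (s2 n) * b n)"
    and k: "HR.htp (hx Z) (hx Y) (\<lambda>n. rep (f1 n) * a n) (\<lambda>n. rep (f2 n) * b n)"
  shows "((Z1, s1, f1), (Z2, s2, f2)) \<in> roof_rel C X Y"
proof -
  note r1 = roofsD[OF X Y R1] and r2 = roofsD[OF X Y R2]
  obtain a' where a': "chain_map C Z Z1 a'" "\<And>n. rep (a' n) = a n" using cm_chain_map[OF Z r1(1) a] by blast
  obtain b' where b': "chain_map C Z Z2 b'" "\<And>n. rep (b' n) = b n" using cm_chain_map[OF Z r2(1) b] by blast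
  note s1a = chain_comp_rep[OF a'(1) r1(3)] and s2b = chain_comp_rep[OF b'(1) r2(3)]
    and f1a = chain_comp_rep[OF a'(1) r1(4)] and f2b = chain_comp_rep[OF b'(1) r2(4)]
  have "quasi_iso C Z X (chain_comp C s1 a')"
    using quasi_iso_iff[OF Z X chain_map_comp[OF Z r1(1) X a'(1) r1(3)]] q by (simp add: s1a(1) a'(2))
  moreover have "homotopic C Z X (chain_comp C s1 a') (chain_comp C s2 b')"
    using homotopic_iff[OF Z X s1a(2) s2b(2)] h by (simp add: s1a(1) s2b(1) a'(2) b'(2))
  moreover have "homotopic C Z Y (chain_comp C f1 a') (chain_comp C f2 b')"
    using homotopic_iff[OF Z Y f1a(2) f2b(2)] k by (simp add: f1a(1) f2b(1) a'(2) b'(2))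
  ultimately show ?thesis using R1 R2 Z a'(1) b'(1) unfolding roof_rel_def by blast
qed

lemma roof_rel_refl:
  assumes X: "bounded_cx C X" and Y: "bounded_cx C Y" and R: "R \<in> roofs C X Y"
  shows "(R, R) \<in> roof_rel C X Y"
proof -
  obtain Z s f where e: "R = (Z, s, f)" by (cases R) auto
  note r = roofsD[OF X Y R[unfolded e]]
  have o: "rep (s n) * one (cx_ob Z n) = rep (s n)" "rep (f n) * one (cx_ob Z n) = rep (f n)" for n
    using HR.mult_one[OF homI[OF chain_mapD(1)[OF r(3)]]] HR.mult_one[OF homI[OF chain_mapD(1)[OF r(4)]]] by auto
  note Zc = bounded_hx[OF r(1)]
  have i: "HR.cm (hx Z) (hx Z) (\<lambda>n. one (cx_ob Z n))" using HR.cm_one[OF Zc] by simp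
  show ?thesis unfolding e
    by (rule roof_relI[OF X Y R[unfolded e] R[unfolded e] r(1) i i])
      (simp_all add: o r(5) HR.htp_refl[OF Zc bounded_hx[OF X]] HR.htp_refl[OF Zc bounded_hx[OF Y]])
qed

text \<open>The definition asks only the first composite to be a quasi-isomorphism; the second one
  is homotopic to it.\<close>

lemma roof_rel_sym:
  assumes X: "bounded_cx C X" and Y: "bounded_cx C Y" and r: "(R1, R2) \<in> roof_rel C X Y"
  shows "(R2, R1) \<in> roof_rel C X Y"
proof -
  obtain Z1 s1 f1 Z2 s2 f2 where e: "R1 = (Z1, s1, f1)" "R2 = (Z2, s2, f2)" by (cases R1, cases R2) auto
  from r[unfolded e] obtain Z a b where R1: "(Z1, s1, f1) \<in> roofs C X Y" and R2: "(Z2, s2, f2) \<in> roofs C X Y"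
    and Z: "bounded_cx C Z" and a: "chain_map C Z Z1 a" and b: "chain_map C Z Z2 b"
    and q: "quasi_iso C Z X (chain_comp C s1 a)"
    and h: "homotopic C Z X (chain_comp C s1 a) (chain_comp C s2 b)"
    and k: "homotopic C Z Y (chain_comp C f1 a) (chain_comp C f2 b)"
    unfolding roof_rel_def by blast
  note r1 = roofsD[OF X Y R1] and r2 = roofsD[OF X Y R2]
  note s1a = chain_comp_rep[OF a r1(3)] and s2b = chain_comp_rep[OF b r2(3)]
    and f1a = chain_comp_rep[OF a r1(4)] and f2b = chain_comp_rep[OF b r2(4)]
  have h': "HR.htp (hx Z) (hx X) (\<lambda>n. rep (s1 n) * rep (a n)) (\<lambda>n. rep (s2 n) * rep (b n))"
    using h homotopic_iff[OF Z X s1a(2) s2b(2)] by (simp add: s1a(1) s2b(1))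
  have k': "HR.htp (hx Z) (hx Y) (\<lambda>n. rep (f1 n) * rep (a n)) (\<lambda>n. rep (f2 n) * rep (b n))"
    using k homotopic_iff[OF Z Y f1a(2) f2b(2)] by (simp add: f1a(1) f2b(1))
  have q': "HR.qi (hx Z) (hx X) (\<lambda>n. rep (s1 n) * rep (a n))" using quasi_iso_qi[OF Z X q] by (simp add: s1a(1))
  note bm = chain_map_cm[OF Z r2(1) b]
  have "HR.qi (hx Z) (hx X) (\<lambda>n. rep (s2 n) * rep (b n))"
    using HR.qi_htp[OF q' h' HR.cm_comp[OF bm r2(6)] bounded_hx[OF Z] bounded_hx[OF X]] .
  then show ?thesis unfolding e
    using roof_relI[OF X Y R2 R1 Z bm chain_map_cm[OF Z r1(1) a]] HR.htp_sym[OF h'] HR.htp_sym[OF k'] by blast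
qed

lemma roof_rel_roof_corr:
  assumes X: "bounded_cx C X" and Y: "bounded_cx C Y" and r: "((Z1, s1, f1), (Z2, s2, f2)) \<in> roof_rel C X Y"
    and P: "P \<in> PR" and x: "x \<in> hom P (cx_ob X n)"
    and c: "HR.roof_corr (hx X) (hx Y) (hx Z1) (\<lambda>n. rep (s1 n)) (\<lambda>n. rep (f1 n)) P n x y"
  shows "HR.roof_corr (hx X) (hx Y) (hx Z2) (\<lambda>n. rep (s2 n)) (\<lambda>n. rep (f2 n)) P n x y"
proof -
  from X Y r obtain Z a b where R: "(Z1, s1, f1) \<in> roofs C X Y" "(Z2, s2, f2) \<in> roofs C X Y" "HR.cx (hx Z)"
    "HR.cm (hx Z) (hx Z1) a" "HR.cm (hx Z) (hx Z2) b"
    "HR.qi (hx Z) (hx X) (\<lambda>n. rep (s1 n) * a n)" "HR.htp (hx Z) (hx X) (\<lambda>n. rep (s1 n) * a n) (\<lambda>n. rep (s2 n) * b n)"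
    "HR.htp (hx Z) (hx Y) (\<lambda>n. rep (f1 n) * a n) (\<lambda>n. rep (f2 n) * b n)" by (rule roof_relD)
  note r1 = roofsD[OF X Y R(1)] and r2 = roofsD[OF X Y R(2)]
  have x': "x \<in> hom P (cx_ob (hx X) n)" using x by simp
  show ?thesis
    using HR.roof_corr_cong[OF c P x' bounded_hx[OF X] R(3) bounded_hx[OF r1(1)] r1(5,7) r2(6,7) R(4-8)] .
qed

text \<open>The correspondence \<open>HR.roof_corr\<close> depends only on the class of a roof.
  Applied to the composites of F with its inverse G, it shows that the right leg of a roof of F is
  injective on cohomology since G F is the identity, and surjective since F G is.\<close>

lemma D_iso_arr_quasi_iso:
  assumes X: "bounded_cx C X" and Y: "bounded_cx C Y" and F: "D_iso_arr C X Y F"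
  obtains Z s f where "bounded_cx C Z" "HR.qi (hx Z) (hx X) (\<lambda>n. rep (s n))" "HR.qi (hx Z) (hx Y) (\<lambda>n. rep (f n))"
proof -
  note Xc = bounded_hx[OF X] and Yc = bounded_hx[OF Y]
  obtain G where FH: "F \<in> D_Hom C X Y" and GH: "G \<in> D_Hom C Y X"
    and GF: "D_comp C X Y X G F = D_id C X" and FG: "D_comp C Y X Y F G = D_id C Y"
    using F by (auto simp: D_iso_arr_def)
  obtain Z0 s0 f0 where R0: "(Z0, s0, f0) \<in> roofs C X Y" and FR: "F = roof_rel C X Y `` {(Z0, s0, f0)}"
    using FH unfolding D_Hom_def quotient_def by auto
  obtain W0 t0 g0 where W0: "(W0, t0, g0) \<in> roofs C Y X" and GR: "G = roof_rel C Y X `` {(W0, t0, g0)}"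
    using GH unfolding D_Hom_def quotient_def by auto
  note z0 = roofsD[OF X Y R0]
  have Frel: "((Z0, s0, f0), (U, s, f)) \<in> roof_rel C X Y" if "(U, s, f) \<in> F" for U s f using that FR by simp
  have Froof: "(U, s, f) \<in> roofs C X Y" if "(U, s, f) \<in> F" for U s f
    using Frel[OF that] unfolding roof_rel_def by blast
  have Groof: "(U, s, f) \<in> roofs C Y X" if "(U, s, f) \<in> G" for U s f
    using that unfolding GR roof_rel_def by blast
  have idR: "(X, chain_id C X, chain_id C X) \<in> D_id C X" if X: "bounded_cx C X" for X
  proof -
    have "quasi_iso C X X (chain_id C X)"
      using quasi_iso_iff[OF X X chain_id_map(1)[OF X]] HR.qi_one[OF bounded_hx[OF X]] chain_id_map(2)[OF X] by simp
    then have "(X, chain_id C X, chain_id C X) \<in> roofs C X X" using X chain_id_map(1)[OF X] by (simp add: roofs_def)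
    then show ?thesis using roof_rel_refl[OF X X] by (simp add: D_id_def D_of_def)
  qed
  \<comment> \<open>If the image of z under \<open>f0\<close> bounds, then F relates x, the image of
    z under \<open>s0\<close>, to 0, and so does the composite with G. That composite is the
    identity, so x bounds; then z bounds by injectivity of \<open>s0\<close>.\<close>
  have inj: "\<exists>z' \<in> hom P (cx_ob Z0 n). z = rep (cx_d Z0 n) * z'"
    if P: "P \<in> PR" and z: "z \<in> hom P (cx_ob Z0 (n + 1))" and y: "y \<in> hom P (cx_ob Y n)"
    and dz: "rep (cx_d Z0 (n + 1)) * z = 0" and fz: "rep (f0 (n + 1)) * z = rep (cx_d Y n) * y" for P n z y
  proof -
    obtain U s f V t g T a b where U: "(U, s, f) \<in> F" and V: "(V, t, g) \<in> G" and T: "bounded_cx C T"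
      and a: "quasi_iso C T U a" and b: "chain_map C T V b"
      and h: "homotopic C T Y (chain_comp C f a) (chain_comp C t b)"
      and rel: "((T, chain_comp C s a, chain_comp C g b), (X, chain_id C X, chain_id C X)) \<in> roof_rel C X X"
      using idR[OF X] unfolding GF[symmetric] D_comp_def by blast
    note u = roofsD[OF X Y Froof[OF U]] and v = roofsD[OF Y X Groof[OF V]]
    have am: "chain_map C T U a" using a by (simp add: quasi_iso_def)
    note aq = quasi_iso_qi[OF T u(1) a] and bm = chain_map_cm[OF T v(1) b]
    note sa = chain_comp_rep[OF am u(3)] and fa = chain_comp_rep[OF am u(4)] and tb = chain_comp_rep[OF b v(3)] and gb = chain_comp_rep[OF b v(4)]
    have h': "HR.htp (hx T) (hx Y) (\<lambda>n. rep (f n) * rep (a n)) (\<lambda>n. rep (t n) * rep (b n))"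
      using h homotopic_iff[OF T Y fa(2) tb(2)] by (simp add: fa(1) tb(1))
    define m where "m = n + 1"
    define x where "x = rep (s0 m) * z"
    have x: "x \<in> hom P (cx_ob X m)" using HR.cm_el[OF z0(6), of z P m] z by (simp add: x_def m_def)
    have o: "0 \<in> hom P (cx_ob X n)" using HR.zero_H HR.PR_Ob[OF P] bounded_cxD(3)[OF X] by blast
    have "HR.roof_corr (hx X) (hx Y) (hx Z0) (\<lambda>n. rep (s0 n)) (\<lambda>n. rep (f0 n)) P m x 0"
      unfolding HR.roof_corr_def by (intro bexI[of _ z] bexI[of _ 0] bexI[of _ y]) (use z y o dz fz in \<open>auto simp: x_def m_def\<close>)
    from roof_rel_roof_corr[OF X Y Frel[OF U] P x this]
    obtain w a0 b0 where w: "w \<in> hom P (cx_ob U m)" "a0 \<in> hom P (cx_ob X n)" "b0 \<in> hom P (cx_ob Y n)"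
      "rep (cx_d U m) * w = 0" "rep (s m) * w = x + rep (cx_d X n) * a0" "rep (f m) * w = 0 + rep (cx_d Y n) * b0"
      by (auto simp: m_def elim!: HR.corrE)
    obtain \<tau> u1 where ta: "\<tau> \<in> hom P (cx_ob T m)" "rep (cx_d T m) * \<tau> = 0" "u1 \<in> hom P (cx_ob U n)"
      "w = rep (a m) * \<tau> + rep (cx_d U n) * u1"
      using HR.qi_surD[OF aq P, of w m] w(1,4) by (auto simp: m_def)
    obtain c where c: "c \<in> hom P (cx_ob Y n)" "rep (f m) * rep (a m) * \<tau> = rep (t m) * rep (b m) * \<tau> + rep (cx_d Y n) * c"
      using HR.htp_el[OF h', of \<tau> P m] ta(1,2) by (auto simp: m_def)
    have fu: "rep (f m) * (rep (cx_d U n) * u1) = rep (cx_d Y n) * (rep (f n) * u1)"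
      using HR.cm_d_el[OF u(7), of n u1] by (simp add: m_def)
    have su: "rep (s m) * (rep (cx_d U n) * u1) = rep (cx_d X n) * (rep (s n) * u1)"
      using HR.cm_d_el[OF u(6), of n u1] by (simp add: m_def)
    have "rep (t m) * (rep (b m) * \<tau>) = rep (cx_d Y n) * (b0 - rep (f n) * u1 - c)"
      using w(6) ta(4) c(2) fu by (simp add: algebra_simps)
    moreover have "b0 - rep (f n) * u1 - c \<in> hom P (cx_ob Y n)"
      using w(3) c(1) HR.cm_el[OF u(7), of u1 P n] ta(3) HR.minus_H by simp
    moreover have "rep (b m) * \<tau> \<in> hom P (cx_ob V m)" "rep (cx_d V m) * (rep (b m) * \<tau>) = 0"
      using HR.cm_el[OF bm, of \<tau> P m] HR.cm_cocycle[OF bm, of m \<tau>] ta by auto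
    ultimately obtain v1 where v1: "v1 \<in> hom P (cx_ob V n)" "rep (b m) * \<tau> = rep (cx_d V n) * v1"
      using HR.qi_injD[OF v(5) P, of "rep (b m) * \<tau>" m "b0 - rep (f n) * u1 - c"] by (auto simp: m_def)
    have "rep (g m) * rep (b m) * \<tau> = rep (cx_d X n) * (rep (g n) * v1)"
      using v1(2) HR.cm_d_el[OF v(7), of n v1] by (simp add: mult.assoc m_def)
    moreover have "rep (g n) * v1 \<in> hom P (cx_ob X n)" using HR.cm_el[OF v(7), of v1 P n] v1 by simp
    moreover have "rep (s m) * rep (a m) * \<tau> = x + rep (cx_d X n) * (a0 - rep (s n) * u1)"
      using w(5) ta(4) su by (simp add: algebra_simps)
    moreover have "a0 - rep (s n) * u1 \<in> hom P (cx_ob X n)" using w(2) HR.cm_el[OF u(6), of u1 P n] ta(3) HR.minus_H by simp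
    ultimately have "HR.roof_corr (hx X) (hx X) (hx T) (\<lambda>n. rep (chain_comp C s a n)) (\<lambda>n. rep (chain_comp C g b n)) P m x 0"
      unfolding HR.roof_corr_def using ta(1,2)
      by (intro bexI[of _ \<tau>] bexI[of _ "a0 - rep (s n) * u1"] bexI[of _ "rep (g n) * v1"]) (auto simp: sa(1) gb(1) m_def)
    from roof_rel_roof_corr[OF X X rel P x this]
    obtain k a1 b1 where k: "a1 \<in> hom P (cx_ob (hx X) (m - 1))" "b1 \<in> hom P (cx_ob (hx X) (m - 1))"
      "rep (chain_id C X m) * k = x + cx_d (hx X) (m - 1) * a1" "rep (chain_id C X m) * k = 0 + cx_d (hx X) (m - 1) * b1"
      unfolding HR.roof_corr_def by blast
    have k: "a1 \<in> hom P (cx_ob X n)" "b1 \<in> hom P (cx_ob X n)" "x + rep (cx_d X n) * a1 = rep (cx_d X n) * b1"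
      using k by (simp_all add: m_def)
    have "rep (s0 m) * z = rep (cx_d X n) * (b1 - a1)" using k(3) by (simp add: x_def algebra_simps)
    moreover have "b1 - a1 \<in> hom P (cx_ob X n)" using k HR.minus_H by simp
    ultimately show ?thesis
      using HR.qi_injD[OF z0(5) P, of z m "b1 - a1"] z dz by (auto simp: m_def)
  qed
  \<comment> \<open>The identity relates y to itself, hence so does the composite. Its middle class
    yields x, which F relates to y; a representative of x on the fixed roof is mapped to y up to a
    boundary.\<close>
  have sur: "\<exists>z \<in> hom P (cx_ob Z0 (n + 1)). \<exists>y' \<in> hom P (cx_ob Y n). rep (cx_d Z0 (n + 1)) * z = 0 \<and>
      y = rep (f0 (n + 1)) * z + rep (cx_d Y n) * y'"
    if P: "P \<in> PR" and y: "y \<in> hom P (cx_ob Y (n + 1))" and dy: "rep (cx_d Y (n + 1)) * y = 0" for P n y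
  proof -
    obtain V t g U s f T a b where V: "(V, t, g) \<in> G" and U: "(U, s, f) \<in> F" and T: "bounded_cx C T"
      and a: "quasi_iso C T V a" and b: "chain_map C T U b"
      and rel: "((T, chain_comp C t a, chain_comp C f b), (Y, chain_id C Y, chain_id C Y)) \<in> roof_rel C Y Y"
      using idR[OF Y] unfolding FG[symmetric] D_comp_def by blast
    note u = roofsD[OF X Y Froof[OF U]] and v = roofsD[OF Y X Groof[OF V]]
    have am: "chain_map C T V a" using a by (simp add: quasi_iso_def)
    note bm = chain_map_cm[OF T u(1) b] and fb = chain_comp_rep[OF b u(4)]
    define m where "m = n + 1"
    have o: "0 \<in> hom P (cx_ob Y n)" "0 \<in> hom P (cx_ob X n)"
      using HR.zero_H HR.PR_Ob[OF P] bounded_cxD(3)[OF Y] bounded_cxD(3)[OF X] by blast+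
    have y': "y \<in> hom P (cx_ob Y m)" using y by (simp add: m_def)
    have "HR.roof_corr (hx Y) (hx Y) (hx Y) (\<lambda>n. rep (chain_id C Y n)) (\<lambda>n. rep (chain_id C Y n)) P m y y"
      unfolding HR.roof_corr_def using y' o dy HR.one_mult[OF y']
      by (intro bexI[of _ y] bexI[of _ 0] bexI[of _ 0]) (auto simp: chain_id_map(2)[OF Y] m_def)
    from roof_rel_roof_corr[OF Y Y roof_rel_sym[OF Y Y rel] P y' this]
    obtain \<tau> a0 b0 where ta: "\<tau> \<in> hom P (cx_ob T m)" "b0 \<in> hom P (cx_ob Y n)"
      "rep (cx_d T m) * \<tau> = 0" "rep (f m) * rep (b m) * \<tau> = y + rep (cx_d Y n) * b0"
      by (auto simp: m_def fb(1) elim!: HR.corrE)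
    define w where "w = rep (b m) * \<tau>"
    have w: "w \<in> hom P (cx_ob U m)" "rep (cx_d U m) * w = 0" using HR.cm_el[OF bm, of \<tau> P m] HR.cm_cocycle[OF bm, of m \<tau>] ta by (auto simp: w_def)
    define x where "x = rep (s m) * w"
    have x: "x \<in> hom P (cx_ob X m)" using HR.cm_el[OF u(6), of w P m] w by (simp add: x_def)
    have "HR.roof_corr (hx X) (hx Y) (hx U) (\<lambda>n. rep (s n)) (\<lambda>n. rep (f n)) P m x y"
      unfolding HR.roof_corr_def using w ta o
      by (intro bexI[of _ w] bexI[of _ 0] bexI[of _ b0]) (auto simp: x_def w_def m_def mult.assoc)
    from roof_rel_roof_corr[OF X Y roof_rel_sym[OF X Y Frel[OF U]] P x this]
    obtain z b1 where z: "z \<in> hom P (cx_ob Z0 m)" "b1 \<in> hom P (cx_ob Y n)" "rep (cx_d Z0 m) * z = 0"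
      "rep (f0 m) * z = y + rep (cx_d Y n) * b1" by (auto simp: m_def elim!: HR.corrE)
    have "y = rep (f0 m) * z + rep (cx_d Y n) * (- b1)" using z(4) by simp
    then show ?thesis using z HR.uminus_H[OF z(2)] unfolding m_def by blast
  qed
  have "HR.qi (hx Z0) (hx Y) (\<lambda>n. rep (f0 n))"
    by (rule HR.qiI[OF z0(7)]) (use inj sur in \<open>simp_all\<close>)
  then show ?thesis using that z0(1,5) by blast
qed

text \<open>With a projective resolution \<open>\<alpha>\<close> of X at hand, roofs from X are compared after lifting \<open>\<alpha>\<close> to them.\<close>

lemma roof_rel_iff:
  assumes X: "bounded_cx C X" and Y: "bounded_cx C Y" and Q: "bounded_cx C Q" and QP: "\<And>n. cx_ob Q n \<in> PR"
    and \<alpha>: "HR.qi (hx Q) (hx X) \<alpha>" and R1: "(Z1, s1, f1) \<in> roofs C X Y" and R2: "(Z2, s2, f2) \<in> roofs C X Y"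
    and r1: "HR.cm (hx Q) (hx Z1) r1" "HR.htp (hx Q) (hx X) (\<lambda>n. rep (s1 n) * r1 n) \<alpha>"
    and r2: "HR.cm (hx Q) (hx Z2) r2" "HR.htp (hx Q) (hx X) (\<lambda>n. rep (s2 n) * r2 n) \<alpha>"
  shows "((Z1, s1, f1), (Z2, s2, f2)) \<in> roof_rel C X Y \<longleftrightarrow>
    HR.htp (hx Q) (hx Y) (\<lambda>n. rep (f1 n) * r1 n) (\<lambda>n. rep (f2 n) * r2 n)"
proof
  note d1 = roofsD[OF X Y R1] and d2 = roofsD[OF X Y R2]
  note Qb = bounded_bdd[OF Q] and Qc = bounded_hx[OF Q] and Xc = bounded_hx[OF X]
  {
    assume h: "HR.htp (hx Q) (hx Y) (\<lambda>n. rep (f1 n) * r1 n) (\<lambda>n. rep (f2 n) * r2 n)"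
    have "HR.qi (hx Q) (hx X) (\<lambda>n. rep (s1 n) * r1 n)"
      using HR.qi_htp[OF \<alpha> HR.htp_sym[OF r1(2)] HR.cm_comp[OF r1(1) d1(6)] Qc Xc] .
    then show "((Z1, s1, f1), (Z2, s2, f2)) \<in> roof_rel C X Y"
      using roof_relI[OF X Y R1 R2 Q r1(1) r2(1)] HR.htp_trans[OF r1(2) HR.htp_sym[OF r2(2)]] h by blast
  }
  assume "((Z1, s1, f1), (Z2, s2, f2)) \<in> roof_rel C X Y"
  with X Y obtain Z a b where Z: "HR.cx (hx Z)" "HR.cm (hx Z) (hx Z1) a" "HR.cm (hx Z) (hx Z2) b"
    "HR.qi (hx Z) (hx X) (\<lambda>n. rep (s1 n) * a n)" "HR.htp (hx Z) (hx X) (\<lambda>n. rep (s1 n) * a n) (\<lambda>n. rep (s2 n) * b n)"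
    "HR.htp (hx Z) (hx Y) (\<lambda>n. rep (f1 n) * a n) (\<lambda>n. rep (f2 n) * b n)" by (rule roof_relD)
  have QP': "cx_ob (hx Q) n \<in> PR" for n using QP by simp
  obtain c where c: "HR.cm (hx Q) (hx Z) c" "HR.htp (hx Q) (hx X) \<alpha> (\<lambda>n. rep (s1 n) * a n * c n)"
    using HR.lift[OF Qb QP' Z(4,1) Xc HR.qi_cm[OF \<alpha>]] .
  have 1: "HR.htp (hx Q) (hx X) (\<lambda>n. rep (s1 n) * (a n * c n)) (\<lambda>n. rep (s1 n) * r1 n)"
    using HR.htp_sym[OF HR.htp_trans[OF r1(2) c(2)]] by (simp add: mult.assoc)
  have "HR.htp (hx Q) (hx X) \<alpha> (\<lambda>n. rep (s2 n) * b n * c n)"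
    using HR.htp_trans[OF c(2) HR.htp_comp_right[OF Z(5) c(1)]] .
  then have 2: "HR.htp (hx Q) (hx X) (\<lambda>n. rep (s2 n) * (b n * c n)) (\<lambda>n. rep (s2 n) * r2 n)"
    using HR.htp_sym[OF HR.htp_trans[OF r2(2)]] by (simp add: mult.assoc)
  have A: "HR.htp (hx Q) (hx Z1) (\<lambda>n. a n * c n) r1"
    using HR.lift_unique[OF Qb QP' d1(5) bounded_hx[OF d1(1)] Xc HR.cm_comp[OF c(1) Z(2)] r1(1) 1] .
  have B: "HR.htp (hx Q) (hx Z2) (\<lambda>n. b n * c n) r2"
    using HR.lift_unique[OF Qb QP' d2(5) bounded_hx[OF d2(1)] Xc HR.cm_comp[OF c(1) Z(3)] r2(1) 2] .
  have "HR.htp (hx Q) (hx Y) (\<lambda>n. rep (f1 n) * (a n * c n)) (\<lambda>n. rep (f2 n) * (b n * c n))"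
    using HR.htp_comp_right[OF Z(6) c(1)] by (simp add: mult.assoc)
  from HR.htp_trans[OF HR.htp_trans[OF HR.htp_sym[OF HR.htp_comp_left[OF A d1(7)]] this] HR.htp_comp_left[OF B d2(7)]]
  show "HR.htp (hx Q) (hx Y) (\<lambda>n. rep (f1 n) * r1 n) (\<lambda>n. rep (f2 n) * r2 n)" .
qed

lemma roof_lift:
  assumes X: "bounded_cx C X" and Y: "bounded_cx C Y" and Q: "bounded_cx C Q" and QP: "\<And>n. cx_ob Q n \<in> PR"
    and \<alpha>: "HR.qi (hx Q) (hx X) \<alpha>" and R: "(Z, s, f) \<in> roofs C X Y"
  obtains r where "HR.cm (hx Q) (hx Z) r" "HR.htp (hx Q) (hx X) (\<lambda>n. rep (s n) * r n) \<alpha>"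
proof -
  note d = roofsD[OF X Y R]
  have QP': "cx_ob (hx Q) n \<in> PR" for n using QP by simp
  obtain r where r: "HR.cm (hx Q) (hx Z) r" "HR.htp (hx Q) (hx X) \<alpha> (\<lambda>n. rep (s n) * r n)"
    using HR.lift[OF bounded_bdd[OF Q] QP' d(5) bounded_hx[OF d(1)] bounded_hx[OF X] HR.qi_cm[OF \<alpha>]] .
  show ?thesis by (rule that[OF r(1) HR.htp_sym[OF r(2)]])
qed

text \<open>\<open>D_comp\<close> is a set of roofs, so both inclusions are shown. By
  \<open>roof_rel_iff\<close> everything becomes a homotopy between maps out of Q: a roof (Z, s, f)
  lies in the identity class iff f r is homotopic to \<open>\<alpha>\<close>, where r lifts
  \<open>\<alpha>\<close> through s.\<close>

lemma D_comp_inverse: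
  assumes X: "bounded_cx C X" and Y: "bounded_cx C Y" and Q: "bounded_cx C Q" and QP: "\<And>n. cx_ob Q n \<in> PR"
    and \<alpha>: "quasi_iso C Q X \<alpha>" and \<beta>: "quasi_iso C Q Y \<beta>"
  shows "D_comp C X Y X (roof_rel C Y X `` {(Q, \<beta>, \<alpha>)}) (roof_rel C X Y `` {(Q, \<alpha>, \<beta>)}) = D_id C X"
proof -
  note Qc = bounded_hx[OF Q] and Xc = bounded_hx[OF X] and Yc = bounded_hx[OF Y]
  have am: "chain_map C Q X \<alpha>" and bm: "chain_map C Q Y \<beta>" using \<alpha> \<beta> by (auto simp: quasi_iso_def)
  note aq = quasi_iso_qi[OF Q X \<alpha>] and bq = quasi_iso_qi[OF Q Y \<beta>]
  note ac = HR.qi_cm[OF aq] and bc = HR.qi_cm[OF bq]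
  have RQ: "(Q, \<alpha>, \<beta>) \<in> roofs C X Y" "(Q, \<beta>, \<alpha>) \<in> roofs C Y X" "(Q, \<alpha>, \<alpha>) \<in> roofs C X X"
    using Q \<alpha> \<beta> am bm by (auto simp: roofs_def)
  have idq: "quasi_iso C W W (chain_id C W)" if W: "bounded_cx C W" for W
    using quasi_iso_iff[OF W W chain_id_map(1)[OF W]] HR.qi_one[OF bounded_hx[OF W]] chain_id_map(2)[OF W] by simp
  have RX: "(X, chain_id C X, chain_id C X) \<in> roofs C X X" using X idq[OF X] chain_id_map(1)[OF X] by (simp add: roofs_def)
  have i: "HR.cm (hx Q) (hx Q) (\<lambda>n. one (cx_ob Q n))" using HR.cm_one[OF Qc] by simp
  have o: "rep (\<alpha> n) * one (cx_ob Q n) = rep (\<alpha> n)" "rep (\<beta> n) * one (cx_ob Q n) = rep (\<beta> n)"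
    "one (cx_ob X n) * rep (\<alpha> n) = rep (\<alpha> n)" for n
    using HR.mult_one[OF homI[OF chain_mapD(1)[OF am]]] HR.mult_one[OF homI[OF chain_mapD(1)[OF bm]]]
      HR.one_mult[OF homI[OF chain_mapD(1)[OF am]]] by auto
  have iX: "HR.cm (hx Q) (hx X) (\<lambda>n. rep (\<alpha> n))" by (rule ac)
  have id_iff: "(Z, s, f) \<in> D_id C X \<longleftrightarrow> HR.htp (hx Q) (hx X) (\<lambda>n. rep (f n) * r n) (\<lambda>n. rep (\<alpha> n))"
    if R: "(Z, s, f) \<in> roofs C X X" and r: "HR.cm (hx Q) (hx Z) r" "HR.htp (hx Q) (hx X) (\<lambda>n. rep (s n) * r n) (\<lambda>n. rep (\<alpha> n))" for Z s f r
  proof -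
    have "((X, chain_id C X, chain_id C X), (Z, s, f)) \<in> roof_rel C X X \<longleftrightarrow>
      HR.htp (hx Q) (hx X) (\<lambda>n. rep (chain_id C X n) * rep (\<alpha> n)) (\<lambda>n. rep (f n) * r n)"
      using roof_rel_iff[OF X X Q QP aq RX R iX _ r] HR.htp_refl[OF Qc Xc] by (simp add: chain_id_map(2)[OF X] o)
    then show ?thesis using HR.htp_sym by (auto simp: D_id_def D_of_def chain_id_map(2)[OF X] o)
  qed
  show ?thesis
  proof (intro set_eqI iffI)
    fix R assume "R \<in> D_comp C X Y X (roof_rel C Y X `` {(Q, \<beta>, \<alpha>)}) (roof_rel C X Y `` {(Q, \<alpha>, \<beta>)})"
    then obtain U s f V t g T a b where U: "((Q, \<alpha>, \<beta>), (U, s, f)) \<in> roof_rel C X Y"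
      and V: "((Q, \<beta>, \<alpha>), (V, t, g)) \<in> roof_rel C Y X" and T: "bounded_cx C T"
      and a: "quasi_iso C T U a" and b: "chain_map C T V b"
      and h: "homotopic C T Y (chain_comp C f a) (chain_comp C t b)"
      and rel: "((T, chain_comp C s a, chain_comp C g b), R) \<in> roof_rel C X X"
      unfolding D_comp_def by blast
    have UR: "(U, s, f) \<in> roofs C X Y" and VR: "(V, t, g) \<in> roofs C Y X" using U V unfolding roof_rel_def by auto
    note u = roofsD[OF X Y UR] and v = roofsD[OF Y X VR]
    obtain Z' s' f' where R: "R = (Z', s', f')" by (cases R) auto
    have TR: "(T, chain_comp C s a, chain_comp C g b) \<in> roofs C X X" and RR: "(Z', s', f') \<in> roofs C X X"
      using rel unfolding roof_rel_def R by auto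
    have am': "chain_map C T U a" using a by (simp add: quasi_iso_def)
    note aq' = quasi_iso_qi[OF T u(1) a] and bm' = chain_map_cm[OF T v(1) b]
    note sa = chain_comp_rep[OF am' u(3)] and fa = chain_comp_rep[OF am' u(4)] and tb = chain_comp_rep[OF b v(3)] and gb = chain_comp_rep[OF b v(4)]
    have h': "HR.htp (hx T) (hx Y) (\<lambda>n. rep (f n) * rep (a n)) (\<lambda>n. rep (t n) * rep (b n))"
      using h homotopic_iff[OF T Y fa(2) tb(2)] by (simp add: fa(1) tb(1))
    obtain rU where rU: "HR.cm (hx Q) (hx U) rU" "HR.htp (hx Q) (hx X) (\<lambda>n. rep (s n) * rU n) (\<lambda>n. rep (\<alpha> n))"
      using roof_lift[OF X Y Q QP aq UR] .
    obtain rV where rV: "HR.cm (hx Q) (hx V) rV" "HR.htp (hx Q) (hx Y) (\<lambda>n. rep (t n) * rV n) (\<lambda>n. rep (\<beta> n))"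
      using roof_lift[OF Y X Q QP bq VR] .
    obtain r' where r': "HR.cm (hx Q) (hx Z') r'" "HR.htp (hx Q) (hx X) (\<lambda>n. rep (s' n) * r' n) (\<lambda>n. rep (\<alpha> n))"
      using roof_lift[OF X X Q QP aq RR] .
    have fU: "HR.htp (hx Q) (hx Y) (\<lambda>n. rep (\<beta> n)) (\<lambda>n. rep (f n) * rU n)"
      using roof_rel_iff[OF X Y Q QP aq RQ(1) UR i _ rU] HR.htp_refl[OF Qc Xc] U by (simp add: o)
    have gV: "HR.htp (hx Q) (hx X) (\<lambda>n. rep (\<alpha> n)) (\<lambda>n. rep (g n) * rV n)"
      using roof_rel_iff[OF Y X Q QP bq RQ(2) VR i _ rV] HR.htp_refl[OF Qc Yc] V by (simp add: o)
    \<comment> \<open>The lift to U is lifted further, to the corner T of the square.\<close>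
    obtain c where c: "HR.cm (hx Q) (hx T) c" "HR.htp (hx Q) (hx U) rU (\<lambda>n. rep (a n) * c n)"
      using HR.lift[OF bounded_bdd[OF Q] _ aq' bounded_hx[OF T] bounded_hx[OF u(1)] rU(1)] QP by auto
    have "HR.htp (hx Q) (hx Y) (\<lambda>n. rep (f n) * rU n) (\<lambda>n. rep (t n) * (rep (b n) * c n))"
      using HR.htp_trans[OF HR.htp_comp_left[OF c(2) u(7)]] HR.htp_comp_right[OF h' c(1)] by (simp add: mult.assoc)
    from HR.htp_trans[OF HR.htp_trans[OF rV(2) fU] this]
    have tb': "HR.htp (hx Q) (hx Y) (\<lambda>n. rep (t n) * (rep (b n) * c n)) (\<lambda>n. rep (t n) * rV n)" by (rule HR.htp_sym)
    have QP': "cx_ob (hx Q) n \<in> PR" for n using QP by simp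
    \<comment> \<open>Two lifts of \<open>\<beta>\<close> through the quasi-isomorphism t agree up
      to homotopy.\<close>
    have bcV: "HR.htp (hx Q) (hx V) (\<lambda>n. rep (b n) * c n) rV"
      using HR.lift_unique[OF bounded_bdd[OF Q] QP' v(5) bounded_hx[OF v(1)] Yc HR.cm_comp[OF c(1) bm'] rV(1) tb'] .
    have gb': "HR.htp (hx Q) (hx X) (\<lambda>n. rep (chain_comp C g b n) * c n) (\<lambda>n. rep (\<alpha> n))"
      using HR.htp_trans[OF HR.htp_comp_left[OF bcV v(7)] HR.htp_sym[OF gV]] by (simp add: gb(1) mult.assoc)
    have sc: "HR.htp (hx Q) (hx X) (\<lambda>n. rep (chain_comp C s a n) * c n) (\<lambda>n. rep (\<alpha> n))"
      using HR.htp_trans[OF HR.htp_sym[OF HR.htp_comp_left[OF c(2) u(6)]] rU(2)] by (simp add: sa(1) mult.assoc)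
    have "HR.htp (hx Q) (hx X) (\<lambda>n. rep (chain_comp C g b n) * c n) (\<lambda>n. rep (f' n) * r' n)"
      using roof_rel_iff[OF X X Q QP aq TR RR c(1) sc r'] rel R by blast
    then have "HR.htp (hx Q) (hx X) (\<lambda>n. rep (f' n) * r' n) (\<lambda>n. rep (\<alpha> n))"
      using HR.htp_trans[OF HR.htp_sym gb'] by blast
    then show "R \<in> D_id C X" using id_iff[OF RR r'] R by simp
  next
    fix R assume RD: "R \<in> D_id C X"
    obtain Z' s' f' where R: "R = (Z', s', f')" by (cases R) auto
    have RR: "(Z', s', f') \<in> roofs C X X" using RD unfolding D_id_def D_of_def roof_rel_def R by auto
    obtain r' where r': "HR.cm (hx Q) (hx Z') r'" "HR.htp (hx Q) (hx X) (\<lambda>n. rep (s' n) * r' n) (\<lambda>n. rep (\<alpha> n))"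
      using roof_lift[OF X X Q QP aq RR] .
    note k = HR.htp_sym[OF iffD1[OF id_iff[OF RR r'] RD[unfolded R]]]
    have ci: "chain_comp C \<alpha> (chain_id C Q) = \<alpha>" "chain_comp C \<beta> (chain_id C Q) = \<beta>"
      unfolding chain_comp_def chain_id_def
      using Comp_Ident[OF chain_mapD(1)[OF am]] Comp_Ident[OF chain_mapD(1)[OF bm]] by auto
    have "((Q, \<alpha>, \<alpha>), R) \<in> roof_rel C X X"
      using roof_rel_iff[OF X X Q QP aq RQ(3) RR i _ r'] HR.htp_refl[OF Qc Xc] k by (simp add: o R)
    moreover have "homotopic C Q Y \<beta> \<beta>"
      using homotopic_iff[OF Q Y chain_mapD(1)[OF bm] chain_mapD(1)[OF bm]] HR.htp_refl[OF Qc Yc] by simp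
    \<comment> \<open>The square is completed trivially: Q is the middle of both roofs, and T is Q
      with identity maps.\<close>
    ultimately show "R \<in> D_comp C X Y X (roof_rel C Y X `` {(Q, \<beta>, \<alpha>)}) (roof_rel C X Y `` {(Q, \<alpha>, \<beta>)})"
      unfolding D_comp_def
      using roof_rel_refl[OF X Y RQ(1)] roof_rel_refl[OF Y X RQ(2)] Q idq[OF Q] chain_id_map(1)[OF Q]
      by (intro CollectI exI[of _ Q] exI[of _ \<alpha>] exI[of _ \<beta>] exI[of _ "chain_id C Q"]) (simp add: ci)
  qed
qed

text \<open>A common projective resolution is a roof with two quasi-isomorphisms as legs; read
  backwards it gives the inverse.\<close>

lemma D_isomorphicI:
  assumes X: "bounded_cx C X" and Y: "bounded_cx C Y" and Q: "HR.bdd Q" and QP: "\<And>n. cx_ob Q n \<in> PR"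
    and a: "HR.qi Q (hx X) a" and b: "HR.qi Q (hx Y) b"
  shows "D_isomorphic C X Y"
proof -
  obtain Q0 where Q0: "bounded_cx C Q0" "hx Q0 = Q" using bdd_bounded[OF Q] .
  have QP0: "cx_ob Q0 n \<in> PR" for n using QP[of n] by (simp flip: Q0(2))
  obtain \<alpha> where al: "chain_map C Q0 X \<alpha>" "\<And>n. rep (\<alpha> n) = a n" using cm_chain_map[OF Q0(1) X] HR.qi_cm[OF a] Q0(2) by metis
  obtain \<beta> where be: "chain_map C Q0 Y \<beta>" "\<And>n. rep (\<beta> n) = b n" using cm_chain_map[OF Q0(1) Y] HR.qi_cm[OF b] Q0(2) by metis
  have q: "quasi_iso C Q0 X \<alpha>" "quasi_iso C Q0 Y \<beta>"
    using quasi_iso_iff[OF Q0(1) X al(1)] quasi_iso_iff[OF Q0(1) Y be(1)] a b by (simp_all add: Q0(2) al(2) be(2))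
  let ?F = "roof_rel C X Y `` {(Q0, \<alpha>, \<beta>)}" and ?G = "roof_rel C Y X `` {(Q0, \<beta>, \<alpha>)}"
  have "?F \<in> D_Hom C X Y" "?G \<in> D_Hom C Y X"
    unfolding D_Hom_def using q Q0(1) al(1) be(1) by (auto intro!: quotientI simp: roofs_def)
  then have "D_iso_arr C X Y ?F"
    unfolding D_iso_arr_def using D_comp_inverse[OF X Y Q0(1) QP0 q] D_comp_inverse[OF Y X Q0(1) QP0 q(2,1)] by blast
  then show ?thesis using X Y unfolding D_isomorphic_def by blast
qed

end

section \<open>Direct sums and zigzags\<close>

context hom_ring
begin

definition dsum :: "'i set \<Rightarrow> ('i \<Rightarrow> 'o) \<Rightarrow> 'o \<Rightarrow> ('i \<Rightarrow> 'u) \<Rightarrow> bool" where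
  "dsum I X S \<iota> \<longleftrightarrow> finite I \<and> S \<in> Ob \<and> (\<forall>i \<in> I. \<iota> i \<in> H (X i) S) \<and>
    (\<forall>T \<in> Ob. \<forall>g. (\<forall>i \<in> I. g i \<in> H (X i) T) \<longrightarrow> (\<exists>!h. h \<in> H S T \<and> (\<forall>i \<in> I. h * \<iota> i = g i)))"

lemma dsumD:
  assumes "dsum I X S \<iota>"
  shows "finite I" "S \<in> Ob" "i \<in> I \<Longrightarrow> \<iota> i \<in> H (X i) S" "i \<in> I \<Longrightarrow> X i \<in> Ob"
    "(\<And>i. i \<in> I \<Longrightarrow> g i \<in> H (X i) T) \<Longrightarrow> T \<in> Ob \<Longrightarrow> \<exists>h \<in> H S T. \<forall>i \<in> I. h * \<iota> i = g i"
    "h \<in> H S T \<Longrightarrow> k \<in> H S T \<Longrightarrow> (\<And>i. i \<in> I \<Longrightarrow> h * \<iota> i = k * \<iota> i) \<Longrightarrow> h = k"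
proof -
  show "finite I" "S \<in> Ob" "i \<in> I \<Longrightarrow> \<iota> i \<in> H (X i) S" using assms by (auto simp: dsum_def)
  then show "i \<in> I \<Longrightarrow> X i \<in> Ob" using H_Ob by blast
  show "\<exists>h \<in> H S T. \<forall>i \<in> I. h * \<iota> i = g i" if "\<And>i. i \<in> I \<Longrightarrow> g i \<in> H (X i) T" "T \<in> Ob"
    using assms that unfolding dsum_def by blast
  show "h = k" if h: "h \<in> H S T" and k: "k \<in> H S T" and e: "\<And>i. i \<in> I \<Longrightarrow> h * \<iota> i = k * \<iota> i"
  proof -
    have "\<forall>i \<in> I. h * \<iota> i \<in> H (X i) T" using assms h mult_H unfolding dsum_def by blast
    moreover have "T \<in> Ob" using H_Ob[OF h] by blast
    ultimately have "\<exists>!k. k \<in> H S T \<and> (\<forall>i \<in> I. k * \<iota> i = h * \<iota> i)" using assms unfolding dsum_def by (auto elim: allE)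
    then show ?thesis using h k e by metis
  qed
qed

lemma dsumI:
  assumes "finite I" "S \<in> Ob" "\<And>i. i \<in> I \<Longrightarrow> \<iota> i \<in> H (X i) S"
    and ex: "\<And>T g. T \<in> Ob \<Longrightarrow> (\<And>i. i \<in> I \<Longrightarrow> g i \<in> H (X i) T) \<Longrightarrow> \<exists>h \<in> H S T. \<forall>i \<in> I. h * \<iota> i = g i"
    and un: "\<And>T h k. h \<in> H S T \<Longrightarrow> k \<in> H S T \<Longrightarrow> (\<And>i. i \<in> I \<Longrightarrow> h * \<iota> i = k * \<iota> i) \<Longrightarrow> h = k"
  shows "dsum I X S \<iota>"
  unfolding dsum_def
proof (intro conjI ballI allI impI)
  fix T and g :: "_ \<Rightarrow> 'u" assume T: "T \<in> Ob" and g: "\<forall>i \<in> I. g i \<in> H (X i) T"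
  obtain h where h: "h \<in> H S T" "\<forall>i \<in> I. h * \<iota> i = g i" using ex[OF T, of g] g by blast
  show "\<exists>!h. h \<in> H S T \<and> (\<forall>i \<in> I. h * \<iota> i = g i)"
  proof (rule ex1I[of _ h])
    fix k assume "k \<in> H S T \<and> (\<forall>i \<in> I. k * \<iota> i = g i)"
    then show "k = h" using un[of k T h] h by simp
  qed (use h in simp)
qed (use assms in auto)

lemma bp_copair:
  assumes a: "a \<in> H A T" and b: "b \<in> H B T"
  shows "a * pr1 A B + b * pr2 A B \<in> H (bp A B) T" "(a * pr1 A B + b * pr2 A B) * in1 A B = a"
    "(a * pr1 A B + b * pr2 A B) * in2 A B = b"
  using H_Ob[OF a] H_Ob[OF b] mult_one[OF a] mult_one[OF b] mult_H[OF pr1_H a] mult_H[OF pr2_H b]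
  by (auto simp: distrib_right mult.assoc)

lemma dsum_empty: "dsum {} X zo \<iota>"
proof (rule dsumI)
  show "\<exists>h \<in> H zo T. \<forall>i \<in> {}. h * \<iota> i = g i" if "T \<in> Ob" for T g
    using that by (intro bexI[of _ 0]) auto
  show "h = k" if "h \<in> H zo T" "k \<in> H zo T" for T h k
    using from_zob[OF zob_zo that(1)] from_zob[OF zob_zo that(2)] by simp
qed auto

lemma dsum_Un:
  assumes I: "dsum I X S \<iota>" and J: "dsum J X S' \<iota>'" and d: "I \<inter> J = {}"
  shows "dsum (I \<union> J) X (bp S S') (\<lambda>i. if i \<in> I then in1 S S' * \<iota> i else in2 S S' * \<iota>' i)"
proof -
  note i = dsumD[OF I] and j = dsumD[OF J]
  let ?k = "\<lambda>i. if i \<in> I then in1 S S' * \<iota> i else in2 S S' * \<iota>' i"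
  show ?thesis
  proof (rule dsumI)
    show "finite (I \<union> J)" "bp S S' \<in> Ob" using i(1,2) j(1,2) by auto
    show "?k x \<in> H (X x) (bp S S')" if "x \<in> I \<union> J" for x
      using that mult_H[OF i(3) in1_H[OF i(2) j(2)]] mult_H[OF j(3) in2_H[OF i(2) j(2)]] by auto
  next
    fix T g assume T: "T \<in> Ob" and g: "\<And>x. x \<in> I \<union> J \<Longrightarrow> g x \<in> H (X x) T"
    obtain a where a: "a \<in> H S T" "\<forall>x \<in> I. a * \<iota> x = g x" using i(5)[of g T] T g by blast
    obtain b where b: "b \<in> H S' T" "\<forall>x \<in> J. b * \<iota>' x = g x" using j(5)[of g T] T g by blast
    note c = bp_copair[OF a(1) b(1)]
    show "\<exists>h \<in> H (bp S S') T. \<forall>x \<in> I \<union> J. h * ?k x = g x"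
      using c(1) a(2) b(2) mult_eq_assoc[OF c(2)] mult_eq_assoc[OF c(3)] by (intro bexI[OF _ c(1)]) auto
  next
    fix T h k assume h: "h \<in> H (bp S S') T" and k: "k \<in> H (bp S S') T" and e: "\<And>x. x \<in> I \<union> J \<Longrightarrow> h * ?k x = k * ?k x"
    have e1: "h * in1 S S' * \<iota> x = k * in1 S S' * \<iota> x" if "x \<in> I" for x
      using e[of x] that by (simp add: mult.assoc)
    have e2: "h * in2 S S' * \<iota>' x = k * in2 S S' * \<iota>' x" if "x \<in> J" for x
    proof -
      have "x \<notin> I" using that d by blast
      then show ?thesis using e[of x] that by (simp add: mult.assoc)
    qed
    have "h * in1 S S' = k * in1 S S'"
      by (rule i(6)[OF mult_H[OF in1_H[OF i(2) j(2)] h] mult_H[OF in1_H[OF i(2) j(2)] k] e1])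
    moreover have "h * in2 S S' = k * in2 S S'"
      by (rule j(6)[OF mult_H[OF in2_H[OF i(2) j(2)] h] mult_H[OF in2_H[OF i(2) j(2)] k] e2])
    ultimately show "h = k" using bp_eqI[OF h k i(2) j(2)] by blast
  qed
qed

lemma dsum_singleton: assumes "A \<in> Ob" shows "dsum {i} (\<lambda>_. A) A (\<lambda>_. one A)"
proof (rule dsumI)
  show "\<exists>h \<in> H A T. \<forall>j \<in> {i}. h * one A = g j" if "\<And>j. j \<in> {i} \<Longrightarrow> g j \<in> H A T" for T g
    using that[of i] mult_one by (intro bexI[of _ "g i"]) auto
  show "h = k" if "h \<in> H A T" "k \<in> H A T" "\<And>j. j \<in> {i} \<Longrightarrow> h * one A = k * one A" for T h k
    using that(3)[of i] mult_one[OF that(1)] mult_one[OF that(2)] by simp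
qed (use assms in auto)

lemma dsum_cong: "dsum I X S \<iota> \<Longrightarrow> (\<And>i. i \<in> I \<Longrightarrow> X i = Y i) \<Longrightarrow> dsum I Y S \<iota>"
  unfolding dsum_def by (simp cong: ball_cong)

lemma dsum_reindex:
  assumes D: "dsum J (\<lambda>_. A) S \<iota>" and b: "bij_betw \<sigma> K J"
  shows "dsum K (\<lambda>_. A) S (\<lambda>i. \<iota> (\<sigma> i))"
proof -
  note d = dsumD[OF D]
  have s: "\<sigma> i \<in> J" if "i \<in> K" for i using b that by (auto simp: bij_betw_def)
  show ?thesis
  proof (rule dsumI)
    show "finite K" using d(1) bij_betw_finite[OF b] by simp
    show "\<exists>h \<in> H S T. \<forall>i \<in> K. h * \<iota> (\<sigma> i) = g i" if T: "T \<in> Ob" and g: "\<And>i. i \<in> K \<Longrightarrow> g i \<in> H A T" for T g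
    proof -
      have inv: "inv_into K \<sigma> j \<in> K" if "j \<in> J" for j using b that inv_into_into[of j \<sigma> K] by (auto simp: bij_betw_def)
      obtain h where h: "h \<in> H S T" "\<forall>j \<in> J. h * \<iota> j = g (inv_into K \<sigma> j)" using d(5)[of "\<lambda>j. g (inv_into K \<sigma> j)" T] T g inv by blast
      have "h * \<iota> (\<sigma> i) = g i" if "i \<in> K" for i
        using h(2) s[OF that] b that inv_into_f_f[of \<sigma> K i] by (auto simp: bij_betw_def)
      then show ?thesis using h(1) by blast
    qed
    show "h = k" if h: "h \<in> H S T" and k: "k \<in> H S T" and e: "\<And>i. i \<in> K \<Longrightarrow> h * \<iota> (\<sigma> i) = k * \<iota> (\<sigma> i)" for T h k
    proof (rule d(6)[OF h k])
      fix j assume "j \<in> J"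
      then obtain i where "i \<in> K" "j = \<sigma> i" using b by (auto simp: bij_betw_def)
      then show "h * \<iota> j = k * \<iota> j" using e by simp
    qed
  qed (use d s in auto)
qed

text \<open>Used to add two BGG complexes, whose terms are sums over the same index set.\<close>

lemma dsum_bp:
  assumes D: "dsum I X S \<iota>" and D': "dsum I X' S' \<iota>'"
  shows "dsum I (\<lambda>i. bp (X i) (X' i)) (bp S S')
    (\<lambda>i. in1 S S' * (\<iota> i * pr1 (X i) (X' i)) + in2 S S' * (\<iota>' i * pr2 (X i) (X' i)))"
proof -
  note d = dsumD[OF D] and d' = dsumD[OF D']
  let ?k = "\<lambda>i. in1 S S' * (\<iota> i * pr1 (X i) (X' i)) + in2 S S' * (\<iota>' i * pr2 (X i) (X' i))"
  have k: "?k i = in1 S S' * \<iota> i * pr1 (X i) (X' i) + in2 S S' * \<iota>' i * pr2 (X i) (X' i)" for i by (simp add: mult.assoc)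
  have c: "?k i \<in> H (bp (X i) (X' i)) (bp S S')" "?k i * in1 (X i) (X' i) = in1 S S' * \<iota> i"
    "?k i * in2 (X i) (X' i) = in2 S S' * \<iota>' i" if "i \<in> I" for i
    unfolding k using bp_copair[OF mult_H[OF d(3)[OF that] in1_H[OF d(2) d'(2)]] mult_H[OF d'(3)[OF that] in2_H[OF d(2) d'(2)]]] by auto
  show ?thesis
  proof (rule dsumI)
    show "finite I" "bp S S' \<in> Ob" using d(1,2) d'(2) by auto
    show "?k i \<in> H (bp (X i) (X' i)) (bp S S')" if "i \<in> I" for i using c(1)[OF that] .
  next
    fix T g assume T: "T \<in> Ob" and g: "\<And>i. i \<in> I \<Longrightarrow> g i \<in> H (bp (X i) (X' i)) T"
    have "g i * in1 (X i) (X' i) \<in> H (X i) T" "g i * in2 (X i) (X' i) \<in> H (X' i) T" if "i \<in> I" for i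
      using mult_H[OF in1_H g] mult_H[OF in2_H g] d(4) d'(4) that by auto
    then obtain a b where a: "a \<in> H S T" "\<forall>i \<in> I. a * \<iota> i = g i * in1 (X i) (X' i)"
      and b: "b \<in> H S' T" "\<forall>i \<in> I. b * \<iota>' i = g i * in2 (X i) (X' i)"
      using d(5)[of "\<lambda>i. g i * in1 (X i) (X' i)" T] d'(5)[of "\<lambda>i. g i * in2 (X i) (X' i)" T] T by blast
    note h = bp_copair[OF a(1) b(1)]
    let ?h = "a * pr1 S S' + b * pr2 S S'"
    have "?h * ?k i = g i" if i: "i \<in> I" for i
    proof (rule bp_eqI[OF mult_H[OF c(1)[OF i] h(1)] g[OF i] d(4)[OF i] d'(4)[OF i]])
      show "?h * ?k i * in1 (X i) (X' i) = g i * in1 (X i) (X' i)"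
        using c(2)[OF i] mult_eq_assoc[OF h(2), of "\<iota> i"] a(2) i by (simp add: mult.assoc)
      show "?h * ?k i * in2 (X i) (X' i) = g i * in2 (X i) (X' i)"
        using c(3)[OF i] mult_eq_assoc[OF h(3), of "\<iota>' i"] b(2) i by (simp add: mult.assoc)
    qed
    then show "\<exists>h \<in> H (bp S S') T. \<forall>i \<in> I. h * ?k i = g i" using h(1) by blast
  next
    fix T h k assume h: "h \<in> H (bp S S') T" and k: "k \<in> H (bp S S') T" and e: "\<And>i. i \<in> I \<Longrightarrow> h * ?k i = k * ?k i"
    have e1: "h * in1 S S' * \<iota> i = k * in1 S S' * \<iota> i" if "i \<in> I" for i
    proof -
      have "h * ?k i * in1 (X i) (X' i) = k * ?k i * in1 (X i) (X' i)" using e[OF that] by simp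
      then show ?thesis using c(2)[OF that] by (simp only: mult.assoc)
    qed
    have e2: "h * in2 S S' * \<iota>' i = k * in2 S S' * \<iota>' i" if "i \<in> I" for i
    proof -
      have "h * ?k i * in2 (X i) (X' i) = k * ?k i * in2 (X i) (X' i)" using e[OF that] by simp
      then show ?thesis using c(3)[OF that] by (simp only: mult.assoc)
    qed
    have o: "S \<in> Ob" "S' \<in> Ob" using d(2) d'(2) .
    show "h = k"
      using bp_eqI[OF h k o] d(6)[OF mult_H[OF in1_H[OF o] h] mult_H[OF in1_H[OF o] k] e1]
        d'(6)[OF mult_H[OF in2_H[OF o] h] mult_H[OF in2_H[OF o] k] e2] by blast
  qed
qed

text \<open>An induction principle: a finite direct sum is isomorphic to an iterated biproduct of
  its summands.\<close>

lemma dsum_property: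
  assumes D: "dsum I X S \<iota>" and p: "\<And>i. i \<in> I \<Longrightarrow> p (X i)"
    and z: "p zo" and b: "\<And>A B. A \<in> Ob \<Longrightarrow> B \<in> Ob \<Longrightarrow> p A \<Longrightarrow> p B \<Longrightarrow> p (bp A B)"
    and iso: "\<And>A B u v. p A \<Longrightarrow> u \<in> H A B \<Longrightarrow> v \<in> H B A \<Longrightarrow> v * u = one A \<Longrightarrow> u * v = one B \<Longrightarrow> p B"
  shows "p S"
proof -
  note d = dsumD[OF D]
  have "\<exists>S' \<iota>'. dsum J X S' \<iota>' \<and> p S'" if "finite J" "J \<subseteq> I" for J
    using that
  proof (induction J)
    case empty
    then show ?case using dsum_empty z by blast
  next
    case (insert i J)
    then obtain S' \<iota>' where S': "dsum J X S' \<iota>'" "p S'" by blast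
    have iI: "i \<in> I" using insert.prems by simp
    have i: "dsum {i} X (X i) (\<lambda>_. one (X i))"
      using dsum_singleton[OF d(4)[OF iI], of i] by (rule dsum_cong) simp
    have "p (bp (X i) S')" using b[OF d(4)[OF iI] dsumD(2)[OF S'(1)] p[OF iI] S'(2)] .
    moreover have "\<exists>\<kappa>. dsum (insert i J) X (bp (X i) S') \<kappa>" using dsum_Un[OF i S'(1)] insert.hyps by auto
    ultimately show ?case by blast
  qed
  then obtain S' \<iota>' where S': "dsum I X S' \<iota>'" "p S'" using d(1) by blast
  note d' = dsumD[OF S'(1)]
  obtain u where u: "u \<in> H S' S" "\<forall>i \<in> I. u * \<iota>' i = \<iota> i" using d'(5)[of \<iota> S] d(2,3) by blast
  obtain v where v: "v \<in> H S S'" "\<forall>i \<in> I. v * \<iota> i = \<iota>' i" using d(5)[of \<iota>' S'] d'(2,3) by blast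
  have "v * u = one S'"
    by (rule d'(6)[OF mult_H[OF u(1) v(1)] one_H[OF d'(2)]]) (use u(2) v(2) one_mult[OF d'(3)] in \<open>simp add: mult.assoc\<close>)
  moreover have "u * v = one S"
    by (rule d(6)[OF mult_H[OF v(1) u(1)] one_H[OF d(2)]]) (use u(2) v(2) one_mult[OF d(3)] in \<open>simp add: mult.assoc\<close>)
  ultimately show ?thesis using iso[OF S'(2) u(1) v(1)] by blast
qed

text \<open>The diagonal map with entries q' and q'' commutes with the twisted differentials because
  condition \<open>c\<close> holds strictly and not just up to homotopy. \<open>five_lemma\<close>
  does the rest.\<close>

lemma tw_map:
  assumes Q': "cx Q'" and Q'': "cx Q''" and B': "cx B'" and B'': "cx B''"
    and psi: "anti Q'' Q' \<psi>" and g: "anti B'' B' g" and q': "qi Q' B' q'" and q'': "qi Q'' B'' q''"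
    and c: "\<And>n. q' (n + 1) * \<psi> n = g n * q'' n"
  obtains \<theta> where "qi (tw Q' Q'' \<psi>) (tw B' B'' g) \<theta>"
proof -
  note T = tw_dsplit[OF Q' Q'' psi] and U = tw_dsplit[OF B' B'' g]
  note Td = dsplitD[OF T(1)] and Ud = dsplitD[OF U(1)]
  note qm = qi_cm[OF q'] and qm' = qi_cm[OF q'']
  note Ob = cx_Ob[OF Q'] cx_Ob[OF Q''] cx_Ob[OF B'] cx_Ob[OF B'']
  define \<theta> where "\<theta> n = ti1 B' B'' n * q' n * tp1 Q' Q'' n + ti2 B' B'' n * q'' n * tp2 Q' Q'' n" for n
  have a: "ti1 B' B'' n * q' n \<in> H (cx_ob Q' n) (bp (cx_ob B' n) (cx_ob B'' n))"
    and b: "ti2 B' B'' n * q'' n \<in> H (cx_ob Q'' n) (bp (cx_ob B' n) (cx_ob B'' n))" for n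
    using mult_H[OF cm_H[OF qm] in1_H] mult_H[OF cm_H[OF qm'] in2_H] Ob by auto
  have t: "\<theta> n \<in> H (bp (cx_ob Q' n) (cx_ob Q'' n)) (bp (cx_ob B' n) (cx_ob B'' n))"
    "\<theta> n * ti1 Q' Q'' n = ti1 B' B'' n * q' n" "\<theta> n * ti2 Q' Q'' n = ti2 B' B'' n * q'' n" for n
    unfolding \<theta>_def using bp_copair[OF a b] by auto
  have "\<theta> (n + 1) * cx_d (tw Q' Q'' \<psi>) n = cx_d (tw B' B'' g) n * \<theta> n" for n
  proof (rule bp_eqI)
    show "\<theta> (n + 1) * cx_d (tw Q' Q'' \<psi>) n \<in> H (bp (cx_ob Q' n) (cx_ob Q'' n)) (bp (cx_ob B' (n + 1)) (cx_ob B'' (n + 1)))"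
      "cx_d (tw B' B'' g) n * \<theta> n \<in> H (bp (cx_ob Q' n) (cx_ob Q'' n)) (bp (cx_ob B' (n + 1)) (cx_ob B'' (n + 1)))"
      using mult_H[OF cx_H[OF Td(2), of n, unfolded T(4)] t(1)] mult_H[OF t(1) cx_H[OF Ud(2), of n, unfolded U(4)]] by auto
    have "\<theta> (n + 1) * (ti1 Q' Q'' (n + 1) * cx_d Q' n) = ti1 B' B'' (n + 1) * (cx_d B' n * q' n)"
      using mult_eq_assoc[OF t(2), of "n + 1" "cx_d Q' n"] cm_d[OF qm] by (simp add: mult.assoc)
    also have "\<dots> = cx_d (tw B' B'' g) n * (ti1 B' B'' n * q' n)"
      using mult_eq_assoc[OF U(2), of n "q' n"] by (simp add: mult.assoc)
    finally show "\<theta> (n + 1) * cx_d (tw Q' Q'' \<psi>) n * ti1 Q' Q'' n = cx_d (tw B' B'' g) n * \<theta> n * ti1 Q' Q'' n"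
      by (simp add: mult.assoc T(2) t(2))
    have "\<theta> (n + 1) * (ti1 Q' Q'' (n + 1) * \<psi> n + ti2 Q' Q'' (n + 1) * cx_d Q'' n) =
      ti1 B' B'' (n + 1) * (g n * q'' n) + ti2 B' B'' (n + 1) * (cx_d B'' n * q'' n)"
      using mult_eq_assoc[OF t(2), of "n + 1" "\<psi> n"] mult_eq_assoc[OF t(3), of "n + 1" "cx_d Q'' n"] cm_d[OF qm'] c
      by (simp add: mult.assoc distrib_left)
    also have "\<dots> = cx_d (tw B' B'' g) n * (ti2 B' B'' n * q'' n)"
      using mult_eq_assoc[OF U(3), of n "q'' n"] by (simp add: mult.assoc distrib_right)
    finally show "\<theta> (n + 1) * cx_d (tw Q' Q'' \<psi>) n * ti2 Q' Q'' n = cx_d (tw B' B'' g) n * \<theta> n * ti2 Q' Q'' n"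
      by (simp add: mult.assoc T(3) t(3))
  qed (use Ob in auto)
  then have "cm (tw Q' Q'' \<psi>) (tw B' B'' g) \<theta>" using t(1) by (simp add: cm_def T(4) U(4))
  moreover have "tp2 B' B'' n * \<theta> n = q'' n * tp2 Q' Q'' n" for n
    using Ob one_mult[OF cm_H[OF qm'], of n]
    by (simp add: \<theta>_def distrib_left mult_eq_assoc[OF pr2_in2] mult_zero_cancel[OF pr2_in1] mult.assoc)
       (simp flip: mult.assoc)
  ultimately show ?thesis using that five_lemma[OF T(1) U(1) _ t(2) _ q' q''] by blast
qed

text \<open>The sign is a boolean of its own, which keeps parity computations out of the chases; it
  is set to \<open>even m\<close> when derived shifts are translated.\<close>

definition shift_by :: "bool \<Rightarrow> int \<Rightarrow> ('o, 'u) cochain \<Rightarrow> ('o, 'u) cochain" where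
  "shift_by e m X = \<lparr>cx_ob = (\<lambda>n. cx_ob X (n + m)), cx_d = (\<lambda>n. if e then cx_d X (n + m) else - cx_d X (n + m))\<rparr>"

lemma shift_by_simps: "cx_ob (shift_by e m X) n = cx_ob X (n + m)"
  "cx_d (shift_by e m X) n = (if e then cx_d X (n + m) else - cx_d X (n + m))"
  by (simp_all add: shift_by_def)

lemma shift_by_sh: "shift_by e m (sh X) = sh (shift_by e m X)"
  by (simp add: shift_by_def sh_def fun_eq_iff add_ac)

lemma shift_by_index: "n + 1 + m = n + m + (1 :: int)" by simp

lemma cx_shift_by: assumes "cx X" shows "cx (shift_by e m X)"
  unfolding cx_def shift_by_simps shift_by_index using cx_H[OF assms] cx_dd[OF assms] by simp

lemma bdd_shift_by: assumes "bdd X" shows "bdd (shift_by e m X)"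
proof -
  obtain a b where ab: "\<And>n. n < a \<or> b < n \<Longrightarrow> zob (cx_ob X n)" using assms by (auto simp: bdd_def)
  have "zob (cx_ob (shift_by e m X) n)" if "n < a - m \<or> b - m < n" for n
    unfolding shift_by_simps by (rule ab) (use that in linarith)
  then show ?thesis using cx_shift_by[OF bdd_cx[OF assms]] unfolding bdd_def by blast
qed

lemma cm_shift_by: assumes "cm X Y f" shows "cm (shift_by e m X) (shift_by e m Y) (\<lambda>n. f (n + m))"
  unfolding cm_def shift_by_simps shift_by_index using cm_H[OF assms] cm_d[OF assms] by simp

lemma dsplit_shift_by:
  assumes "dsplit X' X X'' i p j r"
  shows "dsplit (shift_by e m X') (shift_by e m X) (shift_by e m X'') (\<lambda>n. i (n + m)) (\<lambda>n. p (n + m)) (\<lambda>n. j (n + m)) (\<lambda>n. r (n + m))"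
  using assms cx_shift_by cm_shift_by unfolding dsplit_def shift_by_simps by blast

lemma qi_shift_by: assumes q: "qi X Y f" shows "qi (shift_by e m X) (shift_by e m Y) (\<lambda>n. f (n + m))"
proof (rule qiI[OF cm_shift_by[OF qi_cm[OF q]]])
  let ?s = "\<lambda>x :: 'u. if e then x else - x"
  have s: "?s (?s x) = x" "?s (x * y) = ?s x * y" "?s x * y = x * ?s y" "?s x = 0 \<longleftrightarrow> x = 0" for x y by auto
  fix P n x y assume P: "P \<in> PR" and x: "x \<in> H P (cx_ob (shift_by e m X) (n + 1))" and y: "y \<in> H P (cx_ob (shift_by e m Y) n)"
    and dx: "cx_d (shift_by e m X) (n + 1) * x = 0" and fx: "f (n + 1 + m) * x = cx_d (shift_by e m Y) n * y"
  have "x \<in> H P (cx_ob X (n + m + 1))" "?s y \<in> H P (cx_ob Y (n + m))" "cx_d X (n + m + 1) * x = 0"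
    "f (n + m + 1) * x = cx_d Y (n + m) * ?s y"
    using x y dx fx unfolding shift_by_simps shift_by_index by (auto split: if_splits)
  then obtain x' where x': "x' \<in> H P (cx_ob X (n + m))" "x = cx_d X (n + m) * x'"
    using q P unfolding qi_def qinj_def by blast
  have "x = cx_d (shift_by e m X) n * ?s x'" "?s x' \<in> H P (cx_ob (shift_by e m X) n)" using x' by (simp_all add: shift_by_simps)
  then show "\<exists>x' \<in> H P (cx_ob (shift_by e m X) n). x = cx_d (shift_by e m X) n * x'" by blast
next
  let ?s = "\<lambda>x :: 'u. if e then x else - x"
  fix P n y assume P: "P \<in> PR" and y: "y \<in> H P (cx_ob (shift_by e m Y) (n + 1))" and dy: "cx_d (shift_by e m Y) (n + 1) * y = 0"
  have "y \<in> H P (cx_ob Y (n + m + 1))" "cx_d Y (n + m + 1) * y = 0"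
    using y dy unfolding shift_by_simps shift_by_index by (auto split: if_splits)
  then obtain x y' where x: "x \<in> H P (cx_ob X (n + m + 1))" "y' \<in> H P (cx_ob Y (n + m))" "cx_d X (n + m + 1) * x = 0"
    "y = f (n + m + 1) * x + cx_d Y (n + m) * y'" using q P unfolding qi_def qsur_def by blast
  have "x \<in> H P (cx_ob (shift_by e m X) (n + 1))" "?s y' \<in> H P (cx_ob (shift_by e m Y) n)" "cx_d (shift_by e m X) (n + 1) * x = 0"
    "y = f (n + 1 + m) * x + cx_d (shift_by e m Y) n * ?s y'"
    using x unfolding shift_by_simps shift_by_index by simp_all
  then show "\<exists>x \<in> H P (cx_ob (shift_by e m X) (n + 1)). \<exists>y' \<in> H P (cx_ob (shift_by e m Y) n).
    cx_d (shift_by e m X) (n + 1) * x = 0 \<and> y = f (n + 1 + m) * x + cx_d (shift_by e m Y) n * y'" by blast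
qed

section \<open>Zigzags, transfer of resolutions, and the twisted extension\<close>

definition zigzag :: "('o, 'u) cochain \<Rightarrow> ('o, 'u) cochain \<Rightarrow> bool" where
  "zigzag X Y \<longleftrightarrow> cx X \<and> cx Y \<and> (\<exists>Z s f. cx Z \<and> qi Z X s \<and> qi Z Y f)"

lemma zigzag_sym: "zigzag X Y \<Longrightarrow> zigzag Y X" by (auto simp: zigzag_def)

lemma zigzag_shift_by: "zigzag X Y \<Longrightarrow> zigzag (shift_by e m X) (shift_by e m Y)"
  unfolding zigzag_def using cx_shift_by qi_shift_by by blast

text \<open>A substitute for an isomorphism from X to Y in the derived category. In this form
  transitivity is immediate, while composing zigzags would require completing squares.\<close>

definition resolvable_via :: "('o, 'u) cochain \<Rightarrow> ('o, 'u) cochain \<Rightarrow> bool" where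
  "resolvable_via Y X \<longleftrightarrow> (\<forall>Q a. bdd Q \<longrightarrow> (\<forall>n. cx_ob Q n \<in> PR) \<longrightarrow> qi Q X a \<longrightarrow> (\<exists>b. qi Q Y b))"

lemma resolvable_viaD:
  assumes "resolvable_via Y X" "bdd Q" "\<And>n. cx_ob Q n \<in> PR" "qi Q X a"
  obtains b where "qi Q Y b"
  using assms unfolding resolvable_via_def by blast

lemma resolvable_via_trans: "resolvable_via Z Y \<Longrightarrow> resolvable_via Y X \<Longrightarrow> resolvable_via Z X"
  unfolding resolvable_via_def by blast

text \<open>Projectivity lifts the resolution through the left leg. By two out of three the lift is
  a quasi-isomorphism, and it is composed with the right leg.\<close>

lemma zigzag_resolvable: assumes z: "zigzag X Y" shows "resolvable_via Y X"
  unfolding resolvable_via_def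
proof (intro allI impI)
  fix Q a assume Q: "bdd Q" and P: "\<forall>n. cx_ob Q n \<in> PR" and a: "qi Q X a"
  have QP: "cx_ob Q n \<in> PR" for n using P by blast
  obtain Z s f where Z: "cx X" "cx Y" "cx Z" "qi Z X s" "qi Z Y f" using z by (auto simp: zigzag_def)
  obtain r where r: "cm Q Z r" "htp Q X a (\<lambda>n. s n * r n)" using lift[OF Q QP Z(4,3,1) qi_cm[OF a]] .
  have "qi Q X (\<lambda>n. s n * r n)" using qi_htp[OF a r(2) cm_comp[OF r(1) qi_cm[OF Z(4)]] bdd_cx[OF Q] Z(1)] .
  then have "qi Q Z r" using qi_cancel_left[OF Z(4) _ r(1) Z(3)] by blast
  then show "\<exists>b. qi Q Y b" using qi_comp[OF _ Z(5)] by blast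
qed

text \<open>The resolutions of B' and B'' also resolve X and K, so Y is resolved by a twisted
  extension of them with twist \<open>\<psi>\<close>. Pushed to B' by q', the twist descends along
  q'' to a twist g, and the same complex of projectives resolves the extension of B'' by B' twisted
  by g.\<close>

lemma twisted_extension_resolution:
  assumes D: "dsplit Y K (sh X) i p j r" and X: "cx X"
    and B': "bdd B'" and B'': "bdd B''"
    and obj': "\<And>n. cx_ob B' n \<in> resolved_objs PR (vanishing B' n)" and obj'': "\<And>n. cx_ob B'' n \<in> resolved_objs PR (vanishing B' n)"
    and rX: "resolvable_via X B'" and rK: "resolvable_via K B''"
  obtains g Q a b where "anti B'' B' g" "bdd Q" "\<And>n. cx_ob Q n \<in> PR" "qi Q Y a" "qi Q (tw B' B'' g) b"
proof -
  note B'c = bdd_cx[OF B'] and B''c = bdd_cx[OF B'']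
  obtain Q' q' where Q': "good_res B' B' Q' q'" using good_resolution[OF B'c B' obj'] .
  obtain Q'' q'' where Q'': "good_res B' B'' Q'' q''" using good_resolution[OF B'c B'' obj''] .
  have b': "bdd Q'" and P': "\<And>n. cx_ob Q' n \<in> PR" and s': "qi Q' B' q'" using Q' by (auto simp: good_res_def)
  have b'': "bdd Q''" and P'': "\<And>n. cx_ob Q'' n \<in> PR" and s'': "qi Q'' B'' q''"
    and sur: "\<And>n P x. P \<in> PR \<Longrightarrow> x \<in> H P (cx_ob B'' n) \<Longrightarrow> \<exists>y \<in> H P (cx_ob Q'' n). x = q'' n * y"
    and fac: "\<And>\<phi> n. anti Q'' B' \<phi> \<Longrightarrow> \<exists>g \<in> H (cx_ob B'' n) (cx_ob B' (n + 1)). \<phi> n = g * q'' n"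
    using Q'' by (auto simp: good_res_def)
  obtain a where a: "qi Q' X a" using resolvable_viaD[OF rX b' P' s'] .
  obtain k where k: "qi Q'' K k" using resolvable_viaD[OF rK b'' P'' s''] .
  obtain \<psi> \<theta> where psi: "anti Q'' Q' \<psi>" and th: "qi (tw Q' Q'' \<psi>) Y \<theta>"
    using fibre_resolution[OF D X b' b'' P'' a k] .
  note q'm = qi_cm[OF s'] and q''m = qi_cm[OF s'']
  have psiH: "\<psi> n \<in> H (cx_ob Q'' n) (cx_ob Q' (n + 1))" and psid: "cx_d Q' (n + 1) * \<psi> n + \<psi> (n + 1) * cx_d Q'' n = 0" for n
    using psi by (auto simp: anti_def)
  have phid: "cx_d B' (n + 1) * (q' (n + 1) * \<psi> n) + q' (n + 1 + 1) * \<psi> (n + 1) * cx_d Q'' n = 0" for n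
  proof -
    have "cx_d B' (n + 1) * (q' (n + 1) * \<psi> n) = q' (n + 1 + 1) * (cx_d Q' (n + 1) * \<psi> n)"
      using cm_d_el[OF q'm, of "n + 1" "\<psi> n"] by simp
    then have "cx_d B' (n + 1) * (q' (n + 1) * \<psi> n) + q' (n + 1 + 1) * \<psi> (n + 1) * cx_d Q'' n =
      q' (n + 1 + 1) * (cx_d Q' (n + 1) * \<psi> n + \<psi> (n + 1) * cx_d Q'' n)" by (simp only: distrib_left mult.assoc)
    then show ?thesis using psid by simp
  qed
  have phi: "anti Q'' B' (\<lambda>n. q' (n + 1) * \<psi> n)"
    using mult_H[OF psiH cm_H[OF q'm]] phid by (simp add: anti_def)
  have "\<forall>n. \<exists>g. g \<in> H (cx_ob B'' n) (cx_ob B' (n + 1)) \<and> q' (n + 1) * \<psi> n = g * q'' n" using fac[OF phi] by blast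
  then obtain g where g: "\<And>n. g n \<in> H (cx_ob B'' n) (cx_ob B' (n + 1))" "\<And>n. q' (n + 1) * \<psi> n = g n * q'' n" by metis
  \<comment> \<open>The factorization is made in each degree separately. That g anticommutes is seen
    after composing with q'', which is surjective on generalized elements in every degree.\<close>
  have "cx_d B' (n + 1) * g n + g (n + 1) * cx_d B'' n = 0" for n
  proof (rule H_eqI)
    let ?u = "cx_d B' (n + 1) * g n + g (n + 1) * cx_d B'' n"
    show "?u \<in> H (cx_ob B'' n) (cx_ob B' (n + 1 + 1))"
      using mult_H[OF g(1) cx_H[OF B'c]] mult_H[OF cx_H[OF B''c] g(1)] by blast
    have "?u * q'' n = cx_d B' (n + 1) * (g n * q'' n) + g (n + 1) * q'' (n + 1) * cx_d Q'' n"
      by (simp add: distrib_right mult.assoc cm_d[OF q''m])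
    also have "\<dots> = 0" unfolding g(2)[symmetric] by (rule phid)
    finally have uq: "?u * q'' n = 0" .
    fix P x assume "P \<in> PR" "x \<in> H P (cx_ob B'' n)"
    then obtain y where "x = q'' n * y" using sur by blast
    then show "?u * x = 0" using mult_zero_cancel[OF uq, of y] by simp
  qed
  then have ga: "anti B'' B' g" using g(1) by (simp add: anti_def)
  obtain b where b: "qi (tw Q' Q'' \<psi>) (tw B' B'' g) b"
    using tw_map[OF bdd_cx[OF b'] bdd_cx[OF b''] B'c B''c psi ga s' s'' g(2)] .
  have "cx_ob (tw Q' Q'' \<psi>) n \<in> PR" for n using P' P'' by (simp add: tw_def)
  then show ?thesis using that[OF ga tw_bdd[OF b' b'' psi] _ th b] by blast
qed

end

section \<open>Composition series\<close>

text \<open>Filtrations with lists in place of indexed families, the quotients being listed from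
  bottom to top. This gives rule induction and lets series be concatenated.\<close>

inductive ser :: "('o, 'm, 'k) lincat \<Rightarrow> 'o \<Rightarrow> 'o list \<Rightarrow> bool" for C where
  ser_zero: "zero_object C Z \<Longrightarrow> ser C Z []"
| ser_step: "ser C F Qs \<Longrightarrow> i \<in> Hom C F X \<Longrightarrow> q \<in> Hom C X Q \<Longrightarrow> short_exact C i q \<Longrightarrow> ser C X (Qs @ [Q])"

lemma filtration_ser: assumes "filtration C X n F i q Q" shows "ser C X (map Q [0..<n])"
proof -
  have "k \<le> n \<Longrightarrow> ser C (F k) (map Q [0..<k])" for k
  proof (induction k)
    case 0
    then show ?case using assms by (auto simp: filtration_def intro: ser_zero)
  next
    case (Suc k)
    then have "ser C (F (Suc k)) (map Q [0..<k] @ [Q k])"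
      using assms by (intro ser_step[of _ "F k" _ "i k" _ "q k"]) (auto simp: filtration_def)
    then show ?case by simp
  qed
  from this[of n] show ?thesis using assms by (simp add: filtration_def)
qed

lemma ser_filtration: "ser C X Qs \<Longrightarrow> \<exists>F i q. filtration C X (length Qs) F i q (\<lambda>j. Qs ! j)"
proof (induction rule: ser.induct)
  case (ser_zero Z)
  then show ?case by (intro exI[of _ "\<lambda>_. Z"]) (simp add: filtration_def)
next
  case (ser_step F Qs i X q Q)
  then obtain G i' q' where G: "filtration C F (length Qs) G i' q' (\<lambda>j. Qs ! j)" by blast
  let ?n = "length Qs"
  have "filtration C X (length (Qs @ [Q])) (\<lambda>j. if j \<le> ?n then G j else X) (i'(?n := i)) (q'(?n := q)) (\<lambda>j. (Qs @ [Q]) ! j)"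
    using G ser_step.hyps unfolding filtration_def by (auto simp: less_Suc_eq nth_append)
  then show ?case by blast
qed

lemma finite_length_iff: "finite_length C X \<longleftrightarrow> (\<exists>Qs. ser C X Qs \<and> (\<forall>Q \<in> set Qs. simple_obj C Q))"
proof
  assume "finite_length C X"
  then obtain n Q F i q where "filtration C X n F i q Q" "\<forall>j<n. simple_obj C (Q j)"
    by (auto simp: finite_length_def composition_series_def)
  then show "\<exists>Qs. ser C X Qs \<and> (\<forall>Q \<in> set Qs. simple_obj C Q)"
    using filtration_ser by (intro exI[of _ "map Q [0..<n]"]) auto
next
  assume "\<exists>Qs. ser C X Qs \<and> (\<forall>Q \<in> set Qs. simple_obj C Q)"
  then show "finite_length C X"
    using ser_filtration unfolding finite_length_def composition_series_def by (metis nth_mem)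
qed

lemma composition_factor_iff:
  "composition_factor C S X \<longleftrightarrow> (\<exists>Qs. ser C X Qs \<and> (\<forall>Q \<in> set Qs. simple_obj C Q) \<and> (\<exists>Q \<in> set Qs. iso_objs C S Q))"
proof
  assume "composition_factor C S X"
  then obtain n Q F i q j where "filtration C X n F i q Q" "\<forall>j<n. simple_obj C (Q j)" "j < n" "iso_objs C S (Q j)"
    by (auto simp: composition_factor_def composition_series_def)
  then show "\<exists>Qs. ser C X Qs \<and> (\<forall>Q \<in> set Qs. simple_obj C Q) \<and> (\<exists>Q \<in> set Qs. iso_objs C S Q)"
    using filtration_ser by (intro exI[of _ "map Q [0..<n]"]) auto
next
  assume "\<exists>Qs. ser C X Qs \<and> (\<forall>Q \<in> set Qs. simple_obj C Q) \<and> (\<exists>Q \<in> set Qs. iso_objs C S Q)"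
  then obtain Qs Q where Q: "ser C X Qs" "\<forall>Q \<in> set Qs. simple_obj C Q" "Q \<in> set Qs" "iso_objs C S Q" by blast
  obtain j where "j < length Qs" "Q = Qs ! j" using Q(3) by (auto simp: in_set_conv_nth)
  moreover have "composition_series C X (length Qs) (\<lambda>j. Qs ! j)"
    using ser_filtration[OF Q(1)] Q(2) by (auto simp: composition_series_def)
  ultimately show "composition_factor C S X" using Q(4) unfolding composition_factor_def by blast
qed

section \<open>Direct sums, exact sequences and composition factors\<close>

context enough_projectives_category
begin

lemma direct_sum_dsum: assumes D: "is_direct_sum C I X S \<iota>" shows "HR.dsum I X S (\<lambda>i. rep (\<iota> i))"
proof -
  have f: "finite I" and S: "S \<in> Obj C" and i: "\<And>i. i \<in> I \<Longrightarrow> \<iota> i \<in> Hom C (X i) S"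
    and u: "\<And>T g. T \<in> Obj C \<Longrightarrow> (\<And>i. i \<in> I \<Longrightarrow> g i \<in> Hom C (X i) T) \<Longrightarrow> \<exists>!h. h \<in> Hom C S T \<and> (\<forall>i \<in> I. h \<cdot> \<iota> i = g i)"
    using D by (auto simp: is_direct_sum_def)
  show ?thesis
  proof (rule HR.dsumI[OF f S])
    show "rep (\<iota> j) \<in> hom (X j) S" if "j \<in> I" for j using i[OF that] by blast
    fix T
    show "\<exists>h \<in> hom S T. \<forall>i \<in> I. h * rep (\<iota> i) = g i" if T: "T \<in> Obj C" and g: "\<And>i. i \<in> I \<Longrightarrow> g i \<in> hom (X i) T" for g
    proof -
      obtain h where h: "h \<in> Hom C S T" "\<forall>j \<in> I. h \<cdot> \<iota> j = unrep (X j) T (g j)"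
        using u[OF T, of "\<lambda>j. unrep (X j) T (g j)"] unrep(1)[OF g] by blast
      have "rep h * rep (\<iota> j) = g j" if "j \<in> I" for j
        using rep_Comp[OF i[OF that] h(1)] h(2) that unrep(2)[OF g[OF that]] by simp
      then show ?thesis using h(1) by blast
    qed
    show "h = k" if h: "h \<in> hom S T" and k: "k \<in> hom S T" and e: "\<And>j. j \<in> I \<Longrightarrow> h * rep (\<iota> j) = k * rep (\<iota> j)" for h k
    proof -
      obtain h' where h': "h' \<in> Hom C S T" "h = rep h'" using h by (rule homE)
      obtain k' where k': "k' \<in> Hom C S T" "k = rep k'" using k by (rule homE)
      have "h' \<cdot> \<iota> j = k' \<cdot> \<iota> j" if "j \<in> I" for j
        using rep_eq_iff[OF Comp_Hom[OF i[OF that] h'(1)] Comp_Hom[OF i[OF that] k'(1)]] e[OF that]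
          rep_Comp[OF i[OF that] h'(1)] rep_Comp[OF i[OF that] k'(1)] h'(2) k'(2) by simp
      moreover have "T \<in> Obj C" using Hom_Obj[OF h'(1)] by simp
      ultimately have "h' = k'" using u[of T "\<lambda>j. k' \<cdot> \<iota> j"] Comp_Hom[OF i k'(1)] h'(1) k'(1) by blast
      then show ?thesis using h'(2) k'(2) by simp
    qed
  qed
qed

lemma dsum_direct_sum: assumes D: "HR.dsum I X S \<kappa>" obtains \<iota> where "is_direct_sum C I X S \<iota>"
proof -
  note d = HR.dsumD[OF D]
  define \<iota> where "\<iota> i = unrep (X i) S (\<kappa> i)" for i
  have i: "\<iota> j \<in> Hom C (X j) S" "rep (\<iota> j) = \<kappa> j" if "j \<in> I" for j using unrep[OF d(3)[OF that]] by (auto simp: \<iota>_def)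
  have "\<exists>!h. h \<in> Hom C S T \<and> (\<forall>i \<in> I. h \<cdot> \<iota> i = g i)" if T: "T \<in> Obj C" and g: "\<forall>i \<in> I. g i \<in> Hom C (X i) T" for T g
  proof -
    have eq: "h \<cdot> \<iota> j = g j \<longleftrightarrow> rep h * \<kappa> j = rep (g j)" if "h \<in> Hom C S T" "j \<in> I" for h j
      using rep_eq_iff[OF Comp_Hom[OF i(1)[OF that(2)] that(1)], of "g j"] g that rep_Comp[OF i(1)[OF that(2)] that(1)] i(2)[OF that(2)] by simp
    obtain h where h: "h \<in> hom S T" "\<forall>j \<in> I. h * \<kappa> j = rep (g j)"
      using d(5)[of "\<lambda>j. rep (g j)" T] g T by blast
    obtain h' where h': "h' \<in> Hom C S T" "h = rep h'" using h(1) by (rule homE)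
    show ?thesis
    proof (rule ex1I[of _ h'])
      show "h' \<in> Hom C S T \<and> (\<forall>i \<in> I. h' \<cdot> \<iota> i = g i)" using h'(1) eq[OF h'(1)] h(2) h'(2) by simp
      fix k assume k: "k \<in> Hom C S T \<and> (\<forall>i \<in> I. k \<cdot> \<iota> i = g i)"
      then have "rep k = rep h'" using d(6)[of "rep k" T "rep h'"] h(2) h' eq[of k] by auto
      then show "k = h'" using rep_inj k h'(1) by blast
    qed
  qed
  then have "is_direct_sum C I X S \<iota>" using d(1,2) i(1) by (simp add: is_direct_sum_def)
  then show ?thesis by (rule that)
qed

lemma cover: assumes "A \<in> Obj C"
  obtains R r where "R \<in> PR" "r \<in> hom R A" "\<And>P x. P \<in> PR \<Longrightarrow> x \<in> hom P A \<Longrightarrow> \<exists>y \<in> hom P R. x = r * y"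
proof -
  obtain R p where p: "projective_obj C R" "p \<in> Hom C R A" "epic C p" using enough_proj[OF assms] by blast
  then show ?thesis using that[of R "rep p"] epic_iff[OF p(2)] by (auto simp: PR_def)
qed

text \<open>\<open>HR.exact\<close> tests projective sources only. A general source A is covered by
  a projective, over which the lift exists, and the lift descends to A by
  \<open>HR.factor\<close>.\<close>

lemma exactD:
  assumes e: "HR.exact K P M i q"
  shows "i \<in> hom K P" "q \<in> hom P M" "q * (i * x) = 0"
    and "R \<in> PR \<Longrightarrow> x \<in> hom R M \<Longrightarrow> \<exists>y \<in> hom R P. x = q * y"
    and "g \<in> hom A P \<Longrightarrow> q * g = 0 \<Longrightarrow> \<exists>h \<in> hom A K. g = i * h"
    and "z \<in> hom A K \<Longrightarrow> i * z = 0 \<Longrightarrow> z = 0"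
    and "f \<in> hom P B \<Longrightarrow> f * i = 0 \<Longrightarrow> \<exists>h \<in> hom M B. f = h * q"
    and "u \<in> hom M B \<Longrightarrow> u * q = 0 \<Longrightarrow> u = 0"
proof -
  show i: "i \<in> hom K P" and q: "q \<in> hom P M" and "q * (i * x) = 0"
    and sur: "\<And>R x. R \<in> PR \<Longrightarrow> x \<in> hom R M \<Longrightarrow> \<exists>y \<in> hom R P. x = q * y"
    using e HR.mult_zero_cancel[of q i x] by (auto simp: HR.exact_def)
  have ker: "\<And>R x. R \<in> PR \<Longrightarrow> x \<in> hom R P \<Longrightarrow> q * x = 0 \<Longrightarrow> \<exists>k \<in> hom R K. x = i * k"
    and inj: "\<And>R x. R \<in> PR \<Longrightarrow> x \<in> hom R K \<Longrightarrow> i * x = 0 \<Longrightarrow> x = 0"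
    using e by (auto simp: HR.exact_def)
  have mono: "z = 0" if z: "z \<in> hom A K" and iz: "i * z = 0" for z A
  proof (rule HR.H_eqI[OF z])
    fix P x assume "P \<in> PR" "x \<in> hom P A"
    then show "z * x = 0" using inj[OF _ HR.mult_H[OF _ z]] HR.mult_zero_cancel[OF iz, of x] by blast
  qed
  show "z \<in> hom A K \<Longrightarrow> i * z = 0 \<Longrightarrow> z = 0" by (rule mono)
  show epi: "u \<in> hom M B \<Longrightarrow> u * q = 0 \<Longrightarrow> u = 0" for u B
  proof (rule HR.H_eqI)
    fix P x assume uq: "u * q = 0" and P: "P \<in> PR" and x: "x \<in> hom P M"
    obtain y where "x = q * y" using sur[OF P x] by blast
    then show "u * x = 0" using HR.mult_zero_cancel[OF uq] by simp
  qed
  show "\<exists>h \<in> hom M B. f = h * q" if f: "f \<in> hom P B" and fi: "f * i = 0"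
  proof (rule HR.factor[OF q f sur])
    fix R x assume "R \<in> PR" "x \<in> hom R P" "q * x = 0"
    then obtain k where "x = i * k" using ker by blast
    then show "f * x = 0" using HR.mult_zero_cancel[OF fi] by simp
  qed
  show "\<exists>h \<in> hom A K. g = i * h" if g: "g \<in> hom A P" and qg: "q * g = 0"
  proof -
    have "A \<in> Obj C" using HR.H_Ob[OF g] by simp
    then obtain R r where r: "R \<in> PR" "r \<in> hom R A" "\<And>P x. P \<in> PR \<Longrightarrow> x \<in> hom P A \<Longrightarrow> \<exists>y \<in> hom P R. x = r * y"
      using cover by blast
    obtain k where k: "k \<in> hom R K" "g * r = i * k"
      using ker[OF r(1) HR.mult_H[OF r(2) g]] HR.mult_zero_cancel[OF qg] by blast
    \<comment> \<open>Whatever r kills is also killed by k, because i is injective on generalized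
      elements.\<close>
    have "\<exists>h \<in> hom A K. k = h * r"
    proof (rule HR.factor[OF r(2) k(1) r(3)])
      fix P x assume P: "P \<in> PR" and x: "x \<in> hom P R" and reindex: "r * x = 0"
      have "i * (k * x) = g * (r * x)" using k(2) by (simp flip: mult.assoc)
      then show "k * x = 0" using inj[OF P HR.mult_H[OF x k(1)]] reindex by simp
    qed
    then obtain h where h: "h \<in> hom A K" "k = h * r" by blast
    have "i * h - g = 0"
    proof (rule HR.H_eqI)
      show "i * h - g \<in> hom A P" using HR.minus_H[OF HR.mult_H[OF h(1) i] g] .
      fix P' x assume "P' \<in> PR" "x \<in> hom P' A"
      then obtain y where y: "x = r * y" using r(3) by blast
      have "(i * h - g) * r = 0" using k(2) h(2) by (simp add: left_diff_distrib mult.assoc)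
      then show "(i * h - g) * x = 0" using HR.mult_zero_cancel y by blast
    qed
    then show ?thesis using h(1) by auto
  qed
qed

lemma short_exact_iff: assumes i: "i \<in> Hom C K P" and p: "p \<in> Hom C P M"
  shows "short_exact C i p \<longleftrightarrow> HR.exact K P M (rep i) (rep p)"
proof
  have D: "Dom C i = K" "Cod C i = P" "Dom C p = P" "Cod C p = M" "i \<in> Arr C" "p \<in> Arr C" using HomD[OF i] HomD[OF p] by auto
  {
    assume "short_exact C i p"
    then have k: "is_kernel C i p" and c: "is_cokernel C p i" by (auto simp: short_exact_def)
    show "HR.exact K P M (rep i) (rep p)"
      unfolding HR.exact_def using homI[OF i] homI[OF p] kernel_rep[OF k, unfolded D] epic_iff[OF p] cokernel_rep(3)[OF c] by blast
  }
  assume e: "HR.exact K P M (rep i) (rep p)"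
  note x = exactD[OF e]
  have o: "K \<in> Obj C" "P \<in> Obj C" "M \<in> Obj C" using Hom_Obj i p by auto
  have "rep p * rep i = 0" using e by (simp add: HR.exact_def)
  then have pi: "p \<cdot> i = Zero C K M" using rep_0_iff[OF Comp_Hom[OF i p]] rep_Comp[OF i p] by simp
  have "\<exists>!h. h \<in> Hom C A K \<and> i \<cdot> h = g" if g: "g \<in> Hom C A P" and pg: "p \<cdot> g = Zero C A M" for A g
  proof -
    have "rep p * rep g = 0" using rep_0_iff[OF Comp_Hom[OF g p]] rep_Comp[OF g p] pg by simp
    then obtain h where h: "h \<in> Hom C A K" "rep g = rep i * rep h" using x(5)[OF homI[OF g]] by (auto elim: homE)
    have "i \<cdot> h = g" using rep_eq_iff[OF Comp_Hom[OF h(1) i] g] rep_Comp[OF h(1) i] h(2) by simp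
    moreover have "k = h" if k: "k \<in> Hom C A K" "i \<cdot> k = g" for k
    proof -
      have "rep i * (rep k - rep h) = 0" using rep_Comp[OF k(1) i] k(2) h(2) by (simp add: right_diff_distrib)
      then have "rep k - rep h = 0" using x(6)[OF HR.minus_H[OF homI[OF k(1)] homI[OF h(1)]]] by simp
      then show ?thesis using rep_inj[OF k(1) h(1)] by simp
    qed
    ultimately show ?thesis using h(1) by blast
  qed
  then have "is_kernel C i p" using D pi by (simp add: is_kernel_def)
  moreover have "\<exists>!h. h \<in> Hom C M B \<and> h \<cdot> p = g" if g: "g \<in> Hom C P B" and gi: "g \<cdot> i = Zero C K B" for B g
  proof -
    have "rep g * rep i = 0" using rep_0_iff[OF Comp_Hom[OF i g]] rep_Comp[OF i g] gi by simp
    then obtain h where h: "h \<in> Hom C M B" "rep g = rep h * rep p" using x(7)[OF homI[OF g]] by (auto elim: homE)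
    have "h \<cdot> p = g" using rep_eq_iff[OF Comp_Hom[OF p h(1)] g] rep_Comp[OF p h(1)] h(2) by simp
    moreover have "k = h" if k: "k \<in> Hom C M B" "k \<cdot> p = g" for k
    proof -
      have "(rep k - rep h) * rep p = 0" using rep_Comp[OF p k(1)] k(2) h(2) by (simp add: left_diff_distrib)
      then have "rep k - rep h = 0" using x(8)[OF HR.minus_H[OF homI[OF k(1)] homI[OF h(1)]]] by simp
      then show ?thesis using rep_inj[OF k(1) h(1)] by simp
    qed
    ultimately show ?thesis using h(1) by blast
  qed
  then have "is_cokernel C p i" using D pi by (simp add: is_cokernel_def)
  ultimately show "short_exact C i p" by (simp add: short_exact_def)
qed

lemma exact_conj_iso:
  assumes e: "HR.exact F A Q i q" and u: "u \<in> hom A B" and v: "v \<in> hom B A" and vu: "v * u = one A" and uv: "u * v = one B"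
  shows "HR.exact F B Q (u * i) (q * v)"
proof -
  note x = exactD[OF e]
  have vu': "v * (u * x) = x" if "x \<in> hom R A" for x R using HR.mult_eq_assoc[OF vu, of x] HR.one_mult[OF that] by simp
  have uv': "u * (v * x) = x" if "x \<in> hom R B" for x R using HR.mult_eq_assoc[OF uv, of x] HR.one_mult[OF that] by simp
  have ui: "u * i \<in> hom F B" and qv: "q * v \<in> hom B Q" using HR.mult_H[OF x(1) u] HR.mult_H[OF v x(2)] by auto
  have 0: "q * v * (u * i) = 0" using vu'[OF x(1)] e by (simp add: mult.assoc HR.exact_def)
  have s: "\<exists>y \<in> hom R B. x = q * v * y" if R: "R \<in> PR" and xx: "x \<in> hom R Q" for R x
  proof -
    obtain y where y: "y \<in> hom R A" "x = q * y" using x(4)[OF R xx] by blast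
    then show ?thesis using vu'[OF y(1)] HR.mult_H[OF y(1) u] by (intro bexI[of _ "u * y"]) (simp_all add: mult.assoc)
  qed
  have k: "\<exists>k \<in> hom R F. x = u * i * k" if xx: "x \<in> hom R B" and z: "q * v * x = 0" for R x
  proof -
    obtain k where "k \<in> hom R F" "v * x = i * k" using x(5)[OF HR.mult_H[OF xx v]] z by (auto simp: mult.assoc)
    then show ?thesis using uv'[OF xx] by (intro bexI[of _ k]) (simp_all add: mult.assoc)
  qed
  have m: "x = 0" if xx: "x \<in> hom R F" and z: "u * i * x = 0" for R x
    using x(6)[OF xx] vu'[OF HR.mult_H[OF xx x(1)]] z by (metis mult.assoc mult_zero_right)
  show ?thesis unfolding HR.exact_def
    using ui qv 0 s k m by blast
qed

lemma ser_iso: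
  assumes A: "ser C A Qs" and u: "u \<in> hom A B" and v: "v \<in> hom B A" and vu: "v * u = one A" and uv: "u * v = one B"
  shows "ser C B Qs"
  using A
proof cases
  case ser_zero
  have "u = 0" using HR.from_zob[OF _ u] zob_iff ser_zero by blast
  then have "one B = 0" using uv by simp
  then have "zero_object C B" using zero_object_iff HR.H_Ob[OF u] by simp
  then show ?thesis using ser_zero by (auto intro: ser.ser_zero)
next
  case (ser_step F Qs' i q Q)
  have e: "HR.exact F A Q (rep i) (rep q)" using short_exact_iff ser_step by blast
  obtain u' where u': "u' \<in> Hom C A B" "u = rep u'" using u by (rule homE)
  obtain v' where v': "v' \<in> Hom C B A" "v = rep v'" using v by (rule homE)
  have H: "u' \<cdot> i \<in> Hom C F B" "q \<cdot> v' \<in> Hom C B Q" using Comp_Hom ser_step u' v' by blast+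
  have "short_exact C (u' \<cdot> i) (q \<cdot> v')"
    using short_exact_iff[OF H] exact_conj_iso[OF e u v vu uv] rep_Comp[OF _ u'(1), of i] rep_Comp[OF v'(1), of q] ser_step u' v' by simp
  then show ?thesis unfolding ser_step(1) by (rule ser.ser_step[OF ser_step(2) H])
qed

text \<open>The preimages under c of the steps in the series of Y are stacked on the series of
  I.\<close>

lemma ser_append:
  assumes Y: "ser C Y Qs'" and I: "ser C I Qs" and e: "HR.exact I X Y m c"
  shows "ser C X (Qs @ Qs')"
  using Y e
proof (induction arbitrary: X m c rule: ser.induct)
  case (ser_zero Y)
  note x = exactD[OF ser_zero.prems]
  have o: "I \<in> Obj C" "X \<in> Obj C" using HR.H_Ob[OF x(1)] by auto
  \<comment> \<open>If Y is 0, then m is an isomorphism from I to X.\<close>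
  have "c = 0" using HR.to_zob[OF _ x(2)] zob_iff ser_zero by blast
  then obtain h where h: "h \<in> hom X I" "one X = m * h" using x(5)[OF HR.one_H[OF o(2)]] by auto
  have "m * (h * m - one I) = 0"
    using HR.mult_one[OF x(1)] HR.one_mult[OF x(1)] h(2) by (simp add: right_diff_distrib flip: mult.assoc)
  then have "h * m - one I = 0" using x(6)[OF HR.minus_H[OF HR.mult_H[OF x(1) h(1)] HR.one_H[OF o(1)]]] by simp
  then show ?case using ser_iso[OF I x(1) h(1)] h(2) by simp
next
  case (ser_step F Qs'' i Y q Q)
  have eq: "HR.exact F Y Q (rep i) (rep q)" using short_exact_iff ser_step by blast
  note x = exactD[OF ser_step.prems] and y = exactD[OF eq]
  \<comment> \<open>The kernel \<open>X1\<close> of the composite from X over Y to Q is the preimage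
    of F. It is an extension of F by I, so the induction hypothesis applies to it.\<close>
  obtain t where t: "t \<in> Hom C X Q" "rep t = rep q * c" using HR.mult_H[OF x(2) y(2)] by (metis homE)
  obtain k where k: "is_kernel C k t" using ex_kernel HomD[OF t(1)] by blast
  define X1 where "X1 = Dom C k"
  have D: "Dom C t = X" "Cod C t = Q" "Dom C k = X1" using HomD[OF t(1)] by (auto simp: X1_def)
  have kH: "k \<in> Hom C X1 X" using kernelD(1)[OF k] D by simp
  note kr = kernel_rep[OF k, unfolded D]
  have ek: "HR.exact X1 X Q (rep k) (rep t)"
  proof -
    have "\<exists>z \<in> hom R X. w = rep t * z" if R: "R \<in> PR" and w: "w \<in> hom R Q" for R w
    proof -
      obtain b where b: "b \<in> hom R Y" "w = rep q * b" using y(4)[OF R w] by blast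
      obtain z where "z \<in> hom R X" "b = c * z" using x(4)[OF R b(1)] by blast
      then show ?thesis using b(2) t(2) by (auto simp: mult.assoc)
    qed
    then show ?thesis unfolding HR.exact_def using homI[OF kH] homI[OF t(1)] kr by blast
  qed
  have tm: "rep t * m = 0" using x(3)[of "one I"] HR.mult_one[OF x(1)] t(2) by (simp add: mult.assoc)
  obtain m1 where m1: "m1 \<in> hom I X1" "m = rep k * m1" using kr(2)[OF x(1) tm] by blast
  have "rep q * (c * rep k) = 0" using kr(1) t(2) by (simp add: mult.assoc)
  then obtain c1 where c1: "c1 \<in> hom X1 F" "c * rep k = rep i * c1" using y(5)[OF HR.mult_H[OF homI[OF kH] x(2)]] by blast
  have ck: "c * (rep k * z) = rep i * (c1 * z)" for z using c1(2) by (simp flip: mult.assoc)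
  have mk: "m * z = rep k * (m1 * z)" for z using m1(2) by (simp add: mult.assoc)
  have "HR.exact I X1 F m1 c1"
  proof -
    have "rep i * (c1 * m1) = 0" using ck[of m1] m1(2) x(3)[of "one I"] HR.mult_one[OF x(1)] by simp
    then have 0: "c1 * m1 = 0" using y(6)[OF HR.mult_H[OF m1(1) c1(1)]] by simp
    have s: "\<exists>z \<in> hom R X1. w = c1 * z" if R: "R \<in> PR" and w: "w \<in> hom R F" for R w
    proof -
      obtain b where b: "b \<in> hom R X" "rep i * w = c * b" using x(4)[OF R HR.mult_H[OF w y(1)]] by blast
      have "rep t * b = 0" using t(2) b(2) y(3)[of w] by (simp add: mult.assoc flip: b(2))
      then obtain z where z: "z \<in> hom R X1" "b = rep k * z" using kr(2)[OF b(1)] by blast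
      have "rep i * (w - c1 * z) = 0" using b(2) z(2) ck[of z] by (simp add: right_diff_distrib)
      then have "w - c1 * z = 0" using y(6)[OF HR.minus_H[OF w HR.mult_H[OF z(1) c1(1)]]] by simp
      then show ?thesis using z(1) by auto
    qed
    have kk: "\<exists>z \<in> hom R I. w = m1 * z" if w: "w \<in> hom R X1" and z: "c1 * w = 0" for R w
    proof -
      have "c * (rep k * w) = 0" using ck[of w] z by simp
      then obtain z where z: "z \<in> hom R I" "rep k * w = m * z" using x(5)[OF HR.mult_H[OF w homI[OF kH]]] by blast
      have "rep k * (w - m1 * z) = 0" using z(2) mk by (simp add: right_diff_distrib)
      then have "w - m1 * z = 0" using kr(3)[OF HR.minus_H[OF w HR.mult_H[OF z(1) m1(1)]]] by simp
      then show ?thesis using z(1) by auto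
    qed
    have mm: "z = 0" if z: "z \<in> hom R I" "m1 * z = 0" for R z
      using x(6)[OF z(1)] mk[of z] z(2) by simp
    show ?thesis unfolding HR.exact_def using m1(1) c1(1) 0 s kk mm by blast
  qed
  from ser_step.IH[OF this] have s: "ser C X1 (Qs @ Qs'')" .
  have "short_exact C k t" using short_exact_iff[OF kH t(1)] ek by simp
  from ser.ser_step[OF s kH t(1) this] show ?case by simp
qed

text \<open>A composition series of I is continued by one of Y. It serves to show that truncated
  subcategories are closed under subobjects.\<close>

lemma composition_factor_sub:
  assumes e: "HR.exact I X Y m c" and Y: "finite_length C Y" and S: "composition_factor C S I"
  shows "composition_factor C S X"
proof -
  obtain Qs' where Q': "ser C Y Qs'" "\<forall>Q \<in> set Qs'. simple_obj C Q" using Y[unfolded finite_length_iff] by blast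
  obtain Qs Q where Q: "ser C I Qs" "\<forall>Q \<in> set Qs. simple_obj C Q" "Q \<in> set Qs" "iso_objs C S Q"
    using S[unfolded composition_factor_iff] by blast
  have "ser C X (Qs @ Qs')" by (rule ser_append[OF Q'(1) Q(1) e])
  moreover have "\<forall>Q \<in> set (Qs @ Qs'). simple_obj C Q" using Q(2) Q'(2) by auto
  moreover have "Q \<in> set (Qs @ Qs')" using Q(3) by simp
  ultimately show ?thesis using Q(4) unfolding composition_factor_iff by blast
qed

section \<open>Cones, shifts and BGG complexes\<close>

lemma cone_simps:
  "cx_ob (mapping_cone C X Y f) n = bip_ob C (cx_ob X (n + 1)) (cx_ob Y n)"
  "cx_d (mapping_cone C X Y f) n = (bip_in1 C (cx_ob X (n + 1 + 1)) (cx_ob Y (n + 1)) \<cdot>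
        (neg (cx_d X (n + 1))) \<cdot> cone_out C X Y n) \<oplus>
      (cone_in C X Y (n + 1) \<cdot> ((f (n + 1) \<cdot> cone_out C X Y n) \<oplus>
         (cx_d Y n \<cdot> bip_pr2 C (cx_ob X (n + 1)) (cx_ob Y n))))"
  by (simp_all add: mapping_cone_def)

text \<open>Exhibits Y as the fibre of the projection from the cone to X[1], the form in which the
  triangle enters \<open>fibre_resolution\<close>.\<close>

lemma cone_dsplit:
  assumes X: "bounded_cx C X" and Y: "bounded_cx C Y" and f: "chain_map C X Y f"
  shows "bounded_cx C (mapping_cone C X Y f)"
    and "HR.dsplit (hx Y) (hx (mapping_cone C X Y f)) (HR.sh (hx X))
      (\<lambda>n. rep (cone_in C X Y n)) (\<lambda>n. rep (cone_out C X Y n))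
      (\<lambda>n. rep (bip_in1 C (cx_ob X (n + 1)) (cx_ob Y n))) (\<lambda>n. rep (bip_pr2 C (cx_ob X (n + 1)) (cx_ob Y n)))"
proof -
  let ?K = "mapping_cone C X Y f"
  note oX = bounded_cxD(3)[OF X] and oY = bounded_cxD(3)[OF Y]
  note b = bip_Hom[OF oX oY] and r = bip_rep[OF oX oY]
  have dX: "neg (cx_d X n) \<in> Hom C (cx_ob X n) (cx_ob X (n + 1))" "rep (neg (cx_d X n)) = - rep (cx_d X n)" for n
    using Scale_Hom[OF bounded_cxD(1)[OF X]] rep_neg[OF bounded_cxD(1)[OF X]] by auto
  note dY = bounded_cxD(1)[OF Y] and fH = chain_mapD(1)[OF f]
  have inH: "cone_in C X Y n \<in> Hom C (cx_ob Y n) (cx_ob ?K n)" and outH: "cone_out C X Y n \<in> Hom C (cx_ob ?K n) (cx_ob X (n + 1))" for n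
    using b by (auto simp: cone_in_def cone_out_def cone_simps)
  define j1 where "j1 n = bip_in1 C (cx_ob X (n + 1)) (cx_ob Y n)" for n
  define r2 where "r2 n = bip_pr2 C (cx_ob X (n + 1)) (cx_ob Y n)" for n
  have jH: "j1 n \<in> Hom C (cx_ob X (n + 1)) (cx_ob ?K n)" and rH: "r2 n \<in> Hom C (cx_ob ?K n) (cx_ob Y n)" for n
    using b by (auto simp: j1_def r2_def cone_simps)
  have R: "rep (r2 n) * rep (cone_in C X Y n) = one (cx_ob Y n)" "rep (cone_out C X Y n) * rep (j1 n) = one (cx_ob X (n + 1))"
    "rep (cone_out C X Y n) * rep (cone_in C X Y n) = 0" "rep (r2 n) * rep (j1 n) = 0"
    "rep (j1 n) * rep (cone_out C X Y n) + rep (cone_in C X Y n) * rep (r2 n) = one (cx_ob ?K n)" for n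
    using r by (auto simp: j1_def r2_def cone_in_def cone_out_def cone_simps)
  have dK: "cx_d ?K n = (j1 (n + 1) \<cdot> (neg (cx_d X (n + 1)) \<cdot> cone_out C X Y n)) \<oplus>
      (cone_in C X Y (n + 1) \<cdot> ((f (n + 1) \<cdot> cone_out C X Y n) \<oplus> (cx_d Y n \<cdot> r2 n)))" for n
    by (simp add: cone_simps j1_def r2_def)
  have "cx_d ?K n \<in> Hom C (cx_ob ?K n) (cx_ob ?K (n + 1)) \<and>
    rep (cx_d ?K n) = rep (j1 (n + 1)) * (- rep (cx_d X (n + 1)) * rep (cone_out C X Y n)) +
      rep (cone_in C X Y (n + 1)) * (rep (f (n + 1)) * rep (cone_out C X Y n) + rep (cx_d Y n) * rep (r2 n))" for n
  proof -
    note a1 = Comp_Hom[OF outH dX(1), of n] and a2 = Comp_Hom[OF outH fH, of n] and a3 = Comp_Hom[OF rH dY, of n]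
    note a4 = Comp_Hom[OF a1 jH] and a5 = Comp_Hom[OF Add_Hom[OF a2 a3] inH]
    show ?thesis unfolding dK
      using Add_Hom[OF a4 a5] rep_Add[OF a4 a5] rep_Comp[OF a1 jH] rep_Comp[OF Add_Hom[OF a2 a3] inH]
        rep_Comp[OF outH dX(1), of n] rep_Add[OF a2 a3] rep_Comp[OF outH fH, of n] rep_Comp[OF rH dY, of n] dX(2) by simp
  qed
  then have dH: "cx_d ?K n \<in> Hom C (cx_ob ?K n) (cx_ob ?K (n + 1))"
    and dr: "rep (cx_d ?K n) = rep (cone_in C X Y (n + 1)) * (rep (f (n + 1)) * rep (cone_out C X Y n) + rep (cx_d Y n) * rep (r2 n))
      - rep (j1 (n + 1)) * (rep (cx_d X (n + 1)) * rep (cone_out C X Y n))" for n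
    by simp_all
  have od: "rep (cone_out C X Y (n + 1)) * rep (cx_d ?K n) = - (rep (cx_d X (n + 1)) * rep (cone_out C X Y n))" for n
    using HR.mult_eq_assoc[OF R(2), of "n + 1" "rep (cx_d X (n + 1)) * rep (cone_out C X Y n)"]
      HR.one_mult[OF HR.mult_H[OF homI[OF outH] homI[OF bounded_cxD(1)[OF X]]], of n]
      HR.mult_zero_cancel[OF R(3)]
    by (simp add: dr right_diff_distrib)
  have rd: "rep (r2 (n + 1)) * rep (cx_d ?K n) = rep (f (n + 1)) * rep (cone_out C X Y n) + rep (cx_d Y n) * rep (r2 n)" for n
  proof -
    have "rep (f (n + 1)) * rep (cone_out C X Y n) + rep (cx_d Y n) * rep (r2 n) \<in> hom (cx_ob ?K n) (cx_ob Y (n + 1))"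
      using HR.add_H[OF HR.mult_H[OF homI[OF outH] homI[OF fH]] HR.mult_H[OF homI[OF rH] homI[OF dY]]] .
    then show ?thesis
      using HR.mult_eq_assoc[OF R(1), of "n + 1"] HR.mult_zero_cancel[OF R(4)] by (simp add: dr right_diff_distrib)
  qed
  have di: "rep (cx_d ?K n) * rep (cone_in C X Y n) = rep (cone_in C X Y (n + 1)) * rep (cx_d Y n)" for n
    using HR.mult_one[OF homI[OF dY], of n] by (simp add: dr left_diff_distrib distrib_right mult.assoc R)
  have cm: "rep (f (n + 1)) * rep (cx_d X n) = rep (cx_d Y n) * rep (f n)" for n
    using HR.cm_d[OF chain_map_cm[OF X Y f], of n] by simp
  have cm': "rep (cx_d Y (n + 1)) * (rep (f (n + 1)) * x) = rep (f (n + 1 + 1)) * (rep (cx_d X (n + 1)) * x)" for n x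
    using cm[of "n + 1"] by (simp flip: mult.assoc)
  have dd: "rep (cx_d ?K (n + 1)) * rep (cx_d ?K n) = 0" for n
  proof -
    have "rep (cx_d X (n + 1 + 1)) * (rep (cx_d X (n + 1)) * x) = 0" for x
      using HR.cx_dd_el[OF bounded_hx[OF X], of "n + 1"] by simp
    moreover have "rep (cx_d Y (n + 1)) * (rep (cx_d Y n) * x) = 0" for x
      using HR.cx_dd_el[OF bounded_hx[OF Y], of n] by simp
    ultimately have "rep (f (n + 1 + 1)) * (rep (cone_out C X Y (n + 1)) * rep (cx_d ?K n)) + rep (cx_d Y (n + 1)) * (rep (r2 (n + 1)) * rep (cx_d ?K n)) = 0"
      "rep (cx_d X (n + 1 + 1)) * (rep (cone_out C X Y (n + 1)) * rep (cx_d ?K n)) = 0"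
      by (simp_all only: od rd distrib_left cm') simp_all
    then show ?thesis unfolding dr[of "n + 1"] by (simp add: left_diff_distrib distrib_right mult.assoc)
  qed
  obtain a b where ab: "\<And>n. n < a \<or> b < n \<Longrightarrow> HR.zob (cx_ob X n)" using bounded_bdd[OF X] by (auto simp: HR.bdd_def)
  obtain c d where cd: "\<And>n. n < c \<or> d < n \<Longrightarrow> HR.zob (cx_ob Y n)" using bounded_bdd[OF Y] by (auto simp: HR.bdd_def)
  have z: "HR.zob (cx_ob ?K n)" if "n < min (a - 1) c \<or> max b d < n" for n
  proof -
    have "HR.zob (cx_ob X (n + 1))" "HR.zob (cx_ob Y n)" using that by (intro ab cd; linarith)+
    then show ?thesis using HR.zob_bp by (simp add: cone_simps)
  qed
  have cK: "HR.cx (hx ?K)" unfolding HR.cx_def using homI[OF dH] dd by simp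
  moreover have "\<forall>n. n < min (a - 1) c \<or> max b d < n \<longrightarrow> HR.zob (cx_ob (hx ?K) n)" using z by simp
  ultimately have "HR.bdd (hx ?K)" unfolding HR.bdd_def by blast
  then show "bounded_cx C ?K" using bounded_cx_iff[of ?K] dH by blast
  show "HR.dsplit (hx Y) (hx ?K) (HR.sh (hx X))
      (\<lambda>n. rep (cone_in C X Y n)) (\<lambda>n. rep (cone_out C X Y n))
      (\<lambda>n. rep (bip_in1 C (cx_ob X (n + 1)) (cx_ob Y n))) (\<lambda>n. rep (bip_pr2 C (cx_ob X (n + 1)) (cx_ob Y n)))"
    unfolding HR.dsplit_def HR.cm_def j1_def[symmetric] r2_def[symmetric]
    using bounded_hx[OF Y] cK HR.cx_sh[OF bounded_hx[OF X]] homI[OF inH] homI[OF outH] homI[OF jH] homI[OF rH] R od di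
    by (simp add: add.commute[of _ "rep (j1 _) * _"])
qed

lemma shift_hx: assumes X: "bounded_cx C X"
  shows "hx (shift_cx C m X) = HR.shift_by (even m) m (hx X)" "bounded_cx C (shift_cx C m X)"
proof -
  note d = bounded_cxD(1)[OF X]
  have s: "rep ((if even m then 1 else - 1) \<odot> cx_d X n) = (if even m then rep (cx_d X n) else - rep (cx_d X n))" for n
    using Scale_one[OF d] rep_neg[OF d] by simp
  then show e: "hx (shift_cx C m X) = HR.shift_by (even m) m (hx X)"
    by (simp add: hx_def shift_cx_def HR.shift_by_def fun_eq_iff)
  have "cx_d (shift_cx C m X) n \<in> Hom C (cx_ob (shift_cx C m X) n) (cx_ob (shift_cx C m X) (n + 1))" for n
    using Scale_Hom[OF d[of "n + m"]] by (simp add: shift_cx_def HR.shift_by_index)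
  then show "bounded_cx C (shift_cx C m X)"
    using bounded_cx_iff[of "shift_cx C m X"] HR.bdd_shift_by[OF bounded_bdd[OF X]] by (simp add: e)
qed

lemma D_iso_arr_zigzag:
  assumes X: "bounded_cx C X" and Y: "bounded_cx C Y" and F: "D_iso_arr C X Y F"
  shows "HR.zigzag (hx X) (hx Y)"
proof -
  from X Y F obtain Z s f where "bounded_cx C Z" "HR.qi (hx Z) (hx X) (\<lambda>n. rep (s n))" "HR.qi (hx Z) (hx Y) (\<lambda>n. rep (f n))"
    by (rule D_iso_arr_quasi_iso)
  then show ?thesis unfolding HR.zigzag_def using bounded_hx X Y by blast
qed

text \<open>The property p climbs the filtration by extensions. Closure under isomorphism enters
  because the quotients are only isomorphic to members of T.\<close>

lemma filtered_by_property:
  assumes F: "filtered_by C T X" and T: "\<And>Y. Y \<in> T \<Longrightarrow> p Y"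
    and z: "\<And>Z. HR.zob Z \<Longrightarrow> p Z"
    and ext: "\<And>A' A A'' i q. HR.exact A' A A'' i q \<Longrightarrow> p A' \<Longrightarrow> p A'' \<Longrightarrow> p A"
    and iso: "\<And>A B u v. p A \<Longrightarrow> u \<in> hom A B \<Longrightarrow> v \<in> hom B A \<Longrightarrow> v * u = one A \<Longrightarrow> u * v = one B \<Longrightarrow> p B"
  shows "p X"
proof -
  obtain n F i q Q where f: "filtration C X n F i q Q" and Q: "\<forall>j<n. \<exists>Y \<in> T. iso_objs C (Q j) Y"
    using F by (auto simp: filtered_by_def)
  have pQ: "p (Q j)" if j: "j < n" for j
  proof -
    obtain Y g where Y: "Y \<in> T" "g \<in> Hom C (Q j) Y" "iso_arr C g" using Q j by (auto simp: iso_objs_def)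
    obtain h where h: "h \<in> Hom C Y (Q j)" "h \<cdot> g = Ident C (Q j)" "g \<cdot> h = Ident C Y"
      using Y(3) HomD[OF Y(2)] by (auto simp: iso_arr_def)
    have "rep h * rep g = one (Q j)" "rep g * rep h = one Y"
      using rep_Comp[OF Y(2) h(1)] rep_Comp[OF h(1) Y(2)] h by (simp_all add: one_def)
    then show ?thesis using iso[OF T[OF Y(1)] homI[OF h(1)] homI[OF Y(2)]] by blast
  qed
  have "k \<le> n \<Longrightarrow> p (F k)" for k
  proof (induction k)
    case 0
    then show ?case using f z zob_iff by (auto simp: filtration_def)
  next
    case (Suc k)
    then have "i k \<in> Hom C (F k) (F (Suc k))" "q k \<in> Hom C (F (Suc k)) (Q k)" "short_exact C (i k) (q k)"
      using f by (auto simp: filtration_def)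
    then have "HR.exact (F k) (F (Suc k)) (Q k) (rep (i k)) (rep (q k))" using short_exact_iff by blast
    then show ?case using ext pQ[of k] Suc by simp
  qed
  from this[of n] show ?thesis using f by (simp add: filtration_def)
qed

text \<open>Two layers of sums: copies of each \<open>M w\<close>, then the sum over all w of length
  n.\<close>

lemma BGG_property:
  assumes B: "BGG_complex C W M l B" and p: "\<And>w. w \<in> W \<Longrightarrow> l w = n \<Longrightarrow> p (M w)"
    and z: "p zo" and b: "\<And>A B. A \<in> Obj C \<Longrightarrow> B \<in> Obj C \<Longrightarrow> p A \<Longrightarrow> p B \<Longrightarrow> p (bip_ob C A B)"
    and iso: "\<And>A B u v. p A \<Longrightarrow> u \<in> hom A B \<Longrightarrow> v \<in> hom B A \<Longrightarrow> v * u = one A \<Longrightarrow> u * v = one B \<Longrightarrow> p B"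
  shows "p (cx_ob B n)"
proof -
  obtain d T where T: "\<forall>w \<in> W. is_tensor C (M w) (d w) (T w)"
    and S: "\<forall>n. \<exists>\<iota>. is_direct_sum C {w \<in> W. l w = n} T (cx_ob B n) \<iota>" using B by (auto simp: BGG_complex_def)
  have pT: "p (T w)" if w: "w \<in> W" "l w = n" for w
  proof -
    obtain \<iota> where "is_direct_sum C {..<d w} (\<lambda>_. M w) (T w) \<iota>" using T w by (auto simp: is_tensor_def)
    from direct_sum_dsum[OF this] show ?thesis by (rule HR.dsum_property) (use p[OF w] z b iso in auto)
  qed
  obtain \<iota> where "is_direct_sum C {w \<in> W. l w = n} T (cx_ob B n) \<iota>" using S by blast
  from direct_sum_dsum[OF this] show ?thesis by (rule HR.dsum_property) (use pT z b iso in auto)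
qed

text \<open>Multiplicities add, the copies being indexed by two adjacent intervals of
  numbers.\<close>

lemma BGG_complex_bip:
  assumes B': "BGG_complex C W M l B'" and B'': "BGG_complex C W M l B''" and B: "bounded_cx C B"
    and ob: "\<And>n. cx_ob B n = bip_ob C (cx_ob B' n) (cx_ob B'' n)"
  shows "BGG_complex C W M l B"
proof -
  obtain d' T' where T': "\<forall>w \<in> W. is_tensor C (M w) (d' w) (T' w)"
    and S': "\<forall>n. \<exists>\<iota>. is_direct_sum C {w \<in> W. l w = n} T' (cx_ob B' n) \<iota>" using B' by (auto simp: BGG_complex_def)
  obtain d'' T'' where T'': "\<forall>w \<in> W. is_tensor C (M w) (d'' w) (T'' w)"
    and S'': "\<forall>n. \<exists>\<iota>. is_direct_sum C {w \<in> W. l w = n} T'' (cx_ob B'' n) \<iota>" using B'' by (auto simp: BGG_complex_def)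
  have "is_tensor C (M w) (d' w + d'' w) (bip_ob C (T' w) (T'' w))" if w: "w \<in> W" for w
  proof -
    obtain \<iota>' where i': "is_direct_sum C {..<d' w} (\<lambda>_. M w) (T' w) \<iota>'" using T' w by (auto simp: is_tensor_def)
    obtain \<iota>'' where i'': "is_direct_sum C {..<d'' w} (\<lambda>_. M w) (T'' w) \<iota>''" using T'' w by (auto simp: is_tensor_def)
    have bij: "bij_betw (\<lambda>i. i - d' w) {d' w..<d' w + d'' w} {..<d'' w}"
      by (rule bij_betw_byWitness[of _ "\<lambda>i. i + d' w"]) auto
    have un: "{..<d' w} \<union> {d' w..<d' w + d'' w} = {..<d' w + d'' w}" by auto
    have di: "{..<d' w} \<inter> {d' w..<d' w + d'' w} = {}" by auto
    from HR.dsum_Un[OF direct_sum_dsum[OF i'] HR.dsum_reindex[OF direct_sum_dsum[OF i''] bij] di]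
    obtain \<iota> where "is_direct_sum C {..<d' w + d'' w} (\<lambda>_. M w) (bip_ob C (T' w) (T'' w)) \<iota>"
      unfolding un by (rule dsum_direct_sum)
    then show ?thesis unfolding is_tensor_def by blast
  qed
  moreover have "\<exists>\<iota>. is_direct_sum C {w \<in> W. l w = n} (\<lambda>w. bip_ob C (T' w) (T'' w)) (cx_ob B n) \<iota>" for n
  proof -
    obtain \<iota>' where i': "is_direct_sum C {w \<in> W. l w = n} T' (cx_ob B' n) \<iota>'" using S' by blast
    obtain \<iota>'' where i'': "is_direct_sum C {w \<in> W. l w = n} T'' (cx_ob B'' n) \<iota>''" using S'' by blast
    from HR.dsum_bp[OF direct_sum_dsum[OF i'] direct_sum_dsum[OF i'']]
    obtain \<iota> where "is_direct_sum C {w \<in> W. l w = n} (\<lambda>w. bip_ob C (T' w) (T'' w)) (bip_ob C (cx_ob B' n) (cx_ob B'' n)) \<iota>"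
      by (rule dsum_direct_sum)
    then show ?thesis unfolding ob by blast
  qed
  ultimately show ?thesis using B unfolding BGG_complex_def
    by (intro conjI exI[of _ "\<lambda>w. d' w + d'' w"] exI[of _ "\<lambda>w. bip_ob C (T' w) (T'' w)"]) auto
qed

end

section \<open>Highest weight categories\<close>

context highest_weight_category
begin

sublocale enough_projectives_category C
  by unfold_locales (rule enough_projectives)

lemma Hom_full_sub: "f \<in> Hom (full_sub C D) A B \<longleftrightarrow> f \<in> Hom C A B \<and> A \<in> D \<and> B \<in> D"
  by (auto simp: Hom_def full_sub_def)

lemma M_Obj: assumes w: "w \<in> W" shows "M w \<in> Obj C"
  using M_standard[OF w] by (auto simp: projective_cover_def projective_obj_def truncation_def full_sub_def)

text \<open>The image I of q lies in the truncated category, so that \<open>\<mu> w\<close> lifts to a map from \<open>M w\<close> to I;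
  as \<open>End(M w) = k\<close>, this splits the inclusion of I.\<close>

lemma standard_surj:
  assumes w: "w \<in> W" and pc: "projective_cover C P p (L w)" and q: "q \<in> Hom C P (M w)" and qp: "\<mu> w \<cdot> q = p"
    and R: "R \<in> PR" and x: "x \<in> hom R (M w)"
  shows "\<exists>y \<in> hom R P. x = rep q * y"
proof -
  define D where "D = {X \<in> Obj C. \<forall>S. composition_factor C S X \<longrightarrow> (\<exists>y \<in> W. y \<le> w \<and> iso_objs C S (L y))}"
  define T where "T = full_sub C D"
  have pcT: "projective_cover T (M w) (\<mu> w) (L w)" using M_standard[OF w] by (simp add: T_def D_def truncation_def)
  have muT: "\<mu> w \<in> Hom T (M w) (L w)" and prT: "projective_obj T (M w)" using pcT by (auto simp: projective_cover_def)
  have mu: "\<mu> w \<in> Hom C (M w) (L w)" and MD: "M w \<in> D" and LD: "L w \<in> D" using muT by (auto simp: T_def Hom_full_sub)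
  have p: "p \<in> Hom C P (L w)" "epic C p" using pc by (auto simp: projective_cover_def)
  \<comment> \<open>The image I of q is constructed as the kernel m of the cokernel c of q.\<close>
  obtain c where c: "is_cokernel C c q" using ex_cokernel HomD[OF q] by blast
  have cD: "Cod C q = M w" "Dom C q = P" using HomD[OF q] by auto
  define Y where "Y = Cod C c"
  have cH: "c \<in> Hom C (M w) Y" using cokernelD(1)[OF c] cD by (simp add: Y_def)
  obtain m where m: "is_kernel C m c" using ex_kernel HomD[OF cH] by blast
  define I where "I = Dom C m"
  have mD: "Dom C c = M w" "Dom C m = I" using HomD[OF cH] by (auto simp: I_def)
  have mH: "m \<in> Hom C I (M w)" using kernelD(1)[OF m] mD by simp
  note k = kernel_rep[OF m, unfolded mD]
  have ex: "HR.exact I (M w) Y (rep m) (rep c)"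
    unfolding HR.exact_def using homI[OF mH] homI[OF cH] k epic_iff[OF cH] cokernel_rep(3)[OF c] by blast
  have o: "I \<in> Obj C" "Y \<in> Obj C" "L w \<in> Obj C" "M w \<in> Obj C" "P \<in> Obj C"
    using Hom_Obj mH cH mu q by auto
  have "composition_factor C S (M w)" if "composition_factor C S I" for S
    using composition_factor_sub[OF ex all_finite_length[OF o(2)] that] .
  \<comment> \<open>Composition factors of I are composition factors of \<open>M w\<close>, so I
    stays in the truncated subcategory.\<close>
  then have ID: "I \<in> D" using MD o(1) by (simp add: D_def)
  obtain e where e: "e \<in> Hom C P I" "rep q = rep m * rep e"
    using k(2)[OF homI[OF q] cokernel_rep(1)[OF c]] by (auto elim: homE)
  have g: "\<mu> w \<cdot> m \<in> Hom C I (L w)" using Comp_Hom[OF mH mu] .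
  have rp: "rep p = rep (\<mu> w \<cdot> m) * rep e"
    using rep_Comp[OF q mu] rep_Comp[OF mH mu] qp e(2) by (simp add: mult.assoc)
  have "\<exists>y \<in> hom R' I. z = rep (\<mu> w \<cdot> m) * y" if R': "R' \<in> PR" and z: "z \<in> hom R' (L w)" for R' z
  proof -
    obtain y where y: "y \<in> hom R' P" "z = rep p * y" using iffD1[OF epic_iff[OF p(1)] p(2)] R' z by blast
    have "rep e * y \<in> hom R' I" by (rule HR.mult_H[OF y(1) homI[OF e(1)]])
    moreover have "z = rep (\<mu> w \<cdot> m) * (rep e * y)" using y(2) rp by (simp add: mult.assoc)
    ultimately show ?thesis by blast
  qed
  then have "epic C (\<mu> w \<cdot> m)" using epic_iff[OF g] by blast
  \<comment> \<open>An epimorphism of C between objects of a full subcategory is epic there.\<close>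
  then have gT: "epic T (\<mu> w \<cdot> m)"
    using HomD[OF g] ID LD unfolding epic_def T_def by (auto simp: full_sub_def Hom_def)
  have "\<mu> w \<in> Hom T (M w) (Cod T (\<mu> w \<cdot> m))" using muT HomD[OF g] by (simp add: T_def full_sub_def)
  then obtain s where s: "s \<in> Hom T (M w) (Dom T (\<mu> w \<cdot> m))" "(\<mu> w \<cdot> m) \<cdot>\<^bsub>T\<^esub> s = \<mu> w"
    using prT gT unfolding projective_obj_def by blast
  have sH: "s \<in> Hom C (M w) I" and gs: "(\<mu> w \<cdot> m) \<cdot> s = \<mu> w"
    using s HomD[OF g] by (auto simp: T_def Hom_full_sub) (auto simp: full_sub_def)
  have ms: "m \<cdot> s \<in> Hom C (M w) (M w)" using Comp_Hom[OF sH mH] .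
  then obtain a where a: "m \<cdot> s = a \<odot> Ident C (M w)"
    using End_M[OF w] unfolding End_trivial_def bij_betw_def by blast
  have id: "Ident C (M w) \<in> Hom C (M w) (M w)" using Ident_Hom[OF o(4)] .
  have "a \<odot> \<mu> w = \<mu> w \<cdot> (m \<cdot> s)" using a Comp_Scale[OF id mu] Comp_Ident[OF mu] by simp
  then have am: "a \<odot> \<mu> w = \<mu> w" using gs Comp_assoc[OF sH mH mu] by simp
  \<comment> \<open>The scalar a fixes \<open>\<mu> w\<close>, which is nonzero: its composite with
    q is the epimorphism p onto the nonzero object \<open>L w\<close>.\<close>
  have "a = 1"
  proof (rule ccontr)
    assume a1: "a \<noteq> 1"
    have "(a - 1) \<odot> \<mu> w = Zero C (M w) (L w)"
      using Scale_plus[OF mu, of a "- 1"] am Add_neg[OF mu] by simp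
    then have "inverse (a - 1) \<odot> ((a - 1) \<odot> \<mu> w) = Zero C (M w) (L w)" using Scale_Zero o by simp
    then have "\<mu> w = Zero C (M w) (L w)" using Scale_Scale[OF mu] Scale_one[OF mu] a1 by simp
    then have p0: "p = Zero C P (L w)" using qp Zero_Comp[OF q o(3)] by simp
    have "Ident C (L w) \<cdot> p = Zero C (L w) (L w) \<cdot> p"
      using Ident_Comp[OF p(1)] Zero_Comp[OF p(1) o(3)] p0 by simp
    then have "Ident C (L w) = Zero C (L w) (L w)"
      using epicD[OF p(2,1) Ident_Hom[OF o(3)] Zero_Hom[OF o(3,3)]] by simp
    then have "zero_object C (L w)" using zero_object_iff rep_Zero[OF o(3,3)] o(3) by (simp add: one_def)
    then show False using simple_L[OF w] by (simp add: simple_obj_def)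
  qed
  then have "m \<cdot> s = Ident C (M w)" using a Scale_one[OF id] by simp
  then have "rep m * rep s = one (M w)" using rep_Comp[OF sH mH] by (simp add: one_def)
  \<comment> \<open>Since c kills m and m has a right inverse, the cokernel of q vanishes.\<close>
  then have "rep c = 0" using HR.mult_one[OF homI[OF cH]] HR.mult_zero_cancel[OF k(1), of "rep s"] by simp
  then show ?thesis using cokernel_exact[OF c R, unfolded cD, OF x] by simp
qed

text \<open>The axiom provides the kernel of q; surjectivity of q is added by
  \<open>standard_surj\<close>.\<close>

lemma standard_exact:
  assumes w: "w \<in> W"
  obtains P K i q where "P \<in> PR" "HR.exact K P (M w) i q" "filtered_by C (M ` {x \<in> W. w < x}) K"
proof -
  obtain P p q \<kappa> where a: "projective_cover C P p (L w)" "q \<in> Hom C P (M w)" "\<mu> w \<cdot> q = p"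
    "is_kernel C \<kappa> q" "filtered_by C (M ` {x \<in> W. w < x}) (Dom C \<kappa>)" using M_filtration[OF w] by blast
  have D: "Dom C q = P" using HomD[OF a(2)] by simp
  have kH: "\<kappa> \<in> Hom C (Dom C \<kappa>) P" using kernelD(1)[OF a(4)] D by simp
  have "HR.exact (Dom C \<kappa>) P (M w) (rep \<kappa>) (rep q)"
    unfolding HR.exact_def
    using homI[OF kH] homI[OF a(2)] kernel_rep[OF a(4), unfolded D] standard_surj[OF w a(1-3)] by blast
  moreover have "P \<in> PR" using a(1) by (simp add: projective_cover_def PR_def)
  ultimately show ?thesis using that a(5) by blast
qed

lemma hom_M_zero: assumes "x \<in> W" "w \<in> W" "\<not> x \<le> w" shows "hom (M x) (M w) \<subseteq> {0}"
proof -
  have "Hom C (M x) (M w) = {Zero C (M x) (M w)}" using Hom_M[OF assms(2,1)] assms(3) by blast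
  then show ?thesis using rep_Zero[OF M_Obj[OF assms(1)] M_Obj[OF assms(2)]] by (simp add: hom_def)
qed

section \<open>Maps into a BGG complex and resolutions of standard objects\<close>

context
  fixes l :: "'w \<Rightarrow> int" and B :: "('o, 'm) cochain"
  assumes l: "compatible_length W l" and B: "BGG_complex C W M l B"
begin

lemma length_less: "w \<in> W \<Longrightarrow> x \<in> W \<Longrightarrow> w < x \<Longrightarrow> l w < l x"
  using l by (simp add: compatible_length_def)

text \<open>A nonzero map from \<open>M x\<close> to \<open>M w\<close> forces x \<le> w, hence l x
  \<le> l w, which excludes every w with l w = n.\<close>

lemma hom_M_BGG: assumes x: "x \<in> W" and n: "n < l x" shows "hom (M x) (cx_ob B n) \<subseteq> {0}"
proof (rule BGG_property[OF B])
  show "hom (M x) (M w) \<subseteq> {0}" if "w \<in> W" "l w = n" for w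
    using hom_M_zero[OF x that(1)] length_less[OF x that(1)] that n by (force simp: le_less)
  show "hom (M x) zo \<subseteq> {0}" using HR.to_zob[OF HR.zob_zo] by blast
  show "hom (M x) (bip_ob C A A') \<subseteq> {0}" if o: "A \<in> Obj C" "A' \<in> Obj C" and z: "hom (M x) A \<subseteq> {0}" "hom (M x) A' \<subseteq> {0}" for A A'
  proof
    fix y assume y: "y \<in> hom (M x) (bip_ob C A A')"
    have "rep (bip_pr1 C A A') * y = 0" "rep (bip_pr2 C A A') * y = 0"
      using z HR.mult_H[OF y HR.pr1_H[OF o]] HR.mult_H[OF y HR.pr2_H[OF o]] by auto
    moreover have "y = (rep (bip_in1 C A A') * rep (bip_pr1 C A A') + rep (bip_in2 C A A') * rep (bip_pr2 C A A')) * y"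
      using HR.one_mult[OF y] HR.bp_sum[OF o] by simp
    ultimately show "y \<in> {0}" by (simp add: distrib_right mult.assoc)
  qed
  show "hom (M x) A' \<subseteq> {0}" if z: "hom (M x) A \<subseteq> {0}" and u: "u \<in> hom A A'" and v: "v \<in> hom A' A" and uv: "u * v = one A'" for A A' u v
  proof
    fix y assume y: "y \<in> hom (M x) A'"
    have "v * y = 0" using z HR.mult_H[OF y v] by blast
    then show "y \<in> {0}" using HR.mult_eq_assoc[OF uv, of y] HR.one_mult[OF y] by simp
  qed
qed

text \<open>The standard objects that filter K are strictly longer than \<open>M w\<close>, so n = l
  w is allowed here, in contrast to \<open>hom_M_BGG\<close>.\<close>

lemma hom_filtered_BGG:
  assumes F: "filtered_by C (M ` {x \<in> W. w < x}) K" and w: "w \<in> W" and n: "n \<le> l w"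
  shows "hom K (cx_ob B n) \<subseteq> {0}"
proof (rule filtered_by_property[OF F])
  show "hom Y (cx_ob B n) \<subseteq> {0}" if Y: "Y \<in> M ` {x \<in> W. w < x}" for Y
  proof -
    obtain x where x: "x \<in> W" "w < x" "Y = M x" using Y by blast
    then show ?thesis using hom_M_BGG[OF x(1)] length_less[OF w x(1,2)] n by simp
  qed
  show "hom Z (cx_ob B n) \<subseteq> {0}" if "HR.zob Z" for Z using HR.from_zob[OF that] by blast
  show "hom A (cx_ob B n) \<subseteq> {0}" if e: "HR.exact A' A A'' i q" and z: "hom A' (cx_ob B n) \<subseteq> {0}" "hom A'' (cx_ob B n) \<subseteq> {0}" for A' A A'' i q
  proof
    fix f assume f: "f \<in> hom A (cx_ob B n)"
    have "f * i = 0" using z(1) HR.mult_H[OF exactD(1)[OF e] f] by blast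
    then obtain h where h: "h \<in> hom A'' (cx_ob B n)" "f = h * q" using exactD(7)[OF e f] by blast
    then have "h = 0" using z(2) by blast
    then show "f \<in> {0}" using h(2) by simp
  qed
  show "hom A' (cx_ob B n) \<subseteq> {0}" if z: "hom A (cx_ob B n) \<subseteq> {0}" and u: "u \<in> hom A A'" and v: "v \<in> hom A' A" and uv: "u * v = one A'" for A A' u v
  proof
    fix y assume y: "y \<in> hom A' (cx_ob B n)"
    have "y * u = 0" using z HR.mult_H[OF u y] by blast
    then have "y * (u * v) = 0" by (simp flip: mult.assoc)
    then show "y \<in> {0}" using uv HR.mult_one[OF y] by simp
  qed
qed

text \<open>A map from P to a term of B in degree at most c kills K, so it descends to
  \<open>M x\<close> and vanishes there because c < l x. Hence P is in the vanishing class. The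
  kernel K is treated by induction on the number of elements above x.\<close>

lemma M_resolved_objs_vanishing:
  assumes "x \<in> W" "c < l x"
  shows "M x \<in> HR.resolved_objs (HR.vanishing (hx B) c) (HR.vanishing (hx B) c)"
  using assms
proof (induction "card {y \<in> W. x < y}" arbitrary: x rule: less_induct)
  case less
  let ?V = "HR.vanishing (hx B) c"
  note ad = HR.vanishing_admissible(1)[of "hx B" c]
  obtain P K i q where P: "P \<in> PR" and e: "HR.exact K P (M x) i q" and F: "filtered_by C (M ` {y \<in> W. x < y}) K"
    using standard_exact[OF less.prems(1)] .
  note ed = exactD[OF e]
  have "f = 0" if n: "n \<le> c" and f: "f \<in> hom P (cx_ob B n)" for n f
  proof -
    have "f * i = 0" using hom_filtered_BGG[OF F less.prems(1), of n] n less.prems(2) HR.mult_H[OF ed(1) f] by auto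
    then obtain h where h: "h \<in> hom (M x) (cx_ob B n)" "f = h * q" using ed(7)[OF f] by blast
    then have "h = 0" using hom_M_BGG[OF less.prems(1), of n] n less.prems(2) by auto
    then show ?thesis using h(2) by simp
  qed
  then have PV: "P \<in> ?V" using P by (auto simp: HR.vanishing_def)
  have "M y \<in> HR.resolved_objs ?V ?V" if y: "y \<in> W" "x < y" for y
  proof (rule less.hyps)
    have "{z \<in> W. y < z} \<subset> {z \<in> W. x < z}" using y by auto
    then show "card {z \<in> W. y < z} < card {z \<in> W. x < z}" using finite_W by (intro psubset_card_mono) auto
    show "y \<in> W" "c < l y" using y length_less[OF less.prems(1) y] less.prems(2) by auto
  qed
  then have "K \<in> HR.resolved_objs ?V ?V"
    by (intro filtered_by_property[OF F, of "\<lambda>A. A \<in> HR.resolved_objs ?V ?V"])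
      (auto intro: HR.resolved_objs_zob[OF ad] HR.resolved_objs_extension[OF ad] HR.resolved_objs_iso)
  then show ?case using HR.resolved_objs_cokernel[OF ad ad e PV] by blast
qed

text \<open>In the critical case c = l x the head P may map to B in degree c, since
  \<open>M x\<close> may. But all standard objects in K are longer, so K has a resolution with all
  terms in the vanishing class.\<close>

lemma M_resolved_objs:
  assumes x: "x \<in> W"
  shows "M x \<in> HR.resolved_objs PR (HR.vanishing (hx B) (l x))"
proof -
  let ?V = "HR.vanishing (hx B) (l x)"
  note ad = HR.vanishing_admissible(1)[of "hx B" "l x"] and ad' = HR.vanishing_admissible(2)[of "hx B" "l x"]
  obtain P K i q where P: "P \<in> PR" and e: "HR.exact K P (M x) i q" and F: "filtered_by C (M ` {y \<in> W. x < y}) K"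
    using standard_exact[OF x] .
  have "M y \<in> HR.resolved_objs ?V ?V" if y: "y \<in> W" "x < y" for y
    using M_resolved_objs_vanishing[OF y(1) length_less[OF x y]] .
  then have "K \<in> HR.resolved_objs ?V ?V"
    by (intro filtered_by_property[OF F, of "\<lambda>A. A \<in> HR.resolved_objs ?V ?V"])
      (auto intro: HR.resolved_objs_zob[OF ad] HR.resolved_objs_extension[OF ad] HR.resolved_objs_iso)
  then show ?thesis using HR.resolved_objs_cokernel[OF ad' ad e P] by blast
qed

lemma BGG_resolved_objs:
  assumes B': "BGG_complex C W M l B'"
  shows "cx_ob B' n \<in> HR.resolved_objs PR (HR.vanishing (hx B) n)"
proof (rule BGG_property[OF B'])
  note ad = HR.vanishing_admissible(2)[of "hx B" n]
  show "M w \<in> HR.resolved_objs PR (HR.vanishing (hx B) n)" if "w \<in> W" "l w = n" for w using M_resolved_objs that by blast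
  show "zo \<in> HR.resolved_objs PR (HR.vanishing (hx B) n)" using HR.resolved_objs_zob[OF ad HR.zob_zo] .
  show "bip_ob C A A' \<in> HR.resolved_objs PR (HR.vanishing (hx B) n)"
    if "A \<in> HR.resolved_objs PR (HR.vanishing (hx B) n)" "A' \<in> HR.resolved_objs PR (HR.vanishing (hx B) n)" for A A'
    using HR.resolved_objs_bp[OF ad that] .
qed (rule HR.resolved_objs_iso)

end

lemma BGG_resolution_triangle:
  assumes l: "compatible_length W l" and tri: "distinguished_triangle C N' N N'' u v t"
    and R': "admits_BGG_resolution C W M l m N'" and R'': "admits_BGG_resolution C W M l m N''"
  shows "admits_BGG_resolution C W M l m N"
proof -
  have N': "bounded_cx C N'" and N: "bounded_cx C N" and N'': "bounded_cx C N''"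
    using tri by (auto simp: distinguished_triangle_def)
  obtain X Y f \<alpha> \<beta> \<gamma> where X: "bounded_cx C X" and Y: "bounded_cx C Y" and f: "chain_map C X Y f"
    and al: "D_iso_arr C N' X \<alpha>" and be: "D_iso_arr C N Y \<beta>" and ga: "D_iso_arr C N'' (mapping_cone C X Y f) \<gamma>"
    using tri unfolding distinguished_triangle_def by blast
  note K = cone_dsplit[OF X Y f]
  obtain B' where B': "BGG_complex C W M l B'" "D_isomorphic C (shift_cx C m N') B'"
    using R' by (auto simp: admits_BGG_resolution_def)
  obtain B'' where B'': "BGG_complex C W M l B''" "D_isomorphic C (shift_cx C m N'') B''"
    using R'' by (auto simp: admits_BGG_resolution_def)
  have b': "bounded_cx C B'" and b'': "bounded_cx C B''" using B'(1) B''(1) by (auto simp: BGG_complex_def)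
  let ?S = "HR.shift_by (even m) m"
  have z': "HR.zigzag (?S (hx N')) (hx B')"
    using B'(2) D_iso_arr_zigzag[OF shift_hx(2)[OF N'] b'] by (auto simp: D_isomorphic_def shift_hx(1)[OF N'])
  have z'': "HR.zigzag (?S (hx N'')) (hx B'')"
    using B''(2) D_iso_arr_zigzag[OF shift_hx(2)[OF N''] b''] by (auto simp: D_isomorphic_def shift_hx(1)[OF N''])
  have xN: "HR.zigzag (?S (hx N')) (?S (hx X))" "HR.zigzag (?S (hx N)) (?S (hx Y))"
    "HR.zigzag (?S (hx N'')) (?S (hx (mapping_cone C X Y f)))"
    using HR.zigzag_shift_by[OF D_iso_arr_zigzag[OF N' X al]] HR.zigzag_shift_by[OF D_iso_arr_zigzag[OF N Y be]]
      HR.zigzag_shift_by[OF D_iso_arr_zigzag[OF N'' K(1) ga]] by auto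
  \<comment> \<open>Passing through N' and N'', resolutions of B' and B'' become resolutions of the
    shifts of X and of the cone.\<close>
  have rX: "HR.resolvable_via (?S (hx X)) (hx B')" and rK: "HR.resolvable_via (?S (hx (mapping_cone C X Y f))) (hx B'')"
    using HR.resolvable_via_trans[OF HR.zigzag_resolvable[OF xN(1)] HR.zigzag_resolvable[OF HR.zigzag_sym[OF z']]]
      HR.resolvable_via_trans[OF HR.zigzag_resolvable[OF xN(3)] HR.zigzag_resolvable[OF HR.zigzag_sym[OF z'']]] .
  \<comment> \<open>Shifting by m keeps the shape of the sequence from Y over the cone to X[1]; the
    sign of the shift enters all differentials alike.\<close>
  note D = HR.dsplit_shift_by[OF K(2), of "even m" m, unfolded HR.shift_by_sh]
  have obj: "cx_ob (hx B') n \<in> HR.resolved_objs PR (HR.vanishing (hx B') n)" "cx_ob (hx B'') n \<in> HR.resolved_objs PR (HR.vanishing (hx B') n)" for n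
    using BGG_resolved_objs[OF l B'(1) B'(1)] BGG_resolved_objs[OF l B'(1) B''(1)] by simp_all
  obtain g Q a b where r: "HR.anti (hx B'') (hx B') g" "HR.bdd Q" "\<And>n. cx_ob Q n \<in> PR" "HR.qi Q (?S (hx Y)) a"
    "HR.qi Q (HR.tw (hx B') (hx B'') g) b"
    by (rule HR.twisted_extension_resolution[OF D HR.cx_shift_by[OF bounded_hx[OF X]] bounded_bdd[OF b'] bounded_bdd[OF b'']
        obj rX rK]) (rule that)
  \<comment> \<open>Q resolves the shift of Y, hence also N[m], and it resolves the twisted
    extension too. These two complexes are therefore isomorphic in the derived category.\<close>
  obtain a' where a': "HR.qi Q (hx (shift_cx C m N)) a'"
    using HR.resolvable_viaD[OF HR.zigzag_resolvable[OF HR.zigzag_sym[OF xN(2)]] r(2,3,4)] unfolding shift_hx(1)[OF N] .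
  obtain B where B: "bounded_cx C B" "hx B = HR.tw (hx B') (hx B'') g"
    using bdd_bounded[OF HR.tw_bdd[OF bounded_bdd[OF b'] bounded_bdd[OF b''] r(1)]] .
  have "cx_ob (hx B) n = bip_ob C (cx_ob B' n) (cx_ob B'' n)" for n unfolding B(2) by (simp add: HR.tw_def)
  then have "BGG_complex C W M l B" using BGG_complex_bip[OF B'(1) B''(1) B(1)] by simp
  moreover have "D_isomorphic C (shift_cx C m N) B"
    using D_isomorphicI[OF shift_hx(2)[OF N] B(1) r(2,3) a'] r(5) by (simp add: B(2))
  ultimately show ?thesis using N unfolding admits_BGG_resolution_def by blast
qed

end

theorem corollary2p16:
  fixes C :: "('o, 'm, 'k::field) lincat"
    and W :: "'w::order set"
    and L M :: "'w \<Rightarrow> 'o"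
    and \<mu> :: "'w \<Rightarrow> 'm"
    and l :: "'w \<Rightarrow> int"
    and N' N N'' :: "('o, 'm) cochain"
    and u v t :: "('o, 'm) roof set"
    and m :: int
  assumes "highest_weight_category C W L M \<mu>"
    and "compatible_length W l"
    and "distinguished_triangle C N' N N'' u v t"
    and "admits_BGG_resolution C W M l m N'"
    and "admits_BGG_resolution C W M l m N''"
  shows "admits_BGG_resolution C W M l m N"
  using highest_weight_category.BGG_resolution_triangle[OF assms] .

end
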